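(* Let $R$ be a standard graded commutative algebra over a field $k$ and let $K$ be its Koszul complex. Then $R$ is Koszul (as a graded $k$-algebra) if and only if $K$ is Koszul (as a DG $k$-algebra).
   Context: A connected graded $k$-algebra is a $\mathbb{Z}$-graded algebra $A$ with $A_0=k$, $A_j=0$ for $j<0$ and every $A_j$ finite-dimensional. It is called Koszul if $\operatorname{Tor}^A_i(k,k)_j\neq 0$ implies $i=j$ ($i$ is the homological degree, $j$ the internal degree). A standard graded commutative $k$-algebra is a connected graded algebra $R\cong Q/J$, where $Q=k[X_1,\dots,X_n]$ with all variables of degree $1$ and $J$ is a homogeneous ideal contained in $(X_1,\dots,X_n)^2$. Koszul complex: regard $R$ as bigraded, concentrated in homological degree $0$. Let $x_1,\dots,x_n$ be a minimal generating set of the augmentation ideal $\mathfrak{m}_R=\bigoplus_{j>0}R_j$. Then $K=\Lambda_R(t_1,\dots,t_n)$ is the exterior algebra on variables $t_i$ of bidegree (homological degree, internal degree) $=(1,1)$, with differential $\partial$ of bidegree $(-1,0)$ determined by $\partial t_i=x_i$ and the Leibniz rule. It is a DG $k$-algebra, independent of the choice of the $x_i$ up to isomorphism, and $k$ is a DG $K$-module via the augmentation $K\to k$. DG modules are bigraded, with differential of bidegree $(-1,0)$ satisfying the Leibniz rule. A DG $K$-module $F$ is semifree if it has an exhaustive filtration $0=F^{-1}\subseteq F^0\subseteq F^1\subseteq\cdots$ by DG submodules such that each $F^p/F^{p-1}$ is free, after forgetting differentials, on a basis of cycles. A semifree resolution of $k$ over $K$ is a quasi-isomorphism $F\to k$ with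 $F$ semifree, and $\operatorname{Tor}^K_i(k,k)_j=H_{ij}(k\otimes_K F)$. The DG algebra $K$ is called Koszul if $\operatorname{Tor}^K_i(k,k)_j\ne 0$ implies $i=j$. *)

theory Defs
  imports Complex_Main "HOL-Library.Poly_Mapping"
begin

section \<open>Internal gradings\<close>

definition internal_sum :: "'i set \<Rightarrow> ('i \<Rightarrow> 'a::comm_monoid_add set) \<Rightarrow> 'a set" where
  "internal_sum I C = {\<Sum>p\<in>S. y p | S y. finite S \<and> S \<subseteq> I \<and> (\<forall>p\<in>S. y p \<in> C p)}"

definition independent_family :: "('i \<Rightarrow> 'a::comm_monoid_add set) \<Rightarrow> bool" where
  "independent_family C \<longleftrightarrow>
     (\<forall>S y. finite S \<longrightarrow> (\<forall>p\<in>S. y p \<in> C p) \<longrightarrow> (\<Sum>p\<in>S. y p) = 0 \<longrightarrow> (\<forall>p\<in>S. y p = 0))"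

definition additive_subgroup :: "'a::ab_group_add set \<Rightarrow> bool" where
  "additive_subgroup H \<longleftrightarrow> 0 \<in> H \<and> (\<forall>x\<in>H. \<forall>y\<in>H. x - y \<in> H)"


section \<open>Graded algebras\<close>

locale connected_graded_algebra = vector_space scl
  for scl :: "'k::field \<Rightarrow> 'a::ring_1 \<Rightarrow> 'a" +
  fixes gr :: "int \<Rightarrow> 'a set"
  assumes scl_mult_left: "scl c (a * b) = scl c a * b"
    and scl_mult_right: "scl c (a * b) = a * scl c b"
    and subspace_gr: "subspace (gr j)"
    and independent_gr: "independent_family gr"
    and sum_gr: "internal_sum UNIV gr = UNIV"
    and gr_mult: "a \<in> gr i \<Longrightarrow> b \<in> gr j \<Longrightarrow> a * b \<in> gr (i + j)"
    and gr_0: "gr 0 = range (\<lambda>c. scl c 1)"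
    and gr_neg: "j < 0 \<Longrightarrow> gr j = {0}"
    and gr_finite_dim: "\<exists>B. finite B \<and> gr j = span B"

definition augmentation_ideal :: "(int \<Rightarrow> 'a::ring_1 set) \<Rightarrow> 'a set" where
  "augmentation_ideal gr = internal_sum {0<..} gr"

definition algebra_aug :: "('k::field \<Rightarrow> 'a::ring_1 \<Rightarrow> 'a) \<Rightarrow> (int \<Rightarrow> 'a set) \<Rightarrow> 'a \<Rightarrow> 'k" where
  "algebra_aug scl gr a = (THE c. a - scl c 1 \<in> augmentation_ideal gr)"

text \<open>The polynomial ring in the variables \<open>X\<^sub>0, \<dots>, X\<^sub>n\<^sub>-\<^sub>1\<close> is the subring \<open>poly_ring n\<close> of the
  ring of polynomials in countably many variables; a polynomial is a finitely supported
  function on exponent vectors.\<close>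

type_synonym 'k mpol = "(nat \<Rightarrow>\<^sub>0 nat) \<Rightarrow>\<^sub>0 'k"

definition poly_ring :: "nat \<Rightarrow> 'k::field mpol set" where
  "poly_ring n = {p. \<forall>m\<in>Poly_Mapping.keys p. Poly_Mapping.keys m \<subseteq> {..<n}}"

definition poly_var :: "nat \<Rightarrow> 'k::field mpol" where
  "poly_var i = Poly_Mapping.single (Poly_Mapping.single i 1) 1"

definition homogeneous_polys :: "nat \<Rightarrow> nat \<Rightarrow> 'k::field mpol set" where
  "homogeneous_polys n d = {p \<in> poly_ring n. \<forall>m\<in>Poly_Mapping.keys p.
     (\<Sum>i\<in>Poly_Mapping.keys m. Poly_Mapping.lookup m i) = d}"

definition poly_irrelevant_sq :: "nat \<Rightarrow> 'k::field mpol set" where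
  "poly_irrelevant_sq n = {\<Sum>i<n. \<Sum>j<n. q i j * poly_var i * poly_var j | q. \<forall>i j. q i j \<in> poly_ring n}"

text \<open>An isomorphism of graded algebras between \<open>R\<close> and \<open>Q/J\<close> is given as a surjective
  homomorphism \<open>\<phi>\<close> of graded algebras from \<open>Q\<close> to \<open>R\<close> with kernel \<open>J\<close>; the kernel of such a map
  is automatically a homogeneous ideal of \<open>Q\<close>. Only the restriction of \<open>\<phi>\<close> to \<open>poly_ring n\<close>
  matters.\<close>

definition graded_presentation ::
    "('k::field \<Rightarrow> 'r::comm_ring_1 \<Rightarrow> 'r) \<Rightarrow> (int \<Rightarrow> 'r set) \<Rightarrow> nat \<Rightarrow> 'k mpol set \<Rightarrow> ('k mpol \<Rightarrow> 'r) \<Rightarrow> bool"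
  where
  "graded_presentation scl gr n J \<phi> \<longleftrightarrow>
     (\<forall>p\<in>poly_ring n. \<forall>q\<in>poly_ring n. \<phi> (p + q) = \<phi> p + \<phi> q \<and> \<phi> (p * q) = \<phi> p * \<phi> q) \<and>
     (\<forall>c. \<phi> (Poly_Mapping.single 0 c) = scl c 1) \<and>
     (\<forall>d. \<phi> ` homogeneous_polys n d \<subseteq> gr (int d)) \<and>
     \<phi> ` poly_ring n = UNIV \<and>
     {p \<in> poly_ring n. \<phi> p = 0} = J"

definition standard_graded_algebra ::
    "('k::field \<Rightarrow> 'r::comm_ring_1 \<Rightarrow> 'r) \<Rightarrow> (int \<Rightarrow> 'r set) \<Rightarrow> bool" where
  "standard_graded_algebra scl gr \<longleftrightarrow> connected_graded_algebra scl gr \<and>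
     (\<exists>n J \<phi>. graded_presentation scl gr n J \<phi> \<and> J \<subseteq> poly_irrelevant_sq n)"

text \<open>In the Koszul complex the variable \<open>t\<^sub>i\<close> has internal degree 1 and the differential preserves
  internal degrees, so the generators \<open>x\<^sub>i = \<partial> t\<^sub>i\<close> have degree 1.\<close>

definition minimal_generators :: "(int \<Rightarrow> 'r::comm_ring_1 set) \<Rightarrow> nat \<Rightarrow> (nat \<Rightarrow> 'r) \<Rightarrow> bool" where
  "minimal_generators gr n x \<longleftrightarrow>
     (\<forall>i<n. x i \<in> gr 1) \<and>
     module.span (*) (x ` {..<n}) = augmentation_ideal gr \<and>
     (\<forall>I. I \<subset> {..<n} \<longrightarrow> module.span (*) (x ` I) \<noteq> augmentation_ideal gr)"


section \<open>DG algebras and DG modules\<close>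

text \<open>An index \<open>(i, j)\<close> consists of the homological degree \<open>i\<close> and the internal degree \<open>j\<close>.
  The underlying group of a DG algebra or module is the internal direct sum of its components
  inside the ambient type.\<close>

record ('k, 'a) dga =
  acomp :: "int \<times> int \<Rightarrow> 'a set"
  amul :: "'a \<Rightarrow> 'a \<Rightarrow> 'a"
  aone :: 'a
  adif :: "'a \<Rightarrow> 'a"
  aaug :: "'a \<Rightarrow> 'k"

record ('a, 'f) dgm =
  mcomp :: "int \<times> int \<Rightarrow> 'f set"
  mact :: "'a \<Rightarrow> 'f \<Rightarrow> 'f"
  mdif :: "'f \<Rightarrow> 'f"

abbreviation acarrier :: "('k, 'a::ab_group_add) dga \<Rightarrow> 'a set" where
  "acarrier A \<equiv> internal_sum UNIV (acomp A)"

abbreviation mcarrier :: "('a, 'f::ab_group_add) dgm \<Rightarrow> 'f set" where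
  "mcarrier F \<equiv> internal_sum UNIV (mcomp F)"

definition alt_sign :: "int \<Rightarrow> 'f::ab_group_add \<Rightarrow> 'f" where
  "alt_sign i y = (if even i then y else - y)"

locale dg_module =
  fixes A :: "('k, 'a::ab_group_add) dga" and F :: "('a, 'f::ab_group_add) dgm"
  assumes subgroup_mcomp: "additive_subgroup (mcomp F p)"
    and independent_mcomp: "independent_family (mcomp F)"
    and act_add_right: "a \<in> acarrier A \<Longrightarrow> f \<in> mcarrier F \<Longrightarrow> g \<in> mcarrier F \<Longrightarrow>
          mact F a (f + g) = mact F a f + mact F a g"
    and act_add_left: "a \<in> acarrier A \<Longrightarrow> b \<in> acarrier A \<Longrightarrow> f \<in> mcarrier F \<Longrightarrow>
          mact F (a + b) f = mact F a f + mact F b f"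
    and act_mul: "a \<in> acarrier A \<Longrightarrow> b \<in> acarrier A \<Longrightarrow> f \<in> mcarrier F \<Longrightarrow>
          mact F (amul A a b) f = mact F a (mact F b f)"
    and act_one: "f \<in> mcarrier F \<Longrightarrow> mact F (aone A) f = f"
    and act_comp: "a \<in> acomp A (i, j) \<Longrightarrow> f \<in> mcomp F (i', j') \<Longrightarrow>
          mact F a f \<in> mcomp F (i + i', j + j')"
    and dif_add: "f \<in> mcarrier F \<Longrightarrow> g \<in> mcarrier F \<Longrightarrow> mdif F (f + g) = mdif F f + mdif F g"
    and dif_comp: "f \<in> mcomp F (i, j) \<Longrightarrow> mdif F f \<in> mcomp F (i - 1, j)"
    and dif_dif: "f \<in> mcarrier F \<Longrightarrow> mdif F (mdif F f) = 0"
    and leibniz: "a \<in> acomp A (i, j) \<Longrightarrow> f \<in> mcarrier F \<Longrightarrow>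
          mdif F (mact F a f) = mact F (adif A a) f + alt_sign i (mact F a (mdif F f))"

definition dg_submodule :: "('k, 'a::ab_group_add) dga \<Rightarrow> ('a, 'f::ab_group_add) dgm \<Rightarrow> 'f set \<Rightarrow> bool"
  where
  "dg_submodule A F N \<longleftrightarrow>
     additive_subgroup N \<and> N = internal_sum UNIV (\<lambda>p. N \<inter> mcomp F p) \<and>
     (\<forall>a\<in>acarrier A. \<forall>f\<in>N. mact F a f \<in> N) \<and> (\<forall>f\<in>N. mdif F f \<in> N)"

definition cycles :: "('a, 'f::ab_group_add) dgm \<Rightarrow> int \<times> int \<Rightarrow> 'f set" where
  "cycles F p = {z \<in> mcomp F p. mdif F z = 0}"

definition boundaries :: "('a, 'f::ab_group_add) dgm \<Rightarrow> int \<times> int \<Rightarrow> 'f set" where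
  "boundaries F p = mdif F ` mcomp F (fst p + 1, snd p)"

definition dg_hom :: "('k, 'a::ab_group_add) dga \<Rightarrow> ('a, 'f::ab_group_add) dgm \<Rightarrow>
    ('a, 'g::ab_group_add) dgm \<Rightarrow> ('f \<Rightarrow> 'g) \<Rightarrow> bool" where
  "dg_hom A F G h \<longleftrightarrow>
     (\<forall>f\<in>mcarrier F. \<forall>g\<in>mcarrier F. h (f + g) = h f + h g) \<and>
     (\<forall>a\<in>acarrier A. \<forall>f\<in>mcarrier F. h (mact F a f) = mact G a (h f)) \<and>
     (\<forall>p. h ` mcomp F p \<subseteq> mcomp G p) \<and>
     (\<forall>f\<in>mcarrier F. h (mdif F f) = mdif G (h f))"

text \<open>The two clauses say that the induced map in homology is injective and surjective.\<close>

definition quasi_iso :: "('k, 'a::ab_group_add) dga \<Rightarrow> ('a, 'f::ab_group_add) dgm \<Rightarrow>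
    ('a, 'g::ab_group_add) dgm \<Rightarrow> ('f \<Rightarrow> 'g) \<Rightarrow> bool" where
  "quasi_iso A F G h \<longleftrightarrow> dg_hom A F G h \<and>
     (\<forall>p. \<forall>z\<in>cycles F p. h z \<in> boundaries G p \<longrightarrow> z \<in> boundaries F p) \<and>
     (\<forall>p. \<forall>w\<in>cycles G p. \<exists>z\<in>cycles F p. w - h z \<in> boundaries G p)"

definition residue_module :: "('k::field, 'a) dga \<Rightarrow> ('a, 'k) dgm" where
  "residue_module A =
     \<lparr>mcomp = (\<lambda>p. if p = (0, 0) then UNIV else {0}),
      mact = (\<lambda>a c. aaug A a * c),
      mdif = (\<lambda>_. 0)\<rparr>"

text \<open>For graded submodules \<open>N' \<subseteq> N\<close>: the set \<open>E\<close> of homogeneous elements represents a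
  basis of the quotient \<open>N/N'\<close>.\<close>

definition basis_of_quotient :: "('k, 'a::ab_group_add) dga \<Rightarrow> ('a, 'f::ab_group_add) dgm \<Rightarrow>
    'f set \<Rightarrow> 'f set \<Rightarrow> 'f set \<Rightarrow> bool" where
  "basis_of_quotient A F N N' E \<longleftrightarrow>
     E \<subseteq> N \<inter> (\<Union>p. mcomp F p) \<and>
     (\<forall>f\<in>N. \<exists>!a :: 'f \<Rightarrow>\<^sub>0 'a.
        Poly_Mapping.keys a \<subseteq> E \<and> (\<forall>e. Poly_Mapping.lookup a e \<in> acarrier A) \<and>
        f - (\<Sum>e\<in>Poly_Mapping.keys a. mact F (Poly_Mapping.lookup a e) e) \<in> N')"

text \<open>\<open>U 0 = {0}\<close> is the term \<open>F\<^sup>-\<^sup>1\<close> of the filtration, and \<open>U (Suc p)\<close> is the term \<open>F\<^sup>p\<close>.\<close>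

definition semifree :: "('k, 'a::ab_group_add) dga \<Rightarrow> ('a, 'f::ab_group_add) dgm \<Rightarrow> bool" where
  "semifree A F \<longleftrightarrow> dg_module A F \<and>
     (\<exists>U :: nat \<Rightarrow> 'f set. U 0 = {0} \<and> (\<Union>p. U p) = mcarrier F \<and>
        (\<forall>p. dg_submodule A F (U p) \<and> U p \<subseteq> U (Suc p) \<and>
           (\<exists>E. basis_of_quotient A F (U (Suc p)) (U p) E \<and> (\<forall>e\<in>E. mdif F e \<in> U p))))"

definition semifree_resolution :: "('k::field, 'a::ab_group_add) dga \<Rightarrow>
    ('a, 'f::ab_group_add) dgm \<Rightarrow> ('f \<Rightarrow> 'k) \<Rightarrow> bool" where
  "semifree_resolution A F \<pi> \<longleftrightarrow> semifree A F \<and> quasi_iso A F (residue_module A) \<pi>"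

text \<open>A graded algebra, regarded as a DG algebra concentrated in homological degree 0.
  A DG module over it is a complex of graded modules.\<close>

definition algebra_dga :: "('k::field \<Rightarrow> 'a::ring_1 \<Rightarrow> 'a) \<Rightarrow> (int \<Rightarrow> 'a set) \<Rightarrow> ('k, 'a) dga" where
  "algebra_dga scl gr =
     \<lparr>acomp = (\<lambda>(i, j). if i = 0 then gr j else {0}),
      amul = (*), aone = 1, adif = (\<lambda>_. 0), aaug = algebra_aug scl gr\<rparr>"

definition free_resolution :: "('k::field \<Rightarrow> 'a::ring_1 \<Rightarrow> 'a) \<Rightarrow> (int \<Rightarrow> 'a set) \<Rightarrow>
    ('a, 'f::ab_group_add) dgm \<Rightarrow> ('f \<Rightarrow> 'k) \<Rightarrow> bool" where
  "free_resolution scl gr P \<pi> \<longleftrightarrow>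
     dg_module (algebra_dga scl gr) P \<and>
     (\<forall>i j. i < 0 \<longrightarrow> mcomp P (i, j) = {0}) \<and>
     (\<forall>i. \<exists>E. basis_of_quotient (algebra_dga scl gr) P (internal_sum ({i} \<times> UNIV) (mcomp P)) {0} E) \<and>
     quasi_iso (algebra_dga scl gr) P (residue_module (algebra_dga scl gr)) \<pi>"


section \<open>Tor\<close>

text \<open>The tensor product of \<open>k\<close> and \<open>F\<close> over \<open>A\<close> is the quotient of the free abelian group on
  pairs by the subgroup \<open>tensor_relations\<close>. Its homology is computed on representatives:
  \<open>tensor_comp\<close> maps onto the components of the tensor product, and \<open>tensor_dif\<close> induces
  its differential.\<close>

definition tensor_relations :: "('k::field, 'a::ab_group_add) dga \<Rightarrow> ('a, 'f::ab_group_add) dgm \<Rightarrow>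
    ('k \<times> 'f \<Rightarrow>\<^sub>0 int) set" where
  "tensor_relations A F = additive_subgroup hull
     ({frag_of (c + c', f) - frag_of (c, f) - frag_of (c', f) | c c' f. f \<in> mcarrier F} \<union>
      {frag_of (c, f + f') - frag_of (c, f) - frag_of (c, f') | c f f'. f \<in> mcarrier F \<and> f' \<in> mcarrier F} \<union>
      {frag_of (c * aaug A a, f) - frag_of (c, mact F a f) | c a f. a \<in> acarrier A \<and> f \<in> mcarrier F})"

definition tensor_comp :: "('a, 'f::ab_group_add) dgm \<Rightarrow> int \<times> int \<Rightarrow> ('k::field \<times> 'f \<Rightarrow>\<^sub>0 int) set" where
  "tensor_comp F p = additive_subgroup hull {frag_of (c, f) | c f. f \<in> mcomp F p}"

definition tensor_dif :: "('a, 'f::ab_group_add) dgm \<Rightarrow> ('k::field \<times> 'f \<Rightarrow>\<^sub>0 int) \<Rightarrow> ('k \<times> 'f \<Rightarrow>\<^sub>0 int)" where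
  "tensor_dif F = frag_extend (\<lambda>(c, f). frag_of (c, mdif F f))"

definition tensor_homology :: "('k::field, 'a::ab_group_add) dga \<Rightarrow> ('a, 'f::ab_group_add) dgm \<Rightarrow>
    int \<Rightarrow> int \<Rightarrow> ('k \<times> 'f \<Rightarrow>\<^sub>0 int) set set" where
  "tensor_homology A F i j =
     {z \<in> tensor_comp F (i, j). tensor_dif F z \<in> tensor_relations A F} //
     {(z, w). \<exists>v\<in>tensor_comp F (i + 1, j). z - w - tensor_dif F v \<in> tensor_relations A F}"

text \<open>The resolutions are chosen inside \<open>nat \<Rightarrow>\<^sub>0 'a\<close>. This type contains the direct sum of countably
  many copies of the algebra, hence a copy of every semifree module on a countable basis.\<close>

definition chosen_free_resolution ::
    "('k::field \<Rightarrow> 'a::ring_1 \<Rightarrow> 'a) \<Rightarrow> (int \<Rightarrow> 'a set) \<Rightarrow> ('a, nat \<Rightarrow>\<^sub>0 'a) dgm" where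
  "chosen_free_resolution scl gr = (SOME P. \<exists>\<pi>. free_resolution scl gr P \<pi>)"

definition chosen_semifree_resolution ::
    "('k::field, 'a::ab_group_add) dga \<Rightarrow> ('a, nat \<Rightarrow>\<^sub>0 'a) dgm" where
  "chosen_semifree_resolution A = (SOME F. \<exists>\<pi>. semifree_resolution A F \<pi>)"

definition algebra_Tor :: "('k::field \<Rightarrow> 'a::ring_1 \<Rightarrow> 'a) \<Rightarrow> (int \<Rightarrow> 'a set) \<Rightarrow> int \<Rightarrow> int \<Rightarrow>
    ('k \<times> (nat \<Rightarrow>\<^sub>0 'a) \<Rightarrow>\<^sub>0 int) set set" where
  "algebra_Tor scl gr = tensor_homology (algebra_dga scl gr) (chosen_free_resolution scl gr)"

definition dga_Tor :: "('k::field, 'a::ab_group_add) dga \<Rightarrow> int \<Rightarrow> int \<Rightarrow>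
    ('k \<times> (nat \<Rightarrow>\<^sub>0 'a) \<Rightarrow>\<^sub>0 int) set set" where
  "dga_Tor A = tensor_homology A (chosen_semifree_resolution A)"

text \<open>A quotient group is zero if and only if it has exactly one coset.\<close>

definition koszul_algebra :: "('k::field \<Rightarrow> 'a::ring_1 \<Rightarrow> 'a) \<Rightarrow> (int \<Rightarrow> 'a set) \<Rightarrow> bool" where
  "koszul_algebra scl gr \<longleftrightarrow> (\<forall>i j. \<not> is_singleton (algebra_Tor scl gr i j) \<longrightarrow> i = j)"

definition koszul_dga :: "('k::field, 'a::ab_group_add) dga \<Rightarrow> bool" where
  "koszul_dga A \<longleftrightarrow> (\<forall>i j. \<not> is_singleton (dga_Tor A i j) \<longrightarrow> i = j)"


section \<open>The Koszul complex\<close>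

text \<open>An element of the exterior algebra on \<open>t\<^sub>0, \<dots>, t\<^sub>n\<^sub>-\<^sub>1\<close> is a combination
  of the products \<open>t\<^sub>I\<close> of the \<open>t\<^sub>i\<close>, \<open>i \<in> I\<close>, taken in increasing order, for \<open>I \<subseteq> {..<n}\<close>.
  The products are \<open>t\<^sub>I t\<^sub>J = \<plusminus> t\<^sub>I\<^sub>\<union>\<^sub>J\<close> for disjoint \<open>I\<close> and \<open>J\<close>, the sign being that of the shuffle
  (one factor -1 for each \<open>i \<in> I\<close>, \<open>j \<in> J\<close> with \<open>j < i\<close>), and 0 otherwise.
  The Leibniz rule gives \<open>\<partial> t\<^sub>I\<close> as the alternating sum of the \<open>x\<^sub>i t\<^sub>I\<^sub>-\<^sub>{\<^sub>i\<^sub>}\<close>.\<close>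

definition ext_mul :: "(nat set \<Rightarrow>\<^sub>0 'r::comm_ring_1) \<Rightarrow> (nat set \<Rightarrow>\<^sub>0 'r) \<Rightarrow> (nat set \<Rightarrow>\<^sub>0 'r)" where
  "ext_mul f g = (\<Sum>I\<in>Poly_Mapping.keys f. \<Sum>J\<in>Poly_Mapping.keys g.
     if I \<inter> J = {}
     then Poly_Mapping.single (I \<union> J)
       ((-1) ^ card {(i, j). i \<in> I \<and> j \<in> J \<and> j < i} * Poly_Mapping.lookup f I * Poly_Mapping.lookup g J)
     else 0)"

definition koszul_dif :: "(nat \<Rightarrow> 'r::comm_ring_1) \<Rightarrow> (nat set \<Rightarrow>\<^sub>0 'r) \<Rightarrow> (nat set \<Rightarrow>\<^sub>0 'r)" where
  "koszul_dif x f = (\<Sum>I\<in>Poly_Mapping.keys f. \<Sum>i\<in>I.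
     Poly_Mapping.single (I - {i}) ((-1) ^ card {j \<in> I. j < i} * x i * Poly_Mapping.lookup f I))"

definition koszul_complex :: "('k::field \<Rightarrow> 'r::comm_ring_1 \<Rightarrow> 'r) \<Rightarrow> (int \<Rightarrow> 'r set) \<Rightarrow> nat \<Rightarrow>
    (nat \<Rightarrow> 'r) \<Rightarrow> ('k, nat set \<Rightarrow>\<^sub>0 'r) dga" where
  "koszul_complex scl gr n x =
     \<lparr>acomp = (\<lambda>(i, j). {f. \<forall>I\<in>Poly_Mapping.keys f. I \<subseteq> {..<n} \<and> int (card I) = i \<and>
                 Poly_Mapping.lookup f I \<in> gr (j - i)}),
      amul = ext_mul,
      aone = Poly_Mapping.single {} 1,
      adif = koszul_dif x,
      aaug = (\<lambda>f. algebra_aug scl gr (Poly_Mapping.lookup f {}))\<rparr>"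

end

theory Submission
  imports Defs "HOL-Library.Product_Plus" "HOL-Library.Nat_Bijection" "HOL-Library.Countable_Set"
begin

text \<open>Let \<open>\<mm>\<close> be the augmentation ideal of \<open>R\<close>. Fix a semifree resolution \<open>F\<close> of \<open>k\<close> over \<open>K\<close>. As \<open>K\<close> is
  free over \<open>R\<close> with basis the \<open>t\<^sub>I\<close>, \<open>F\<close> is also a free resolution of \<open>k\<close> over \<open>R\<close>. So one and the same
  complex computes both sides: \<open>Tor\<close> over \<open>R\<close> is the homology of \<open>F/\<mm>F\<close>, and \<open>Tor\<close> over \<open>K\<close> is that of
  \<open>F/K\<^sub>+F\<close>, where \<open>K\<^sub>+\<close> consists of \<open>\<mm>K\<close> and the part of \<open>K\<close> in positive homological degree. Since \<open>\<partial>\<close>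
  maps \<open>K\<close> into \<open>\<mm>K\<close>, the module \<open>F/\<mm>F\<close> has a filtration with quotients the tensor products of
  \<open>F/K\<^sub>+F\<close> with the \<open>p\<close>-th exterior power of \<open>k\<^sup>n\<close>, shifted by the bidegree \<open>(p, p)\<close> on the diagonal.

  If \<open>K\<close> is Koszul, the quotients have no homology off the diagonal, hence neither has \<open>F/\<mm>F\<close>:
  \<open>R\<close> is Koszul (\<open>tor_zero_R_if_K\<close>).

  Conversely let \<open>R\<close> be Koszul (\<open>tor_zero_K_if_R\<close>), let \<open>v\<close> in \<open>F\<^sub>i\<^sub>j\<close> represent a cycle of \<open>F/K\<^sub>+F\<close>, where
  \<open>i \<noteq> j\<close>, and suppose that \<open>Tor\<close> over \<open>K\<close> is diagonal in all internal degrees less than \<open>j\<close>. The boundary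
  \<open>\<partial>v\<close> lies in \<open>K\<^sub>+F\<close>. If \<open>i - 1 \<noteq> j\<close>, the quotients of the filtration of \<open>K\<^sub>+F/\<mm>F\<close> involve \<open>Tor\<close> only in
  off-diagonal bidegrees of smaller internal degree, so \<open>\<partial>v\<close> equals \<open>\<partial>u\<close> modulo \<open>\<mm>F\<close> for some \<open>u\<close> in
  \<open>K\<^sub>+F\<close>; now \<open>v - u\<close> is a cycle modulo \<open>\<mm>F\<close>, and a boundary modulo \<open>\<mm>F\<close> because \<open>R\<close> is Koszul. If
  \<open>i - 1 = j\<close>, the cycle \<open>\<partial>v\<close> is even the boundary of an element \<open>h\<close> of \<open>K\<^sub>+F\<close> (\<open>diagonal_boundary\<close>), and
  the cycle \<open>v - h\<close> is a boundary as \<open>F\<close> is exact there. To find \<open>h\<close>, one filters \<open>K\<^sub>+\<close> by the internal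
  degree and then by the homological degree. The off-diagonal part is removed by induction. On the
  diagonal the leading monomials are the \<open>t\<^sub>I\<close>; there the coordinates of the vanishing \<open>\<partial>\<partial>v\<close> at \<open>x\<^sub>k t\<^sub>I\<^sub>-\<^sub>{\<^sub>k\<^sub>}\<close>
  exhibit the coefficient of \<open>t\<^sub>I\<close> as a boundary, because the minimal generators \<open>x\<^sub>k\<close> are linearly
  independent over \<open>k\<close>.

  Both \<open>Tor\<close> groups are defined by chosen resolutions and as tensor products. The vanishing of the
  latter can be read off from the quotient by \<open>K\<^sub>+F\<close> (\<open>tensor_homology_zero_iff\<close>) and is independent of the
  resolution by the usual comparison of semifree resolutions (\<open>tor_zero_independent\<close>); a free resolution
  over \<open>R\<close> is a special semifree resolution. The resolution \<open>F\<close> is the bar resolution, whose words are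
  in a monomial basis of \<open>K\<^sub>+\<close> over \<open>k\<close>; its coefficients can be compared monomial by monomial.\<close>

abbreviation lookup :: "('a \<Rightarrow>\<^sub>0 'b::zero) \<Rightarrow> 'a \<Rightarrow> 'b" where "lookup \<equiv> Poly_Mapping.lookup"
abbreviation single :: "'a \<Rightarrow> 'b::zero \<Rightarrow> 'a \<Rightarrow>\<^sub>0 'b" where "single \<equiv> Poly_Mapping.single"
abbreviation keys :: "('a \<Rightarrow>\<^sub>0 'b::zero) \<Rightarrow> 'a set" where "keys \<equiv> Poly_Mapping.keys"

section \<open>Internal direct sums\<close>

lemma additive_subgroup_zero: "additive_subgroup H \<Longrightarrow> 0 \<in> H"
  by (simp add: additive_subgroup_def)

lemma additive_subgroup_diff: "additive_subgroup H \<Longrightarrow> x \<in> H \<Longrightarrow> y \<in> H \<Longrightarrow> x - y \<in> H"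
  by (simp add: additive_subgroup_def)

lemma additive_subgroup_uminus: "additive_subgroup H \<Longrightarrow> x \<in> H \<Longrightarrow> - x \<in> H"
  using additive_subgroup_diff[of H 0 x] by (simp add: additive_subgroup_zero)

lemma additive_subgroup_add: "additive_subgroup H \<Longrightarrow> x \<in> H \<Longrightarrow> y \<in> H \<Longrightarrow> x + y \<in> H"
  using additive_subgroup_diff[of H x "- y"] by (simp add: additive_subgroup_uminus)

lemma additive_subgroup_sum:
  "additive_subgroup H \<Longrightarrow> (\<And>i. i \<in> S \<Longrightarrow> f i \<in> H) \<Longrightarrow> sum f S \<in> H"
  by (induction S rule: infinite_finite_induct)
    (auto simp: additive_subgroup_zero additive_subgroup_add)

lemmas additive_subgroup_closed = additive_subgroup_zero additive_subgroup_diff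
  additive_subgroup_uminus additive_subgroup_add

lemma additive_subgroup_hull: "additive_subgroup (additive_subgroup hull X)"
  by (rule hull_in) (auto simp: additive_subgroup_def)

lemma additive_subgroup_alt_sign: "additive_subgroup H \<Longrightarrow> x \<in> H \<Longrightarrow> alt_sign i x \<in> H"
  by (simp add: alt_sign_def additive_subgroup_uminus)

lemma alt_sign_zero [simp]: "alt_sign i 0 = 0"
  by (simp add: alt_sign_def)

lemma alt_sign_add: "alt_sign i (x + y) = alt_sign i x + alt_sign i y"
  by (simp add: alt_sign_def)

lemma alt_sign_diff: "alt_sign i (x - y) = alt_sign i x - alt_sign i y"
  by (simp add: alt_sign_def)

lemma alt_sign_alt_sign: "alt_sign i (alt_sign j x) = alt_sign (i + j) x"
  by (simp add: alt_sign_def)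

lemma alt_sign_twice [simp]: "alt_sign i (alt_sign i x) = x"
  by (simp add: alt_sign_def)

lemma alt_sign_pred: "alt_sign (i - 1) x = - alt_sign i x"
  by (simp add: alt_sign_def)

lemma alt_sign_sum: "alt_sign i (sum f S) = (\<Sum>x\<in>S. alt_sign i (f x))"
  by (simp add: alt_sign_def sum_negf)

locale graded_family =
  fixes C :: "'i \<Rightarrow> 'a::ab_group_add set"
  assumes subgroup_comp: "additive_subgroup (C p)"
    and independent: "independent_family C"

definition decomposition :: "('i \<Rightarrow> 'a::ab_group_add set) \<Rightarrow> 'a \<Rightarrow> ('i \<Rightarrow> 'a) \<Rightarrow> bool" where
  "decomposition C f y \<longleftrightarrow> finite {p. y p \<noteq> 0} \<and> (\<forall>p. y p \<in> C p) \<and> f = (\<Sum>p | y p \<noteq> 0. y p)"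

definition component :: "('i \<Rightarrow> 'a::ab_group_add set) \<Rightarrow> 'a \<Rightarrow> 'i \<Rightarrow> 'a" where
  "component C f = (SOME y. decomposition C f y)"

text \<open>The automorphism acting on homological degree \<open>i\<close> by \<open>(-1)\<^sup>i\<close>. It absorbs the signs of
  the Leibniz rule when elements are not homogeneous.\<close>

definition twist :: "(int \<times> int \<Rightarrow> 'a::ab_group_add set) \<Rightarrow> 'a \<Rightarrow> 'a" where
  "twist C f = (\<Sum>p | component C f p \<noteq> 0. alt_sign (fst p) (component C f p))"

context graded_family
begin

abbreviation carr :: "'a set" where "carr \<equiv> internal_sum UNIV C"

lemma decompositionI:
  assumes "finite S" "\<And>p. y p \<in> C p" "\<And>p. p \<notin> S \<Longrightarrow> y p = 0" "f = sum y S"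
  shows "decomposition C f y"
proof -
  have sub: "{p. y p \<noteq> 0} \<subseteq> S" using assms(3) by auto
  have "sum y S = (\<Sum>p | y p \<noteq> 0. y p)"
    by (rule sum.mono_neutral_right[OF assms(1) sub]) auto
  then show ?thesis unfolding decomposition_def
    using assms(2,4) finite_subset[OF sub assms(1)] by simp
qed

lemma decomposition_sum:
  assumes "decomposition C f y" "finite S" "\<And>p. y p \<noteq> 0 \<Longrightarrow> p \<in> S"
  shows "f = sum y S"
proof -
  have "sum y S = (\<Sum>p | y p \<noteq> 0. y p)"
    by (rule sum.mono_neutral_right) (use assms in auto)
  then show ?thesis using assms(1) by (simp add: decomposition_def)
qed

lemma decomposition_unique:
  assumes "decomposition C f y" "decomposition C f z"
  shows "y = z"
proof
  fix p
  let ?S = "insert p ({p. y p \<noteq> 0} \<union> {p. z p \<noteq> 0})"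
  have fin: "finite ?S" using assms by (auto simp: decomposition_def)
  have "f = sum y ?S" "f = sum z ?S"
    by (rule decomposition_sum[OF assms(1) fin]; auto) (rule decomposition_sum[OF assms(2) fin]; auto)
  then have "(\<Sum>p\<in>?S. y p - z p) = 0" by (metis sum_subtractf diff_self)
  moreover have "\<forall>p\<in>?S. y p - z p \<in> C p"
    using assms additive_subgroup_diff[OF subgroup_comp] by (simp add: decomposition_def)
  ultimately have "\<forall>p\<in>?S. y p - z p = 0"
    using independent fin unfolding independent_family_def
    by (metis (mono_tags, lifting))
  then show "y p = z p" by simp
qed

lemma carr_decomposition: "f \<in> carr \<Longrightarrow> \<exists>y. decomposition C f y"
proof -
  assume "f \<in> carr"
  then obtain S y where *: "f = (\<Sum>p\<in>S. y p)" "finite S" "\<forall>p\<in>S. y p \<in> C p"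
    by (auto simp: internal_sum_def)
  let ?y = "\<lambda>p. if p \<in> S then y p else 0"
  have "decomposition C f ?y"
    by (rule decompositionI[of S]) (use * subgroup_comp in \<open>auto simp: additive_subgroup_zero\<close>)
  then show ?thesis by blast
qed

lemma decomposition_component: "f \<in> carr \<Longrightarrow> decomposition C f (component C f)"
  using someI_ex[OF carr_decomposition] unfolding component_def .

lemma component_eqI: "decomposition C f y \<Longrightarrow> component C f = y"
  using decomposition_unique[OF someI[of "decomposition C f" y]] unfolding component_def by simp

lemma decomposition_carr: "decomposition C f y \<Longrightarrow> f \<in> carr"
  unfolding decomposition_def internal_sum_def by blast

lemma component_in: "f \<in> carr \<Longrightarrow> component C f p \<in> C p"
  using decomposition_component by (simp add: decomposition_def)

lemma finite_component: "f \<in> carr \<Longrightarrow> finite {p. component C f p \<noteq> 0}"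
  using decomposition_component by (simp add: decomposition_def)

lemma component_sum: "f \<in> carr \<Longrightarrow> f = (\<Sum>p | component C f p \<noteq> 0. component C f p)"
  using decomposition_component by (simp add: decomposition_def)

lemma comp_zero: "0 \<in> C p"
  by (rule additive_subgroup_zero[OF subgroup_comp])

lemma decomposition_single: "f \<in> C p \<Longrightarrow> decomposition C f (\<lambda>q. if q = p then f else 0)"
  by (rule decompositionI[of "{p}"]) (auto simp: comp_zero)

lemma comp_carr: "f \<in> C p \<Longrightarrow> f \<in> carr"
  using decomposition_single decomposition_carr by blast

lemma component_single: "f \<in> C p \<Longrightarrow> component C f q = (if q = p then f else 0)"
  using component_eqI[OF decomposition_single] by auto

lemma decomposition_diff:
  assumes "decomposition C f y" "decomposition C g z"
  shows "decomposition C (f - g) (\<lambda>p. y p - z p)"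
proof (rule decompositionI[of "{p. y p \<noteq> 0} \<union> {p. z p \<noteq> 0}"])
  show fin: "finite ({p. y p \<noteq> 0} \<union> {p. z p \<noteq> 0})" using assms by (auto simp: decomposition_def)
  show "y p - z p \<in> C p" for p
    using assms additive_subgroup_diff[OF subgroup_comp] by (simp add: decomposition_def)
  show "f - g = (\<Sum>p\<in>{p. y p \<noteq> 0} \<union> {p. z p \<noteq> 0}. y p - z p)"
    using decomposition_sum[OF assms(1) fin] decomposition_sum[OF assms(2) fin]
    by (simp add: sum_subtractf)
qed auto

lemma carr_subgroup: "additive_subgroup carr"
proof -
  have "f - g \<in> carr" if "f \<in> carr" "g \<in> carr" for f g
    using decomposition_carr[OF decomposition_diff[OF decomposition_component decomposition_component]]
      that by blast
  then show ?thesis using comp_carr[OF comp_zero] by (simp add: additive_subgroup_def)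
qed

lemmas carr_closed = additive_subgroup_closed[OF carr_subgroup]

lemma component_diff:
  "f \<in> carr \<Longrightarrow> g \<in> carr \<Longrightarrow> component C (f - g) p = component C f p - component C g p"
  using component_eqI[OF decomposition_diff[OF decomposition_component decomposition_component]]
  by simp

lemma component_zero: "component C 0 p = 0"
  using component_single[OF comp_zero, of p p] by simp

lemma component_uminus: "f \<in> carr \<Longrightarrow> component C (- f) p = - component C f p"
  using component_diff[of 0 f] carr_closed(1) component_zero by simp

lemma component_add:
  "f \<in> carr \<Longrightarrow> g \<in> carr \<Longrightarrow> component C (f + g) p = component C f p + component C g p"
  using component_diff[of f "- g"] carr_closed(3) component_uminus by simp

lemma component_all_zero: "f \<in> carr \<Longrightarrow> (\<And>p. component C f p = 0) \<Longrightarrow> f = 0"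
  using component_sum[of f] by simp

lemma carr_induct [consumes 1, case_names zero add homogeneous]:
  assumes "f \<in> carr" "P 0" "\<And>f g. f \<in> carr \<Longrightarrow> g \<in> carr \<Longrightarrow> P f \<Longrightarrow> P g \<Longrightarrow> P (f + g)"
    and "\<And>p f. f \<in> C p \<Longrightarrow> P f"
  shows "P f"
proof -
  obtain S y where *: "f = (\<Sum>p\<in>S. y p)" "finite S" "\<forall>p\<in>S. y p \<in> C p"
    using assms(1) by (auto simp: internal_sum_def)
  have "sum y S \<in> carr \<and> P (sum y S)" using *(2,3)
    by (induction S) (auto simp: carr_closed comp_carr intro: assms)
  then show ?thesis using * by simp
qed

lemma component_map:
  assumes D: "graded_family D" and f: "f \<in> carr" and inj: "inj t"
    and hom: "\<And>p f. f \<in> C p \<Longrightarrow> h f \<in> D (t p)"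
    and add: "\<And>f g. f \<in> carr \<Longrightarrow> g \<in> carr \<Longrightarrow> h (f + g) = h f + h g"
  shows "h f \<in> internal_sum UNIV D \<and> component D (h f) (t p) = h (component C f p)"
proof -
  interpret D: graded_family D by (rule D)
  have h0: "h 0 = 0" using add[of 0 0] carr_closed(1) by simp
  show ?thesis using f
  proof (induction rule: carr_induct)
    case zero then show ?case by (simp add: h0 D.carr_closed component_zero D.component_zero)
  next
    case (add f g)
    then show ?case
      using comp_carr[OF component_in]
      by (simp add: assms(5) D.carr_closed D.component_add component_add)
  next
    case (homogeneous q f)
    have "t p = t q \<longleftrightarrow> p = q" using inj by (auto dest: injD)
    moreover have "component D (h f) (t p) = (if t p = t q then h f else 0)"
      using D.component_single[OF hom[OF homogeneous]] .
    moreover have "component C f p = (if p = q then f else 0)"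
      using component_single[OF homogeneous] .
    ultimately show ?case using D.comp_carr[OF hom[OF homogeneous]] h0 by simp
  qed
qed

end

locale bigraded_family = graded_family C for C :: "int \<times> int \<Rightarrow> 'a::ab_group_add set"
begin

lemma twist_sum:
  assumes "f \<in> carr" "finite S" "\<And>p. component C f p \<noteq> 0 \<Longrightarrow> p \<in> S"
  shows "twist C f = (\<Sum>p\<in>S. alt_sign (fst p) (component C f p))"
  unfolding twist_def by (rule sum.mono_neutral_left) (use assms in auto)

lemma twist_add:
  assumes "f \<in> carr" "g \<in> carr"
  shows "twist C (f + g) = twist C f + twist C g"
proof -
  let ?S = "{p. component C f p \<noteq> 0} \<union> {p. component C g p \<noteq> 0}"
  have fin: "finite ?S" using assms finite_component by simp
  have "twist C (f + g) = (\<Sum>p\<in>?S. alt_sign (fst p) (component C (f + g) p))"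
    by (rule twist_sum) (use assms fin in \<open>auto simp: carr_closed component_add\<close>)
  moreover have "twist C f = (\<Sum>p\<in>?S. alt_sign (fst p) (component C f p))"
    "twist C g = (\<Sum>p\<in>?S. alt_sign (fst p) (component C g p))"
    by (rule twist_sum; use assms fin in auto)+
  ultimately show ?thesis
    by (simp add: assms component_add alt_sign_add sum.distrib)
qed

lemma twist_homogeneous: assumes "f \<in> C p" shows "twist C f = alt_sign (fst p) f"
proof -
  have *: "component C f q = (if q = p then f else 0)" for q
    by (rule component_single[OF assms])
  have "twist C f = (\<Sum>q\<in>{p}. alt_sign (fst q) (component C f q))"
    by (rule twist_sum[OF comp_carr[OF assms]]) (auto simp only: * if_False finite.intros split: if_splits)
  then show ?thesis by (simp only: * sum.insert sum.empty finite.emptyI) simp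
qed

lemma twist_zero [simp]: "twist C 0 = 0"
  using twist_homogeneous[OF comp_zero, of "(0,0)"] by simp

lemma twist_comp: assumes "f \<in> C p" shows "twist C f \<in> C p"
  unfolding twist_homogeneous[OF assms] by (rule additive_subgroup_alt_sign[OF subgroup_comp assms])

lemma twist_carr: "f \<in> carr \<Longrightarrow> twist C f \<in> carr"
proof (induction rule: carr_induct)
  case (homogeneous p f)
  then show ?case by (rule comp_carr[OF twist_comp])
qed (auto simp: carr_closed twist_add)

lemma twist_twist: "f \<in> carr \<Longrightarrow> twist C (twist C f) = f"
proof (induction rule: carr_induct)
  case (homogeneous p f)
  then show ?case using twist_homogeneous[OF twist_comp[OF homogeneous]]
    by (simp add: twist_homogeneous[OF homogeneous])
qed (auto simp: twist_add twist_carr)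

end

section \<open>DG algebras with a field of scalars\<close>

text \<open>The setting shared by the algebra and its Koszul complex. The field of scalars is present as a copy
  in bidegree \<open>(0, 0)\<close>, so that modules inherit their vector space structure from the action.\<close>

locale connected_dga =
  fixes A :: "('k::field, 'a::ab_group_add) dga" and scal :: "'k \<Rightarrow> 'a"
  assumes acomp_subgroup: "additive_subgroup (acomp A p)"
    and acomp_independent: "independent_family (acomp A)"
    and mul_add_right: "a \<in> acarrier A \<Longrightarrow> b \<in> acarrier A \<Longrightarrow> c \<in> acarrier A \<Longrightarrow>
          amul A a (b + c) = amul A a b + amul A a c"
    and mul_add_left: "a \<in> acarrier A \<Longrightarrow> b \<in> acarrier A \<Longrightarrow> c \<in> acarrier A \<Longrightarrow>
          amul A (a + b) c = amul A a c + amul A b c"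
    and mul_assoc: "a \<in> acarrier A \<Longrightarrow> b \<in> acarrier A \<Longrightarrow> c \<in> acarrier A \<Longrightarrow>
          amul A (amul A a b) c = amul A a (amul A b c)"
    and one_mul: "a \<in> acarrier A \<Longrightarrow> amul A (aone A) a = a"
    and mul_one: "a \<in> acarrier A \<Longrightarrow> amul A a (aone A) = a"
    and mul_comp: "a \<in> acomp A (i, j) \<Longrightarrow> b \<in> acomp A (i', j') \<Longrightarrow> amul A a b \<in> acomp A (i + i', j + j')"
    and adif_add: "a \<in> acarrier A \<Longrightarrow> b \<in> acarrier A \<Longrightarrow> adif A (a + b) = adif A a + adif A b"
    and adif_comp: "a \<in> acomp A (i, j) \<Longrightarrow> adif A a \<in> acomp A (i - 1, j)"
    and adif_adif: "a \<in> acarrier A \<Longrightarrow> adif A (adif A a) = 0"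
    and adif_mul: "a \<in> acomp A (i, j) \<Longrightarrow> b \<in> acarrier A \<Longrightarrow>
          adif A (amul A a b) = amul A (adif A a) b + alt_sign i (amul A a (adif A b))"
    and aug_add: "a \<in> acarrier A \<Longrightarrow> b \<in> acarrier A \<Longrightarrow> aaug A (a + b) = aaug A a + aaug A b"
    and aug_mul: "a \<in> acarrier A \<Longrightarrow> b \<in> acarrier A \<Longrightarrow> aaug A (amul A a b) = aaug A a * aaug A b"
    and aug_comp: "a \<in> acomp A p \<Longrightarrow> p \<noteq> (0, 0) \<Longrightarrow> aaug A a = 0"
    and aug_adif: "a \<in> acarrier A \<Longrightarrow> aaug A (adif A a) = 0"
    and acomp_neg: "i < 0 \<or> j < 0 \<Longrightarrow> acomp A (i, j) = {0}"
    and scal_comp: "scal u \<in> acomp A (0, 0)"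
    and scal_add: "scal (u + v) = scal u + scal v"
    and scal_mul: "amul A (scal u) (scal v) = scal (u * v)"
    and scal_one: "scal 1 = aone A"
    and aug_scal: "aaug A (scal u) = u"
    and scal_central: "a \<in> acarrier A \<Longrightarrow> amul A (scal u) a = amul A a (scal u)"
begin

sublocale A: bigraded_family "acomp A"
  by unfold_locales (rule acomp_subgroup acomp_independent)+

lemma scal_carrier: "scal c \<in> acarrier A"
  using A.comp_carr[OF scal_comp] .

lemma one_comp: "aone A \<in> acomp A (0, 0)"
  using scal_comp[of 1] by (simp add: scal_one)

lemma one_carrier: "aone A \<in> acarrier A"
  using A.comp_carr[OF one_comp] .

lemma aug_one: "aaug A (aone A) = 1"
  using aug_scal[of 1] by (simp add: scal_one)

lemma aug_zero [simp]: "aaug A 0 = 0"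
proof -
  have "aaug A 0 = aaug A 0 + aaug A 0" using aug_add[of 0 0] A.carr_closed(1) by simp
  then show ?thesis by (metis add_cancel_right_right)
qed

lemma aug_uminus: "a \<in> acarrier A \<Longrightarrow> aaug A (- a) = - aaug A a"
  using aug_add[of a "- a"] by (simp add: A.carr_closed eq_neg_iff_add_eq_0 add.commute)

lemma aug_diff: "a \<in> acarrier A \<Longrightarrow> b \<in> acarrier A \<Longrightarrow> aaug A (a - b) = aaug A a - aaug A b"
  using aug_add[of a "- b"] by (simp add: A.carr_closed aug_uminus)

lemma mul_zero_right [simp]: "a \<in> acarrier A \<Longrightarrow> amul A a 0 = 0"
  using mul_add_right[of a 0 0] by (simp add: A.carr_closed)

lemma mul_zero_left [simp]: "a \<in> acarrier A \<Longrightarrow> amul A 0 a = 0"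
  using mul_add_left[of 0 0 a] by (simp add: A.carr_closed)

lemma adif_zero [simp]: "adif A 0 = 0"
  using adif_add[of 0 0] by (simp add: A.carr_closed)

lemma scal_zero [simp]: "scal 0 = 0"
  using scal_add[of 0 0] by simp

lemma adif_scal: "adif A (scal c) = 0"
  using adif_comp[OF scal_comp, of c] acomp_neg[of "-1" 0] by simp

lemma adif_comp': "a \<in> acomp A p \<Longrightarrow> adif A a \<in> acomp A (fst p - 1, snd p)"
  using adif_comp[of a "fst p" "snd p"] by simp

lemma adif_carrier: "a \<in> acarrier A \<Longrightarrow> adif A a \<in> acarrier A"
proof (induction rule: A.carr_induct)
  case (homogeneous p a)
  then show ?case by (rule A.comp_carr[OF adif_comp'])
qed (auto simp: A.carr_closed adif_add)

lemma mul_comp': "a \<in> acomp A p \<Longrightarrow> b \<in> acomp A q \<Longrightarrow> amul A a b \<in> acomp A (p + q)"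
  using mul_comp[of a "fst p" "snd p" b "fst q" "snd q"] by (simp add: plus_prod_def)

lemma mul_carrier:
  assumes "a \<in> acarrier A" "b \<in> acarrier A"
  shows "amul A a b \<in> acarrier A"
  using assms(1)
proof (induction rule: A.carr_induct)
  case (homogeneous p a)
  note a = homogeneous
  show ?case using assms(2)
  proof (induction rule: A.carr_induct)
    case (homogeneous q b)
    then show ?case by (rule A.comp_carr[OF mul_comp'[OF a]])
  qed (use A.comp_carr[OF a] in \<open>auto simp: mul_add_right A.carr_closed\<close>)
qed (auto simp: mul_add_left A.carr_closed assms)

end

text \<open>The submodule generated by the products with elements of augmentation 0; the quotient
  of a module by it is its tensor product with the residue field.\<close>

definition aug_part :: "('k::field, 'a::ab_group_add) dga \<Rightarrow> ('a, 'f::ab_group_add) dgm \<Rightarrow> 'f set" where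
  "aug_part A F = additive_subgroup hull
     {mact F a f | a f. a \<in> acarrier A \<and> aaug A a = 0 \<and> f \<in> mcarrier F}"

text \<open>The vanishing of the homology of the quotient by \<open>aug_part\<close> in bidegree \<open>(i, j)\<close>, expressed
  on representatives.\<close>

definition tor_zero :: "('k::field, 'a::ab_group_add) dga \<Rightarrow> ('a, 'f::ab_group_add) dgm \<Rightarrow> int \<Rightarrow> int \<Rightarrow> bool" where
  "tor_zero A F i j \<longleftrightarrow> (\<forall>f\<in>mcomp F (i, j). mdif F f \<in> aug_part A F \<longrightarrow>
     (\<exists>g\<in>mcomp F (i + 1, j). f - mdif F g \<in> aug_part A F))"

locale dg_module_over = connected_dga A scal + dg_module A F
  for A :: "('k::field, 'a::ab_group_add) dga" and scal and F :: "('a, 'f::ab_group_add) dgm"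
begin

sublocale F: bigraded_family "mcomp F"
  by unfold_locales (rule subgroup_mcomp independent_mcomp)+

lemma act_zero_left [simp]: "f \<in> mcarrier F \<Longrightarrow> mact F 0 f = 0"
  using act_add_left[of 0 0 f] by (simp add: A.carr_closed)

lemma act_zero_right [simp]: "a \<in> acarrier A \<Longrightarrow> mact F a 0 = 0"
  using act_add_right[of a 0 0] by (simp add: F.carr_closed)

lemma act_uminus_right: "a \<in> acarrier A \<Longrightarrow> f \<in> mcarrier F \<Longrightarrow> mact F a (- f) = - mact F a f"
  using act_add_right[of a f "- f"] by (simp add: F.carr_closed eq_neg_iff_add_eq_0 add.commute)

lemma act_uminus_left: "a \<in> acarrier A \<Longrightarrow> f \<in> mcarrier F \<Longrightarrow> mact F (- a) f = - mact F a f"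
  using act_add_left[of a "- a" f] by (simp add: A.carr_closed eq_neg_iff_add_eq_0 add.commute)

lemma act_diff_right:
  "a \<in> acarrier A \<Longrightarrow> f \<in> mcarrier F \<Longrightarrow> g \<in> mcarrier F \<Longrightarrow> mact F a (f - g) = mact F a f - mact F a g"
  using act_add_right[of a f "- g"] by (simp add: F.carr_closed act_uminus_right)

lemma act_diff_left:
  "a \<in> acarrier A \<Longrightarrow> b \<in> acarrier A \<Longrightarrow> f \<in> mcarrier F \<Longrightarrow> mact F (a - b) f = mact F a f - mact F b f"
  using act_add_left[of a "- b" f] by (simp add: A.carr_closed act_uminus_left)

lemma act_alt_sign_right: "a \<in> acarrier A \<Longrightarrow> f \<in> mcarrier F \<Longrightarrow> mact F a (alt_sign i f) = alt_sign i (mact F a f)"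
  by (simp add: alt_sign_def act_uminus_right)

lemma dif_zero [simp]: "mdif F 0 = 0"
  using dif_add[of 0 0] by (simp add: F.carr_closed)

lemma dif_uminus: "f \<in> mcarrier F \<Longrightarrow> mdif F (- f) = - mdif F f"
  using dif_add[of f "- f"] by (simp add: F.carr_closed eq_neg_iff_add_eq_0 add.commute)

lemma dif_diff: "f \<in> mcarrier F \<Longrightarrow> g \<in> mcarrier F \<Longrightarrow> mdif F (f - g) = mdif F f - mdif F g"
  using dif_add[of f "- g"] by (simp add: F.carr_closed dif_uminus)

lemma dif_alt_sign: "f \<in> mcarrier F \<Longrightarrow> mdif F (alt_sign i f) = alt_sign i (mdif F f)"
  by (simp add: alt_sign_def dif_uminus)

lemma dif_comp': "f \<in> mcomp F p \<Longrightarrow> mdif F f \<in> mcomp F (fst p - 1, snd p)"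
  using dif_comp[of f "fst p" "snd p"] by simp

lemma dif_carrier: "f \<in> mcarrier F \<Longrightarrow> mdif F f \<in> mcarrier F"
proof (induction rule: F.carr_induct)
  case (homogeneous p f)
  then show ?case by (rule F.comp_carr[OF dif_comp'])
qed (auto simp: F.carr_closed dif_add)

lemma act_comp': "a \<in> acomp A p \<Longrightarrow> f \<in> mcomp F q \<Longrightarrow> mact F a f \<in> mcomp F (p + q)"
  using act_comp[of a "fst p" "snd p" f "fst q" "snd q"] by (simp add: plus_prod_def)

lemma act_carrier:
  assumes "a \<in> acarrier A" "f \<in> mcarrier F"
  shows "mact F a f \<in> mcarrier F"
  using assms(1)
proof (induction rule: A.carr_induct)
  case (homogeneous p a)
  note a = homogeneous
  show ?case using assms(2)
  proof (induction rule: F.carr_induct)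
    case (homogeneous q f)
    then show ?case by (rule F.comp_carr[OF act_comp'[OF a]])
  qed (use A.comp_carr[OF a] in \<open>auto simp: act_add_right F.carr_closed\<close>)
qed (auto simp: act_add_left F.carr_closed assms)

lemma act_scal_comp: "f \<in> mcomp F p \<Longrightarrow> mact F (scal c) f \<in> mcomp F p"
  using act_comp'[OF scal_comp] by (metis add_0 zero_prod_def)

lemma dif_act_scal: "f \<in> mcarrier F \<Longrightarrow> mdif F (mact F (scal c) f) = mact F (scal c) (mdif F f)"
  using leibniz[OF scal_comp, of f c] by (simp add: adif_scal dif_carrier alt_sign_def)

lemma aug_part_subgroup: "additive_subgroup (aug_part A F)"
  unfolding aug_part_def by (rule additive_subgroup_hull)

lemmas aug_part_closed = additive_subgroup_closed[OF aug_part_subgroup]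

lemma act_aug_part:
  "a \<in> acarrier A \<Longrightarrow> aaug A a = 0 \<Longrightarrow> f \<in> mcarrier F \<Longrightarrow> mact F a f \<in> aug_part A F"
  unfolding aug_part_def by (rule hull_inc) blast

lemma aug_part_induct [consumes 1, case_names zero diff act]:
  assumes "f \<in> aug_part A F" "P 0"
    "\<And>f g. f \<in> mcarrier F \<Longrightarrow> g \<in> mcarrier F \<Longrightarrow> P f \<Longrightarrow> P g \<Longrightarrow> P (f - g)"
    "\<And>a f. a \<in> acarrier A \<Longrightarrow> aaug A a = 0 \<Longrightarrow> f \<in> mcarrier F \<Longrightarrow> P (mact F a f)"
  shows "P f"
proof -
  have "f \<in> mcarrier F \<and> P f"
    using assms(1) unfolding aug_part_def
    by (rule hull_induct)
      (auto simp: additive_subgroup_def F.carr_closed assms act_carrier)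
  then show ?thesis by simp
qed

end

section \<open>Tor on representatives\<close>

lemma singleton_quotient_iff:
  assumes "z0 \<in> Z" "(z0, z0) \<in> r" "\<And>z w. (z, z0) \<in> r \<Longrightarrow> (z, w) \<in> r \<longleftrightarrow> (z0, w) \<in> r"
  shows "is_singleton (Z // r) \<longleftrightarrow> (\<forall>z\<in>Z. (z, z0) \<in> r)"
proof
  assume "is_singleton (Z // r)"
  then obtain c where "Z // r = {c}" by (auto simp: is_singleton_def)
  then have "r `` {z} = c" if "z \<in> Z" for z
    using quotientI[OF that, of r] by simp
  then have *: "r `` {z} = r `` {z0}" if "z \<in> Z" for z
    using that assms(1) by simp
  show "\<forall>z\<in>Z. (z, z0) \<in> r"
  proof
    fix z assume "z \<in> Z"
    have "z0 \<in> r `` {z0}" using assms(2) by simp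
    then show "(z, z0) \<in> r" unfolding *[OF \<open>z \<in> Z\<close>, symmetric] by simp
  qed
next
  assume z: "\<forall>z\<in>Z. (z, z0) \<in> r"
  have "r `` {z} = r `` {z0}" if "z \<in> Z" for z
  proof (rule set_eqI)
    fix w
    show "w \<in> r `` {z} \<longleftrightarrow> w \<in> r `` {z0}"
      using assms(3)[OF bspec[OF z that], of w] by simp
  qed
  then have "X = r `` {z0}" if "X \<in> Z // r" for X
    using that by (elim quotientE) simp
  moreover have "r `` {z0} \<in> Z // r" by (rule quotientI[OF assms(1)])
  ultimately have "Z // r = {r `` {z0}}" by blast
  then show "is_singleton (Z // r)" by (simp add: is_singleton_def)
qed

context dg_module_over
begin

text \<open>The additive map from the free group on pairs to the module sending \<open>(c, f)\<close> to \<open>c f\<close>. It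
  induces the isomorphism of the tensor product with the quotient by \<open>aug_part\<close>.\<close>

definition tensor_eval :: "('k \<times> 'f \<Rightarrow>\<^sub>0 int) \<Rightarrow> 'f" where
  "tensor_eval z = (\<Sum>p\<in>keys z. if snd p \<in> mcarrier F
     then mact F (scal (of_int (lookup z p) * fst p)) (snd p) else 0)"

lemma tensor_eval_add: "tensor_eval (z + w) = tensor_eval z + tensor_eval w"
  unfolding tensor_eval_def
  by (rule setsum_keys_plus_distrib)
    (auto simp: distrib_right scal_add act_add_left scal_carrier)

lemma tensor_eval_frag: "f \<in> mcarrier F \<Longrightarrow> tensor_eval (frag_of (c, f)) = mact F (scal c) f"
  by (simp add: tensor_eval_def)

lemma tensor_eval_zero: "tensor_eval 0 = 0"
  by (simp add: tensor_eval_def)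

lemma tensor_eval_diff: "tensor_eval (z - w) = tensor_eval z - tensor_eval w"
  using tensor_eval_add[of "z - w" w] by simp

lemma tensor_rel_subgroup: "additive_subgroup (tensor_relations A F)"
  unfolding tensor_relations_def by (rule additive_subgroup_hull)

lemmas tensor_rel_closed = additive_subgroup_closed[OF tensor_rel_subgroup]

lemma tensor_rel_left: "f \<in> mcarrier F \<Longrightarrow>
    frag_of (c + c', f) - frag_of (c, f) - frag_of (c', f) \<in> tensor_relations A F"
  unfolding tensor_relations_def by (rule hull_inc) blast

lemma tensor_rel_right: "f \<in> mcarrier F \<Longrightarrow> f' \<in> mcarrier F \<Longrightarrow>
    frag_of (c, f + f') - frag_of (c, f) - frag_of (c, f') \<in> tensor_relations A F"
  unfolding tensor_relations_def by (rule hull_inc) blast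

lemma tensor_rel_act: "a \<in> acarrier A \<Longrightarrow> f \<in> mcarrier F \<Longrightarrow>
    frag_of (c * aaug A a, f) - frag_of (c, mact F a f) \<in> tensor_relations A F"
  unfolding tensor_relations_def by (rule hull_inc) blast

lemma tensor_rel_diff:
  assumes "f \<in> mcarrier F" "g \<in> mcarrier F"
  shows "frag_of (c, f) - frag_of (c, g) - frag_of (c, f - g) \<in> tensor_relations A F"
  using tensor_rel_right[OF F.carr_closed(2)[OF assms] assms(2), of c] by (simp add: algebra_simps)

lemma tensor_rel_zero_left:
  assumes "f \<in> mcarrier F" shows "frag_of (0, f) \<in> tensor_relations A F"
  using tensor_rel_closed(3)[OF tensor_rel_left[OF assms, of 0 0]] by simp

lemma tensor_rel_aug_part: "f \<in> aug_part A F \<Longrightarrow> frag_of (c, f) \<in> tensor_relations A F"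
proof (induction rule: aug_part_induct)
  case zero
  show ?case
    using tensor_rel_closed(3)[OF tensor_rel_right[OF F.carr_closed(1) F.carr_closed(1), of c]] by simp
next
  case (diff f g)
  have "frag_of (c, f) - frag_of (c, g) \<in> tensor_relations A F"
    using diff tensor_rel_closed(2) by blast
  from tensor_rel_closed(2)[OF this tensor_rel_diff[OF diff(1,2), of c]] show ?case by simp
next
  case (act a f)
  show ?case
    using tensor_rel_closed(2)[OF tensor_rel_zero_left tensor_rel_act] act by fastforce
qed

lemma tensor_eval_rel: "z \<in> tensor_relations A F \<Longrightarrow> tensor_eval z \<in> aug_part A F"
  unfolding tensor_relations_def
proof (erule hull_induct)
  show "additive_subgroup {z. tensor_eval z \<in> aug_part A F}"
    by (simp add: additive_subgroup_def tensor_eval_zero tensor_eval_diff aug_part_closed)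
  fix z assume "z \<in> {frag_of (c + c', f) - frag_of (c, f) - frag_of (c', f) | c c' f. f \<in> mcarrier F} \<union>
      {frag_of (c, f + f') - frag_of (c, f) - frag_of (c, f') | c f f'. f \<in> mcarrier F \<and> f' \<in> mcarrier F} \<union>
      {frag_of (c * aaug A a, f) - frag_of (c, mact F a f) | c a f. a \<in> acarrier A \<and> f \<in> mcarrier F}"
  then consider (l) c c' f where "f \<in> mcarrier F" "z = frag_of (c + c', f) - frag_of (c, f) - frag_of (c', f)"
    | (r) c f f' where "f \<in> mcarrier F" "f' \<in> mcarrier F" "z = frag_of (c, f + f') - frag_of (c, f) - frag_of (c, f')"
    | (a) c a f where "a \<in> acarrier A" "f \<in> mcarrier F" "z = frag_of (c * aaug A a, f) - frag_of (c, mact F a f)"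
    by blast
  then show "tensor_eval z \<in> aug_part A F"
  proof cases
    case l
    then show ?thesis
      by (simp add: tensor_eval_diff tensor_eval_frag scal_add act_add_left scal_carrier aug_part_closed)
  next
    case r
    then show ?thesis
      by (simp add: tensor_eval_diff tensor_eval_frag act_add_right scal_carrier aug_part_closed
          F.carr_closed)
  next
    case a
    have "tensor_eval z = mact F (scal (c * aaug A a)) f - mact F (amul A (scal c) a) f"
      using a by (simp add: tensor_eval_diff tensor_eval_frag act_carrier act_mul scal_carrier)
    also have "\<dots> = mact F (scal (c * aaug A a) - amul A (scal c) a) f"
      using a by (simp add: act_diff_left scal_carrier mul_carrier)
    also have "\<dots> \<in> aug_part A F"
      using a by (intro act_aug_part)
        (simp_all add: A.carr_closed scal_carrier mul_carrier aug_diff aug_scal aug_mul)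
    finally show ?thesis .
  qed
qed

lemma tensor_comp_subgroup: "additive_subgroup (tensor_comp F p)"
  unfolding tensor_comp_def by (rule additive_subgroup_hull)

lemma tensor_comp_frag: "f \<in> mcomp F p \<Longrightarrow> frag_of (c, f) \<in> tensor_comp F p"
  unfolding tensor_comp_def by (rule hull_inc) blast

lemma tensor_dif_frag: "tensor_dif F (frag_of (c, f)) = frag_of (c, mdif F f)"
  by (simp add: tensor_dif_def)

lemma tensor_dif_diff: "tensor_dif F (z - w) = tensor_dif F z - tensor_dif F w"
  by (simp add: tensor_dif_def frag_extend_diff)

lemma tensor_comp_induct [consumes 1, case_names zero diff frag]:
  assumes "z \<in> tensor_comp F p" "P 0" "\<And>z w. P z \<Longrightarrow> P w \<Longrightarrow> P (z - w)"
    "\<And>c f. f \<in> mcomp F p \<Longrightarrow> P (frag_of (c, f))"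
  shows "P z"
  using assms(1) unfolding tensor_comp_def
  by (rule hull_induct) (auto simp: additive_subgroup_def assms)

text \<open>Modulo the relations every element is a single pure tensor with first factor 1, so nothing is lost
  by evaluating.\<close>

lemma tensor_eval_comp:
  assumes "z \<in> tensor_comp F p"
  shows "tensor_eval z \<in> mcomp F p \<and> tensor_eval (tensor_dif F z) = mdif F (tensor_eval z) \<and>
    z - frag_of (1, tensor_eval z) \<in> tensor_relations A F"
  using assms
proof (induction rule: tensor_comp_induct)
  case zero
  have "frag_of (1, 0) \<in> tensor_relations A F"
    by (rule tensor_rel_aug_part) (rule aug_part_closed)
  then show ?case
    using tensor_rel_closed(3) by (simp add: tensor_eval_zero F.comp_zero tensor_dif_def)
next
  case (diff z w)
  then have car: "tensor_eval z \<in> mcarrier F" "tensor_eval w \<in> mcarrier F"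
    by (auto intro: F.comp_carr)
  have "z - frag_of (1, tensor_eval z) - (w - frag_of (1, tensor_eval w)) \<in> tensor_relations A F"
    using diff tensor_rel_closed(2) by blast
  from tensor_rel_closed(4)[OF this tensor_rel_diff[OF car, of 1]] show ?case
    using diff car
    by (simp add: tensor_eval_diff tensor_dif_diff dif_diff additive_subgroup_diff[OF subgroup_mcomp]
        algebra_simps)
next
  case (frag c f)
  have car: "f \<in> mcarrier F" "mdif F f \<in> mcarrier F"
    using frag by (auto intro: F.comp_carr dif_carrier)
  show ?case
    using car frag tensor_rel_act[OF scal_carrier car(1), of 1 c]
    by (simp add: tensor_eval_frag tensor_dif_frag act_scal_comp dif_act_scal aug_scal)
qed

lemma tensor_homology_zero_iff: "is_singleton (tensor_homology A F i j) \<longleftrightarrow> tor_zero A F i j"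
proof -
  let ?Z = "{z \<in> tensor_comp F (i, j). tensor_dif F z \<in> tensor_relations A F}"
  let ?r = "{(z, w). \<exists>v\<in>tensor_comp F (i + 1, j). z - w - tensor_dif F v \<in> tensor_relations A F}"
  note tc = additive_subgroup_closed[OF tensor_comp_subgroup]
  have td0: "tensor_dif F 0 = 0" by (simp add: tensor_dif_def)
  have Z0: "0 \<in> ?Z" by (simp add: tc tensor_rel_closed td0)
  have refl0: "(0, 0) \<in> ?r" using tc(1)[of "(i+1,j)"] by (force simp: tensor_rel_closed td0)
  have shift: "(z, w) \<in> ?r \<longleftrightarrow> (0, w) \<in> ?r" if "(z, 0) \<in> ?r" for z w
  proof -
    from that obtain v where v: "v \<in> tensor_comp F (i + 1, j)"
      "z - tensor_dif F v \<in> tensor_relations A F" by auto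
    show ?thesis
    proof
      assume "(z, w) \<in> ?r"
      then obtain u where u: "u \<in> tensor_comp F (i + 1, j)"
        "z - w - tensor_dif F u \<in> tensor_relations A F" by auto
      have "0 - w - tensor_dif F (u - v) \<in> tensor_relations A F"
        using tensor_rel_closed(2)[OF u(2) v(2)] by (simp add: tensor_dif_diff algebra_simps)
      then show "(0, w) \<in> ?r" using tc(2)[OF u(1) v(1)] by blast
    next
      assume "(0, w) \<in> ?r"
      then obtain u where u: "u \<in> tensor_comp F (i + 1, j)"
        "0 - w - tensor_dif F u \<in> tensor_relations A F" by auto
      have "z - w - tensor_dif F (v + u) \<in> tensor_relations A F"
        using tensor_rel_closed(4)[OF v(2) u(2)]
        by (simp add: tensor_dif_def frag_extend_add algebra_simps)
      then show "(z, w) \<in> ?r" using tc(4)[OF v(1) u(1)] by blast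
    qed
  qed
  have "is_singleton (?Z // ?r) \<longleftrightarrow> (\<forall>z\<in>?Z. (z, 0) \<in> ?r)"
    by (rule singleton_quotient_iff[OF Z0 refl0 shift])
  also have "\<dots> \<longleftrightarrow> tor_zero A F i j"
  proof
    assume *: "\<forall>z\<in>?Z. (z, 0) \<in> ?r"
    show "tor_zero A F i j" unfolding tor_zero_def
    proof (intro ballI impI)
      fix f assume f: "f \<in> mcomp F (i, j)" "mdif F f \<in> aug_part A F"
      have "frag_of (1, f) \<in> ?Z"
        using f by (simp add: tensor_comp_frag tensor_dif_frag tensor_rel_aug_part)
      with * obtain v where v: "v \<in> tensor_comp F (i + 1, j)"
        "frag_of (1, f) - tensor_dif F v \<in> tensor_relations A F" by auto
      have "mact F (scal 1) f = f" using F.comp_carr[OF f(1)] by (simp add: scal_one act_one)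
      then have "f - mdif F (tensor_eval v) \<in> aug_part A F"
        using tensor_eval_rel[OF v(2)] tensor_eval_comp[OF v(1)] F.comp_carr[OF f(1)]
        by (simp add: tensor_eval_diff tensor_eval_frag)
      then show "\<exists>g\<in>mcomp F (i + 1, j). f - mdif F g \<in> aug_part A F"
        using tensor_eval_comp[OF v(1)] by blast
    qed
  next
    assume *: "tor_zero A F i j"
    show "\<forall>z\<in>?Z. (z, 0) \<in> ?r"
    proof
      fix z assume z: "z \<in> ?Z"
      let ?f = "tensor_eval z"
      have f: "?f \<in> mcomp F (i, j)" "mdif F ?f \<in> aug_part A F"
        "z - frag_of (1, ?f) \<in> tensor_relations A F"
        using tensor_eval_comp[of z "(i, j)"] tensor_eval_rel[of "tensor_dif F z"] z by auto
      with * obtain g where g: "g \<in> mcomp F (i + 1, j)" "?f - mdif F g \<in> aug_part A F"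
        unfolding tor_zero_def by blast
      have car: "?f \<in> mcarrier F" "mdif F g \<in> mcarrier F"
        using F.comp_carr[OF f(1)] dif_carrier[OF F.comp_carr[OF g(1)]] by auto
      have "frag_of (1, ?f) - frag_of (1, mdif F g) \<in> tensor_relations A F"
        using tensor_rel_closed(4)[OF tensor_rel_diff[OF car, of 1] tensor_rel_aug_part[OF g(2), of 1]]
        by simp
      from tensor_rel_closed(4)[OF f(3) this]
      have "z - tensor_dif F (frag_of (1, g)) \<in> tensor_relations A F"
        by (simp add: tensor_dif_frag)
      then show "(z, 0) \<in> ?r" using tensor_comp_frag[OF g(1), of 1] by auto
    qed
  qed
  finally show ?thesis by (simp add: tensor_homology_def)
qed

end

section \<open>Comparison of semifree resolutions\<close>

lemma dg_submodule_component:
  assumes M: "dg_module_over A scal F" and N: "dg_submodule A F N" and f: "f \<in> N"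
  shows "component (mcomp F) f p \<in> N"
proof -
  interpret dg_module_over A scal F by (rule M)
  have sub: "additive_subgroup N" and eq: "N = internal_sum UNIV (\<lambda>p. N \<inter> mcomp F p)"
    using N by (simp_all add: dg_submodule_def)
  from f eq obtain S y where y: "f = (\<Sum>p\<in>S. y p)" "finite S" "\<forall>p\<in>S. y p \<in> N \<inter> mcomp F p"
    unfolding internal_sum_def by blast
  have "sum y S \<in> mcarrier F \<and> component (mcomp F) (sum y S) p \<in> N" using y(2,3)
  proof (induction S)
    case empty
    then show ?case by (simp add: F.carr_closed F.component_zero additive_subgroup_zero[OF sub])
  next
    case (insert q S)
    then have q: "y q \<in> mcomp F q" "y q \<in> N" and IH: "sum y S \<in> mcarrier F"
        "component (mcomp F) (sum y S) p \<in> N" by auto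
    have "component (mcomp F) (y q) p \<in> N"
      using q(2) additive_subgroup_zero[OF sub] by (simp add: F.component_single[OF q(1)])
    then show ?case
      using insert(1,2) IH F.comp_carr[OF q(1)]
      by (simp add: F.carr_closed F.component_add additive_subgroup_add[OF sub])
  qed
  then show ?thesis using y(1) by simp
qed

text \<open>As the residue field is concentrated in bidegree \<open>(0, 0)\<close>, a quasi-isomorphism to it says that
  the cycles killed by \<open>\<rho>\<close> are boundaries and that cycles in bidegree \<open>(0, 0)\<close> take all values.\<close>

locale residue_resolution = dg_module_over A scal G
  for A :: "('k::field, 'a::ab_group_add) dga" and scal and G :: "('a, 'g::ab_group_add) dgm" +
  fixes \<rho> :: "'g \<Rightarrow> 'k"
  assumes qi: "quasi_iso A G (residue_module A) \<rho>"
begin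

lemma res_add: "f \<in> mcarrier G \<Longrightarrow> g \<in> mcarrier G \<Longrightarrow> \<rho> (f + g) = \<rho> f + \<rho> g"
  using qi by (simp add: quasi_iso_def dg_hom_def)

lemma res_act: "a \<in> acarrier A \<Longrightarrow> g \<in> mcarrier G \<Longrightarrow> \<rho> (mact G a g) = aaug A a * \<rho> g"
  using qi by (simp add: quasi_iso_def dg_hom_def residue_module_def)

lemma res_comp: "g \<in> mcomp G p \<Longrightarrow> p \<noteq> (0, 0) \<Longrightarrow> \<rho> g = 0"
proof -
  assume g: "g \<in> mcomp G p" "p \<noteq> (0, 0)"
  have "\<rho> ` mcomp G p \<subseteq> mcomp (residue_module A) p"
    using qi unfolding quasi_iso_def dg_hom_def by blast
  then have "\<rho> g \<in> mcomp (residue_module A) p" using g(1) by blast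
  then show "\<rho> g = 0" using g(2) by (simp add: residue_module_def)
qed

lemma res_dif: "g \<in> mcarrier G \<Longrightarrow> \<rho> (mdif G g) = 0"
  using qi by (simp add: quasi_iso_def dg_hom_def residue_module_def)

lemma boundaries_residue: "boundaries (residue_module A) p = {0}"
  by (auto simp: boundaries_def residue_module_def)

lemma exact:
  assumes "z \<in> mcomp G (i, j)" "mdif G z = 0" "\<rho> z = 0"
  obtains y where "y \<in> mcomp G (i + 1, j)" "mdif G y = z"
proof -
  have "z \<in> boundaries G (i, j)"
    using qi assms unfolding quasi_iso_def cycles_def boundaries_residue by blast
  then show thesis using that by (auto simp: boundaries_def)
qed

lemma res_surj:
  assumes "p \<noteq> (0, 0) \<Longrightarrow> c = 0"
  obtains z where "z \<in> mcomp G p" "mdif G z = 0" "\<rho> z = c"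
proof -
  have "c \<in> cycles (residue_module A) p"
    using assms by (auto simp: cycles_def residue_module_def)
  then obtain z where "z \<in> cycles G p" "c - \<rho> z \<in> boundaries (residue_module A) p"
    using qi unfolding quasi_iso_def by blast
  then show thesis using that by (auto simp: boundaries_residue cycles_def)
qed

end

lemma semifree_resolutionD:
  assumes "connected_dga A scal" "semifree_resolution A F \<pi>"
  shows "residue_resolution A scal F \<pi>"
  using assms unfolding semifree_resolution_def semifree_def residue_resolution_def
    dg_module_over_def residue_resolution_axioms_def by blast

text \<open>The data for extending a map from \<open>F\<close> to a resolution \<open>G\<close>: an \<open>A\<close>-linear \<open>h\<close> of
  homological degree \<open>n\<close> is sought with \<open>\<partial> h - h \<partial> = \<theta>\<close> and \<open>\<rho> h = \<zeta>\<close>. For \<open>n = 0\<close> and \<open>\<theta> = 0\<close> this is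
  a chain map. For \<open>n = 1\<close> and a difference of chain maps, composed with the twist, as \<open>\<theta>\<close> it is a
  homotopy; the twist makes it linear without the sign that a map of odd degree would carry.\<close>

locale lifting_problem = F: dg_module_over A scal F + G: residue_resolution A scal G \<rho>
  for A :: "('k::field, 'a::ab_group_add) dga" and scal and F :: "('a, 'f::ab_group_add) dgm"
    and G :: "('a, 'g::ab_group_add) dgm" and \<rho> +
  fixes n :: int and \<theta> :: "'f \<Rightarrow> 'g" and \<zeta> :: "'f \<Rightarrow> 'k"
  assumes \<theta>_add: "f \<in> mcarrier F \<Longrightarrow> f' \<in> mcarrier F \<Longrightarrow> \<theta> (f + f') = \<theta> f + \<theta> f'"
    and \<theta>_act: "a \<in> acomp A p \<Longrightarrow> f \<in> mcarrier F \<Longrightarrow> \<theta> (mact F a f) = alt_sign (fst p) (mact G a (\<theta> f))"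
    and \<theta>_comp: "f \<in> mcomp F p \<Longrightarrow> \<theta> f \<in> mcomp G (p + (n - 1, 0))"
    and \<theta>_dif: "f \<in> mcarrier F \<Longrightarrow> mdif G (\<theta> f) = - \<theta> (mdif F f)"
    and \<zeta>_add: "f \<in> mcarrier F \<Longrightarrow> f' \<in> mcarrier F \<Longrightarrow> \<zeta> (f + f') = \<zeta> f + \<zeta> f'"
    and \<zeta>_act: "a \<in> acarrier A \<Longrightarrow> f \<in> mcarrier F \<Longrightarrow> \<zeta> (mact F a f) = aaug A a * \<zeta> f"
    and \<zeta>_comp: "f \<in> mcomp F p \<Longrightarrow> p + (n, 0) \<noteq> (0, 0) \<Longrightarrow> \<zeta> f = 0"
    and \<zeta>_dif: "f \<in> mcarrier F \<Longrightarrow> \<zeta> (mdif F f) + \<rho> (\<theta> f) = 0"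
begin

definition lift_at :: "('f \<Rightarrow> 'g) \<Rightarrow> 'f \<Rightarrow> bool" where
  "lift_at h f \<longleftrightarrow> mdif G (h f) = h (mdif F f) + \<theta> f \<and> \<rho> (h f) = \<zeta> f"

definition lift_on :: "'f set \<Rightarrow> ('f \<Rightarrow> 'g) \<Rightarrow> bool" where
  "lift_on U h \<longleftrightarrow> (\<forall>f\<in>U. \<forall>g\<in>U. h (f + g) = h f + h g) \<and>
     (\<forall>a\<in>acarrier A. \<forall>f\<in>U. h (mact F a f) = mact G a (h f)) \<and>
     (\<forall>p. \<forall>f\<in>U \<inter> mcomp F p. h f \<in> mcomp G (p + (n, 0))) \<and> (\<forall>f\<in>U. lift_at h f)"

lemma \<theta>_carr: "f \<in> mcarrier F \<Longrightarrow> \<theta> f \<in> mcarrier G"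
proof (induction rule: F.F.carr_induct)
  case zero
  have "\<theta> 0 = 0" using \<theta>_add[OF F.F.carr_closed(1) F.F.carr_closed(1)] by simp
  then show ?case by (simp add: G.F.carr_closed)
next
  case (homogeneous p f)
  then show ?case by (rule G.F.comp_carr[OF \<theta>_comp])
qed (simp add: \<theta>_add G.F.carr_closed)

end

text \<open>One step of the filtration: \<open>h\<close> solves the problem on \<open>U\<close> and is to be extended to \<open>N\<close>.\<close>

locale lifting_step = lifting_problem A scal F G \<rho> n \<theta> \<zeta>
  for A :: "('k::field, 'a::ab_group_add) dga" and scal and F :: "('a, 'f::ab_group_add) dgm"
    and G :: "('a, 'g::ab_group_add) dgm" and \<rho> n \<theta> \<zeta> +
  fixes U N E h
  assumes subU: "dg_submodule A F U" and subN: "dg_submodule A F N" and UN: "U \<subseteq> N"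
    and basis: "basis_of_quotient A F N U E" and dE: "\<And>e. e \<in> E \<Longrightarrow> mdif F e \<in> U"
    and lift: "lift_on U h" and NF: "N \<subseteq> mcarrier F"
begin

lemma U_add: "f \<in> U \<Longrightarrow> g \<in> U \<Longrightarrow> f + g \<in> U"
  using subU by (auto simp: dg_submodule_def intro: additive_subgroup_add)

lemma U_zero: "0 \<in> U"
  using subU by (auto simp: dg_submodule_def intro: additive_subgroup_zero)

lemma U_act: "a \<in> acarrier A \<Longrightarrow> f \<in> U \<Longrightarrow> mact F a f \<in> U"
  using subU by (simp add: dg_submodule_def)

lemma U_dif: "f \<in> U \<Longrightarrow> mdif F f \<in> U"
  using subU by (simp add: dg_submodule_def)

lemma N_add: "f \<in> N \<Longrightarrow> g \<in> N \<Longrightarrow> f + g \<in> N"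
  using subN by (auto simp: dg_submodule_def intro: additive_subgroup_add)

lemma N_act: "a \<in> acarrier A \<Longrightarrow> f \<in> N \<Longrightarrow> mact F a f \<in> N"
  using subN by (simp add: dg_submodule_def)

lemma N_dif: "f \<in> N \<Longrightarrow> mdif F f \<in> N"
  using subN by (simp add: dg_submodule_def)

lemma U_carr: "f \<in> U \<Longrightarrow> f \<in> mcarrier F"
  using UN NF by blast

lemma E_N: "e \<in> E \<Longrightarrow> e \<in> N"
  using basis by (auto simp: basis_of_quotient_def)

lemma E_carr: "e \<in> E \<Longrightarrow> e \<in> mcarrier F"
  using NF E_N by blast

lemma h_add: "f \<in> U \<Longrightarrow> g \<in> U \<Longrightarrow> h (f + g) = h f + h g"
  using lift by (simp add: lift_on_def)

lemma h_zero: "h 0 = 0"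
  using h_add[OF U_zero U_zero] by simp

lemma h_act: "a \<in> acarrier A \<Longrightarrow> f \<in> U \<Longrightarrow> h (mact F a f) = mact G a (h f)"
  using lift by (simp add: lift_on_def)

lemma h_comp: "f \<in> U \<Longrightarrow> f \<in> mcomp F p \<Longrightarrow> h f \<in> mcomp G (p + (n, 0))"
  using lift unfolding lift_on_def by blast

lemma h_lift: "f \<in> U \<Longrightarrow> lift_at h f"
  using lift by (simp add: lift_on_def)

lemma h_carr: "f \<in> U \<Longrightarrow> h f \<in> mcarrier G"
proof -
  assume f: "f \<in> U"
  have "U = internal_sum UNIV (\<lambda>p. U \<inter> mcomp F p)" using subU by (simp add: dg_submodule_def)
  then obtain S y where y: "f = (\<Sum>p\<in>S. y p)" "finite S" "\<forall>p\<in>S. y p \<in> U \<inter> mcomp F p"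
    using f unfolding internal_sum_def by blast
  have "sum y S \<in> U \<and> h (sum y S) \<in> mcarrier G" using y(2,3)
  proof (induction S)
    case empty
    then show ?case by (simp add: U_zero h_zero G.F.carr_closed)
  next
    case (insert q S)
    then show ?case using G.F.comp_carr[OF h_comp[of "y q" q]]
      by (simp add: U_add h_add G.F.carr_closed)
  qed
  then show ?thesis using y(1) by simp
qed

definition deg :: "'f \<Rightarrow> int \<times> int" where
  "deg e = (SOME p. e \<in> mcomp F p)"

lemma E_comp: "e \<in> E \<Longrightarrow> e \<in> mcomp F (deg e)"
proof -
  assume "e \<in> E"
  then obtain p where "e \<in> mcomp F p" using basis by (auto simp: basis_of_quotient_def)
  then show ?thesis unfolding deg_def by (rule someI)
qed

text \<open>The image of a basis element: its boundary is prescribed and is a cycle that \<open>\<rho>\<close> kills, hence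
  a boundary; a cycle corrects the value of \<open>\<rho>\<close>.\<close>

lemma image_exists:
  assumes e: "e \<in> E"
  shows "\<exists>y. y \<in> mcomp G (deg e + (n, 0)) \<and> mdif G y = h (mdif F e) + \<theta> e \<and> \<rho> y = \<zeta> e"
proof -
  obtain i j where ij: "deg e = (i, j)" by (cases "deg e")
  have ec: "e \<in> mcomp F (i, j)" using E_comp[OF e] ij by simp
  note car = E_carr[OF e] F.dif_carrier[OF E_carr[OF e]]
  let ?z = "h (mdif F e) + \<theta> e"
  have h1: "h (mdif F e) \<in> mcomp G (i + n - 1, j)"
    using h_comp[OF dE[OF e] F.dif_comp[OF ec]] by (simp add: algebra_simps)
  have t1: "\<theta> e \<in> mcomp G (i + n - 1, j)" using \<theta>_comp[OF ec] by (simp add: algebra_simps)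
  have z1: "?z \<in> mcomp G (i + n - 1, j)"
    using additive_subgroup_add[OF G.subgroup_mcomp h1 t1] .
  have l: "mdif G (h (mdif F e)) = \<theta> (mdif F e)" "\<rho> (h (mdif F e)) = \<zeta> (mdif F e)"
    using h_lift[OF dE[OF e]] by (simp_all add: lift_at_def F.dif_dif[OF car(1)] h_zero)
  have z2: "mdif G ?z = 0"
    using l(1) \<theta>_dif[OF car(1)] G.F.comp_carr[OF h1] G.F.comp_carr[OF t1] by (simp add: G.dif_add)
  have z3: "\<rho> ?z = 0"
    using l(2) \<zeta>_dif[OF car(1)] G.F.comp_carr[OF h1] G.F.comp_carr[OF t1] by (simp add: G.res_add)
  obtain y where y: "y \<in> mcomp G (i + n, j)" "mdif G y = ?z"
    using G.exact[OF z1 z2 z3] by (metis diff_add_cancel)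
  obtain c where c: "c \<in> mcomp G (i + n, j)" "mdif G c = 0" "\<rho> c = \<zeta> e - \<rho> y"
    using G.res_surj[of "(i + n, j)" "\<zeta> e - \<rho> y"] \<zeta>_comp[OF ec] G.res_comp[OF y(1)] by auto
  have "y + c \<in> mcomp G (deg e + (n, 0))"
    using additive_subgroup_add[OF G.subgroup_mcomp y(1) c(1)] by (simp add: ij)
  moreover have "mdif G (y + c) = ?z" "\<rho> (y + c) = \<zeta> e"
    using y c G.F.comp_carr[OF y(1)] G.F.comp_carr[OF c(1)] by (simp_all add: G.dif_add G.res_add)
  ultimately show ?thesis by blast
qed

definition img :: "'f \<Rightarrow> 'g" where
  "img e = (SOME y. y \<in> mcomp G (deg e + (n, 0)) \<and> mdif G y = h (mdif F e) + \<theta> e \<and> \<rho> y = \<zeta> e)"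

lemma img:
  assumes "e \<in> E"
  shows "img e \<in> mcomp G (deg e + (n, 0))" "mdif G (img e) = h (mdif F e) + \<theta> e" "\<rho> (img e) = \<zeta> e"
  using someI_ex[OF image_exists[OF assms]] unfolding img_def by blast+

lemma img_carr: "e \<in> E \<Longrightarrow> img e \<in> mcarrier G"
  using G.F.comp_carr[OF img(1)] .

text \<open>The coefficients form a total function, so that presentations with different supports can be
  compared over the union of the supports.\<close>

definition rep :: "'f \<Rightarrow> 'f \<Rightarrow> 'f set \<Rightarrow> ('f \<Rightarrow> 'a) \<Rightarrow> bool" where
  "rep f u S a \<longleftrightarrow> finite S \<and> S \<subseteq> E \<and> u \<in> U \<and> (\<forall>e. a e \<in> acarrier A) \<and> (\<forall>e. e \<notin> S \<longrightarrow> a e = 0) \<and>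
     f = u + (\<Sum>e\<in>S. mact F (a e) e)"

lemma rep_exists: "f \<in> N \<Longrightarrow> \<exists>u S a. rep f u S a"
proof -
  assume "f \<in> N"
  then obtain a where a: "keys a \<subseteq> E" "\<forall>e. lookup a e \<in> acarrier A"
    "f - (\<Sum>e\<in>keys a. mact F (lookup a e) e) \<in> U"
    using basis unfolding basis_of_quotient_def by blast
  then have "rep f (f - (\<Sum>e\<in>keys a. mact F (lookup a e) e))
      (keys a) (lookup a)"
    by (simp add: rep_def in_keys_iff)
  then show ?thesis by blast
qed

lemma rep_extend:
  assumes "rep f u S a" "finite T" "T \<subseteq> E" "S \<subseteq> T"
  shows "rep f u T a"
proof -
  have "(\<Sum>e\<in>S. mact F (a e) e) = (\<Sum>e\<in>T. mact F (a e) e)"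
    by (rule sum.mono_neutral_left) (use assms E_carr in \<open>auto simp: rep_def\<close>)
  then show ?thesis using assms by (auto simp: rep_def)
qed

lemma rep_unique:
  assumes "rep f u S a" "rep f u' T b" "f \<in> N"
  shows "u = u' \<and> a = b"
proof -
  have T: "finite (S \<union> T)" "S \<union> T \<subseteq> E" using assms by (auto simp: rep_def)
  have *: "\<exists>m. lookup m = a \<and> keys m \<subseteq> E \<and> (\<forall>e. lookup m e \<in> acarrier A) \<and>
        f - (\<Sum>e\<in>keys m. mact F (lookup m e) e) = u \<and> u \<in> U"
    if r: "rep f u S a" for u S a
  proof -
    have fin: "finite {e. a e \<noteq> 0}"
      using r by (auto simp: rep_def intro: finite_subset[of _ S])
    define m where "m = Abs_poly_mapping a"
    have m: "lookup m = a" unfolding m_def using fin by simp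
    have k: "keys m = {e. a e \<noteq> 0}" by (auto simp: in_keys_iff m)
    have "(\<Sum>e\<in>S. mact F (a e) e) = (\<Sum>e\<in>keys m. mact F (a e) e)"
      by (rule sum.mono_neutral_right) (use r E_carr k in \<open>auto simp: rep_def\<close>)
    then show ?thesis using r k m by (auto simp: rep_def intro!: exI[of _ m])
  qed
  obtain m where m: "lookup m = a" "keys m \<subseteq> E" "\<forall>e. lookup m e \<in> acarrier A"
    "f - (\<Sum>e\<in>keys m. mact F (lookup m e) e) = u" "u \<in> U"
    using *[OF assms(1)] by blast
  obtain m' where m': "lookup m' = b" "keys m' \<subseteq> E" "\<forall>e. lookup m' e \<in> acarrier A"
    "f - (\<Sum>e\<in>keys m'. mact F (lookup m' e) e) = u'" "u' \<in> U"
    using *[OF assms(2)] by blast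
  have "\<exists>!a. keys a \<subseteq> E \<and> (\<forall>e. lookup a e \<in> acarrier A) \<and>
        f - (\<Sum>e\<in>keys a. mact F (lookup a e) e) \<in> U"
    using basis assms(3) unfolding basis_of_quotient_def by blast
  then have "m = m'" using m m' by blast
  then show ?thesis using m m' by simp
qed

definition ext :: "'f \<Rightarrow> 'g" where
  "ext f = (THE y. \<exists>u S a. rep f u S a \<and> y = h u + (\<Sum>e\<in>S. mact G (a e) (img e)))"

lemma ext_eq:
  assumes f: "f \<in> N" and r: "rep f u S a"
  shows "ext f = h u + (\<Sum>e\<in>S. mact G (a e) (img e))"
  unfolding ext_def
proof (rule the_equality)
  show "\<exists>v T b. rep f v T b \<and> h u + (\<Sum>e\<in>S. mact G (a e) (img e)) = h v + (\<Sum>e\<in>T. mact G (b e) (img e))"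
    using r by blast
next
  fix y assume "\<exists>v T b. rep f v T b \<and> y = h v + (\<Sum>e\<in>T. mact G (b e) (img e))"
  then obtain v T b where r': "rep f v T b" and y: "y = h v + (\<Sum>e\<in>T. mact G (b e) (img e))"
    by blast
  have eq: "u = v" "a = b" using rep_unique[OF r r' f] by auto
  have fin: "finite S" "finite T" "S \<subseteq> E" "T \<subseteq> E" using r r' by (auto simp: rep_def)
  have a0: "mact G (a e) (img e) = 0" if "e \<in> S \<union> T" "e \<notin> S \<inter> T" for e
  proof -
    have "a e = 0" "e \<in> E" using that r r' eq by (auto simp: rep_def)
    then show ?thesis using img_carr by simp
  qed
  have "(\<Sum>e\<in>S. mact G (a e) (img e)) = (\<Sum>e\<in>S \<inter> T. mact G (a e) (img e))"
    by (rule sum.mono_neutral_right) (use fin a0 in auto)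
  moreover have "(\<Sum>e\<in>T. mact G (a e) (img e)) = (\<Sum>e\<in>S \<inter> T. mact G (a e) (img e))"
    by (rule sum.mono_neutral_right) (use fin a0 in auto)
  ultimately have "(\<Sum>e\<in>S. mact G (a e) (img e)) = (\<Sum>e\<in>T. mact G (a e) (img e))" by simp
  then show "y = h u + (\<Sum>e\<in>S. mact G (a e) (img e))" using y eq by simp
qed

lemma rep_single:
  assumes "u \<in> U" shows "rep u u {} (\<lambda>_. 0)"
  using assms by (simp add: rep_def F.A.carr_closed)

lemma ext_U: "f \<in> U \<Longrightarrow> ext f = h f"
  using ext_eq[OF _ rep_single] UN by auto

lemma ext_add:
  assumes "f \<in> N" "g \<in> N" shows "ext (f + g) = ext f + ext g"
proof -
  obtain u S a where r: "rep f u S a" using rep_exists assms by blast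
  obtain v T b where r': "rep g v T b" using rep_exists assms by blast
  have T: "finite (S \<union> T)" "S \<union> T \<subseteq> E" using r r' by (auto simp: rep_def)
  have R: "rep f u (S \<union> T) a" "rep g v (S \<union> T) b"
    using rep_extend[OF r T] rep_extend[OF r' T] by auto
  have ab: "a e \<in> acarrier A" "b e \<in> acarrier A" for e using r r' by (auto simp: rep_def)
  have uv: "u \<in> U" "v \<in> U" using r r' by (auto simp: rep_def)
  have eq: "(\<Sum>e\<in>S \<union> T. mact F (a e + b e) e) = (\<Sum>e\<in>S \<union> T. mact F (a e) e) + (\<Sum>e\<in>S \<union> T. mact F (b e) e)"
    unfolding sum.distrib[symmetric] by (rule sum.cong) (use ab T E_carr F.act_add_left in auto)
  have "rep (f + g) (u + v) (S \<union> T) (\<lambda>e. a e + b e)"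
    using R uv ab T by (auto simp: rep_def U_add F.A.carr_closed eq algebra_simps)
  then have "ext (f + g) = h (u + v) + (\<Sum>e\<in>S \<union> T. mact G (a e + b e) (img e))"
    by (rule ext_eq[OF N_add[OF assms]])
  also have "(\<Sum>e\<in>S \<union> T. mact G (a e + b e) (img e)) =
      (\<Sum>e\<in>S \<union> T. mact G (a e) (img e)) + (\<Sum>e\<in>S \<union> T. mact G (b e) (img e))"
    unfolding sum.distrib[symmetric] by (rule sum.cong) (use ab T img_carr G.act_add_left in auto)
  finally show ?thesis
    using ext_eq[OF assms(1) R(1)] ext_eq[OF assms(2) R(2)] uv by (simp add: h_add algebra_simps)
qed

lemma act_sum_F: "b \<in> acarrier A \<Longrightarrow> (\<And>e. e \<in> S \<Longrightarrow> y e \<in> mcarrier F) \<Longrightarrow>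
    mact F b (sum y S) = (\<Sum>e\<in>S. mact F b (y e))"
proof (induction S rule: infinite_finite_induct)
  case (insert x S)
  then show ?case by (simp add: F.act_add_right additive_subgroup_sum[OF F.F.carr_subgroup])
qed auto

lemma act_sum_G: "b \<in> acarrier A \<Longrightarrow> (\<And>e. e \<in> S \<Longrightarrow> y e \<in> mcarrier G) \<Longrightarrow>
    mact G b (sum y S) = (\<Sum>e\<in>S. mact G b (y e))"
proof (induction S rule: infinite_finite_induct)
  case (insert x S)
  then show ?case by (simp add: G.act_add_right additive_subgroup_sum[OF G.F.carr_subgroup])
qed auto

lemma ext_act:
  assumes "f \<in> N" "b \<in> acarrier A" shows "ext (mact F b f) = mact G b (ext f)"
proof -
  obtain u S a where r: "rep f u S a" using rep_exists assms by blast
  have a: "a e \<in> acarrier A" for e using r by (auto simp: rep_def)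
  have S: "e \<in> mcarrier F" "img e \<in> mcarrier G" if "e \<in> S" for e
    using r that E_carr img_carr by (auto simp: rep_def)
  have u: "u \<in> U" "u \<in> mcarrier F" using r U_carr by (auto simp: rep_def)
  have sF: "mact F b (\<Sum>e\<in>S. mact F (a e) e) = (\<Sum>e\<in>S. mact F (amul A b (a e)) e)"
    using a S assms(2) by (subst act_sum_F) (auto simp: F.act_carrier F.act_mul)
  have "f = u + (\<Sum>e\<in>S. mact F (a e) e)" using r by (simp add: rep_def)
  moreover have "(\<Sum>e\<in>S. mact F (a e) e) \<in> mcarrier F"
    using a S by (intro additive_subgroup_sum[OF F.F.carr_subgroup] F.act_carrier)
  ultimately have "mact F b f = mact F b u + (\<Sum>e\<in>S. mact F (amul A b (a e)) e)"
    using u assms(2) sF by (simp add: F.act_add_right)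
  then have "rep (mact F b f) (mact F b u) S (\<lambda>e. amul A b (a e))"
    using r assms(2) by (simp add: rep_def U_act F.mul_carrier)
  then have "ext (mact F b f) = h (mact F b u) + (\<Sum>e\<in>S. mact G (amul A b (a e)) (img e))"
    by (rule ext_eq[OF N_act[OF assms(2,1)]])
  also have "\<dots> = mact G b (h u) + mact G b (\<Sum>e\<in>S. mact G (a e) (img e))"
    using a S assms(2) u by (subst act_sum_G) (auto simp: G.act_carrier G.act_mul h_act)
  also have "\<dots> = mact G b (ext f)"
    using ext_eq[OF assms(1) r] a S u assms(2)
    by (simp add: G.act_add_right h_carr additive_subgroup_sum[OF G.F.carr_subgroup] G.act_carrier)
  finally show ?thesis .
qed

lemma component_act:
  assumes "a \<in> acarrier A" "e \<in> mcomp F q"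
  shows "component (mcomp F) (mact F a e) p = mact F (component (acomp A) a (p - q)) e"
  using F.A.component_map[OF F.F.graded_family_axioms assms(1), of "\<lambda>p. p + q" "\<lambda>a. mact F a e" "p - q"]
    F.act_comp'[OF _ assms(2)] F.F.comp_carr[OF assms(2)]
  by (simp add: inj_def F.act_add_left)

text \<open>The coefficients of a homogeneous element can be assumed homogeneous: replacing them by their
  components in the right degrees gives another presentation of the element.\<close>

lemma ext_comp:
  assumes f: "f \<in> N" "f \<in> mcomp F q"
  shows "ext f \<in> mcomp G (q + (n, 0))"
proof -
  obtain u S a where r: "rep f u S a" using rep_exists f by blast
  have a: "a e \<in> acarrier A" for e using r by (auto simp: rep_def)
  have S: "e \<in> mcarrier F" "e \<in> E" if "e \<in> S" for e
    using r that E_carr by (auto simp: rep_def)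
  have u: "u \<in> U" "u \<in> mcarrier F" using r U_carr by (auto simp: rep_def)
  define a' where "a' e = component (acomp A) (a e) (q - deg e)" for e
  have a': "a' e \<in> acomp A (q - deg e)" for e
    unfolding a'_def by (rule F.A.component_in[OF a])
  have sum: "component (mcomp F) (\<Sum>e\<in>T. mact F (a e) e) q = (\<Sum>e\<in>T. mact F (a' e) e)"
    if "finite T" "T \<subseteq> S" for T
    using that
  proof (induction T)
    case (insert e T)
    then have e: "e \<in> mcarrier F" "e \<in> mcomp F (deg e)" using S E_comp by auto
    have "(\<Sum>e\<in>T. mact F (a e) e) \<in> mcarrier F"
      using insert S by (intro additive_subgroup_sum[OF F.F.carr_subgroup] F.act_carrier a) auto
    then show ?case using insert e
      by (simp add: F.F.component_add F.act_carrier a component_act[OF a e(2)] a'_def)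
  qed (simp add: F.F.component_zero)
  have "f = component (mcomp F) f q" using F.F.component_single[OF f(2), of q] by simp
  also have "\<dots> = component (mcomp F) (u + (\<Sum>e\<in>S. mact F (a e) e)) q" using r by (simp add: rep_def)
  also have "component (mcomp F) (u + (\<Sum>e\<in>S. mact F (a e) e)) q =
      component (mcomp F) u q + (\<Sum>e\<in>S. mact F (a' e) e)"
    using u a S r sum[of S]
    by (simp add: F.F.component_add additive_subgroup_sum[OF F.F.carr_subgroup] F.act_carrier rep_def)
  finally have "f = component (mcomp F) u q + (\<Sum>e\<in>S. mact F (a' e) e)" .
  moreover have cu: "component (mcomp F) u q \<in> U"
    by (rule dg_submodule_component[OF F.dg_module_over_axioms subU u(1)])
  ultimately have "rep f (component (mcomp F) u q) S a'"
    using r a' F.A.comp_carr by (simp add: rep_def a'_def F.A.component_zero) (meson F.A.comp_carr)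
  then have "ext f = h (component (mcomp F) u q) + (\<Sum>e\<in>S. mact G (a' e) (img e))"
    by (rule ext_eq[OF f(1)])
  moreover have "mact G (a' e) (img e) \<in> mcomp G (q + (n, 0))" if "e \<in> S" for e
    using G.act_comp'[OF a'[of e] img(1)[OF S(2)[OF that]]] by (simp add: algebra_simps)
  ultimately show ?thesis
    using h_comp[OF cu F.F.component_in[OF u(2)]]
    by (simp add: additive_subgroup_add[OF G.subgroup_mcomp] additive_subgroup_sum[OF G.subgroup_mcomp])
qed

lemma ext_basis: "e \<in> E \<Longrightarrow> ext e = img e"
proof -
  assume e: "e \<in> E"
  have "rep e 0 {e} (\<lambda>e'. if e' = e then aone A else 0)"
    using e E_carr by (auto simp: rep_def U_zero F.one_carrier F.A.carr_closed F.act_one)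
  from ext_eq[OF E_N[OF e] this] show ?thesis
    using img_carr[OF e] by (simp add: h_zero G.act_one)
qed

lemma lift_at_add:
  assumes "f \<in> N" "g \<in> N" "lift_at ext f" "lift_at ext g" "ext f \<in> mcarrier G" "ext g \<in> mcarrier G"
  shows "lift_at ext (f + g)"
  using assms NF N_dif
  by (simp add: lift_at_def ext_add subset_iff G.dif_add F.dif_add G.res_add \<theta>_add \<zeta>_add)

lemma lift_at_act_basis:
  assumes e: "e \<in> E" and a: "a \<in> acarrier A"
  shows "lift_at ext (mact F a e)"
  using a
proof (induction rule: F.A.carr_induct)
  case zero
  have "lift_at ext 0" using h_lift[OF U_zero] by (simp add: lift_at_def ext_U U_zero)
  then show ?case using E_carr[OF e] by simp
next
  case (add a b)
  have "ext (mact F c e) \<in> mcarrier G" if "c \<in> acarrier A" for c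
    using that e E_N img_carr by (simp add: ext_act ext_basis G.act_carrier)
  then show ?case using add e E_N E_carr
    by (simp add: F.act_add_left lift_at_add N_act)
next
  case (homogeneous p a)
  obtain i j where p: "p = (i, j)" by (cases p)
  have a: "a \<in> acomp A (i, j)" using homogeneous p by simp
  note ac = F.A.comp_carr[OF a] and dc = F.adif_carrier[OF F.A.comp_carr[OF a]]
  note eN = E_N[OF e] and dU = dE[OF e]
  have dN: "mdif F e \<in> N" using dU UN by blast
  have adN: "mact F a (mdif F e) \<in> N" using N_act[OF ac dN] .
  have neg: "ext (alt_sign i f) = alt_sign i (ext f)" if "f \<in> N" for f
  proof -
    have fc: "- f \<in> N" using subN that by (auto simp: dg_submodule_def intro: additive_subgroup_uminus)
    have "ext 0 = 0" using ext_U[OF U_zero] h_zero by simp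
    then have "ext (- f) = - ext f" using ext_add[OF that fc] by (simp add: eq_neg_iff_add_eq_0 add.commute)
    then show ?thesis by (simp add: alt_sign_def)
  qed
  have aN: "alt_sign i (mact F a (mdif F e)) \<in> N"
    using subN adN by (auto simp: dg_submodule_def intro: additive_subgroup_alt_sign)
  have "ext (mdif F (mact F a e)) =
      mact G (adif A a) (img e) + alt_sign i (mact G a (h (mdif F e)))"
    using a E_carr[OF e] dc ac eN dU dN adN aN
    by (simp add: F.leibniz ext_add N_act neg ext_act ext_basis[OF e] ext_U)
  moreover have "mdif G (ext (mact F a e)) =
      mact G (adif A a) (img e) + alt_sign i (mact G a (h (mdif F e) + \<theta> e))"
    using ac eN img_carr[OF e] by (simp add: ext_act ext_basis[OF e] G.leibniz[OF a] img(2)[OF e])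
  moreover have "\<theta> (mact F a e) = alt_sign i (mact G a (\<theta> e))"
    using \<theta>_act[OF a E_carr[OF e]] by simp
  moreover have "\<rho> (ext (mact F a e)) = \<zeta> (mact F a e)"
    using ac eN img_carr[OF e] E_carr[OF e]
    by (simp add: ext_act ext_basis[OF e] G.res_act img(3)[OF e] \<zeta>_act)
  ultimately show ?case
    using h_carr[OF dU] \<theta>_carr[OF E_carr[OF e]] ac
    by (simp add: lift_at_def G.act_add_right alt_sign_add algebra_simps)
qed

lemma lift_on_ext: "lift_on N ext"
  unfolding lift_on_def
proof (intro conjI ballI allI)
  fix f assume f: "f \<in> N"
  obtain u S a where r: "rep f u S a" using rep_exists f by blast
  have "finite S" "S \<subseteq> E" using r by (auto simp: rep_def)
  then have "u + (\<Sum>e\<in>S. mact F (a e) e) \<in> N \<and> ext (u + (\<Sum>e\<in>S. mact F (a e) e)) \<in> mcarrier G \<and>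
      lift_at ext (u + (\<Sum>e\<in>S. mact F (a e) e))"
  proof (induction S)
    case empty
    have u: "u \<in> U" using r by (simp add: rep_def)
    then have "lift_at ext u" using h_lift[OF u] ext_U[OF U_dif] ext_U by (simp add: lift_at_def)
    then show ?case using u UN by (auto simp: ext_U h_carr)
  next
    case (insert e S)
    have a: "a e \<in> acarrier A" using r by (auto simp: rep_def)
    have "ext (mact F (a e) e) \<in> mcarrier G" "mact F (a e) e \<in> N"
      using insert a E_N img_carr by (auto simp: ext_act ext_basis G.act_carrier N_act)
    then have "lift_at ext (u + (\<Sum>e\<in>S. mact F (a e) e) + mact F (a e) e)"
      "u + (\<Sum>e\<in>S. mact F (a e) e) + mact F (a e) e \<in> N"
      "ext (u + (\<Sum>e\<in>S. mact F (a e) e) + mact F (a e) e) \<in> mcarrier G"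
      using insert a lift_at_act_basis by (auto intro!: lift_at_add N_add simp: ext_add G.F.carr_closed)
    then show ?case using insert by (simp add: algebra_simps)
  qed
  then show "lift_at ext f" using r by (simp add: rep_def)
qed (auto simp: ext_add ext_act ext_comp)

end

context lifting_problem
begin

text \<open>The extensions along the filtration agree where both are defined, so they glue.\<close>

lemma lift_exists:
  assumes sf: "semifree A F"
  shows "\<exists>h. lift_on (mcarrier F) h"
proof -
  obtain U where U0: "U 0 = {0}" and UU: "(\<Union>p. U p) = mcarrier F"
    and sub: "\<And>p. dg_submodule A F (U p)" and mono: "\<And>p. U p \<subseteq> U (Suc p)"
    and ex: "\<And>p. \<exists>E. basis_of_quotient A F (U (Suc p)) (U p) E \<and> (\<forall>e\<in>E. mdif F e \<in> U p)"
    using sf unfolding semifree_def by (auto; blast)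
  have z: "\<theta> 0 = 0" "\<zeta> 0 = 0"
    using \<theta>_add[OF F.F.carr_closed(1) F.F.carr_closed(1)]
      \<zeta>_act[OF F.A.carr_closed(1) F.F.carr_closed(1)] by (simp_all add: F.F.carr_closed)
  have r0: "\<rho> 0 = 0" using G.res_dif[OF G.F.carr_closed(1)] by simp
  have base: "lift_on (U 0) (\<lambda>_. 0)"
    by (auto simp: lift_on_def lift_at_def U0 z r0 G.F.comp_zero)
  have step: "\<exists>h'. lift_on (U (Suc p)) h' \<and> (\<forall>f\<in>U p. h' f = h f)" if h: "lift_on (U p) h" for p h
  proof -
    obtain E where E: "basis_of_quotient A F (U (Suc p)) (U p) E" "\<forall>e\<in>E. mdif F e \<in> U p"
      using ex by blast
    interpret lifting_step A scal F G \<rho> n \<theta> \<zeta> "U p" "U (Suc p)" E h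
      by unfold_locales (use sub mono E h UU in blast)+
    show ?thesis using lift_on_ext ext_U by blast
  qed
  obtain H where H: "\<And>p. lift_on (U p) (H p)" and HS: "\<And>p. \<forall>f\<in>U p. H (Suc p) f = H p f"
    using dependent_nat_choice[of "\<lambda>p h. lift_on (U p) h" "\<lambda>p h h'. \<forall>f\<in>U p. h' f = h f"]
      base step by blast
  have mono': "U p \<subseteq> U q" if "p \<le> q" for p q using lift_Suc_mono_le[of U, OF mono that] .
  have agree: "H q f = H p f" if "p \<le> q" "f \<in> U p" for p q f
    using that(1)
  proof (induction q rule: dec_induct)
    case (step q)
    then show ?case using HS mono'[OF step(1)] that(2) by auto
  qed simp
  define h where "h f = H (LEAST p. f \<in> U p) f" for f
  have h: "h f = H p f" if "f \<in> U p" for f p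
    unfolding h_def using agree[of "LEAST p. f \<in> U p" p f] that Least_le LeastI by metis
  have "lift_on (U p) h" for p
  proof -
    have d: "mdif F f \<in> U p" if "f \<in> U p" for f using sub that by (simp add: dg_submodule_def)
    have ac: "mact F a f \<in> U p" if "f \<in> U p" "a \<in> acarrier A" for f a
      using sub that by (simp add: dg_submodule_def)
    have ad: "f + g \<in> U p" if "f \<in> U p" "g \<in> U p" for f g
      using sub that by (auto simp: dg_submodule_def intro: additive_subgroup_add)
    have Hp: "H p (f + g) = H p f + H p g" "a \<in> acarrier A \<Longrightarrow> H p (mact F a f) = mact G a (H p f)"
      "f \<in> mcomp F q \<Longrightarrow> H p f \<in> mcomp G (q + (n, 0))" "lift_at (H p) f"
      if "f \<in> U p" "g \<in> U p" for f g a q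
      using H[of p] that unfolding lift_on_def by blast+
    show ?thesis unfolding lift_on_def
    proof (intro conjI ballI allI)
      fix f assume f: "f \<in> U p"
      show "lift_at h f" using Hp(4)[OF f f] by (simp add: lift_at_def h[OF f] h[OF d[OF f]])
    next
      fix q f assume f: "f \<in> U p \<inter> mcomp F q"
      then show "h f \<in> mcomp G (q + (n, 0))" using Hp(3)[of f f q] h[of f p] by simp
    next
      fix f g assume fg: "f \<in> U p" "g \<in> U p"
      show "h (f + g) = h f + h g" unfolding h[OF ad[OF fg]] h[OF fg(1)] h[OF fg(2)] by (rule Hp(1)[OF fg])
    next
      fix a f assume af: "a \<in> acarrier A" "f \<in> U p"
      show "h (mact F a f) = mact G a (h f)"
        unfolding h[OF ac[OF af(2,1)]] h[OF af(2)] by (rule Hp(2)[OF af(2,2,1)])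
    qed
  qed
  note hp = this
  have two: "\<exists>p. f \<in> U p \<and> g \<in> U p" if "f \<in> mcarrier F" "g \<in> mcarrier F" for f g
  proof -
    have "f \<in> (\<Union>p. U p)" "g \<in> (\<Union>p. U p)" using that by (simp_all only: UU)
    then obtain p q where "f \<in> U p" "g \<in> U q" by blast
    then have "f \<in> U (max p q)" "g \<in> U (max p q)"
      using subsetD[OF mono'[of p "max p q"]] subsetD[OF mono'[of q "max p q"]] by simp_all
    then show ?thesis by blast
  qed
  have "lift_on (mcarrier F) h"
    unfolding lift_on_def
  proof (intro conjI ballI allI)
    fix f g assume "f \<in> mcarrier F" "g \<in> mcarrier F"
    then obtain p where "f \<in> U p" "g \<in> U p" using two by blast
    then show "h (f + g) = h f + h g" using hp[of p] by (simp add: lift_on_def)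
  next
    fix a f assume a: "a \<in> acarrier A" and "f \<in> mcarrier F"
    then obtain p where "f \<in> U p" using two by blast
    then show "h (mact F a f) = mact G a (h f)" using hp[of p] a by (simp add: lift_on_def)
  next
    fix q f assume f: "f \<in> mcarrier F \<inter> mcomp F q"
    then obtain p where p: "f \<in> U p" using two by blast
    have "\<forall>q. \<forall>f\<in>U p \<inter> mcomp F q. h f \<in> mcomp G (q + (n, 0))"
      using hp[of p] unfolding lift_on_def by (elim conjE)
    then show "h f \<in> mcomp G (q + (n, 0))" using f p by blast
  next
    fix f assume "f \<in> mcarrier F"
    then obtain p where "f \<in> U p" using two by blast
    then show "lift_at h f" using hp[of p] by (simp add: lift_on_def)
  qed
  then show ?thesis by blast
qed

end

context dg_module_over
begin

lemma twist_act:
  assumes "a \<in> acomp A p" "f \<in> mcarrier F"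
  shows "twist (mcomp F) (mact F a f) = alt_sign (fst p) (mact F a (twist (mcomp F) f))"
  using assms(2)
proof (induction rule: F.carr_induct)
  case (homogeneous q f)
  have "mact F a f \<in> mcomp F (p + q)" using act_comp'[OF assms(1) homogeneous] .
  from F.twist_homogeneous[OF this] show ?case
    using A.comp_carr[OF assms(1)] F.comp_carr[OF homogeneous]
    by (simp add: F.twist_homogeneous[OF homogeneous] act_alt_sign_right alt_sign_alt_sign)
qed (use A.comp_carr[OF assms(1)] in
    \<open>simp_all add: act_add_right F.twist_add F.twist_carr act_carrier alt_sign_add\<close>)

lemma twist_dif: "f \<in> mcarrier F \<Longrightarrow> mdif F (twist (mcomp F) f) = - twist (mcomp F) (mdif F f)"
proof (induction rule: F.carr_induct)
  case (homogeneous q f)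
  from F.twist_homogeneous[OF dif_comp'[OF homogeneous]] show ?case
    using F.comp_carr[OF homogeneous]
    by (simp add: F.twist_homogeneous[OF homogeneous] dif_alt_sign alt_sign_pred)
qed (simp_all add: F.twist_add F.twist_carr dif_add dif_carrier)

lemma aug_part_map:
  assumes "dg_module_over A scal G" "f \<in> aug_part A F"
    and add: "\<And>f g. f \<in> mcarrier F \<Longrightarrow> g \<in> mcarrier F \<Longrightarrow> h (f + g) = h f + h g"
    and act: "\<And>a f. a \<in> acarrier A \<Longrightarrow> f \<in> mcarrier F \<Longrightarrow> h (mact F a f) = mact G a (h f)"
    and carr: "\<And>f. f \<in> mcarrier F \<Longrightarrow> h f \<in> mcarrier G"
  shows "h f \<in> aug_part A G"
proof -
  interpret G: dg_module_over A scal G by (rule assms(1))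
  have h0: "h 0 = 0" using add[OF F.carr_closed(1) F.carr_closed(1)] by simp
  show ?thesis using assms(2)
  proof (induction rule: aug_part_induct)
    case zero then show ?case by (simp add: h0 G.aug_part_closed)
  next
    case (diff f g)
    have "h (f - g) = h f - h g"
      using add[of "f - g" g] diff by (simp add: F.carr_closed)
    then show ?case using diff by (simp add: G.aug_part_closed)
  next
    case (act a f) then show ?case by (simp add: assms(4) carr G.act_aug_part)
  qed
qed

end

context residue_resolution
begin

lemma res_zero [simp]: "\<rho> 0 = 0"
  using res_dif[OF F.carr_closed(1)] by simp

lemma res_uminus: "g \<in> mcarrier G \<Longrightarrow> \<rho> (- g) = - \<rho> g"
  using res_add[of g "- g"] by (simp add: F.carr_closed eq_neg_iff_add_eq_0 add.commute)

lemma res_diff: "f \<in> mcarrier G \<Longrightarrow> g \<in> mcarrier G \<Longrightarrow> \<rho> (f - g) = \<rho> f - \<rho> g"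
  using res_add[of f "- g"] by (simp add: F.carr_closed res_uminus)

lemma res_twist: "g \<in> mcarrier G \<Longrightarrow> \<rho> (twist (mcomp G) g) = \<rho> g"
proof (induction rule: F.carr_induct)
  case (homogeneous p g)
  then show ?case using res_comp[OF homogeneous] res_comp[OF F.twist_comp[OF homogeneous]]
    by (cases "p = (0, 0)") (auto simp: F.twist_homogeneous[OF homogeneous] alt_sign_def)
qed (simp_all add: F.twist_add F.twist_carr res_add)

end

text \<open>The lifting problem with \<open>n = 0\<close> and \<open>\<theta> = 0\<close>.\<close>

lemma chain_map_exists:
  assumes F: "residue_resolution A scal F \<pi>" and G: "residue_resolution A scal G \<rho>"
    and sf: "semifree A F"
  obtains h where "\<And>f g. f \<in> mcarrier F \<Longrightarrow> g \<in> mcarrier F \<Longrightarrow> h (f + g) = h f + h g"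
    "\<And>a f. a \<in> acarrier A \<Longrightarrow> f \<in> mcarrier F \<Longrightarrow> h (mact F a f) = mact G a (h f)"
    "\<And>f p. f \<in> mcomp F p \<Longrightarrow> h f \<in> mcomp G p"
    "\<And>f. f \<in> mcarrier F \<Longrightarrow> mdif G (h f) = h (mdif F f)"
    "\<And>f. f \<in> mcarrier F \<Longrightarrow> \<rho> (h f) = \<pi> f"
proof -
  interpret F: residue_resolution A scal F \<pi> by (rule F)
  interpret G: residue_resolution A scal G \<rho> by (rule G)
  interpret lifting_problem A scal F G \<rho> 0 "\<lambda>_. 0" \<pi>
  proof unfold_locales
    fix f p assume "f \<in> mcomp F p" "p + (0::int, 0::int) \<noteq> (0, 0)"
    then show "\<pi> f = 0" using F.res_comp by (metis add_0_right zero_prod_def)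
  qed (auto simp: F.res_add F.res_act F.res_dif G.F.comp_zero F.A.comp_carr)
  obtain h where h: "lift_on (mcarrier F) h" using lift_exists[OF sf] by blast
  show thesis
  proof (rule that[of h])
    fix f p assume f: "f \<in> mcomp F p"
    have "h f \<in> mcomp G (p + (0, 0))" using h F.F.comp_carr[OF f] f unfolding lift_on_def by blast
    then show "h f \<in> mcomp G p" by (metis add_0_right zero_prod_def)
  qed (use h in \<open>simp_all add: lift_on_def lift_at_def\<close>)
qed

text \<open>There are chain maps in both directions, and the composite \<open>\<beta>\<alpha>\<close> is homotopic to the identity. All
  these maps are linear, so they preserve the parts generated by the augmentation ideal.\<close>

lemma tor_zero_independent:
  fixes A :: "('k::field, 'a::ab_group_add) dga" and F :: "('a, 'f::ab_group_add) dgm"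
    and G :: "('a, 'g::ab_group_add) dgm"
  assumes A: "connected_dga A scal" and SF: "semifree_resolution A F \<pi>" and SG: "semifree_resolution A G \<rho>"
    and tz: "tor_zero A F i j"
  shows "tor_zero A G i j"
proof -
  note RF = semifree_resolutionD[OF A SF] and RG = semifree_resolutionD[OF A SG]
  interpret F: residue_resolution A scal F \<pi> by (rule RF)
  interpret G: residue_resolution A scal G \<rho> by (rule RG)
  have sF: "semifree A F" and sG: "semifree A G" using SF SG by (simp_all add: semifree_resolution_def)
  obtain \<alpha> where \<alpha>: "\<And>f g. f \<in> mcarrier G \<Longrightarrow> g \<in> mcarrier G \<Longrightarrow> \<alpha> (f + g) = \<alpha> f + \<alpha> g"
    "\<And>a f. a \<in> acarrier A \<Longrightarrow> f \<in> mcarrier G \<Longrightarrow> \<alpha> (mact G a f) = mact F a (\<alpha> f)"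
    "\<And>f p. f \<in> mcomp G p \<Longrightarrow> \<alpha> f \<in> mcomp F p"
    "\<And>f. f \<in> mcarrier G \<Longrightarrow> mdif F (\<alpha> f) = \<alpha> (mdif G f)"
    "\<And>f. f \<in> mcarrier G \<Longrightarrow> \<pi> (\<alpha> f) = \<rho> f"
    using chain_map_exists[OF RG RF sG] by blast
  obtain \<beta> where \<beta>: "\<And>f g. f \<in> mcarrier F \<Longrightarrow> g \<in> mcarrier F \<Longrightarrow> \<beta> (f + g) = \<beta> f + \<beta> g"
    "\<And>a f. a \<in> acarrier A \<Longrightarrow> f \<in> mcarrier F \<Longrightarrow> \<beta> (mact F a f) = mact G a (\<beta> f)"
    "\<And>f p. f \<in> mcomp F p \<Longrightarrow> \<beta> f \<in> mcomp G p"
    "\<And>f. f \<in> mcarrier F \<Longrightarrow> mdif G (\<beta> f) = \<beta> (mdif F f)"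
    "\<And>f. f \<in> mcarrier F \<Longrightarrow> \<rho> (\<beta> f) = \<pi> f"
    using chain_map_exists[OF RF RG sF] by blast
  have carr_map: "\<gamma> f \<in> internal_sum UNIV D"
    if "graded_family C" "graded_family D" "f \<in> internal_sum UNIV C"
      "\<And>f p. f \<in> C p \<Longrightarrow> \<gamma> f \<in> D p"
      "\<And>f g. f \<in> internal_sum UNIV C \<Longrightarrow> g \<in> internal_sum UNIV C \<Longrightarrow> \<gamma> (f + g) = \<gamma> f + \<gamma> g"
    for \<gamma> :: "'x::ab_group_add \<Rightarrow> 'y::ab_group_add" and C D :: "int \<times> int \<Rightarrow> _" and f
    using graded_family.component_map[OF that(1,2,3), of "\<lambda>p. p" \<gamma>] that(4,5) by auto
  have \<alpha>c: "\<alpha> f \<in> mcarrier F" if "f \<in> mcarrier G" for f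
    by (rule carr_map[OF G.F.graded_family_axioms F.F.graded_family_axioms that]) (use \<alpha> in auto)
  have \<beta>c: "\<beta> f \<in> mcarrier G" if "f \<in> mcarrier F" for f
    by (rule carr_map[OF F.F.graded_family_axioms G.F.graded_family_axioms that]) (use \<beta> in auto)
  define \<delta> where "\<delta> g = \<beta> (\<alpha> g) - g" for g
  have \<delta>: "\<delta> (f + g) = \<delta> f + \<delta> g" "\<delta> f \<in> mcarrier G" "mdif G (\<delta> f) = \<delta> (mdif G f)" "\<rho> (\<delta> f) = 0"
    "a \<in> acarrier A \<Longrightarrow> \<delta> (mact G a f) = mact G a (\<delta> f)"
    if "f \<in> mcarrier G" "g \<in> mcarrier G" for f g a
    using that by (simp_all add: \<delta>_def \<alpha> \<beta> \<alpha>c \<beta>c G.F.carr_closed G.dif_diff G.res_diff G.act_diff_right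
        G.dif_carrier)
  have \<delta>p: "\<delta> f \<in> mcomp G p" if "f \<in> mcomp G p" for f p
    unfolding \<delta>_def by (rule additive_subgroup_diff[OF G.subgroup_mcomp \<beta>(3)[OF \<alpha>(3)[OF that]] that])
  interpret H: lifting_problem A scal G G \<rho> 1 "\<lambda>g. twist (mcomp G) (\<delta> g)" "\<lambda>_. 0"
  proof unfold_locales
    fix f p assume f: "f \<in> mcomp G p"
    have "twist (mcomp G) (\<delta> f) \<in> mcomp G p" using G.F.twist_comp[OF \<delta>p[OF f]] .
    then show "twist (mcomp G) (\<delta> f) \<in> mcomp G (p + (1 - 1, 0))"
      by (metis add_0_right diff_self zero_prod_def)
  next
    fix a p f assume "a \<in> acomp A p" "f \<in> mcarrier G"
    then show "twist (mcomp G) (\<delta> (mact G a f)) = alt_sign (fst p) (mact G a (twist (mcomp G) (\<delta> f)))"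
      using F.A.comp_carr by (metis G.twist_act \<delta>(2,5))
  qed (simp_all add: \<delta> G.F.twist_add G.twist_dif G.res_twist)
  obtain h where h: "H.lift_on (mcarrier G) h" using H.lift_exists[OF sG] by blast
  show ?thesis unfolding tor_zero_def
  proof (intro ballI impI)
    fix g assume g: "g \<in> mcomp G (i, j)" and dg: "mdif G g \<in> aug_part A G"
    note gc = G.F.comp_carr[OF g]
    have "mdif F (\<alpha> g) \<in> aug_part A F"
      unfolding \<alpha>(4)[OF gc]
      by (rule G.aug_part_map[OF F.dg_module_over_axioms dg]) (use \<alpha> \<alpha>c in auto)
    then obtain u where u: "u \<in> mcomp F (i + 1, j)" "\<alpha> g - mdif F u \<in> aug_part A F"
      using tz \<alpha>(3)[OF g] unfolding tor_zero_def by blast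
    note uc = F.F.comp_carr[OF u(1)]
    have "\<beta> (\<alpha> g - mdif F u) \<in> aug_part A G"
      by (rule F.aug_part_map[OF G.dg_module_over_axioms u(2)]) (use \<beta> \<beta>c in auto)
    moreover have "\<beta> (\<alpha> g - mdif F u) = \<beta> (\<alpha> g) - mdif G (\<beta> u)"
      using \<beta>(1)[of "\<alpha> g - mdif F u" "mdif F u"] \<beta>(4)[OF uc] \<alpha>c[OF gc] F.dif_carrier[OF uc]
      by (simp add: F.F.carr_closed)
    ultimately have 1: "\<beta> (\<alpha> g) - mdif G (\<beta> u) \<in> aug_part A G" by simp
    have "h g \<in> mcomp G ((i, j) + (1, 0))" using h gc g unfolding H.lift_on_def by blast
    then have hg: "h g \<in> mcomp G (i + 1, j)" by simp
    have hc: "h f \<in> mcarrier G" if "f \<in> mcarrier G" for f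
    proof -
      have "inj (\<lambda>p::int \<times> int. p + (1, 0))" by (simp add: inj_def)
      then show ?thesis
        using G.F.component_map[OF G.F.graded_family_axioms that, of "\<lambda>p. p + (1, 0)" h] h
        unfolding H.lift_on_def by (metis G.F.comp_carr IntI)
    qed
    have "h (mdif G g) \<in> aug_part A G"
      by (rule G.aug_part_map[OF G.dg_module_over_axioms dg]) (use h hc in \<open>auto simp: H.lift_on_def\<close>)
    moreover have "mdif G (h g) = h (mdif G g) + alt_sign i (\<delta> g)"
      using h gc G.F.twist_homogeneous[OF \<delta>p[OF g]] by (simp add: H.lift_on_def H.lift_at_def)
    ultimately have "alt_sign i (mdif G (h g) - alt_sign i (\<delta> g)) \<in> aug_part A G"
      by (simp add: additive_subgroup_alt_sign[OF G.aug_part_subgroup])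
    then have 2: "alt_sign i (mdif G (h g)) - \<delta> g \<in> aug_part A G"
      by (simp add: alt_sign_diff)
    (* g = beta (alpha g) - delta g, and up to the augmentation part these terms are the boundaries of
       the corresponding terms of ?w *)
    let ?w = "\<beta> u - alt_sign i (h g)"
    have "?w \<in> mcomp G (i + 1, j)"
      using \<beta>(3)[OF u(1)] hg by (intro additive_subgroup_diff[OF G.subgroup_mcomp]
          additive_subgroup_alt_sign[OF G.subgroup_mcomp])
    moreover have "g - mdif G ?w \<in> aug_part A G"
    proof -
      have "mdif G ?w = mdif G (\<beta> u) - alt_sign i (mdif G (h g))"
        using \<beta>c[OF uc] hc[OF gc] G.F.carr_closed
        by (simp add: G.dif_diff G.dif_alt_sign additive_subgroup_alt_sign[OF G.F.carr_subgroup])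
      moreover have "x - y + (z - (x - v)) = v - (y - z)" for x y z v :: "'g"
        by (simp add: algebra_simps)
      ultimately show ?thesis
        using G.aug_part_closed(4)[OF 1 2] unfolding \<delta>_def by metis
    qed
    ultimately show "\<exists>w\<in>mcomp G (i + 1, j). g - mdif G w \<in> aug_part A G" by blast
  qed
qed

section \<open>The bar resolution\<close>

lemma sum_single_lookup: "(\<Sum>w\<in>keys f. single w (lookup f w)) = f"
proof (rule poly_mapping_eqI)
  fix v
  have "(\<Sum>w\<in>keys f. lookup f w when w = v) = lookup f v"
    by (cases "v \<in> keys f")
      (simp_all add: when_def in_keys_iff)
  then show "lookup (\<Sum>w\<in>keys f. single w (lookup f w)) v =
      lookup f v"
    by (simp add: lookup_sum lookup_single)
qed

text \<open>The definition of a basis has coefficients indexed by the basis elements themselves. Coordinate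
  functions indexed by an arbitrary set are easier to give and to compute with.\<close>

lemma (in dg_module_over) basis_of_quotientI:
  fixes b :: "'x \<Rightarrow> 'f" and \<kappa> :: "'f \<Rightarrow> 'x \<Rightarrow> 'a"
  assumes inj: "inj_on b X" and b: "\<And>x. x \<in> X \<Longrightarrow> b x \<in> N \<and> (\<exists>p. b x \<in> mcomp F p)"
    and fin: "\<And>f. f \<in> N \<Longrightarrow> finite {x \<in> X. \<kappa> f x \<noteq> 0}"
    and carr: "\<And>f x. f \<in> N \<Longrightarrow> x \<in> X \<Longrightarrow> \<kappa> f x \<in> acarrier A"
    and gen: "\<And>f. f \<in> N \<Longrightarrow> f - (\<Sum>x | x \<in> X \<and> \<kappa> f x \<noteq> 0. mact F (\<kappa> f x) (b x)) \<in> N'"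
    and uniq: "\<And>f a S x. f \<in> N \<Longrightarrow> finite S \<Longrightarrow> S \<subseteq> X \<Longrightarrow> (\<And>y. a y \<in> acarrier A) \<Longrightarrow>
        (\<And>y. y \<notin> S \<Longrightarrow> a y = 0) \<Longrightarrow> f - (\<Sum>y\<in>S. mact F (a y) (b y)) \<in> N' \<Longrightarrow> x \<in> X \<Longrightarrow> \<kappa> f x = a x"
  shows "basis_of_quotient A F N N' (b ` X)"
  unfolding basis_of_quotient_def
proof (intro conjI ballI)
  show "b ` X \<subseteq> N \<inter> (\<Union>p. mcomp F p)" using b by blast
  fix f assume f: "f \<in> N"
  let ?P = "\<lambda>a. keys a \<subseteq> b ` X \<and> (\<forall>e. lookup a e \<in> acarrier A) \<and>
        f - (\<Sum>e\<in>keys a. mact F (lookup a e) e) \<in> N'"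
  define c where "c = inv_into X b"
  have c: "c (b x) = x" if "x \<in> X" for x using inj that by (simp add: c_def)
  have bc: "b (c e) = e" "c e \<in> X" if "e \<in> b ` X" for e
    using that by (auto simp: c_def f_inv_into_f inv_into_into)
  show "\<exists>!a. ?P a"
  proof (rule ex_ex1I)
    let ?S = "{x \<in> X. \<kappa> f x \<noteq> 0}"
    let ?g = "\<lambda>e. if e \<in> b ` ?S then \<kappa> f (c e) else 0"
    have "finite {e. ?g e \<noteq> 0}" by (rule finite_subset[of _ "b ` ?S"]) (use fin[OF f] in auto)
    then have l: "lookup (Abs_poly_mapping ?g) = ?g" by simp
    have k: "keys (Abs_poly_mapping ?g) = b ` ?S"
      unfolding keys.rep_eq l using c by auto
    have "(\<Sum>e\<in>b ` ?S. mact F (?g e) e) = (\<Sum>x\<in>?S. mact F (\<kappa> f x) (b x))"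
      by (subst sum.reindex) (use inj c in \<open>auto simp: inj_on_def intro!: sum.cong\<close>)
    then have "?P (Abs_poly_mapping ?g)"
      unfolding k l using gen[OF f] carr[OF f] c A.carr_closed(1) by auto
    then show "\<exists>a. ?P a" by blast
  next
    fix m m' assume m: "?P m" and m': "?P m'"
    have *: "lookup m (b x) = \<kappa> f x" if P: "?P m" and x: "x \<in> X" for m x
    proof -
      let ?S = "c ` keys m"
      let ?a = "\<lambda>y. if y \<in> ?S then lookup m (b y) else 0"
      have S: "?S \<subseteq> X" "inj_on c (keys m)"
        using P bc by (auto simp: inj_on_def) (metis subsetD)
      have "(\<Sum>e\<in>keys m. mact F (lookup m e) e) = (\<Sum>y\<in>?S. mact F (?a y) (b y))"
        by (subst sum.reindex[OF S(2)]) (use P bc in \<open>auto intro!: sum.cong\<close>)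
      then have "f - (\<Sum>y\<in>?S. mact F (?a y) (b y)) \<in> N'" using P by simp
      then have "\<kappa> f x = ?a x"
        by (rule uniq[OF f _ S(1) _ _ _ x, rotated -1]) (use P A.carr_closed(1) in auto)
      also have "\<dots> = lookup m (b x)"
        using c[OF x] by (auto simp: in_keys_iff) (metis bc(1) c image_eqI in_keys_iff x)
      finally show ?thesis by simp
    qed
    show "m = m'"
    proof (rule poly_mapping_eqI)
      fix e
      show "lookup m e = lookup m' e"
      proof (cases "e \<in> b ` X")
        case True
        then show ?thesis using *[OF m] *[OF m'] by auto
      next
        case False
        then have "e \<notin> keys m" "e \<notin> keys m'" using m m' by auto
        then show ?thesis by (simp add: in_keys_iff)
      qed
    qed
  qed
qed

text \<open>A homogeneous basis of the augmentation ideal over the scalars, indexed by the set \<open>N\<close> of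
  letters, with the coordinates \<open>co\<close>.\<close>

locale bar_data = connected_dga A scal
  for A :: "('k::field, 'a::ab_group_add) dga" and scal +
  fixes N :: "nat set" and lt :: "nat \<Rightarrow> 'a" and ldeg :: "nat \<Rightarrow> int \<times> int" and co :: "'a \<Rightarrow> nat \<Rightarrow> 'k"
  assumes lt_comp: "l \<in> N \<Longrightarrow> lt l \<in> acomp A (ldeg l)"
    and lt_aug: "l \<in> N \<Longrightarrow> aaug A (lt l) = 0"
    and co_add: "a \<in> acarrier A \<Longrightarrow> b \<in> acarrier A \<Longrightarrow> co (a + b) l = co a l + co b l"
    and co_mul_scal: "a \<in> acarrier A \<Longrightarrow> co (amul A (scal c) a) l = c * co a l"
    and co_lt: "l \<in> N \<Longrightarrow> m \<in> N \<Longrightarrow> co (lt m) l = (if l = m then 1 else 0)"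
    and co_scal: "co (scal c) l = 0"
    and co_comp: "a \<in> acomp A p \<Longrightarrow> co a l \<noteq> 0 \<Longrightarrow> l \<in> N \<and> ldeg l = p"
    and co_finite: "a \<in> acarrier A \<Longrightarrow> finite {l. co a l \<noteq> 0}"
    and expansion: "a \<in> acarrier A \<Longrightarrow>
          a = scal (aaug A a) + (\<Sum>l | co a l \<noteq> 0. amul A (scal (co a l)) (lt l))"
begin

lemma lt_carr: "l \<in> N \<Longrightarrow> lt l \<in> acarrier A"
  using A.comp_carr[OF lt_comp] .

lemma co_zero [simp]: "co 0 l = 0"
  using co_scal[of 0] by simp

lemma co_letter: "a \<in> acarrier A \<Longrightarrow> co a l \<noteq> 0 \<Longrightarrow> l \<in> N"
proof (induction rule: A.carr_induct)
  case (add a b)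
  then show ?case by (cases "co a l = 0") (auto simp: co_add)
qed (auto dest: co_comp)

lemma ldeg_nonneg: "l \<in> N \<Longrightarrow> 0 \<le> fst (ldeg l) \<and> 0 \<le> snd (ldeg l)"
proof -
  assume l: "l \<in> N"
  have "lt l \<noteq> 0" using co_lt[OF l l] by auto
  then show ?thesis
    using lt_comp[OF l] acomp_neg[of "fst (ldeg l)" "snd (ldeg l)"] by fastforce
qed

text \<open>The word \<open>w\<close> with letters in \<open>N\<close> stands for the basis element \<open>[w]\<close> of the bar resolution.
  Words are encoded by natural numbers.\<close>

definition words :: "nat set" where
  "words = list_encode ` lists N"

fun wdeg_list :: "nat list \<Rightarrow> int \<times> int" where
  "wdeg_list [] = (0, 0)"
| "wdeg_list (l # ls) = ldeg l + (1, 0) + wdeg_list ls"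

definition wdeg :: "nat \<Rightarrow> int \<times> int" where
  "wdeg w = wdeg_list (list_decode w)"

definition wcons :: "nat \<Rightarrow> nat \<Rightarrow> nat" where
  "wcons l w = list_encode (l # list_decode w)"

lemma wcons_eq_iff [simp]: "wcons l w = wcons l' w' \<longleftrightarrow> l = l' \<and> w = w'"
proof -
  have "wcons l w = wcons l' w' \<longleftrightarrow> list_decode w = list_decode w' \<and> l = l'"
    unfolding wcons_def by (metis list_encode_inverse list.inject)
  then show ?thesis by (metis list_decode_inverse)
qed

lemma wcons_neq_zero [simp]: "wcons l w \<noteq> 0" "0 \<noteq> wcons l w"
  by (auto simp: wcons_def)

lemma list_decode_wcons [simp]: "list_decode (wcons l w) = l # list_decode w"
  unfolding wcons_def by (rule list_encode_inverse)

lemma wdeg_zero: "wdeg 0 = (0, 0)"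
  by (simp add: wdeg_def)

lemma wdeg_wcons: "wdeg (wcons l w) = ldeg l + (1, 0) + wdeg w"
  by (simp add: wdeg_def)

lemma words_zero: "0 \<in> words"
  unfolding words_def by (rule image_eqI[of _ _ "[]"]) auto

lemma words_wcons: "wcons l w \<in> words \<longleftrightarrow> l \<in> N \<and> w \<in> words"
proof -
  have *: "v \<in> words \<longleftrightarrow> list_decode v \<in> lists N" for v
    unfolding words_def by (metis image_iff list_decode_inverse list_encode_inverse)
  show ?thesis by (simp add: *)
qed

lemma word_cases: obtains "v = 0" | l w where "v = wcons l w"
proof (cases "list_decode v")
  case Nil
  then have "v = 0" by (metis list_decode_inverse list_encode.simps(1))
  then show ?thesis using that by blast
next
  case (Cons l ls)
  then have "v = wcons l (list_encode ls)"
    unfolding wcons_def by (metis list_decode_inverse list_encode_inverse)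
  then show ?thesis using that by blast
qed

lemma word_induct [consumes 1, case_names zero wcons]:
  assumes "v \<in> words" "P 0" "\<And>l w. l \<in> N \<Longrightarrow> w \<in> words \<Longrightarrow> P w \<Longrightarrow> P (wcons l w)"
  shows "P v"
proof -
  obtain ls where "v = list_encode ls" "ls \<in> lists N" using assms(1) by (auto simp: words_def)
  from this(2) have "P (list_encode ls)"
  proof (induction ls)
    case (Cons l ls)
    have "list_encode ls \<in> words" using Cons by (auto simp: words_def)
    then have "P (wcons l (list_encode ls))" using Cons assms(3) by blast
    then show ?case by (simp only: wcons_def list_encode_inverse)
  qed (use assms(2) in simp)
  then show ?thesis using \<open>v = list_encode ls\<close> by simp
qed

lemma wdeg_nonneg: "w \<in> words \<Longrightarrow> 0 \<le> fst (wdeg w) \<and> 0 \<le> snd (wdeg w)"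
proof (induction rule: word_induct)
  case (wcons l w)
  then show ?case using ldeg_nonneg[of l] by (simp add: wdeg_wcons)
qed (simp add: wdeg_zero)

definition bcomp :: "int \<times> int \<Rightarrow> (nat \<Rightarrow>\<^sub>0 'a) set" where
  "bcomp p = {f. (\<forall>w. w \<notin> words \<longrightarrow> lookup f w = 0) \<and> (\<forall>w. lookup f w \<in> acomp A (p - wdeg w))}"

definition bact :: "'a \<Rightarrow> (nat \<Rightarrow>\<^sub>0 'a) \<Rightarrow> (nat \<Rightarrow>\<^sub>0 'a)" where
  "bact a f = Poly_Mapping.map (amul A a) f"

text \<open>The contracting homotopy \<open>a[w] \<mapsto> \<Sum> a\<^sub>l [l w]\<close>, where the \<open>a\<^sub>l\<close> are the coordinates of \<open>a\<close>.\<close>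

definition bcontr :: "(nat \<Rightarrow>\<^sub>0 'a) \<Rightarrow> (nat \<Rightarrow>\<^sub>0 'a)" where
  "bcontr f = Abs_poly_mapping (\<lambda>v. case list_decode v of [] \<Rightarrow> 0
     | l # ls \<Rightarrow> scal (co (lookup f (list_encode ls)) l))"

text \<open>The differential is forced by the contracting homotopy \<open>s\<close>: the word \<open>l w\<close> is \<open>s (l [w])\<close>, so that
  \<open>\<partial> s + s \<partial> = 1\<close> determines its boundary by recursion on the length.\<close>

fun bdif_list :: "nat list \<Rightarrow> (nat \<Rightarrow>\<^sub>0 'a)" where
  "bdif_list [] = 0"
| "bdif_list (l # ls) = single (list_encode ls) (lt l) -
     bcontr (single (list_encode ls) (adif A (lt l)) + bact (twist (acomp A) (lt l)) (bdif_list ls))"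

definition bdw :: "nat \<Rightarrow> (nat \<Rightarrow>\<^sub>0 'a)" where
  "bdw w = (if w \<in> words then bdif_list (list_decode w) else 0)"

definition bdif :: "(nat \<Rightarrow>\<^sub>0 'a) \<Rightarrow> (nat \<Rightarrow>\<^sub>0 'a)" where
  "bdif f = (\<Sum>w\<in>keys f. single w (adif A (lookup f w)) +
     bact (twist (acomp A) (lookup f w)) (bdw w))"

definition bar :: "('a, nat \<Rightarrow>\<^sub>0 'a) dgm" where
  "bar = \<lparr>mcomp = bcomp, mact = bact, mdif = bdif\<rparr>"

definition bcarr :: "(nat \<Rightarrow>\<^sub>0 'a) set" where
  "bcarr = {f. (\<forall>w. w \<notin> words \<longrightarrow> lookup f w = 0) \<and> (\<forall>w. lookup f w \<in> acarrier A)}"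

lemma bdw_zero [simp]: "bdw 0 = 0"
  by (simp add: bdw_def)

lemma bdw_wcons: "l \<in> N \<Longrightarrow> w \<in> words \<Longrightarrow> bdw (wcons l w) = single w (lt l) -
    bcontr (single w (adif A (lt l)) + bact (twist (acomp A) (lt l)) (bdw w))"
  by (simp add: bdw_def words_wcons)

lemma bcarr_subgroup: "additive_subgroup bcarr"
  unfolding additive_subgroup_def bcarr_def
  by (simp add: lookup_minus A.carr_closed)

lemmas bcarr_closed = additive_subgroup_closed[OF bcarr_subgroup]

lemma bcarr_lookup: "f \<in> bcarr \<Longrightarrow> lookup f w \<in> acarrier A"
  by (simp add: bcarr_def)

lemma bcarr_single: "w \<in> words \<Longrightarrow> a \<in> acarrier A \<Longrightarrow> single w a \<in> bcarr"
  by (auto simp: bcarr_def lookup_single when_def A.carr_closed)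

lemma bcomp_carr: "f \<in> bcomp p \<Longrightarrow> f \<in> bcarr"
  unfolding bcomp_def bcarr_def by (auto intro: A.comp_carr)

lemma bcomp_subgroup: "additive_subgroup (bcomp p)"
  unfolding additive_subgroup_def bcomp_def
  by (simp add: lookup_minus A.comp_zero additive_subgroup_diff[OF acomp_subgroup])

lemma bcomp_single: "w \<in> words \<Longrightarrow> a \<in> acomp A q \<Longrightarrow> single w a \<in> bcomp (q + wdeg w)"
  by (auto simp: bcomp_def lookup_single when_def A.comp_zero)

lemma bcomp_independent: "independent_family bcomp"
  unfolding independent_family_def
proof (intro allI impI ballI)
  fix S y p assume fin: "finite S" and y: "\<forall>p\<in>S. y p \<in> bcomp p" and 0: "(\<Sum>p\<in>S. y p) = 0" and p: "p \<in> S"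
  show "y p = 0"
  proof (rule poly_mapping_eqI)
    fix w
    let ?T = "(\<lambda>p. p - wdeg w) ` S"
    let ?z = "\<lambda>q. lookup (y (q + wdeg w)) w"
    have "(\<Sum>q\<in>?T. ?z q) = (\<Sum>p\<in>S. lookup (y p) w)"
      by (subst sum.reindex) (auto simp: inj_on_def)
    also have "\<dots> = 0" using 0 by (simp flip: lookup_sum)
    finally have "(\<Sum>q\<in>?T. ?z q) = 0" .
    moreover have "\<forall>q\<in>?T. ?z q \<in> acomp A q" using y by (auto simp: bcomp_def)
    moreover have "finite ?T" using fin by (rule finite_imageI)
    ultimately have "\<forall>q\<in>?T. ?z q = 0"
      using acomp_independent[unfolded independent_family_def, THEN spec, THEN spec, of ?T ?z] by (elim impE)
    then have "?z (p - wdeg w) = 0" using p by blast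
    then show "lookup (y p) w = lookup 0 w" by simp
  qed
qed

lemma bcarr_induct [consumes 1, case_names zero add single]:
  assumes "f \<in> bcarr" "P 0" "\<And>f g. f \<in> bcarr \<Longrightarrow> g \<in> bcarr \<Longrightarrow> P f \<Longrightarrow> P g \<Longrightarrow> P (f + g)"
    "\<And>w a. w \<in> words \<Longrightarrow> a \<in> acarrier A \<Longrightarrow> P (single w a)"
  shows "P f"
proof -
  have s: "single w (lookup f w) \<in> bcarr"
    "P (single w (lookup f w))" if "w \<in> keys f" for w
  proof -
    have "w \<in> words" "lookup f w \<in> acarrier A"
      using that assms(1) by (auto simp: bcarr_def in_keys_iff)
    then show "single w (lookup f w) \<in> bcarr"
      "P (single w (lookup f w))" by (simp_all add: bcarr_single assms(4))
  qed
  have "sum (\<lambda>w. single w (lookup f w)) W \<in> bcarr \<and>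
      P (sum (\<lambda>w. single w (lookup f w)) W)"
    if "finite W" "W \<subseteq> keys f" for W
    using that by (induction W) (auto simp: bcarr_closed assms(2) s intro!: assms(3))
  from this[of "keys f"] show ?thesis by (simp add: sum_single_lookup)
qed

lemma bcarr_eq: "internal_sum UNIV bcomp = bcarr"
proof -
  interpret B: graded_family bcomp
    by unfold_locales (rule bcomp_subgroup bcomp_independent)+
  have "f \<in> internal_sum UNIV bcomp" if "f \<in> bcarr" for f
    using that
  proof (induction rule: bcarr_induct)
    case (single w a)
    from single(2) show ?case
    proof (induction rule: A.carr_induct)
      case (homogeneous p a)
      then show ?case using B.comp_carr[OF bcomp_single[OF single(1)]] by blast
    qed (simp_all add: B.carr_closed single_add)
  qed (simp_all add: B.carr_closed)
  moreover have "f \<in> bcarr" if "f \<in> internal_sum UNIV bcomp" for f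
    using that by (induction rule: B.carr_induct) (auto simp: bcarr_closed bcomp_carr)
  ultimately show ?thesis by blast
qed

lemma lookup_bact: "a \<in> acarrier A \<Longrightarrow> lookup (bact a f) w = amul A a (lookup f w)"
  by (simp add: bact_def map.rep_eq when_def)

lemma bact_single: "a \<in> acarrier A \<Longrightarrow> bact a (single w b) = single w (amul A a b)"
  by (rule poly_mapping_eqI) (simp add: lookup_bact lookup_single when_def)

lemma bact_carr: "a \<in> acarrier A \<Longrightarrow> f \<in> bcarr \<Longrightarrow> bact a f \<in> bcarr"
  by (simp add: bcarr_def lookup_bact mul_carrier)

lemma bact_comp: "a \<in> acomp A q \<Longrightarrow> f \<in> bcomp p \<Longrightarrow> bact a f \<in> bcomp (q + p)"
  using mul_comp'[of a q] by (auto simp: bcomp_def lookup_bact[OF A.comp_carr] A.comp_carr simp flip: add_diff_eq)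

lemma bact_add: "a \<in> acarrier A \<Longrightarrow> f \<in> bcarr \<Longrightarrow> g \<in> bcarr \<Longrightarrow> bact a (f + g) = bact a f + bact a g"
  by (rule poly_mapping_eqI) (simp add: lookup_bact lookup_add mul_add_right bcarr_lookup)

lemma bact_add_left:
  "a \<in> acarrier A \<Longrightarrow> b \<in> acarrier A \<Longrightarrow> f \<in> bcarr \<Longrightarrow> bact (a + b) f = bact a f + bact b f"
  by (rule poly_mapping_eqI) (simp add: lookup_bact lookup_add mul_add_left bcarr_lookup A.carr_closed)

lemma bact_bact: "a \<in> acarrier A \<Longrightarrow> b \<in> acarrier A \<Longrightarrow> f \<in> bcarr \<Longrightarrow> bact (amul A a b) f = bact a (bact b f)"
  by (rule poly_mapping_eqI) (simp add: lookup_bact mul_assoc bcarr_lookup mul_carrier)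

lemma bact_one: "f \<in> bcarr \<Longrightarrow> bact (aone A) f = f"
  by (rule poly_mapping_eqI) (simp add: lookup_bact one_carrier one_mul bcarr_lookup)

lemma bact_zero [simp]: "a \<in> acarrier A \<Longrightarrow> bact a 0 = 0"
  by (rule poly_mapping_eqI) (simp add: lookup_bact)

lemma bact_zero_left [simp]: "f \<in> bcarr \<Longrightarrow> bact 0 f = 0"
  by (rule poly_mapping_eqI) (simp add: lookup_bact A.carr_closed bcarr_lookup)

lemma bact_uminus_left: "a \<in> acarrier A \<Longrightarrow> f \<in> bcarr \<Longrightarrow> bact (- a) f = - bact a f"
  using bact_add_left[of a "- a" f] by (simp add: A.carr_closed eq_neg_iff_add_eq_0 add.commute)

lemma lookup_bcontr:
  assumes "f \<in> bcarr"
  shows "lookup (bcontr f) 0 = 0"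
    "lookup (bcontr f) (wcons l w) = scal (co (lookup f w) l)"
proof -
  let ?g = "\<lambda>v. case list_decode v of [] \<Rightarrow> 0
     | l # ls \<Rightarrow> scal (co (lookup f (list_encode ls)) l)"
  have "{v. ?g v \<noteq> 0} \<subseteq> (\<Union>w\<in>keys f. (\<lambda>l. wcons l w) ` {l. co (lookup f w) l \<noteq> 0})"
  proof
    fix v assume v: "v \<in> {v. ?g v \<noteq> 0}"
    have "\<exists>l w. v = wcons l w" using v by (cases v rule: word_cases) auto
    then obtain l w where lw: "v = wcons l w" by blast
    then have "co (lookup f w) l \<noteq> 0" using v by auto
    then show "v \<in> (\<Union>w\<in>keys f. (\<lambda>l. wcons l w) ` {l. co (lookup f w) l \<noteq> 0})"
      using lw by (auto simp: in_keys_iff intro!: bexI[of _ w])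
  qed
  moreover have "finite (\<Union>w\<in>keys f. (\<lambda>l. wcons l w) ` {l. co (lookup f w) l \<noteq> 0})"
    using assms by (auto simp: co_finite bcarr_lookup)
  ultimately have "finite {v. ?g v \<noteq> 0}" by (rule finite_subset)
  then have "lookup (bcontr f) = ?g" unfolding bcontr_def by simp
  then show "lookup (bcontr f) 0 = 0"
    "lookup (bcontr f) (wcons l w) = scal (co (lookup f w) l)" by simp_all
qed

lemma bcarr_eqI:
  assumes "lookup f 0 = lookup g 0"
    "\<And>l w. lookup f (wcons l w) = lookup g (wcons l w)"
  shows "f = g"
proof (rule poly_mapping_eqI)
  fix v show "lookup f v = lookup g v"
    using assms by (cases v rule: word_cases) auto
qed

lemma bcontr_comp:
  assumes f: "f \<in> bcomp p" shows "bcontr f \<in> bcomp (p + (1, 0))"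
proof -
  note fc = bcomp_carr[OF f]
  have "lookup (bcontr f) v \<in> acomp A (p + (1, 0) - wdeg v) \<and>
      (lookup (bcontr f) v \<noteq> 0 \<longrightarrow> v \<in> words)" for v
  proof (cases v rule: word_cases)
    case 1
    then show ?thesis by (simp add: lookup_bcontr[OF fc] A.comp_zero)
  next
    case (2 l w)
    let ?a = "lookup f w"
    have a: "?a \<in> acomp A (p - wdeg w)" using f by (simp add: bcomp_def)
    show ?thesis
    proof (cases "co ?a l = 0")
      case True then show ?thesis using 2 by (simp add: lookup_bcontr[OF fc] A.comp_zero)
    next
      case False
      then have l: "l \<in> N" "ldeg l = p - wdeg w" using co_comp[OF a] by auto
      have "?a \<noteq> 0" using False by auto
      then have "w \<in> words" using f by (auto simp: bcomp_def)
      moreover have "p + (1, 0) - wdeg v = (0, 0)"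
        unfolding 2 wdeg_wcons l by (simp add: zero_prod_def[symmetric])
      ultimately show ?thesis using 2 l(1) scal_comp
        by (simp only: lookup_bcontr(2)[OF fc] words_wcons) simp
    qed
  qed
  then show ?thesis unfolding bcomp_def by auto
qed

lemma bcontr_carr: "f \<in> bcarr \<Longrightarrow> bcontr f \<in> bcarr"
proof -
  assume f: "f \<in> bcarr"
  have "lookup (bcontr f) v \<in> acarrier A \<and>
      (lookup (bcontr f) v \<noteq> 0 \<longrightarrow> v \<in> words)" for v
  proof (cases v rule: word_cases)
    case (2 l w)
    let ?a = "lookup f w"
    have "l \<in> N \<and> w \<in> words" if "co ?a l \<noteq> 0"
    proof -
      have "?a \<noteq> 0" using that by auto
      then show ?thesis using f that co_letter[OF bcarr_lookup[OF f] that]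
        by (auto simp: bcarr_def)
    qed
    then show ?thesis using 2 scal_carrier
      by (cases "co ?a l = 0") (auto simp: lookup_bcontr[OF f] words_wcons A.carr_closed)
  qed (simp add: lookup_bcontr[OF f] A.carr_closed)
  then show ?thesis unfolding bcarr_def by auto
qed

lemma bcontr_add: "f \<in> bcarr \<Longrightarrow> g \<in> bcarr \<Longrightarrow> bcontr (f + g) = bcontr f + bcontr g"
  by (rule bcarr_eqI) (simp_all add: lookup_bcontr bcarr_closed lookup_add co_add scal_add bcarr_lookup)

lemma bcontr_zero [simp]: "bcontr 0 = 0"
  by (rule bcarr_eqI) (simp_all add: lookup_bcontr bcarr_closed)

lemma bcontr_uminus: "f \<in> bcarr \<Longrightarrow> bcontr (- f) = - bcontr f"
  using bcontr_add[of f "- f"] by (simp add: bcarr_closed eq_neg_iff_add_eq_0 add.commute)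

lemma bcontr_diff: "f \<in> bcarr \<Longrightarrow> g \<in> bcarr \<Longrightarrow> bcontr (f - g) = bcontr f - bcontr g"
  using bcontr_add[of f "- g"] by (simp add: bcarr_closed bcontr_uminus)

lemma bcontr_scal: "f \<in> bcarr \<Longrightarrow> bcontr (bact (scal c) f) = bact (scal c) (bcontr f)"
  by (rule bcarr_eqI)
    (simp_all add: lookup_bcontr lookup_bact bact_carr scal_carrier co_mul_scal bcarr_lookup scal_mul)

lemma bcontr_bcontr: "f \<in> bcarr \<Longrightarrow> bcontr (bcontr f) = 0"
proof (rule bcarr_eqI)
  fix l w assume f: "f \<in> bcarr"
  show "lookup (bcontr (bcontr f)) (wcons l w) = lookup 0 (wcons l w)"
    by (cases w rule: word_cases) (simp_all add: lookup_bcontr f bcontr_carr co_scal)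
qed (simp add: lookup_bcontr bcontr_carr)

lemma bcontr_one: "w \<in> words \<Longrightarrow> bcontr (single w (scal c)) = 0"
  by (rule bcarr_eqI)
    (simp_all add: lookup_bcontr bcarr_single scal_carrier lookup_single when_def co_scal)

lemma bcontr_letter:
  assumes "l \<in> N" "w \<in> words"
  shows "bcontr (single w (lt l)) = single (wcons l w) (aone A)"
proof (rule bcarr_eqI)
  fix m v
  have "co (lt l) m = (if m = l then 1 else 0)"
    using co_lt[of m l] co_letter[OF lt_carr[OF assms(1)], of m] assms by (cases "m \<in> N") auto
  then show "lookup (bcontr (single w (lt l))) (wcons m v) =
      lookup (single (wcons l w) (aone A)) (wcons m v)"
    using assms by (auto simp: lookup_bcontr bcarr_single lt_carr lookup_single when_def scal_one)
qed (use assms in \<open>simp add: lookup_bcontr bcarr_single lt_carr lookup_single when_def\<close>)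

lemma bdw_comp: "w \<in> words \<Longrightarrow> bdw w \<in> bcomp (wdeg w - (1, 0))"
proof (induction rule: word_induct)
  case zero
  then show ?case by (simp add: additive_subgroup_zero[OF bcomp_subgroup])
next
  case (wcons l w)
  note l = lt_comp[OF wcons(1)]
  have 1: "single w (lt l) \<in> bcomp (ldeg l + wdeg w)" by (rule bcomp_single[OF wcons(2) l])
  have "single w (adif A (lt l)) \<in> bcomp ((fst (ldeg l) - 1, snd (ldeg l)) + wdeg w)"
    by (rule bcomp_single[OF wcons(2) adif_comp'[OF l]])
  moreover have "(fst (ldeg l) - 1, snd (ldeg l)) + wdeg w = ldeg l + wdeg w - (1, 0)"
    by (simp add: prod_eq_iff)
  moreover have "bact (twist (acomp A) (lt l)) (bdw w) \<in> bcomp (ldeg l + (wdeg w - (1, 0)))"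
    by (rule bact_comp[OF A.twist_comp[OF l] wcons(3)])
  moreover have "ldeg l + (wdeg w - (1, 0)) = ldeg l + wdeg w - (1, 0)" by (simp add: algebra_simps)
  ultimately have "single w (adif A (lt l)) + bact (twist (acomp A) (lt l)) (bdw w)
      \<in> bcomp (ldeg l + wdeg w - (1, 0))"
    using additive_subgroup_add[OF bcomp_subgroup] by metis
  from bcontr_comp[OF this] have 2: "bcontr (single w (adif A (lt l)) +
      bact (twist (acomp A) (lt l)) (bdw w)) \<in> bcomp (ldeg l + wdeg w)" by simp
  have "wdeg (wcons l w) - (1, 0) = ldeg l + wdeg w" by (simp add: wdeg_wcons algebra_simps)
  then show ?case using additive_subgroup_diff[OF bcomp_subgroup 1 2] by (simp only: bdw_wcons[OF wcons(1,2)])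
qed

lemma bdw_carr: "bdw w \<in> bcarr"
  using bcomp_carr[OF bdw_comp] by (cases "w \<in> words") (simp_all add: bdw_def bcarr_closed)

lemma bdif_zero [simp]: "bdif 0 = 0"
  by (simp add: bdif_def)

lemma bdif_add:
  assumes "f \<in> bcarr" "g \<in> bcarr" shows "bdif (f + g) = bdif f + bdif g"
  unfolding bdif_def
proof (rule setsum_keys_plus_distrib)
  fix w
  show "single w (adif A (lookup f w + lookup g w)) +
      bact (twist (acomp A) (lookup f w + lookup g w)) (bdw w) =
      single w (adif A (lookup f w)) + bact (twist (acomp A) (lookup f w)) (bdw w) +
      (single w (adif A (lookup g w)) + bact (twist (acomp A) (lookup g w)) (bdw w))"
    using assms
    by (simp add: bcarr_lookup adif_add A.twist_add single_add bact_add_left A.twist_carr bdw_carr)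
next
  show "single w (adif A 0) + bact (twist (acomp A) 0) (bdw w) = 0" for w
    by (simp add: bdw_carr)
qed

lemma bdif_single:
  assumes "w \<in> words" "a \<in> acarrier A"
  shows "bdif (single w a) = single w (adif A a) + bact (twist (acomp A) a) (bdw w)"
  by (cases "a = 0") (simp_all add: bdif_def bdw_carr)

lemma bdif_comp:
  assumes f: "f \<in> bcomp p" shows "bdif f \<in> bcomp (p - (1, 0))"
  unfolding bdif_def
proof (rule additive_subgroup_sum[OF bcomp_subgroup])
  fix w assume "w \<in> keys f"
  then have w: "w \<in> words" using f by (auto simp: bcomp_def in_keys_iff)
  let ?a = "lookup f w" and ?q = "p - wdeg w"
  have a: "?a \<in> acomp A ?q" using f by (simp add: bcomp_def)
  have "single w (adif A ?a) \<in> bcomp ((fst ?q - 1, snd ?q) + wdeg w)"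
    by (rule bcomp_single[OF w adif_comp'[OF a]])
  moreover have "(fst ?q - 1, snd ?q) + wdeg w = p - (1, 0)" by (simp add: prod_eq_iff)
  moreover have "bact (twist (acomp A) ?a) (bdw w) \<in> bcomp (?q + (wdeg w - (1, 0)))"
    by (rule bact_comp[OF A.twist_comp[OF a] bdw_comp[OF w]])
  moreover have "?q + (wdeg w - (1, 0)) = p - (1, 0)" by (simp add: algebra_simps)
  ultimately show "single w (adif A ?a) + bact (twist (acomp A) ?a) (bdw w) \<in> bcomp (p - (1, 0))"
    using additive_subgroup_add[OF bcomp_subgroup] by metis
qed

lemma bdif_carr: "f \<in> bcarr \<Longrightarrow> bdif f \<in> bcarr"
proof (induction rule: bcarr_induct)
  case (single w a)
  then show ?case
    by (simp add: bdif_single bcarr_closed bcarr_single adif_carrier bact_carr A.twist_carr bdw_carr)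
qed (simp_all add: bcarr_closed bdif_add)

lemma bdif_uminus: "f \<in> bcarr \<Longrightarrow> bdif (- f) = - bdif f"
  using bdif_add[of f "- f"] by (simp add: bcarr_closed eq_neg_iff_add_eq_0 add.commute)

lemma bdif_diff: "f \<in> bcarr \<Longrightarrow> g \<in> bcarr \<Longrightarrow> bdif (f - g) = bdif f - bdif g"
  using bdif_add[of f "- g"] by (simp add: bcarr_closed bdif_uminus)

lemma twist_mul:
  assumes "a \<in> acarrier A" "b \<in> acarrier A"
  shows "twist (acomp A) (amul A a b) = amul A (twist (acomp A) a) (twist (acomp A) b)"
  using assms(1)
proof (induction rule: A.carr_induct)
  case (homogeneous p a)
  note a = homogeneous and ac = A.comp_carr[OF homogeneous]
  have neg: "amul A (alt_sign i a) (alt_sign j b) = alt_sign (i + j) (amul A a b)"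
    if "b \<in> acarrier A" for i j b
  proof -
    have "amul A (- a) b = - amul A a b" if "a \<in> acarrier A" "b \<in> acarrier A" for a b
      using mul_add_left[of a "- a" b] that by (simp add: A.carr_closed eq_neg_iff_add_eq_0 add.commute)
    moreover have "amul A a (- b) = - amul A a b" if "a \<in> acarrier A" "b \<in> acarrier A" for a b
      using mul_add_right[of a b "- b"] that by (simp add: A.carr_closed eq_neg_iff_add_eq_0 add.commute)
    ultimately show ?thesis using that ac by (simp add: alt_sign_def A.carr_closed)
  qed
  show ?case using assms(2)
  proof (induction rule: A.carr_induct)
    case (homogeneous q b)
    show ?case
      using A.twist_homogeneous[OF mul_comp'[OF a homogeneous]] neg[OF A.comp_carr[OF homogeneous]]
      by (simp add: A.twist_homogeneous[OF a] A.twist_homogeneous[OF homogeneous])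
  qed (simp_all add: mul_add_right ac A.twist_add mul_carrier A.twist_carr)
qed (simp_all add: mul_add_left assms A.twist_add mul_carrier A.twist_carr)

lemma twist_adif: "a \<in> acarrier A \<Longrightarrow> twist (acomp A) (adif A a) = - adif A (twist (acomp A) a)"
proof (induction rule: A.carr_induct)
  case (homogeneous p a)
  have "adif A (- b) = - adif A b" if "b \<in> acarrier A" for b
    using adif_add[of b "- b"] that by (simp add: A.carr_closed eq_neg_iff_add_eq_0 add.commute)
  then have "adif A (alt_sign i a) = alt_sign i (adif A a)" for i
    using A.comp_carr[OF homogeneous] by (simp add: alt_sign_def)
  then show ?case
    by (simp add: A.twist_homogeneous[OF homogeneous] A.twist_homogeneous[OF adif_comp'[OF homogeneous]]
        alt_sign_pred)
qed (simp_all add: A.twist_add adif_add adif_carrier A.twist_carr)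

lemma adif_mul':
  assumes "a \<in> acarrier A" "b \<in> acarrier A"
  shows "adif A (amul A a b) = amul A (adif A a) b + amul A (twist (acomp A) a) (adif A b)"
  using assms(1)
proof (induction rule: A.carr_induct)
  case (homogeneous p a)
  note ac = A.comp_carr[OF homogeneous]
  have "amul A (- a) (adif A b) = - amul A a (adif A b)"
    using mul_add_left[of a "- a" "adif A b"] assms(2) ac
    by (simp add: A.carr_closed adif_carrier eq_neg_iff_add_eq_0 add.commute)
  then show ?case
    using adif_mul[of a "fst p" "snd p" b] homogeneous assms(2)
    by (simp add: A.twist_homogeneous[OF homogeneous] alt_sign_def)
qed (simp_all add: mul_add_left assms adif_add A.twist_add mul_carrier adif_carrier A.twist_carr)

lemma bdif_bact:
  assumes a: "a \<in> acarrier A" and f: "f \<in> bcarr"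
  shows "bdif (bact a f) = bact (adif A a) f + bact (twist (acomp A) a) (bdif f)"
  using f
proof (induction rule: bcarr_induct)
  case (single w b)
  note ab = mul_carrier[OF a single(2)] and ta = A.twist_carr[OF a] and tb = A.twist_carr[OF single(2)]
  have "bdif (bact a (single w b)) =
      single w (adif A (amul A a b)) + bact (twist (acomp A) (amul A a b)) (bdw w)"
    using single ab by (simp add: bact_single[OF a] bdif_single)
  also have "\<dots> = single w (amul A (adif A a) b) +
      (single w (amul A (twist (acomp A) a) (adif A b)) +
       bact (twist (acomp A) a) (bact (twist (acomp A) b) (bdw w)))"
    using a single ta tb by (simp add: adif_mul' twist_mul single_add bact_bact bdw_carr algebra_simps)
  also have "single w (amul A (twist (acomp A) a) (adif A b)) +
       bact (twist (acomp A) a) (bact (twist (acomp A) b) (bdw w)) =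
      bact (twist (acomp A) a) (bdif (single w b))"
    using single ta tb
    by (simp add: bdif_single bact_add bcarr_single adif_carrier bact_carr bdw_carr bact_single)
  finally show ?case using adif_carrier[OF a] by (simp add: bact_single)
qed (simp_all add: a A.twist_carr adif_carrier bact_add bdif_add bact_carr bdif_carr)

lemma twist_scal: "twist (acomp A) (scal c) = scal c"
  using A.twist_homogeneous[OF scal_comp] by (simp add: alt_sign_def)

lemma bdif_scal: "f \<in> bcarr \<Longrightarrow> bdif (bact (scal c) f) = bact (scal c) (bdif f)"
  by (simp add: bdif_bact scal_carrier adif_scal twist_scal)

lemma bdif_one: "w \<in> words \<Longrightarrow> bdif (single w (aone A)) = bdw w"
  using bdif_single[OF _ one_carrier] adif_scal[of 1] twist_scal[of 1]
  by (simp add: scal_one bact_one bdw_carr)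

lemma bcontr_bdw:
  assumes "l \<in> N" "w \<in> words"
  shows "bcontr (bdw (wcons l w)) = single (wcons l w) (aone A)"
proof -
  let ?x = "single w (adif A (lt l)) + bact (twist (acomp A) (lt l)) (bdw w)"
  have x: "?x \<in> bcarr"
    using assms by (simp add: bcarr_closed bcarr_single adif_carrier lt_carr bact_carr A.twist_carr bdw_carr)
  show ?thesis
    using assms x by (simp add: bdw_wcons bcontr_diff bcarr_single lt_carr bcontr_carr bcontr_bcontr bcontr_letter)
qed

definition baug :: "(nat \<Rightarrow>\<^sub>0 'a) \<Rightarrow> 'k" where
  "baug f = aaug A (lookup f 0)"

lemma baug_add: "f \<in> bcarr \<Longrightarrow> g \<in> bcarr \<Longrightarrow> baug (f + g) = baug f + baug g"
  by (simp add: baug_def lookup_add aug_add bcarr_lookup)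

definition bunit :: "(nat \<Rightarrow>\<^sub>0 'a) \<Rightarrow> (nat \<Rightarrow>\<^sub>0 'a)" where
  "bunit f = single 0 (scal (baug f))"

lemma bunit_add: "f \<in> bcarr \<Longrightarrow> g \<in> bcarr \<Longrightarrow> bunit (f + g) = bunit f + bunit g"
  by (simp add: bunit_def baug_add scal_add single_add)

text \<open>On a word with a letter as coefficient the identity is the definition of the differential. The
  letters and the unit span the algebra, and all maps involved are linear over the scalars.\<close>

lemma bcontr_homotopy:
  assumes "f \<in> bcarr"
  shows "bdif (bcontr f) + bcontr (bdif f) = f - bunit f"
  using assms
proof (induction rule: bcarr_induct)
  case zero
  then show ?case by (simp add: bunit_def baug_def)
next
  case (add f g)
  have "bdif (bcontr (f + g)) + bcontr (bdif (f + g)) =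
      (bdif (bcontr f) + bcontr (bdif f)) + (bdif (bcontr g) + bcontr (bdif g))"
    using add(1,2) by (simp add: bcontr_add bdif_add bdif_carr bcontr_carr algebra_simps)
  then show ?case using add by (simp add: bunit_add)
next
  case (single w a)
  define P where "P f \<longleftrightarrow> f \<in> bcarr \<and> bdif (bcontr f) + bcontr (bdif f) = f - bunit f" for f
  have P_add: "P (f + g)" if "P f" "P g" for f g
  proof -
    have "f \<in> bcarr" "g \<in> bcarr" using that by (simp_all add: P_def)
    then have "bdif (bcontr (f + g)) + bcontr (bdif (f + g)) =
        (bdif (bcontr f) + bcontr (bdif f)) + (bdif (bcontr g) + bcontr (bdif g))"
      by (simp add: bcontr_add bdif_add bdif_carr bcontr_carr algebra_simps)
    then show ?thesis using that by (simp add: P_def bcarr_closed bunit_add)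
  qed
  have P_scal: "P (bact (scal c) f)" if "P f" for f c
  proof -
    have f: "f \<in> bcarr" and e: "bdif (bcontr f) + bcontr (bdif f) = f - bunit f"
      using that by (simp_all add: P_def)
    have bu: "bact (scal c) (bunit f) = bunit (bact (scal c) f)"
      using f by (simp add: bunit_def bact_single scal_carrier scal_mul baug_def lookup_bact aug_mul
          bcarr_lookup aug_scal)
    have c1: "bdif (bcontr f) \<in> bcarr" "bcontr (bdif f) \<in> bcarr" "bunit f \<in> bcarr"
      using f by (simp_all add: bdif_carr bcontr_carr bunit_def bcarr_single words_zero scal_carrier)
    have "bdif (bcontr (bact (scal c) f)) + bcontr (bdif (bact (scal c) f)) =
        bact (scal c) (bdif (bcontr f) + bcontr (bdif f))"
      using f c1 by (simp add: bcontr_scal bdif_scal bcontr_carr bdif_carr bact_add scal_carrier)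
    also have "\<dots> = bact (scal c) (f - bunit f)" by (simp add: e)
    also have "\<dots> = bact (scal c) f - bact (scal c) (bunit f)"
      using bact_add[OF scal_carrier, of "f - bunit f" "bunit f" c] f c1 by (simp add: bcarr_closed)
    finally show ?thesis using f by (simp add: P_def bact_carr scal_carrier bu)
  qed
  have P_one: "P (single w (aone A))"
  proof (cases w rule: word_cases)
    case 1
    then show ?thesis
      using bcontr_one[OF words_zero, of 1] bdif_one[OF words_zero] aug_one scal_one
      by (simp add: P_def bunit_def baug_def bcarr_single one_carrier words_zero)
  next
    case (2 l v)
    then have lv: "l \<in> N" "v \<in> words" using single(1) words_wcons by auto
    show ?thesis
      using bcontr_one[OF single(1), of 1] bdif_one[OF single(1)] bcontr_bdw[OF lv] single(1) 2
      by (simp add: P_def bunit_def baug_def bcarr_single one_carrier scal_one lookup_single when_def)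
  qed
  have P_lt: "P (single w (lt l))" if l: "l \<in> N" for l
  proof -
    have lw: "wcons l w \<in> words" using l single(1) by (simp add: words_wcons)
    have "bunit (single w (lt l)) = 0"
      using l by (simp add: bunit_def baug_def lookup_single when_def lt_aug)
    then show ?thesis
      using l single(1) lw
      by (simp add: P_def bcarr_single lt_carr bcontr_letter bdif_one bdw_wcons bdif_single)
  qed
  have P_sum: "P (single w (\<Sum>l\<in>L. amul A (scal (co a l)) (lt l)))"
    if "finite L" "L \<subseteq> {l. co a l \<noteq> 0}" for L
    using that
  proof (induction L)
    case empty
    then show ?case by (simp add: P_def bcarr_closed bunit_def baug_def)
  next
    case (insert l L)
    have l: "l \<in> N" using insert co_letter[OF single(2)] by auto
    have "P (bact (scal (co a l)) (single w (lt l)))" by (rule P_scal[OF P_lt[OF l]])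
    then show ?case using insert P_add by (simp add: bact_single scal_carrier single_add)
  qed
  have "P (bact (scal (aaug A a)) (single w (aone A)))" by (rule P_scal[OF P_one])
  then have "P (single w (scal (aaug A a)))"
    using mul_one[OF scal_carrier] by (simp add: bact_single scal_carrier)
  then have "P (single w (scal (aaug A a)) +
      single w (\<Sum>l | co a l \<noteq> 0. amul A (scal (co a l)) (lt l)))"
    using P_add P_sum[OF co_finite[OF single(2)]] by blast
  then have "P (single w a)"
    using expansion[OF single(2)] by (simp flip: single_add)
  then show ?case by (simp add: P_def)
qed

lemma baug_bdw: "baug (bdw w) = 0"
proof (cases "w \<in> words")
  case True
  then show ?thesis
  proof (cases w rule: word_cases)
    case (2 l v)
    then have lv: "l \<in> N" "v \<in> words" using True words_wcons by auto
    then show ?thesis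
      by (simp add: 2 bdw_wcons baug_def lookup_minus lookup_bcontr bcarr_closed bcarr_single adif_carrier
          lt_carr bact_carr A.twist_carr bdw_carr lookup_single when_def lt_aug)
  qed (simp add: baug_def)
qed (simp add: bdw_def baug_def)

lemma baug_bdif: "f \<in> bcarr \<Longrightarrow> baug (bdif f) = 0"
proof (induction rule: bcarr_induct)
  case (single w a)
  have "baug (bact (twist (acomp A) a) (bdw w)) = 0"
    using single baug_bdw[of w]
    by (simp add: baug_def lookup_bact A.twist_carr aug_mul bcarr_lookup bdw_carr)
  moreover have "baug (single w (adif A a)) = 0"
    using single by (simp add: baug_def lookup_single when_def aug_adif)
  ultimately show ?case using single
    by (simp add: bdif_single baug_add bcarr_single adif_carrier bact_carr A.twist_carr bdw_carr)
qed (simp_all add: baug_def bdif_add lookup_add aug_add bcarr_lookup bdif_carr)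

lemma bdif_bdif_single:
  assumes "w \<in> words" "a \<in> acarrier A" "bdif (bdw w) = 0"
  shows "bdif (bdif (single w a)) = 0"
  using assms A.twist_carr[OF assms(2)] A.twist_carr[OF adif_carrier[OF assms(2)]]
  by (simp add: bdif_single bdif_add bcarr_single adif_carrier bact_carr bdw_carr adif_adif bdif_bact
      twist_adif bact_uminus_left A.twist_twist)

text \<open>With \<open>x = l[w]\<close> and the homotopy \<open>s\<close>, the boundary of the word \<open>l w\<close> is \<open>x - s \<partial> x\<close>. As \<open>\<partial> x\<close> is a
  cycle by induction, \<open>\<partial> s \<partial> x = \<partial> x\<close>.\<close>

lemma bdif_bdw: "w \<in> words \<Longrightarrow> bdif (bdw w) = 0"
proof (induction rule: word_induct)
  case (wcons l w)
  let ?x = "single w (lt l)"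
  have x: "?x \<in> bcarr" by (rule bcarr_single[OF wcons(2) lt_carr[OF wcons(1)]])
  have 0: "bdif (bdif ?x) = 0"
    by (rule bdif_bdif_single[OF wcons(2) lt_carr[OF wcons(1)] wcons(3)])
  have "bdw (wcons l w) = ?x - bcontr (bdif ?x)"
    using wcons by (simp add: bdw_wcons bdif_single lt_carr)
  moreover have "bunit (bdif ?x) = 0" using baug_bdif[OF x] by (simp add: bunit_def)
  moreover have "bdif (bcontr (bdif ?x)) = bdif ?x"
    using bcontr_homotopy[OF bdif_carr[OF x]] 0 calculation(2) by simp
  ultimately show ?case using x by (simp add: bdif_diff bcontr_carr bdif_carr)
qed simp

lemma bdif_bdif: "f \<in> bcarr \<Longrightarrow> bdif (bdif f) = 0"
  by (induction rule: bcarr_induct) (simp_all add: bdif_add bdif_carr bdif_bdif_single bdif_bdw)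

lemma bar_simps: "mcomp bar = bcomp" "mact bar = bact" "mdif bar = bdif" "internal_sum UNIV bcomp = bcarr"
  by (simp_all add: bar_def bcarr_eq)

lemma bar_dg_module: "dg_module_over A scal bar"
proof (unfold_locales; unfold bar_simps)
  fix a i j f i' j' assume "a \<in> acomp A (i, j)" "f \<in> bcomp (i', j')"
  then show "bact a f \<in> bcomp (i + i', j + j')" using bact_comp[of a "(i, j)" f "(i', j')"] by simp
next
  fix f i j assume "f \<in> bcomp (i, j)"
  then show "bdif f \<in> bcomp (i - 1, j)" using bdif_comp[of f "(i, j)"] by simp
next
  fix a i j f assume a: "a \<in> acomp A (i, j)" and f: "f \<in> bcarr"
  have "bact (alt_sign i a) (bdif f) = alt_sign i (bact a (bdif f))"
    using A.comp_carr[OF a] f by (simp add: alt_sign_def bact_uminus_left bdif_carr)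
  then show "bdif (bact a f) = bact (adif A a) f + alt_sign i (bact a (bdif f))"
    using bdif_bact[OF A.comp_carr[OF a] f] A.twist_homogeneous[OF a] by simp
qed (simp_all add: bcomp_subgroup bcomp_independent bact_add bact_add_left bact_bact bact_one bdif_add bdif_bdif)

lemma bar_quasi_iso: "quasi_iso A bar (residue_module A) baug"
  unfolding quasi_iso_def dg_hom_def bar_simps
proof (intro conjI allI ballI impI)
  fix p
  show "baug ` bcomp p \<subseteq> mcomp (residue_module A) p"
  proof (cases "p = (0, 0)")
    case False
    have "baug f = 0" if "f \<in> bcomp p" for f
    proof -
      have "lookup f 0 \<in> acomp A (p - wdeg 0)" using that by (simp add: bcomp_def)
      moreover have "p - wdeg 0 = p" by (simp add: wdeg_zero prod_eq_iff)
      ultimately show ?thesis using aug_comp False by (simp add: baug_def)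
    qed
    then show ?thesis by (auto simp: residue_module_def)
  qed (simp add: residue_module_def)
next
  fix p z assume z: "z \<in> cycles bar p" and b: "baug z \<in> boundaries (residue_module A) p"
  have zc: "z \<in> bcomp p" "bdif z = 0" using z by (auto simp: cycles_def bar_simps)
  have "baug z = 0" using b by (auto simp: boundaries_def residue_module_def)
  then have "bdif (bcontr z) = z" using bcontr_homotopy[OF bcomp_carr[OF zc(1)]] zc by (simp add: bunit_def)
  moreover have "bcontr z \<in> bcomp (fst p + 1, snd p)"
    using bcontr_comp[OF zc(1)] by (simp add: plus_prod_def)
  ultimately show "z \<in> boundaries bar p" unfolding boundaries_def bar_simps by (metis image_eqI)
next
  fix p w assume w: "w \<in> cycles (residue_module A) p"
  let ?z = "single 0 (scal w)"
  have "?z \<in> cycles bar p"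
  proof (cases "p = (0, 0)")
    case True
    have "?z \<in> bcomp ((0, 0) + wdeg 0)" by (rule bcomp_single[OF words_zero scal_comp])
    then show ?thesis using True
      by (simp add: cycles_def bar_simps wdeg_zero bdif_single words_zero scal_carrier adif_scal twist_scal)
  next
    case False
    then have "w = 0" using w by (simp add: cycles_def residue_module_def)
    then show ?thesis by (simp add: cycles_def bar_simps additive_subgroup_zero[OF bcomp_subgroup])
  qed
  moreover have "w - baug ?z \<in> boundaries (residue_module A) p"
    by (auto simp: baug_def aug_scal boundaries_def residue_module_def)
  ultimately show "\<exists>z\<in>cycles bar p. w - baug z \<in> boundaries (residue_module A) p" by blast
next
  fix f assume "f \<in> bcarr"
  then show "baug (bdif f) = mdif (residue_module A) (baug f)" by (simp add: baug_bdif residue_module_def)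
next
  fix a f assume "a \<in> acarrier A" "f \<in> bcarr"
  then show "baug (bact a f) = mact (residue_module A) a (baug f)"
    by (simp add: residue_module_def baug_def lookup_bact aug_mul bcarr_lookup)
qed (simp add: baug_add)

text \<open>The filtration by the homological degree of words; the differential of a word only involves
  words of smaller degree because coefficients have nonnegative degree.\<close>

definition bfilt :: "nat \<Rightarrow> (nat \<Rightarrow>\<^sub>0 'a) set" where
  "bfilt p = {f \<in> bcarr. \<forall>w. int p \<le> fst (wdeg w) \<longrightarrow> lookup f w = 0}"

lemma bfilt_subgroup: "additive_subgroup (bfilt p)"
  unfolding additive_subgroup_def bfilt_def by (simp add: bcarr_closed lookup_minus)

lemma bdw_filt:
  assumes "w \<in> words" "fst (wdeg w) \<le> int p" shows "bdw w \<in> bfilt p"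
  unfolding bfilt_def
proof (intro CollectI conjI allI impI)
  fix v assume v: "int p \<le> fst (wdeg v)"
  let ?q = "wdeg w - (1, 0) - wdeg v"
  have "lookup (bdw w) v \<in> acomp A ?q" using bdw_comp[OF assms(1)] by (simp add: bcomp_def)
  moreover have "fst ?q < 0" using v assms(2) by simp
  then have "acomp A (fst ?q, snd ?q) = {0}" by (rule acomp_neg[OF disjI1])
  then have "acomp A ?q = {0}" by (simp only: prod.collapse)
  ultimately show "lookup (bdw w) v = 0" by blast
qed (rule bdw_carr)

lemma bact_filt: "a \<in> acarrier A \<Longrightarrow> f \<in> bfilt p \<Longrightarrow> bact a f \<in> bfilt p"
  by (simp add: bfilt_def bact_carr lookup_bact)

lemma bdif_filt:
  assumes f: "f \<in> bfilt p" shows "bdif f \<in> bfilt p"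
  unfolding bdif_def
proof (rule additive_subgroup_sum[OF bfilt_subgroup])
  fix w assume w: "w \<in> keys f"
  then have ww: "w \<in> words" "fst (wdeg w) < int p" "lookup f w \<in> acarrier A"
    using f by (auto simp: bfilt_def bcarr_def in_keys_iff)
  have "single w (adif A (lookup f w)) \<in> bfilt p"
    using ww by (auto simp: bfilt_def bcarr_single adif_carrier lookup_single when_def)
  moreover have "bact (twist (acomp A) (lookup f w)) (bdw w) \<in> bfilt p"
    using ww by (intro bact_filt bdw_filt A.twist_carr) auto
  ultimately show "single w (adif A (lookup f w)) +
      bact (twist (acomp A) (lookup f w)) (bdw w) \<in> bfilt p"
    by (rule additive_subgroup_add[OF bfilt_subgroup])
qed

lemma bfilt_submodule: "dg_submodule A bar (bfilt p)"
  unfolding dg_submodule_def bar_simps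
proof (intro conjI ballI)
  show "bfilt p = internal_sum UNIV (\<lambda>q. bfilt p \<inter> bcomp q)"
  proof (intro equalityI subsetI)
    fix f assume f: "f \<in> bfilt p"
    interpret B: dg_module_over A scal bar by (rule bar_dg_module)
    interpret H: graded_family "\<lambda>q. bfilt p \<inter> bcomp q"
    proof
      show "additive_subgroup (bfilt p \<inter> bcomp q)" for q
        using bfilt_subgroup[of p] bcomp_subgroup[of q] by (simp add: additive_subgroup_def)
      show "independent_family (\<lambda>q. bfilt p \<inter> bcomp q)"
        using bcomp_independent unfolding independent_family_def by (meson IntD2)
    qed
    have s: "single w a \<in> H.carr" if "w \<in> words" "fst (wdeg w) < int p" "a \<in> acarrier A" for w a
      using that(3)
    proof (induction rule: A.carr_induct)
      case (homogeneous q a)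
      have "single w a \<in> bfilt p \<inter> bcomp (q + wdeg w)"
        using that bcomp_single[OF that(1) homogeneous] A.comp_carr[OF homogeneous]
        by (auto simp: bfilt_def bcarr_single lookup_single when_def)
      then show ?case by (rule H.comp_carr)
    qed (simp_all add: H.carr_closed single_add)
    have "(\<Sum>w\<in>keys f. single w (lookup f w)) \<in> H.carr"
    proof (rule additive_subgroup_sum[OF H.carr_subgroup], rule s)
      fix w assume "w \<in> keys f"
      then show "w \<in> words" "fst (wdeg w) < int p" "lookup f w \<in> acarrier A"
        using f by (auto simp: bfilt_def bcarr_def in_keys_iff)
    qed
    then show "f \<in> H.carr" by (simp add: sum_single_lookup)
  next
    fix f assume "f \<in> internal_sum UNIV (\<lambda>q. bfilt p \<inter> bcomp q)"
    then obtain S y where y: "f = (\<Sum>q\<in>S. y q)" "\<forall>q\<in>S. y q \<in> bfilt p \<inter> bcomp q"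
      by (auto simp: internal_sum_def)
    show "f \<in> bfilt p"
      unfolding y(1) by (rule additive_subgroup_sum[OF bfilt_subgroup]) (use y(2) in auto)
  qed
qed (simp_all add: bfilt_subgroup bact_filt bdif_filt)

lemma lookup_sum_bact:
  assumes "finite S" "\<And>y. a y \<in> acarrier A"
  shows "lookup (\<Sum>y\<in>S. bact (a y) (single y (aone A))) w = (if w \<in> S then a w else 0)"
  using assms by (simp add: lookup_sum bact_single mul_one lookup_single when_def)

lemma bar_semifree: "semifree A bar"
proof -
  interpret B: dg_module_over A scal bar by (rule bar_dg_module)
  have zero: "bfilt 0 = {0}"
  proof -
    have "f = 0" if "f \<in> bfilt 0" for f
    proof (rule poly_mapping_eqI)
      fix w show "lookup f w = lookup 0 w"
        using that wdeg_nonneg[of w] by (cases "w \<in> words") (auto simp: bfilt_def bcarr_def)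
    qed
    then show ?thesis using additive_subgroup_zero[OF bfilt_subgroup] by blast
  qed
  have union: "(\<Union>p. bfilt p) = bcarr"
  proof -
    have "\<exists>p. f \<in> bfilt p" if f: "f \<in> bcarr" for f
    proof -
      let ?p = "nat (\<Sum>w\<in>keys f. fst (wdeg w) + 1)"
      have "fst (wdeg w) < int ?p" if w: "w \<in> keys f" for w
      proof -
        have nn: "0 \<le> fst (wdeg v) + 1" if "v \<in> keys f" for v
        proof -
          have "v \<in> words" using that f by (auto simp: bcarr_def in_keys_iff)
          then show ?thesis using wdeg_nonneg[of v] by simp
        qed
        have "fst (wdeg w) + 1 \<le> (\<Sum>w\<in>keys f. fst (wdeg w) + 1)"
          by (rule member_le_sum[OF w]) (use nn in auto)
        then show ?thesis by linarith
      qed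
      then have "lookup f w = 0" if "int ?p \<le> fst (wdeg w)" for w
        using that by (metis in_keys_iff not_le)
      then have "f \<in> bfilt ?p" using f unfolding bfilt_def by blast
      then show ?thesis by blast
    qed
    then show ?thesis by (auto simp: bfilt_def)
  qed
  have basis: "basis_of_quotient A bar (bfilt (Suc p)) (bfilt p)
      ((\<lambda>w. single w (aone A)) ` {w \<in> words. fst (wdeg w) = int p})" for p
  proof (rule B.basis_of_quotientI[where \<kappa> = "\<lambda>f w. lookup f w"]; (unfold bar_simps)?)
    let ?X = "{w \<in> words. fst (wdeg w) = int p}"
    show "inj_on (\<lambda>w. single w (aone A)) ?X"
    proof (rule inj_onI)
      fix v w :: nat assume "single v (aone A) = single w (aone A)"
      then have "keys (single v (aone A)) = keys (single w (aone A))"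
        by simp
      moreover have "aone A \<noteq> 0" using aug_one by auto
      ultimately show "v = w" by simp
    qed
    show "single w (aone A) \<in> bfilt (Suc p) \<and> (\<exists>q. single w (aone A) \<in> bcomp q)"
      if "w \<in> ?X" for w
    proof
      show "single w (aone A) \<in> bfilt (Suc p)"
        using that by (auto simp: bfilt_def bcarr_single one_carrier lookup_single when_def)
      show "\<exists>q. single w (aone A) \<in> bcomp q"
        by (rule exI[of _ "(0, 0) + wdeg w"], rule bcomp_single[OF _ one_comp]) (use that in simp)
    qed
    fix f assume f: "f \<in> bfilt (Suc p)"
    have fc: "f \<in> bcarr" using f by (simp add: bfilt_def)
    show fin: "finite {w \<in> ?X. lookup f w \<noteq> 0}"
      by (rule finite_subset[OF _ finite_keys[of f]]) (auto simp: in_keys_iff)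
    show "lookup f w \<in> acarrier A" for w using fc by (rule bcarr_lookup)
    have sub: "bact (lookup f w) (single w (aone A)) \<in> bcarr" if "w \<in> words" for w
      using that bcarr_lookup[OF fc] by (intro bact_carr bcarr_single one_carrier)
    show "f - (\<Sum>w | w \<in> ?X \<and> lookup f w \<noteq> 0. bact (lookup f w) (single w (aone A))) \<in> bfilt p"
      unfolding bfilt_def
    proof (intro CollectI conjI allI impI)
      show "f - (\<Sum>w | w \<in> ?X \<and> lookup f w \<noteq> 0. bact (lookup f w) (single w (aone A))) \<in> bcarr"
        by (intro bcarr_closed(2)[OF fc] additive_subgroup_sum[OF bcarr_subgroup] sub) simp
      fix v assume v: "int p \<le> fst (wdeg v)"
      show "lookup (f - (\<Sum>w | w \<in> ?X \<and> lookup f w \<noteq> 0. bact (lookup f w) (single w (aone A)))) v = 0"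
      proof (cases "v \<in> words \<and> fst (wdeg v) = int p")
        case True
        then show ?thesis
          using lookup_sum_bact[OF fin, of "lookup f" v] bcarr_lookup[OF fc]
          by (auto simp: lookup_minus)
      next
        case False
        then have "lookup f v = 0" using f v by (auto simp: bfilt_def bcarr_def)
        then show ?thesis
          using lookup_sum_bact[OF fin, of "lookup f" v] bcarr_lookup[OF fc]
          by (auto simp: lookup_minus)
      qed
    qed
    fix a S w assume S: "finite S" "S \<subseteq> ?X" and a: "\<And>y. a y \<in> acarrier A" "\<And>y. y \<notin> S \<Longrightarrow> a y = 0"
      and d: "f - (\<Sum>y\<in>S. bact (a y) (single y (aone A))) \<in> bfilt p" and w: "w \<in> ?X"
    have "lookup (f - (\<Sum>y\<in>S. bact (a y) (single y (aone A)))) w = 0"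
      using d w by (simp add: bfilt_def)
    then show "lookup f w = a w"
      using lookup_sum_bact[OF S(1), of a w] a by (auto simp: lookup_minus split: if_splits)
  qed
  show ?thesis unfolding semifree_def
  proof (intro conjI exI[of _ bfilt] allI)
    show "dg_module A bar" by (rule B.dg_module_axioms)
    show "bfilt p \<subseteq> bfilt (Suc p)" for p by (auto simp: bfilt_def)
    show "\<exists>E. basis_of_quotient A bar (bfilt (Suc p)) (bfilt p) E \<and> (\<forall>e\<in>E. mdif bar e \<in> bfilt p)" for p
      using basis[of p] by (intro exI conjI, assumption) (auto simp: bar_simps bdif_one intro!: bdw_filt)
  qed (simp_all add: zero union bar_simps bfilt_submodule)
qed

lemma bar_resolution: "semifree_resolution A bar baug"
  by (simp add: semifree_resolution_def bar_semifree bar_quasi_iso)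

end

section \<open>Free resolutions as semifree resolutions\<close>

text \<open>A partial sum of components; \<open>internal_sum\<close> is left to the sum of all of them, which is the
  underlying group.\<close>

definition graded_part :: "('i \<Rightarrow> 'a::ab_group_add set) \<Rightarrow> 'i set \<Rightarrow> 'a set" where
  "graded_part C I = internal_sum I C"

context graded_family
begin

lemma internal_sum_subset: "internal_sum I C \<subseteq> carr"
  unfolding internal_sum_def by blast

lemma graded_part_iff: "f \<in> graded_part C I \<longleftrightarrow> f \<in> carr \<and> (\<forall>p. p \<notin> I \<longrightarrow> component C f p = 0)"
proof
  assume "f \<in> graded_part C I"
  then have fI: "f \<in> internal_sum I C" by (simp add: graded_part_def)
  then obtain S y where y: "f = (\<Sum>p\<in>S. y p)" "finite S" "S \<subseteq> I" "\<forall>p\<in>S. y p \<in> C p"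
    unfolding internal_sum_def by blast
  have "decomposition C f (\<lambda>p. if p \<in> S then y p else 0)"
    by (rule decompositionI[of S]) (use y comp_zero in auto)
  then have "component C f = (\<lambda>p. if p \<in> S then y p else 0)" by (rule component_eqI)
  moreover have "f \<in> carr" by (rule subsetD[OF internal_sum_subset fI])
  ultimately show "f \<in> carr \<and> (\<forall>p. p \<notin> I \<longrightarrow> component C f p = 0)"
    using y(3) by auto
next
  assume f: "f \<in> carr \<and> (\<forall>p. p \<notin> I \<longrightarrow> component C f p = 0)"
  then have fc: "f \<in> carr" by simp
  show "f \<in> graded_part C I" unfolding internal_sum_def graded_part_def
  proof (rule CollectI, intro exI conjI)
    show "f = (\<Sum>p | component C f p \<noteq> 0. component C f p)" by (rule component_sum[OF fc])
    show "finite {p. component C f p \<noteq> 0}" by (rule finite_component[OF fc])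
    show "{p. component C f p \<noteq> 0} \<subseteq> I" using f by blast
    show "\<forall>p\<in>{p. component C f p \<noteq> 0}. component C f p \<in> C p" by (simp add: component_in[OF fc])
  qed
qed

lemma graded_part_subgroup: "additive_subgroup (graded_part C I)"
  unfolding additive_subgroup_def
  by (simp add: graded_part_iff carr_closed component_zero component_diff)

lemma graded_part_comp: assumes "f \<in> C p" "p \<in> I" shows "f \<in> graded_part C I"
  using assms(2) comp_carr[OF assms(1)] component_single[OF assms(1)] by (auto simp: graded_part_iff)

lemma graded_part_induct [consumes 1, case_names zero add homogeneous]:
  assumes "f \<in> graded_part C I" "P 0"
    "\<And>f g. f \<in> graded_part C I \<Longrightarrow> g \<in> graded_part C I \<Longrightarrow> P f \<Longrightarrow> P g \<Longrightarrow> P (f + g)"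
    and "\<And>p f. p \<in> I \<Longrightarrow> f \<in> C p \<Longrightarrow> P f"
  shows "P f"
proof -
  obtain S y where *: "f = (\<Sum>p\<in>S. y p)" "finite S" "S \<subseteq> I" "\<forall>p\<in>S. y p \<in> C p"
    using assms(1) unfolding graded_part_def internal_sum_def by blast
  have "sum y S \<in> graded_part C I \<and> P (sum y S)" using *(2,3,4)
  proof (induction S)
    case empty
    then show ?case using assms(2) additive_subgroup_zero[OF graded_part_subgroup] by simp
  next
    case (insert p S)
    then have p: "y p \<in> graded_part C I" "P (y p)"
      using graded_part_comp[of "y p" p I] assms(4)[of p "y p"] by auto
    have S: "sum y S \<in> graded_part C I" "P (sum y S)" using insert by auto
    show ?case using insert(1,2) assms(3)[OF p(1) S(1) p(2) S(2)]
        additive_subgroup_add[OF graded_part_subgroup p(1) S(1)] by simp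
  qed
  then show ?thesis using * by simp
qed

end

abbreviation degree_part :: "('a, 'f::ab_group_add) dgm \<Rightarrow> int set \<Rightarrow> 'f set" where
  "degree_part F J \<equiv> graded_part (mcomp F) (J \<times> UNIV)"

text \<open>Modules over an algebra concentrated in homological degree 0, that is, complexes of graded modules.\<close>

locale complex_over = dg_module_over A scal F
  for A :: "('k::field, 'a::ab_group_add) dga" and scal and F :: "('a, 'f::ab_group_add) dgm" +
  assumes concentrated: "i \<noteq> 0 \<Longrightarrow> acomp A (i, j) = {0}"
begin

lemma degree_part_act:
  assumes "a \<in> acarrier A" "f \<in> degree_part F J"
  shows "mact F a f \<in> degree_part F J"
  using assms(1)
proof (induction rule: A.carr_induct)
  case zero
  have "f \<in> mcarrier F" using assms(2) by (simp add: F.graded_part_iff)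
  then show ?case by (simp add: additive_subgroup_zero[OF F.graded_part_subgroup])
next
  case (add a b)
  have "f \<in> mcarrier F" using assms(2) by (simp add: F.graded_part_iff)
  then show ?case using add by (simp add: act_add_left additive_subgroup_add[OF F.graded_part_subgroup])
next
  case (homogeneous p a)
  note a = homogeneous and ac = A.comp_carr[OF homogeneous]
  show ?case using assms(2)
  proof (induction rule: F.graded_part_induct)
    case zero
    then show ?case using ac additive_subgroup_zero[OF F.graded_part_subgroup] by simp
  next
    case (add f g)
    have "f \<in> mcarrier F" "g \<in> mcarrier F" using add(1,2) by (simp_all add: F.graded_part_iff)
    then show ?case using ac add(3,4)
      by (simp add: act_add_right additive_subgroup_add[OF F.graded_part_subgroup])
  next
    case (homogeneous q f)
    show ?case
    proof (cases "fst p = 0")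
      case True
      then have "fst (p + q) \<in> J" using homogeneous(1) by auto
      then have "p + q \<in> J \<times> UNIV" by (simp add: mem_Times_iff)
      then show ?thesis by (rule F.graded_part_comp[OF act_comp'[OF a homogeneous(2)]])
    next
      case False
      then have "acomp A (fst p, snd p) = {0}" by (rule concentrated)
      then have "a = 0" using a by simp
      then show ?thesis using F.comp_carr[OF homogeneous(2)]
          additive_subgroup_zero[OF F.graded_part_subgroup] by simp
    qed
  qed
qed

lemma degree_part_Int: "f \<in> degree_part F J \<Longrightarrow> f \<in> degree_part F J' \<Longrightarrow> J \<inter> J' = {} \<Longrightarrow> f = 0"
  by (rule F.component_all_zero) (auto simp: F.graded_part_iff)

lemma basis_sum_degree_part:
  assumes "\<And>e. e \<in> S \<Longrightarrow> e \<in> degree_part F J" "\<And>e. a e \<in> acarrier A"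
  shows "(\<Sum>e\<in>S. mact F (a e) e) \<in> degree_part F J"
  by (rule additive_subgroup_sum[OF F.graded_part_subgroup degree_part_act]) (use assms in auto)

text \<open>The action preserves homological degrees, so an expansion splits into the part over the basis
  elements in degree \<open>i\<close> and the part over the others, which lie in complementary submodules.\<close>

lemma degree_part_basis:
  assumes basis: "basis_of_quotient A F (mcarrier F) {0} E"
  shows "\<exists>E. basis_of_quotient A F (degree_part F {i}) {0} E"
proof -
  let ?E = "E \<inter> degree_part F {i}"
  let ?P = "\<lambda>E f a. keys a \<subseteq> E \<and> (\<forall>e. lookup a e \<in> acarrier A) \<and>
        f - (\<Sum>e\<in>keys a. mact F (lookup a e) e) \<in> {0}"
  have "basis_of_quotient A F (degree_part F {i}) {0} ?E"
    unfolding basis_of_quotient_def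
  proof (intro conjI ballI)
    show "?E \<subseteq> degree_part F {i} \<inter> (\<Union>p. mcomp F p)"
      using basis by (auto simp: basis_of_quotient_def)
    fix f assume f: "f \<in> degree_part F {i}"
    then have "f \<in> mcarrier F" by (simp add: F.graded_part_iff)
    then have ex1: "\<exists>!a. ?P E f a" using basis unfolding basis_of_quotient_def by blast
    then obtain a where a: "?P E f a" by blast
    let ?S = "keys a"
    let ?g = "\<lambda>e. if e \<in> ?E then lookup a e else 0"
    have fin: "finite {e. ?g e \<noteq> 0}" by (rule finite_subset[OF _ finite_keys[of a]]) (auto simp: in_keys_iff)
    define b where "b = Abs_poly_mapping ?g"
    have b: "lookup b = ?g" unfolding b_def using fin by simp
    have bk: "keys b = ?S \<inter> ?E" by (auto simp: in_keys_iff b split: if_splits)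
    have Ec: "e \<in> mcarrier F" if "e \<in> E" for e
      using that basis F.comp_carr by (auto simp: basis_of_quotient_def)
    have fa: "f = (\<Sum>e\<in>?S. mact F (lookup a e) e)" using a by simp
    also have "\<dots> = (\<Sum>e\<in>?S \<inter> ?E. mact F (lookup a e) e) +
        (\<Sum>e\<in>?S - ?E. mact F (lookup a e) e)"
      by (metis (no_types) finite_keys sum.Int_Diff)
    finally have split: "f = (\<Sum>e\<in>?S \<inter> ?E. mact F (lookup a e) e) +
        (\<Sum>e\<in>?S - ?E. mact F (lookup a e) e)" .
    have ac: "lookup a e \<in> acarrier A" for e using a by blast
    have 1: "(\<Sum>e\<in>?S \<inter> ?E. mact F (lookup a e) e) \<in> degree_part F {i}"
      by (rule basis_sum_degree_part) (use ac in auto)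
    have 2: "(\<Sum>e\<in>?S - ?E. mact F (lookup a e) e) \<in> degree_part F (- {i})"
    proof (rule basis_sum_degree_part)
      fix e assume e: "e \<in> ?S - ?E"
      then obtain p where p: "e \<in> mcomp F p" using a basis by (auto simp: basis_of_quotient_def)
      have "fst p \<noteq> i"
      proof
        assume "fst p = i"
        then have "e \<in> degree_part F {i}" by (intro F.graded_part_comp[OF p]) (simp add: mem_Times_iff)
        then show False using e a by blast
      qed
      then show "e \<in> degree_part F (- {i})" by (intro F.graded_part_comp[OF p]) (simp add: mem_Times_iff)
    qed (rule ac)
    have "(\<Sum>e\<in>?S - ?E. mact F (lookup a e) e) \<in> degree_part F {i}"
      using additive_subgroup_diff[OF F.graded_part_subgroup f 1] split by simp
    then have "(\<Sum>e\<in>?S - ?E. mact F (lookup a e) e) = 0"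
      by (rule degree_part_Int[OF _ 2]) auto
    then have "f = (\<Sum>e\<in>?S \<inter> ?E. mact F (lookup a e) e)" using split by simp
    moreover have "(\<Sum>e\<in>?S \<inter> ?E. mact F (?g e) e) = (\<Sum>e\<in>?S \<inter> ?E. mact F (lookup a e) e)"
      by (rule sum.cong) auto
    ultimately have Pb: "?P ?E f b"
      unfolding bk b using ac A.carr_closed(1) by auto
    show "\<exists>!a. ?P ?E f a"
    proof (rule ex1I)
      show "?P ?E f b" by (rule Pb)
      fix c assume "?P ?E f c"
      then have "?P E f c" by blast
      moreover have "?P E f b" using Pb by blast
      ultimately show "c = b" using ex1 by blast
    qed
  qed
  then show ?thesis by blast
qed

text \<open>The filtration is by homological degree. The differential lowers the degree, so it maps each new
  basis element into the previous step.\<close>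

lemma semifree_if_degreewise_free:
  assumes neg: "\<And>i j. i < 0 \<Longrightarrow> mcomp F (i, j) = {0}"
    and basis: "\<And>i. \<exists>E. basis_of_quotient A F (degree_part F {i}) {0} E"
  shows "semifree A F"
proof -
  define U where "U p = degree_part F {..<int p}" for p
  note dp_closed = additive_subgroup_closed[OF F.graded_part_subgroup]
  have U0: "U 0 = {0}"
  proof -
    have "f = 0" if "f \<in> U 0" for f
    proof (rule F.component_all_zero)
      show "f \<in> mcarrier F" using that by (simp add: U_def F.graded_part_iff)
      fix p
      show "component (mcomp F) f p = 0"
      proof (cases "fst p < 0")
        case True
        then have "mcomp F (fst p, snd p) = {0}" by (rule neg)
        then show ?thesis using F.component_in[OF \<open>f \<in> mcarrier F\<close>, of p] by simp
      next
        case False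
        then have "p \<notin> {..<int 0} \<times> UNIV" by (simp add: mem_Times_iff)
        then show ?thesis using that unfolding U_def F.graded_part_iff by blast
      qed
    qed
    then show ?thesis using dp_closed(1) by (auto simp: U_def)
  qed
  have UU: "(\<Union>p. U p) = mcarrier F"
  proof -
    have "\<exists>p. f \<in> U p" if f: "f \<in> mcarrier F" for f
    proof -
      let ?T = "{p. component (mcomp F) f p \<noteq> 0}"
      (* any bound for the degrees of the finitely many components *)
      let ?N = "nat (\<Sum>p\<in>?T. \<bar>fst p\<bar> + 1)"
      have lt: "fst p < int ?N" if p: "p \<in> ?T" for p
      proof -
        have "\<bar>fst p\<bar> + 1 \<le> (\<Sum>p\<in>?T. \<bar>fst p\<bar> + 1)"
          by (rule member_le_sum[OF p]) (use F.finite_component[OF f] in auto)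
        then show ?thesis by linarith
      qed
      have "component (mcomp F) f p = 0" if p: "p \<notin> {..<int ?N} \<times> UNIV" for p
      proof (rule ccontr)
        assume "component (mcomp F) f p \<noteq> 0"
        then have "fst p < int ?N" by (intro lt) simp
        then have "p \<in> {..<int ?N} \<times> UNIV" unfolding mem_Times_iff lessThan_iff by simp
        with p show False by contradiction
      qed
      then have "f \<in> U ?N" using f unfolding U_def F.graded_part_iff by blast
      then show ?thesis by blast
    qed
    then show ?thesis by (auto simp: U_def F.graded_part_iff)
  qed
  have Umono: "U p \<subseteq> U (Suc p)" for p
    by (auto simp: U_def F.graded_part_iff mem_Times_iff)
  have Usub: "dg_submodule A F (U p)" for p
    unfolding dg_submodule_def
  proof (intro conjI ballI)
    show "additive_subgroup (U p)" unfolding U_def by (rule F.graded_part_subgroup)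
    show "U p = internal_sum UNIV (\<lambda>q. U p \<inter> mcomp F q)"
    proof (intro equalityI subsetI)
      fix f assume "f \<in> U p"
      then obtain S y where y: "f = (\<Sum>q\<in>S. y q)" "finite S" "S \<subseteq> {..<int p} \<times> UNIV" "\<forall>q\<in>S. y q \<in> mcomp F q"
        unfolding U_def graded_part_def internal_sum_def by blast
      have "\<forall>q\<in>S. y q \<in> U p \<inter> mcomp F q"
        using y(3,4) F.graded_part_comp unfolding U_def by blast
      then show "f \<in> internal_sum UNIV (\<lambda>q. U p \<inter> mcomp F q)" using y(1,2) unfolding internal_sum_def by blast
    next
      fix f assume "f \<in> internal_sum UNIV (\<lambda>q. U p \<inter> mcomp F q)"
      then obtain S y where y: "f = (\<Sum>q\<in>S. y q)" "\<forall>q\<in>S. y q \<in> U p \<inter> mcomp F q"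
        by (auto simp: internal_sum_def)
      show "f \<in> U p" unfolding y(1) U_def
        by (rule additive_subgroup_sum[OF F.graded_part_subgroup]) (use y(2) U_def in auto)
    qed
    show "mact F a f \<in> U p" if "a \<in> acarrier A" "f \<in> U p" for a f
      using that unfolding U_def by (rule degree_part_act)
    fix f assume "f \<in> U p"
    then show "mdif F f \<in> U p"
      unfolding U_def
    proof (induction rule: F.graded_part_induct)
      case zero
      then show ?case using dp_closed(1) by simp
    next
      case (add f g)
      have "f \<in> mcarrier F" "g \<in> mcarrier F" using add(1,2) by (simp_all add: F.graded_part_iff)
      then show ?case using add(3,4) by (simp add: dif_add dp_closed(4))
    next
      case (homogeneous q f)
      show ?case
        by (rule F.graded_part_comp[OF dif_comp'[OF homogeneous(2)]])
          (use homogeneous(1) in \<open>auto simp: mem_Times_iff\<close>)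
    qed
  qed
  have step: "\<exists>E. basis_of_quotient A F (U (Suc p)) (U p) E \<and> (\<forall>e\<in>E. mdif F e \<in> U p)" for p
  proof -
    obtain E where E: "basis_of_quotient A F (degree_part F {int p}) {0} E" using basis by blast
    have EN: "e \<in> degree_part F {int p}" if "e \<in> E" for e using E that by (auto simp: basis_of_quotient_def)
    have sub: "f \<in> U (Suc p)" if "f \<in> degree_part F {int p}" for f
      using that by (auto simp: U_def F.graded_part_iff mem_Times_iff)
    have dE: "mdif F e \<in> U p" if "e \<in> E" for e
      using EN[OF that]
    proof (induction rule: F.graded_part_induct)
      case zero
      then show ?case using dp_closed(1) by (simp add: U_def)
    next
      case (add f g)
      have "f \<in> mcarrier F" "g \<in> mcarrier F" using add(1,2) by (simp_all add: F.graded_part_iff)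
      then show ?case using add(3,4) unfolding U_def by (simp add: dif_add dp_closed(4))
    next
      case (homogeneous q f)
      show ?case unfolding U_def
        by (rule F.graded_part_comp[OF dif_comp'[OF homogeneous(2)]])
          (use homogeneous(1) in \<open>auto simp: mem_Times_iff\<close>)
    qed
    let ?P = "\<lambda>f N a. keys a \<subseteq> E \<and> (\<forall>e. lookup a e \<in> acarrier A) \<and>
        f - (\<Sum>e\<in>keys a. mact F (lookup a e) e) \<in> N"
    have "basis_of_quotient A F (U (Suc p)) (U p) E"
      unfolding basis_of_quotient_def
    proof (intro conjI ballI)
      show "E \<subseteq> U (Suc p) \<inter> (\<Union>p. mcomp F p)"
        using E EN sub by (auto simp: basis_of_quotient_def)
      fix f assume "f \<in> U (Suc p)"
      then have f: "f \<in> mcarrier F" "\<And>q. int p < fst q \<Longrightarrow> component (mcomp F) f q = 0"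
        by (auto simp: U_def F.graded_part_iff mem_Times_iff)
      let ?T = "{q. component (mcomp F) f q \<noteq> 0}"
      let ?T1 = "{q \<in> ?T. fst q = int p}" and ?T2 = "{q \<in> ?T. fst q < int p}"
      define f1 where "f1 = (\<Sum>q\<in>?T1. component (mcomp F) f q)"
      define f2 where "f2 = (\<Sum>q\<in>?T2. component (mcomp F) f q)"
      have "?T = ?T1 \<union> ?T2" using f(2) by force
      moreover have "?T1 \<inter> ?T2 = {}" by auto
      ultimately have "(\<Sum>q\<in>?T. component (mcomp F) f q) = f1 + f2"
        unfolding f1_def f2_def using F.finite_component[OF f(1)]
        by (metis (no_types, lifting) finite_Un sum.union_disjoint)
      then have f12: "f = f1 + f2" using F.component_sum[OF f(1)] by simp
      have f1: "f1 \<in> degree_part F {int p}" unfolding f1_def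
        by (rule additive_subgroup_sum[OF F.graded_part_subgroup F.graded_part_comp[OF F.component_in[OF f(1)]]])
          (auto simp: mem_Times_iff)
      have f2: "f2 \<in> U p" unfolding f2_def U_def
        by (rule additive_subgroup_sum[OF F.graded_part_subgroup F.graded_part_comp[OF F.component_in[OF f(1)]]])
          (auto simp: mem_Times_iff)
      have eq: "?P f (U p) a \<longleftrightarrow> ?P f1 {0} a" for a
      proof -
        let ?s = "\<Sum>e\<in>keys a. mact F (lookup a e) e"
        have "f - ?s \<in> U p \<longleftrightarrow> f1 - ?s \<in> {0}"
          if a: "keys a \<subseteq> E" "\<forall>e. lookup a e \<in> acarrier A"
        proof
          have s: "?s \<in> degree_part F {int p}"
            by (rule basis_sum_degree_part) (use a EN in auto)
          assume "f - ?s \<in> U p"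
          then have "f - ?s - f2 \<in> U p" using f2 unfolding U_def by (rule dp_closed(2))
          then have "f1 - ?s \<in> U p" by (simp add: f12)
          moreover have "f1 - ?s \<in> degree_part F {int p}" by (rule dp_closed(2)[OF f1 s])
          ultimately show "f1 - ?s \<in> {0}" unfolding U_def using degree_part_Int by blast
        next
          assume "f1 - ?s \<in> {0}"
          then show "f - ?s \<in> U p" using f2 by (simp add: f12)
        qed
        then show ?thesis by blast
      qed
      have "\<exists>!a. ?P f1 {0} a" using E f1 unfolding basis_of_quotient_def by blast
      then show "\<exists>!a. ?P f (U p) a" unfolding eq .
    qed
    then show ?thesis using dE by blast
  qed
  show ?thesis unfolding semifree_def
    by (intro conjI exI[of _ U] allI dg_module_axioms U0 UU Usub Umono step)
qed

end

context bar_data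
begin

lemma bar_basis: "basis_of_quotient A bar (mcarrier bar) {0} ((\<lambda>w. single w (aone A)) ` words)"
proof -
  interpret B: dg_module_over A scal bar by (rule bar_dg_module)
  show ?thesis
  proof (rule B.basis_of_quotientI[where \<kappa> = "\<lambda>f w. lookup f w"]; (unfold bar_simps)?)
    show "inj_on (\<lambda>w. single w (aone A)) words"
    proof (rule inj_onI)
      fix v w :: nat assume "single v (aone A) = single w (aone A)"
      then have "keys (single v (aone A)) = keys (single w (aone A))"
        by simp
      moreover have "aone A \<noteq> 0" using aug_one by auto
      ultimately show "v = w" by simp
    qed
    show "single w (aone A) \<in> bcarr \<and> (\<exists>q. single w (aone A) \<in> bcomp q)"
      if "w \<in> words" for w
    proof
      show "single w (aone A) \<in> bcarr" by (rule bcarr_single[OF that one_carrier])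
      show "\<exists>q. single w (aone A) \<in> bcomp q"
        by (rule exI[of _ "(0, 0) + wdeg w"], rule bcomp_single[OF that one_comp])
    qed
    fix f assume f: "f \<in> bcarr"
    show fin: "finite {w \<in> words. lookup f w \<noteq> 0}"
      by (rule finite_subset[OF _ finite_keys[of f]]) (auto simp: in_keys_iff)
    show "lookup f w \<in> acarrier A" for w using f by (rule bcarr_lookup)
    have "f = (\<Sum>w | w \<in> words \<and> lookup f w \<noteq> 0. bact (lookup f w) (single w (aone A)))"
    proof (rule poly_mapping_eqI)
      fix v
      have "v \<notin> words \<Longrightarrow> lookup f v = 0" using f by (simp add: bcarr_def)
      then show "lookup f v = lookup (\<Sum>w | w \<in> words \<and> lookup f w \<noteq> 0.
          bact (lookup f w) (single w (aone A))) v"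
        using lookup_sum_bact[OF fin, of "lookup f" v] bcarr_lookup[OF f] by auto
    qed
    then show "f - (\<Sum>w | w \<in> words \<and> lookup f w \<noteq> 0. bact (lookup f w) (single w (aone A))) \<in> {0}"
      by simp
    fix a S w assume S: "finite S" and a: "\<And>y. a y \<in> acarrier A" "\<And>y. y \<notin> S \<Longrightarrow> a y = 0"
      and d: "f - (\<Sum>y\<in>S. bact (a y) (single y (aone A))) \<in> {0}"
    then have "lookup f w = lookup (\<Sum>y\<in>S. bact (a y) (single y (aone A))) w"
      by simp
    then show "lookup f w = a w"
      using lookup_sum_bact[OF S(1), of a w] a by (auto split: if_splits)
  qed
qed

lemma bcomp_neg: "i < 0 \<or> j < 0 \<Longrightarrow> bcomp (i, j) = {0}"
proof -
  assume ij: "i < 0 \<or> j < 0"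
  have "f = 0" if f: "f \<in> bcomp (i, j)" for f
  proof (rule poly_mapping_eqI)
    fix w
    show "lookup f w = lookup 0 w"
    proof (cases "w \<in> words")
      case True
      let ?q = "(i, j) - wdeg w"
      have "acomp A (fst ?q, snd ?q) = {0}"
        by (rule acomp_neg) (use wdeg_nonneg[OF True] ij in auto)
      moreover have "lookup f w \<in> acomp A (fst ?q, snd ?q)"
        using f by (simp only: bcomp_def prod.collapse) blast
      ultimately show ?thesis by simp
    qed (use f in \<open>simp add: bcomp_def\<close>)
  qed
  then show ?thesis using additive_subgroup_zero[OF bcomp_subgroup] by blast
qed

end

lemma free_resolution_semifree:
  assumes A: "connected_dga (algebra_dga scl gr) scal" and P: "free_resolution scl gr P \<pi>"
  shows "semifree_resolution (algebra_dga scl gr) P \<pi>"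
proof -
  interpret P: complex_over "algebra_dga scl gr" scal P
    using A P unfolding complex_over_def complex_over_axioms_def dg_module_over_def
    by (simp add: free_resolution_def algebra_dga_def)
  show ?thesis
    using P P.semifree_if_degreewise_free by (simp add: semifree_resolution_def free_resolution_def graded_part_def)
qed

lemma bar_free_resolution:
  assumes "bar_data (algebra_dga scl gr) scal N lt ldeg co"
  shows "\<exists>\<pi>. free_resolution scl gr (bar_data.bar (algebra_dga scl gr) scal N lt ldeg co) \<pi>"
proof -
  interpret bar_data "algebra_dga scl gr" scal N lt ldeg co by (rule assms)
  interpret B: dg_module_over "algebra_dga scl gr" scal bar by (rule bar_dg_module)
  interpret C: complex_over "algebra_dga scl gr" scal bar
    by unfold_locales (simp add: algebra_dga_def)
  have "free_resolution scl gr bar baug"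
    unfolding free_resolution_def
    using B.dg_module_axioms bcomp_neg C.degree_part_basis[OF bar_basis] bar_quasi_iso
    by (auto simp: bar_simps(1) graded_part_def)
  then show ?thesis by blast
qed

section \<open>A homogeneous basis of the algebra\<close>

text \<open>Words are coded by numbers, so letters are numbers as well; an enumeration allows bases that are
  indexed by any other countable set.\<close>

lemma bar_data_countable:
  fixes X :: "'x set" and e :: "'x \<Rightarrow> 'a::ab_group_add" and \<kappa> :: "'a \<Rightarrow> 'x \<Rightarrow> 'k::field"
  assumes A: "connected_dga A scal" and count: "countable X"
    and e_comp: "\<And>x. x \<in> X \<Longrightarrow> e x \<in> acomp A (d x)"
    and e_aug: "\<And>x. x \<in> X \<Longrightarrow> aaug A (e x) = 0"
    and add: "\<And>a b x. a \<in> acarrier A \<Longrightarrow> b \<in> acarrier A \<Longrightarrow> x \<in> X \<Longrightarrow> \<kappa> (a + b) x = \<kappa> a x + \<kappa> b x"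
    and mul: "\<And>a c x. a \<in> acarrier A \<Longrightarrow> x \<in> X \<Longrightarrow> \<kappa> (amul A (scal c) a) x = c * \<kappa> a x"
    and delta: "\<And>x y. x \<in> X \<Longrightarrow> y \<in> X \<Longrightarrow> \<kappa> (e y) x = (if x = y then 1 else 0)"
    and sc: "\<And>c x. x \<in> X \<Longrightarrow> \<kappa> (scal c) x = 0"
    and comp: "\<And>a p x. x \<in> X \<Longrightarrow> a \<in> acomp A p \<Longrightarrow> \<kappa> a x \<noteq> 0 \<Longrightarrow> d x = p"
    and fin: "\<And>a. a \<in> acarrier A \<Longrightarrow> finite {x \<in> X. \<kappa> a x \<noteq> 0}"
    and expand: "\<And>a. a \<in> acarrier A \<Longrightarrow>
      a = scal (aaug A a) + (\<Sum>x | x \<in> X \<and> \<kappa> a x \<noteq> 0. amul A (scal (\<kappa> a x)) (e x))"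
  obtains N lt ldeg co where "bar_data A scal N lt ldeg co"
proof -
  interpret connected_dga A scal by (rule A)
  define code where "code = to_nat_on X"
  define dec where "dec = from_nat_into X"
  let ?N = "code ` X"
  have dec: "dec (code x) = x" if "x \<in> X" for x using that count by (simp add: code_def dec_def)
  have inj: "inj_on code X" using inj_on_to_nat_on[OF count] by (simp add: code_def)
  let ?co = "\<lambda>a l. if l \<in> ?N then \<kappa> a (dec l) else 0"
  have supp: "{l. ?co a l \<noteq> 0} = code ` {x \<in> X. \<kappa> a x \<noteq> 0}" for a
    using dec inj_on_eq_iff[OF inj] by auto
  have "bar_data A scal ?N (\<lambda>l. e (dec l)) (\<lambda>l. d (dec l)) ?co"
  proof unfold_locales
    fix a assume a: "a \<in> acarrier A"
    show "finite {l. ?co a l \<noteq> 0}" unfolding supp using fin[OF a] by (rule finite_imageI)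
    have "(\<Sum>l | ?co a l \<noteq> 0. amul A (scal (?co a l)) (e (dec l))) =
        (\<Sum>x | x \<in> X \<and> \<kappa> a x \<noteq> 0. amul A (scal (\<kappa> a x)) (e x))"
      unfolding supp by (subst sum.reindex) (use inj dec in \<open>auto simp: inj_on_def intro!: sum.cong\<close>)
    then show "a = scal (aaug A a) + (\<Sum>l | ?co a l \<noteq> 0. amul A (scal (?co a l)) (e (dec l)))"
      using expand[OF a] by simp
  qed (use dec e_comp e_aug add mul delta sc comp in \<open>auto split: if_splits\<close>)
  then show thesis by (rule that)
qed

lemma (in graded_family) independentD:
  assumes "finite S" "\<And>p. p \<in> S \<Longrightarrow> y p \<in> C p" "(\<Sum>p\<in>S. y p) = 0" "p \<in> S"
  shows "y p = 0"
proof -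
  have "\<forall>p\<in>S. y p \<in> C p" using assms(2) by (rule ballI)
  then have "\<forall>p\<in>S. y p = 0"
    using independent[unfolded independent_family_def, THEN spec, THEN spec, THEN mp, OF assms(1), of y]
      assms(3) by (elim impE)
  then show ?thesis using assms(4) by (rule bspec)
qed

locale graded_generators = connected_graded_algebra scl gr
  for scl :: "'k::field \<Rightarrow> 'r::comm_ring_1 \<Rightarrow> 'r" and gr +
  fixes n :: nat and x :: "nat \<Rightarrow> 'r"
  assumes generators: "minimal_generators gr n x"
begin

sublocale G: graded_family gr
proof
  show "additive_subgroup (gr p)" for p
    using subspace_0[OF subspace_gr] subspace_diff[OF subspace_gr] by (simp add: additive_subgroup_def)
qed (rule independent_gr)

lemma G_carr: "G.carr = UNIV"
  by (rule sum_gr)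

lemma gr_zero: "0 \<in> gr j"
  by (rule subspace_0[OF subspace_gr])

lemma gr_add: "a \<in> gr j \<Longrightarrow> b \<in> gr j \<Longrightarrow> a + b \<in> gr j"
  by (rule subspace_add[OF subspace_gr])

lemma gr_diff: "a \<in> gr j \<Longrightarrow> b \<in> gr j \<Longrightarrow> a - b \<in> gr j"
  by (rule subspace_diff[OF subspace_gr])

lemma gr_scl: "a \<in> gr j \<Longrightarrow> scl c a \<in> gr j"
  by (rule subspace_scale[OF subspace_gr])

lemmas gr_closed = gr_zero gr_add gr_diff gr_scl

abbreviation aug :: "'r \<Rightarrow> 'k" where "aug \<equiv> algebra_aug scl gr"
abbreviation ideal_m :: "'r set" where "ideal_m \<equiv> augmentation_ideal gr"

lemma module_times: "module ((*) :: 'r \<Rightarrow> 'r \<Rightarrow> 'r)"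
  by unfold_locales (simp_all add: algebra_simps)

lemma span_ideal: "module.span (*) (x ` {..<n}) = ideal_m"
  using generators by (simp add: minimal_generators_def)

lemma x_deg: "i < n \<Longrightarrow> x i \<in> gr 1"
  using generators by (simp add: minimal_generators_def)

lemma ideal_m_iff: "r \<in> ideal_m \<longleftrightarrow> (\<forall>j\<le>0. component gr r j = 0)"
proof -
  have "ideal_m = graded_part gr {0<..}" by (simp add: augmentation_ideal_def graded_part_def)
  then show ?thesis by (simp add: G.graded_part_iff G_carr not_less)
qed

lemma ideal_m_mult: "r \<in> ideal_m \<Longrightarrow> a * r \<in> ideal_m"
  unfolding span_ideal[symmetric] by (rule module.span_scale[OF module_times])

lemma ideal_m_mult': "r \<in> ideal_m \<Longrightarrow> r * a \<in> ideal_m"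
  using ideal_m_mult[of r a] by (simp add: mult.commute)

lemma ideal_m_closed: "0 \<in> ideal_m" "a \<in> ideal_m \<Longrightarrow> b \<in> ideal_m \<Longrightarrow> a + b \<in> ideal_m"
  "a \<in> ideal_m \<Longrightarrow> b \<in> ideal_m \<Longrightarrow> a - b \<in> ideal_m"
  using module.span_zero[OF module_times] module.span_add[OF module_times]
    module.span_diff[OF module_times] unfolding span_ideal[symmetric] by blast+

lemma gr_ideal_m: assumes "0 < j" "r \<in> gr j" shows "r \<in> ideal_m"
  using assms(1) unfolding ideal_m_iff by (auto simp: G.component_single[OF assms(2)])

lemma scl_one_inj: "scl c 1 = scl d 1 \<Longrightarrow> c = d"
  by (simp add: scale_cancel_right)

lemma scl_one_gr: "scl c 1 \<in> gr 0"
  by (simp add: gr_0)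

lemma scl_mult: "scl c a = scl c 1 * a"
  using scl_mult_left[of c 1 a] by simp

lemma aug_unique: "r - scl c 1 \<in> ideal_m \<Longrightarrow> r - scl d 1 \<in> ideal_m \<Longrightarrow> c = d"
proof -
  assume "r - scl c 1 \<in> ideal_m" "r - scl d 1 \<in> ideal_m"
  then have "(r - scl c 1) - (r - scl d 1) \<in> ideal_m" by (rule ideal_m_closed)
  then have "scl (d - c) 1 \<in> ideal_m" by (simp add: scale_left_diff_distrib)
  then have "component gr (scl (d - c) 1) 0 = 0" by (simp add: ideal_m_iff)
  then have "scl (d - c) 1 = 0" by (simp add: G.component_single[OF scl_one_gr])
  then have "scl (d - c) 1 = scl 0 1" by simp
  then show ?thesis using scl_one_inj by fastforce
qed

lemma aug_eqI: "r - scl c 1 \<in> ideal_m \<Longrightarrow> aug r = c"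
  unfolding algebra_aug_def by (rule the_equality) (auto dest: aug_unique)

lemma aug_diff_ideal: "r - scl (aug r) 1 \<in> ideal_m"
proof -
  have c0: "component gr r 0 \<in> gr 0" using G.component_in G_carr by blast
  then obtain c where c: "component gr r 0 = scl c 1" by (auto simp: gr_0)
  have "component gr (r - scl c 1) j = 0" if "j \<le> 0" for j
  proof -
    have "component gr r j \<in> gr j" using G.component_in G_carr by blast
    then have "j < 0 \<Longrightarrow> component gr r j = 0" using gr_neg[of j] by simp
    then show ?thesis using that c
      by (cases "j = 0") (auto simp: G.component_diff G_carr G.component_single[OF scl_one_gr])
  qed
  then have "r - scl c 1 \<in> ideal_m" by (simp add: ideal_m_iff)
  then show ?thesis using aug_eqI by simp
qed

lemma aug_zero_iff: "aug r = 0 \<longleftrightarrow> r \<in> ideal_m"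
  using aug_diff_ideal[of r] aug_eqI[of r 0] by auto

lemma aug_plus: "aug (a + b) = aug a + aug b"
  using ideal_m_closed(2)[OF aug_diff_ideal[of a] aug_diff_ideal[of b]]
  by (intro aug_eqI) (simp add: scale_left_distrib algebra_simps)

lemma aug_times: "aug (a * b) = aug a * aug b"
proof (rule aug_eqI)
  have "a * b - scl (aug a * aug b) 1 = (a - scl (aug a) 1) * b + scl (aug a) 1 * (b - scl (aug b) 1)"
    by (simp add: algebra_simps flip: scl_mult)
  then show "a * b - scl (aug a * aug b) 1 \<in> ideal_m"
    using ideal_m_mult[OF aug_diff_ideal] ideal_m_mult'[OF aug_diff_ideal] ideal_m_closed(2) by simp
qed

lemma aug_scl: "aug (scl c 1) = c"
  by (rule aug_eqI) (simp add: ideal_m_closed)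

lemma aug_homogeneous: "r \<in> gr j \<Longrightarrow> j \<noteq> 0 \<Longrightarrow> aug r = 0"
  using gr_neg[of j] gr_ideal_m[of j r] ideal_m_closed(1) by (cases "j < 0") (auto simp: aug_zero_iff)

text \<open>In the degree 1 part of a combination of the generators only the scalar parts of the coefficients
  survive.\<close>

lemma gr_1_span: "gr 1 \<subseteq> span (x ` {..<n})"
proof
  fix r assume r: "r \<in> gr 1"
  interpret M: module "(*) :: 'r \<Rightarrow> 'r \<Rightarrow> 'r" by (rule module_times)
  have "component gr s 1 \<in> span (x ` {..<n})" if "s \<in> M.span (x ` {..<n})" for s
    using that
  proof (induction rule: M.span_induct_alt)
    case base
    then show ?case by (simp add: G.component_zero span_zero)
  next
    case (step c y s)
    then obtain i where i: "i < n" "y = x i" by auto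
    have "(component gr (c * y) (0 + 1)) = component gr c 0 * y"
    proof -
      have "(\<lambda>a. a * y) c \<in> G.carr \<and>
          component gr ((\<lambda>a. a * y) c) ((\<lambda>j. j + 1) 0) = (\<lambda>a. a * y) (component gr c 0)"
      proof (rule G.component_map[OF G.graded_family_axioms])
        show "f * y \<in> gr (p + 1)" if "f \<in> gr p" for p f
          using gr_mult[OF that x_deg[OF i(1)]] i(2) by simp
      qed (simp_all add: G_carr inj_def distrib_right)
      then show ?thesis by simp
    qed
    moreover have "component gr c 0 \<in> gr 0" using G.component_in G_carr by blast
    then obtain k where "component gr c 0 = scl k 1" by (auto simp: gr_0)
    ultimately have "component gr (c * y) 1 = scl k y" using scl_mult[of k y] by simp
    then show ?case using step i
      by (simp add: G.component_add G_carr span_add span_scale span_base)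
  qed
  moreover have "r \<in> M.span (x ` {..<n})" using gr_ideal_m[OF _ r] span_ideal by simp
  ultimately show "r \<in> span (x ` {..<n})" using G.component_single[OF r, of 1] by metis
qed

text \<open>A generator in the linear span of the others would be superfluous, against minimality.\<close>

lemma x_not_span: assumes i: "i < n" shows "x i \<notin> span (x ` ({..<n} - {i}))"
proof
  interpret M: module "(*) :: 'r \<Rightarrow> 'r \<Rightarrow> 'r" by (rule module_times)
  let ?I = "{..<n} - {i}"
  assume *: "x i \<in> span (x ` ?I)"
  have "s \<in> M.span (x ` ?I)" if "s \<in> span (x ` ?I)" for s
    using that
  proof (induction rule: span_induct_alt)
    case base
    then show ?case by (rule M.span_zero)
  next
    case (step c y s)
    then have "scl c 1 * y \<in> M.span (x ` ?I)" by (intro M.span_scale M.span_base)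
    then show ?case using step scl_mult[of c y] by (simp add: M.span_add)
  qed
  then have "x i \<in> M.span (x ` ?I)" using * by simp
  have "x j \<in> M.span (x ` ?I)" if "j < n" for j
  proof (cases "j = i")
    case False
    then have "x j \<in> x ` ?I" using that by simp
    then show ?thesis by (rule M.span_base)
  qed (use \<open>x i \<in> M.span (x ` ?I)\<close> in simp)
  then have "x ` {..<n} \<subseteq> M.span (x ` ?I)" by auto
  then have "M.span (x ` {..<n}) \<subseteq> M.span (x ` ?I)"
    by (rule M.span_minimal) (rule M.subspace_span)
  moreover have "M.span (x ` ?I) \<subseteq> M.span (x ` {..<n})" by (rule M.span_mono) auto
  ultimately have "M.span (x ` ?I) = ideal_m" using span_ideal by simp
  moreover have "?I \<subset> {..<n}" using i by auto
  moreover have "\<forall>I. I \<subset> {..<n} \<longrightarrow> M.span (x ` I) \<noteq> ideal_m"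
    using generators by (simp add: minimal_generators_def)
  ultimately show False by simp
qed

lemma inj_x: "inj_on x {..<n}"
proof (rule inj_onI, rule ccontr)
  fix i j assume "i \<in> {..<n}" "j \<in> {..<n}" "x i = x j" "i \<noteq> j"
  then have "x i \<in> x ` ({..<n} - {i})" by auto
  then have "x i \<in> span (x ` ({..<n} - {i}))" by (rule span_base)
  then show False using x_not_span[of i] \<open>i \<in> {..<n}\<close> by simp
qed

lemma independent_x: "independent (x ` {..<n})"
  unfolding dependent_def
proof
  assume "\<exists>a\<in>x ` {..<n}. a \<in> span (x ` {..<n} - {a})"
  then obtain i where i: "i < n" "x i \<in> span (x ` {..<n} - {x i})" by auto
  have "x ` {..<n} - {x i} \<subseteq> x ` ({..<n} - {i})" by auto
  then have "x i \<in> span (x ` ({..<n} - {i}))" by (rule subsetD[OF span_mono i(2)])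
  then show False using x_not_span[OF i(1)] by simp
qed

text \<open>The choices in degrees 0 and 1 make the augmentation and the coefficients of the generators
  coordinates with respect to the basis.\<close>

definition degree_basis :: "int \<Rightarrow> 'r set" where
  "degree_basis j = (if j = 0 then {1} else if j = 1 then x ` {..<n}
     else SOME B. B \<subseteq> gr j \<and> independent B \<and> gr j \<subseteq> span B)"

lemma degree_basis: "degree_basis j \<subseteq> gr j" "independent (degree_basis j)" "gr j \<subseteq> span (degree_basis j)"
proof -
  have "\<exists>B. B \<subseteq> gr j \<and> independent B \<and> gr j \<subseteq> span B"
    by (rule maximal_independent_subset[of "gr j"]) blast
  from someI_ex[OF this] have "degree_basis j \<subseteq> gr j \<and> independent (degree_basis j) \<and> gr j \<subseteq> span (degree_basis j)"
  proof (cases "j = 0 \<or> j = 1")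
    case True
    have "gr 0 \<subseteq> span {1}" using span_scale[OF span_base[of 1 "{1}"]] by (auto simp: gr_0)
    moreover have "1 \<in> gr 0" using scl_one_gr[of 1] by simp
    ultimately show ?thesis
      using True independent_x gr_1_span x_deg independent_insert[of 1 "{}"]
      by (auto simp: degree_basis_def independent_empty)
  qed (simp add: degree_basis_def)
  then show "degree_basis j \<subseteq> gr j" "independent (degree_basis j)" "gr j \<subseteq> span (degree_basis j)" by auto
qed

lemma degree_basis_nonzero: "b \<in> degree_basis j \<Longrightarrow> b \<noteq> 0"
  using degree_basis(2)[of j] dependent_zero[of "degree_basis j"] by auto

lemma degree_basis_finite: "finite (degree_basis j)"
proof -
  obtain T where "finite T" "gr j = span T" using gr_finite_dim by blast
  then have "degree_basis j \<subseteq> span T" using degree_basis(1)[of j] by simp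
  then show ?thesis using independent_span_bound[OF \<open>finite T\<close> degree_basis(2)] by simp
qed

lemma gr_disjoint: "a \<in> gr i \<Longrightarrow> a \<in> gr j \<Longrightarrow> a \<noteq> 0 \<Longrightarrow> i = j"
proof -
  assume a: "a \<in> gr i" "a \<in> gr j" "a \<noteq> 0"
  show "i = j" using G.component_single[OF a(1), of j] G.component_single[OF a(2), of j] a(3)
    by (auto split: if_splits)
qed

definition basis :: "'r set" where
  "basis = (\<Union>j. degree_basis j)"

definition bdeg :: "'r \<Rightarrow> int" where
  "bdeg b = (THE j. b \<in> degree_basis j)"

lemma bdeg_eq: "b \<in> degree_basis j \<Longrightarrow> bdeg b = j"
  unfolding bdeg_def
proof (rule the_equality)
  fix i assume "b \<in> degree_basis j" "b \<in> degree_basis i"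
  then show "i = j"
    using gr_disjoint[of b i j] subsetD[OF degree_basis(1)] degree_basis_nonzero[of b j] by simp
qed

lemma basis_deg: "b \<in> basis \<Longrightarrow> b \<in> degree_basis (bdeg b)"
  using bdeg_eq by (auto simp: basis_def)

lemma basis_gr: "b \<in> basis \<Longrightarrow> b \<in> gr (bdeg b)"
  by (rule subsetD[OF degree_basis(1) basis_deg])

lemma basis_nonneg: "b \<in> basis \<Longrightarrow> 0 \<le> bdeg b"
  using basis_gr[of b] gr_neg[of "bdeg b"] degree_basis_nonzero[OF basis_deg[of b]]
  by (cases "bdeg b < 0") auto

lemma one_basis: "1 \<in> basis" "bdeg 1 = 0"
proof -
  have "1 \<in> degree_basis 0" by (simp add: degree_basis_def)
  then show "1 \<in> basis" "bdeg 1 = 0" using bdeg_eq by (auto simp: basis_def)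
qed

lemma x_basis: "i < n \<Longrightarrow> x i \<in> basis" "i < n \<Longrightarrow> bdeg (x i) = 1"
proof -
  assume "i < n"
  then have "x i \<in> degree_basis 1" by (simp add: degree_basis_def)
  then show "x i \<in> basis" "bdeg (x i) = 1" using bdeg_eq by (auto simp: basis_def)
qed

lemma basis_zero_deg: "b \<in> basis \<Longrightarrow> bdeg b = 0 \<Longrightarrow> b = 1"
  using basis_deg[of b] by (simp add: degree_basis_def)

lemma countable_basis: "countable basis"
  unfolding basis_def by (rule countable_UN) (auto simp: degree_basis_finite countable_finite)

lemma independent_basis: "independent basis"
  unfolding dependent_explicit
proof
  assume "\<exists>t u. finite t \<and> t \<subseteq> basis \<and> (\<Sum>v\<in>t. scl (u v) v) = 0 \<and> (\<exists>v\<in>t. u v \<noteq> 0)"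
  then obtain t u v where t: "finite t" "t \<subseteq> basis" "(\<Sum>v\<in>t. scl (u v) v) = 0" "v \<in> t" "u v \<noteq> 0"
    by blast
  let ?y = "\<lambda>j. \<Sum>b | b \<in> t \<and> bdeg b = j. scl (u b) b"
  have "(\<Sum>j\<in>bdeg ` t. ?y j) = (\<Sum>v\<in>t. scl (u v) v)"
    by (rule sum.group[OF t(1)]) (use t(1) in auto)
  then have sum0: "(\<Sum>j\<in>bdeg ` t. ?y j) = 0" by (simp only: t(3))
  have "?y j \<in> gr j" for j
  proof -
    have "scl (u b) b \<in> gr j" if "b \<in> {b \<in> t. bdeg b = j}" for b
      using gr_scl[OF basis_gr, of b "u b"] that t(2) by auto
    then show "?y j \<in> gr j" by (rule subspace_sum[OF subspace_gr])
  qed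
  then have "?y (bdeg v) = 0"
    by (rule G.independentD[OF finite_imageI[OF t(1)] _ sum0 imageI[OF t(4)]])
  moreover have "{b \<in> t. bdeg b = bdeg v} \<subseteq> degree_basis (bdeg v)" using t(2) basis_deg by force
  moreover have "finite {b \<in> t. bdeg b = bdeg v}" using t(1) by simp
  moreover have "v \<in> {b \<in> t. bdeg b = bdeg v}" using t(4) by simp
  ultimately have "dependent (degree_basis (bdeg v))"
    using t(5) unfolding dependent_explicit by (intro exI[of _ "{b \<in> t. bdeg b = bdeg v}"] exI[of _ u]) blast
  then show False using degree_basis(2)[of "bdeg v"] by simp
qed

lemma span_basis: "span basis = UNIV"
proof -
  have "r \<in> span basis" for r
  proof -
    have "r \<in> G.carr" by (simp add: G_carr)
    then show ?thesis
    proof (induction rule: G.carr_induct)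
      case (homogeneous j r)
      then have "r \<in> span (degree_basis j)" by (rule subsetD[OF degree_basis(3)])
      moreover have "degree_basis j \<subseteq> basis" by (auto simp: basis_def)
      ultimately show ?case using span_mono by (meson subsetD)
    qed (simp_all add: span_zero span_add)
  qed
  then show ?thesis by blast
qed

definition rco :: "'r \<Rightarrow> 'r \<Rightarrow> 'k" where
  "rco r b = representation basis r b"

lemma rco_add: "rco (r + s) b = rco r b + rco s b"
  by (simp add: rco_def representation_add independent_basis span_basis)

lemma rco_zero [simp]: "rco 0 b = 0"
  by (simp add: rco_def representation_zero)

lemma rco_scl: "rco (scl c r) b = c * rco r b"
  by (simp add: rco_def representation_scale independent_basis span_basis)

lemma rco_basis: "b \<in> basis \<Longrightarrow> rco b b' = (if b' = b then 1 else 0)"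
  by (simp add: rco_def representation_basis independent_basis)

lemma rco_support: "rco r b \<noteq> 0 \<Longrightarrow> b \<in> basis"
  by (simp add: rco_def representation_ne_zero)

lemma rco_finite: "finite {b. rco r b \<noteq> 0}"
  unfolding rco_def by (rule finite_representation)

lemma rco_sum: "(\<Sum>b | rco r b \<noteq> 0. scl (rco r b) b) = r"
  unfolding rco_def by (rule sum_nonzero_representation_eq) (simp_all add: independent_basis span_basis)

lemma rco_homogeneous:
  assumes r: "r \<in> gr j" and b: "rco r b \<noteq> 0"
  shows "bdeg b = j"
proof -
  have "representation basis r = representation (degree_basis j) r"
    by (rule representation_extend[OF independent_basis])
      (use degree_basis(3) r in \<open>auto simp: basis_def\<close>)
  then have "representation (degree_basis j) r b \<noteq> 0" using b by (simp add: rco_def)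
  then have "b \<in> degree_basis j" by (rule representation_ne_zero)
  then show ?thesis by (rule bdeg_eq)
qed

lemma rco_eq_zero: "(\<And>b. b \<in> basis \<Longrightarrow> rco r b = 0) \<Longrightarrow> r = 0"
proof -
  assume "\<And>b. b \<in> basis \<Longrightarrow> rco r b = 0"
  then have "{b. rco r b \<noteq> 0} = {}" using rco_support[of r] by auto
  then show "r = 0" using rco_sum[of r] by simp
qed

lemma aug_basis: "b \<in> basis \<Longrightarrow> aug b = (if b = 1 then 1 else 0)"
  using aug_scl[of 1] aug_homogeneous[OF basis_gr, of b] basis_zero_deg[of b] by auto

lemma aug_rco: "aug r = rco r 1"
proof (rule aug_eqI)
  have sc: "rco (scl (rco r 1) 1) b = (if b = 1 then rco r 1 else 0)" for b
    by (simp add: rco_scl rco_basis one_basis)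
  let ?s = "r - scl (rco r 1) 1"
  have s: "rco ?s 1 = 0"
    using rco_add[of ?s "scl (rco r 1) 1" 1] sc[of 1] by simp
  have "scl (rco ?s b) b \<in> ideal_m" if "rco ?s b \<noteq> 0" for b
  proof -
    have "b \<in> basis" "b \<noteq> 1" using rco_support[OF that] s that by auto
    then have "aug b = 0" by (simp add: aug_basis)
    then have "b \<in> ideal_m" by (simp only: aug_zero_iff)
    then show ?thesis using ideal_m_mult[of b "scl (rco ?s b) 1"] by (simp flip: scl_mult)
  qed
  then have "(\<Sum>b | rco ?s b \<noteq> 0. scl (rco ?s b) b) \<in> ideal_m"
    unfolding span_ideal[symmetric] by (intro module.span_sum[OF module_times]) auto
  then show "?s \<in> ideal_m" by (simp only: rco_sum)
qed

abbreviation scal_R :: "'k \<Rightarrow> 'r" where "scal_R c \<equiv> scl c 1"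

abbreviation dga_R :: "('k, 'r) dga" where "dga_R \<equiv> algebra_dga scl gr"

lemma dga_R_comp: "acomp dga_R (i, j) = (if i = 0 then gr j else {0})"
  by (simp add: algebra_dga_def)

lemma dga_R_family: "additive_subgroup (acomp dga_R p)" "independent_family (acomp dga_R)"
proof -
  show "additive_subgroup (acomp dga_R p)"
    by (cases p) (auto simp: dga_R_comp G.subgroup_comp additive_subgroup_def gr_closed)
  show "independent_family (acomp dga_R)"
    unfolding independent_family_def
  proof (intro allI impI ballI)
    fix S y p assume fin: "finite S" and y: "\<forall>p\<in>S. y p \<in> acomp dga_R p" and s: "(\<Sum>p\<in>S. y p) = 0" and p: "p \<in> S"
    show "y p = 0"
    proof (cases "fst p = 0")
      case True
      let ?S = "{q \<in> S. fst q = 0}"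
      have z: "y q = 0" if "q \<in> S - ?S" for q
        using y that by (cases q) (auto simp: dga_R_comp)
      have "(\<Sum>q\<in>?S. y q) = 0"
        using s sum.mono_neutral_left[OF fin, of ?S y] z by auto
      moreover have "(\<Sum>q\<in>?S. y q) = (\<Sum>j\<in>snd ` ?S. y (0, j))"
        by (subst sum.reindex) (auto simp: inj_on_def prod_eq_iff intro!: sum.cong arg_cong[of _ _ y])
      ultimately have sum0: "(\<Sum>j\<in>snd ` ?S. y (0, j)) = 0" by simp
      have "y (0, j) \<in> gr j" if "j \<in> snd ` ?S" for j
      proof -
        have "(0, j) \<in> S" using that by auto
        then have "y (0, j) \<in> acomp dga_R (0, j)" using y by blast
        then show ?thesis by (simp add: dga_R_comp)
      qed
      moreover have "finite (snd ` ?S)" using fin by simp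
      moreover have "snd p \<in> snd ` ?S" using p True by simp
      ultimately have "y (0, snd p) = 0" using G.independentD[OF _ _ sum0] by blast
      then show ?thesis using True by (cases p) simp
    qed (use y p in \<open>cases p, auto simp: dga_R_comp\<close>)
  qed
qed

lemma dga_R_carrier: "acarrier dga_R = UNIV"
proof -
  have "r \<in> acarrier dga_R" for r
  proof -
    have "r \<in> internal_sum UNIV gr" by (simp add: sum_gr)
    then obtain S y where y: "r = (\<Sum>j\<in>S. y j)" "finite S" "\<forall>j\<in>S. y j \<in> gr j"
      by (auto simp: internal_sum_def)
    have "r = (\<Sum>p\<in>(\<lambda>j. (0, j)) ` S. y (snd p))"
      unfolding y(1) by (subst sum.reindex) (auto simp: inj_on_def)
    moreover have "finite ((\<lambda>j. (0::int, j)) ` S)" using y(2) by simp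
    moreover have "\<forall>p\<in>(\<lambda>j. (0, j)) ` S. y (snd p) \<in> acomp dga_R p" using y(3) by (auto simp: dga_R_comp)
    ultimately show ?thesis unfolding internal_sum_def
      by (intro CollectI exI[of _ "(\<lambda>j. (0, j)) ` S"] exI[of _ "\<lambda>p. y (snd p)"]) auto
  qed
  then show ?thesis by blast
qed

lemma dga_R_simps: "amul dga_R = (*)" "aone dga_R = 1" "adif dga_R = (\<lambda>_. 0)" "aaug dga_R = aug"
  by (simp_all add: algebra_dga_def)

lemma connected_dga_R: "connected_dga dga_R scal_R"
proof (unfold_locales; (unfold dga_R_carrier dga_R_simps)?)
  fix a b :: 'r and i j i' j' :: int
  assume "a \<in> acomp dga_R (i, j)" "b \<in> acomp dga_R (i', j')"
  then show "a * b \<in> acomp dga_R (i + i', j + j')"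
    by (auto simp: dga_R_comp gr_mult gr_closed split: if_splits)
next
  fix a p assume "a \<in> acomp dga_R p" "p \<noteq> (0, 0)"
  then show "aug a = 0"
    using aug_homogeneous[of a "snd p"] by (cases p) (auto simp: dga_R_comp aug_zero_iff ideal_m_closed split: if_splits)
qed (auto simp: dga_R_comp dga_R_family algebra_simps gr_closed gr_neg aug_plus aug_times aug_scl scl_one_gr
    scale_left_distrib aug_zero_iff ideal_m_closed simp flip: scl_mult)

lemma bar_data_R: obtains N lt ldeg co where "bar_data dga_R scal_R N lt ldeg co"
proof (rule bar_data_countable[OF connected_dga_R, of "basis - {1}" "\<lambda>b. b" "\<lambda>b. (0, bdeg b)" rco];
    (unfold dga_R_carrier dga_R_simps)?)
  show "countable (basis - {1})" using countable_basis by simp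
  fix a
  show "finite {b \<in> basis - {1}. rco a b \<noteq> 0}" using rco_finite[of a] by (rule rev_finite_subset) auto
  have "a = (\<Sum>b | rco a b \<noteq> 0. scl (rco a b) b)" by (simp only: rco_sum)
  also have "\<dots> = (\<Sum>b\<in>insert 1 {b \<in> basis - {1}. rco a b \<noteq> 0}. scl (rco a b) b)"
    by (rule sum.mono_neutral_left) (use rco_finite[of a] rco_support[of a] in \<open>auto intro: rev_finite_subset\<close>)
  also have "\<dots> = scl (rco a 1) 1 + (\<Sum>b | b \<in> basis - {1} \<and> rco a b \<noteq> 0. scl (rco a b) b)"
    by (subst sum.insert) (use rco_finite[of a] in \<open>auto intro: rev_finite_subset\<close>)
  finally show "a = scal_R (aug a) + (\<Sum>b | b \<in> basis - {1} \<and> rco a b \<noteq> 0. scal_R (rco a b) * b)"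
    by (simp add: aug_rco flip: scl_mult)
next
  fix b a p assume b: "b \<in> basis - {1}" and "a \<in> acomp dga_R p" "rco a b \<noteq> 0"
  then show "(0, bdeg b) = p"
    using rco_homogeneous[of a "snd p" b] by (cases p) (auto simp: dga_R_comp split: if_splits)
qed (auto simp: dga_R_comp basis_gr aug_basis rco_add rco_scl rco_basis one_basis simp flip: scl_mult intro: that)

end

section \<open>The Koszul complex as a DG algebra\<close>

lemma poly_mapping_single_induct [case_names zero add single]:
  fixes f :: "'i \<Rightarrow>\<^sub>0 'a::comm_monoid_add"
  assumes "P 0" "\<And>f g. P f \<Longrightarrow> P g \<Longrightarrow> P (f + g)"
    "\<And>I a. I \<in> keys f \<Longrightarrow> P (single I a)"
  shows "P f"
proof -
  have "P (sum (\<lambda>w. single w (lookup f w)) W)" if "finite W" "W \<subseteq> keys f" for W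
    using that by (induction W) (auto intro: assms)
  from this[of "keys f"] show ?thesis by (simp add: sum_single_lookup)
qed

definition shuffle_inv :: "nat set \<Rightarrow> nat set \<Rightarrow> nat" where
  "shuffle_inv I J = card {(i, j). i \<in> I \<and> j \<in> J \<and> j < i}"

definition below :: "nat set \<Rightarrow> nat \<Rightarrow> nat" where
  "below I k = card {j \<in> I. j < k}"

definition ext_mul_term :: "nat set \<Rightarrow> nat set \<Rightarrow> 'r::comm_ring_1 \<Rightarrow> 'r \<Rightarrow> (nat set \<Rightarrow>\<^sub>0 'r)" where
  "ext_mul_term I J a b = (if I \<inter> J = {} then single (I \<union> J) ((-1) ^ shuffle_inv I J * a * b) else 0)"

definition ext_dif_term :: "(nat \<Rightarrow> 'r::comm_ring_1) \<Rightarrow> nat set \<Rightarrow> 'r \<Rightarrow> (nat set \<Rightarrow>\<^sub>0 'r)" where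
  "ext_dif_term x I a = (\<Sum>i\<in>I. single (I - {i}) ((-1) ^ below I i * x i * a))"

lemma ext_mul_eq: "ext_mul f g = (\<Sum>I\<in>keys f. \<Sum>J\<in>keys g.
    ext_mul_term I J (lookup f I) (lookup g J))"
  unfolding ext_mul_def ext_mul_term_def shuffle_inv_def by (rule refl)

lemma koszul_dif_eq: "koszul_dif x f = (\<Sum>I\<in>keys f. ext_dif_term x I (lookup f I))"
  unfolding koszul_dif_def ext_dif_term_def below_def by (rule refl)

lemma ext_mul_term_add_right: "ext_mul_term I J a (b + c) = ext_mul_term I J a b + ext_mul_term I J a c"
  by (simp add: ext_mul_term_def single_add algebra_simps)

lemma ext_mul_term_add_left: "ext_mul_term I J (a + b) c = ext_mul_term I J a c + ext_mul_term I J b c"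
  by (simp add: ext_mul_term_def single_add algebra_simps)

lemma ext_mul_term_zero [simp]: "ext_mul_term I J a 0 = 0" "ext_mul_term I J 0 b = 0"
  by (simp_all add: ext_mul_term_def)

lemma ext_mul_add_right: "ext_mul f (g + h) = ext_mul f g + ext_mul f h"
  unfolding ext_mul_eq sum.distrib[symmetric]
  by (rule sum.cong[OF refl], rule setsum_keys_plus_distrib) (simp_all add: ext_mul_term_add_right)

lemma ext_mul_add_left: "ext_mul (f + g) h = ext_mul f h + ext_mul g h"
  unfolding ext_mul_eq
  by (rule setsum_keys_plus_distrib) (simp_all add: ext_mul_term_add_left sum.distrib)

lemma ext_mul_zero [simp]: "ext_mul f 0 = 0" "ext_mul 0 g = 0"
  by (simp_all add: ext_mul_eq)

lemma ext_mul_single: "ext_mul (single I a) (single J b) = ext_mul_term I J a b"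
  by (cases "a = 0"; cases "b = 0") (simp_all add: ext_mul_eq)

lemma ext_dif_term_add: "ext_dif_term x I (a + b) = ext_dif_term x I a + ext_dif_term x I b"
  by (simp add: ext_dif_term_def distrib_left single_add sum.distrib)

lemma koszul_dif_add: "koszul_dif x (f + g) = koszul_dif x f + koszul_dif x g"
  unfolding koszul_dif_eq
  by (rule setsum_keys_plus_distrib) (simp_all add: ext_dif_term_add, simp add: ext_dif_term_def)

lemma koszul_dif_single: "koszul_dif x (single I a) = ext_dif_term x I a"
  by (cases "a = 0") (simp_all add: koszul_dif_eq, simp add: ext_dif_term_def)

lemma koszul_dif_zero [simp]: "koszul_dif x 0 = 0"
  by (simp add: koszul_dif_eq)

lemma koszul_dif_uminus: "koszul_dif x (- f) = - koszul_dif x f"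
  using koszul_dif_add[of x f "- f"] by (simp add: eq_neg_iff_add_eq_0 add.commute)

lemma shuffle_inv_finite: "finite I \<Longrightarrow> finite J \<Longrightarrow> finite {(i, j). i \<in> I \<and> j \<in> J \<and> j < i}"
  by (rule finite_subset[of _ "I \<times> J"]) auto

lemma shuffle_inv_Un_left:
  assumes "finite I" "finite J" "finite L" "I \<inter> J = {}"
  shows "shuffle_inv (I \<union> J) L = shuffle_inv I L + shuffle_inv J L"
proof -
  have "{(i, j). i \<in> I \<union> J \<and> j \<in> L \<and> j < i} = {(i, j). i \<in> I \<and> j \<in> L \<and> j < i} \<union> {(i, j). i \<in> J \<and> j \<in> L \<and> j < i}"
    by auto
  then show ?thesis unfolding shuffle_inv_def using assms
    by (simp add: card_Un_disjoint shuffle_inv_finite disjoint_iff)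
qed

lemma shuffle_inv_Un_right:
  assumes "finite I" "finite J" "finite L" "J \<inter> L = {}"
  shows "shuffle_inv I (J \<union> L) = shuffle_inv I J + shuffle_inv I L"
proof -
  have "{(i, j). i \<in> I \<and> j \<in> J \<union> L \<and> j < i} = {(i, j). i \<in> I \<and> j \<in> J \<and> j < i} \<union> {(i, j). i \<in> I \<and> j \<in> L \<and> j < i}"
    by auto
  then show ?thesis unfolding shuffle_inv_def using assms
    by (simp add: card_Un_disjoint shuffle_inv_finite disjoint_iff)
qed

lemma shuffle_inv_single_left: "shuffle_inv {k} J = below J k"
proof -
  have "{(i, j). i \<in> {k} \<and> j \<in> J \<and> j < i} = (\<lambda>j. (k, j)) ` {j \<in> J. j < k}" by auto
  then show ?thesis unfolding shuffle_inv_def below_def by (simp add: card_image inj_on_def)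
qed

definition above :: "nat set \<Rightarrow> nat \<Rightarrow> nat" where
  "above I k = card {i \<in> I. k < i}"

lemma shuffle_inv_single_right: "shuffle_inv I {k} = above I k"
proof -
  have "{(i, j). i \<in> I \<and> j \<in> {k} \<and> j < i} = (\<lambda>i. (i, k)) ` {i \<in> I. k < i}" by auto
  then show ?thesis unfolding shuffle_inv_def above_def by (simp add: card_image inj_on_def)
qed

lemma shuffle_inv_remove_left:
  assumes "finite I" "finite J" "k \<in> I"
  shows "shuffle_inv I J = shuffle_inv (I - {k}) J + below J k"
  using shuffle_inv_Un_left[of "I - {k}" "{k}" J] assms by (simp add: insert_absorb shuffle_inv_single_left)

lemma shuffle_inv_remove_right:
  assumes "finite I" "finite J" "k \<in> J"
  shows "shuffle_inv I J = shuffle_inv I (J - {k}) + above I k"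
  using shuffle_inv_Un_right[of I "J - {k}" "{k}"] assms by (simp add: insert_absorb shuffle_inv_single_right)

lemma below_Un: "finite I \<Longrightarrow> finite J \<Longrightarrow> I \<inter> J = {} \<Longrightarrow> below (I \<union> J) k = below I k + below J k"
proof -
  assume "finite I" "finite J" "I \<inter> J = {}"
  moreover have "{j \<in> I \<union> J. j < k} = {j \<in> I. j < k} \<union> {j \<in> J. j < k}" by auto
  ultimately show ?thesis unfolding below_def by (simp add: card_Un_disjoint disjoint_iff)
qed

lemma card_below_above: "finite I \<Longrightarrow> k \<notin> I \<Longrightarrow> card I = below I k + above I k"
proof -
  assume I: "finite I" "k \<notin> I"
  have "j < k \<or> k < j" if "j \<in> I" for j using that I(2) by (metis nat_neq_iff)
  then have "I = {j \<in> I. j < k} \<union> {j \<in> I. k < j}" by blast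
  then have "card I = card ({j \<in> I. j < k} \<union> {j \<in> I. k < j})" by simp
  also have "\<dots> = below I k + above I k" unfolding below_def above_def
    by (rule card_Un_disjoint) (use I in auto)
  finally show ?thesis .
qed

lemma below_remove: "below (I - {k}) k = below I k"
  unfolding below_def by (rule arg_cong[of _ _ card]) auto

lemma above_remove: "above (I - {k}) k = above I k"
  unfolding above_def by (rule arg_cong[of _ _ card]) auto

lemma card_below_above': "finite I \<Longrightarrow> k \<in> I \<Longrightarrow> card I = below I k + above I k + 1"
  using card_below_above[of "I - {k}" k] card_Suc_Diff1[of I k] by (simp add: below_remove above_remove)

lemma ext_mul_assoc_single:
  assumes "finite I" "finite J" "finite L"
  shows "ext_mul (ext_mul (single I a) (single J b)) (single L c) =
    ext_mul (single I a) (ext_mul (single J b) (single L c))"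
proof (cases "I \<inter> J = {} \<and> (I \<union> J) \<inter> L = {}")
  case True
  then have d: "I \<inter> J = {}" "(I \<union> J) \<inter> L = {}" "J \<inter> L = {}" "I \<inter> (J \<union> L) = {}" by auto
  then show ?thesis
    using assms
    by (simp add: ext_mul_single ext_mul_term_def shuffle_inv_Un_left shuffle_inv_Un_right power_add
        Un_assoc mult_ac)
next
  case False
  then show ?thesis
    by (auto simp: ext_mul_single ext_mul_term_def)
qed

lemma minus_one_cong: "even p = even q \<Longrightarrow> (-1) ^ p = ((-1) ^ q :: 'r::comm_ring_1)"
  by (simp add: minus_one_power_iff)

lemma sign_left:
  fixes y a b :: "'r::comm_ring_1"
  assumes "even (p + q) = even (r + s)"
  shows "(-1) ^ p * y * ((-1) ^ q * a * b) = (-1) ^ r * ((-1) ^ s * y * a) * b"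
proof -
  have "(-1) ^ p * y * ((-1) ^ q * a * b) = (-1) ^ (p + q) * (y * a * b)" by (simp add: power_add mult_ac)
  also have "(-1) ^ (p + q) = ((-1) ^ (r + s) :: 'r)" by (rule minus_one_cong[OF assms])
  finally show ?thesis by (simp add: power_add mult_ac)
qed

lemma sign_right:
  fixes y a b :: "'r::comm_ring_1"
  assumes "even (p + q) = even (m + r + s)"
  shows "(-1) ^ p * y * ((-1) ^ q * a * b) = (-1) ^ m * ((-1) ^ r * a * ((-1) ^ s * y * b))"
proof -
  have "(-1) ^ p * y * ((-1) ^ q * a * b) = (-1) ^ (p + q) * (y * a * b)" by (simp add: power_add mult_ac)
  also have "(-1) ^ (p + q) = ((-1) ^ (m + r + s) :: 'r)" by (rule minus_one_cong[OF assms])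
  finally show ?thesis by (simp add: power_add mult_ac)
qed

lemma sign_cancel:
  fixes y a b :: "'r::comm_ring_1"
  assumes "even (p + q) \<noteq> even (m + r + s)"
  shows "(-1) ^ p * ((-1) ^ q * y * a) * b + (-1) ^ m * ((-1) ^ r * a * ((-1) ^ s * y * b)) = 0"
proof -
  have "(-1) ^ p * ((-1) ^ q * y * a) * b = (-1) ^ (p + q) * (y * a * b)" by (simp add: power_add mult_ac)
  also have "(-1) ^ (p + q) = ((-1) ^ Suc (m + r + s) :: 'r)" by (rule minus_one_cong) (use assms in simp)
  finally show ?thesis by (simp add: power_add mult_ac)
qed

lemma ext_mul_sum_left: "ext_mul (sum f S) g = (\<Sum>i\<in>S. ext_mul (f i) g)"
  by (induction S rule: infinite_finite_induct) (simp_all add: ext_mul_add_left)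

lemma ext_mul_sum_right: "ext_mul f (sum g S) = (\<Sum>i\<in>S. ext_mul f (g i))"
  by (induction S rule: infinite_finite_induct) (simp_all add: ext_mul_add_right)

text \<open>The Leibniz rule for monomials. If \<open>I\<close> and \<open>J\<close> meet in one index the two remaining terms on
  the right cancel; if they meet in more, all terms vanish.\<close>

lemma koszul_dif_mul_single:
  fixes a b :: "'r::comm_ring_1"
  assumes fin: "finite I" "finite J"
  shows "koszul_dif x (ext_mul (single I a) (single J b)) =
    ext_mul (koszul_dif x (single I a)) (single J b) +
    alt_sign (int (card I)) (ext_mul (single I a) (koszul_dif x (single J b)))"
proof -
  let ?s = "single :: nat set \<Rightarrow> 'r \<Rightarrow> (nat set \<Rightarrow>\<^sub>0 'r)"
  have L: "ext_mul (koszul_dif x (?s I a)) (?s J b) = (\<Sum>k\<in>I. ext_mul_term (I - {k}) J ((-1) ^ below I k * x k * a) b)"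
    by (simp add: koszul_dif_single ext_dif_term_def ext_mul_sum_left ext_mul_single)
  have R: "ext_mul (?s I a) (koszul_dif x (?s J b)) = (\<Sum>k\<in>J. ext_mul_term I (J - {k}) a ((-1) ^ below J k * x k * b))"
    by (simp add: koszul_dif_single ext_dif_term_def ext_mul_sum_right ext_mul_single)
  have sgn: "alt_sign (int m) (?s M c) = ?s M ((-1) ^ m * c)" for m M c
    by (simp add: alt_sign_def single_uminus)
  have sgn': "alt_sign (int m) (ext_mul_term M M' c d) = ext_mul_term M M' ((-1) ^ m * c) d" for m M M' c d
    by (simp add: alt_sign_def ext_mul_term_def single_uminus)
  show ?thesis
  proof (cases "I \<inter> J = {}")
    case True
    have "koszul_dif x (ext_mul (?s I a) (?s J b)) =
        (\<Sum>k\<in>I \<union> J. ?s (I \<union> J - {k}) ((-1) ^ below (I \<union> J) k * x k * ((-1) ^ shuffle_inv I J * a * b)))"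
      using True by (simp add: ext_mul_single ext_mul_term_def koszul_dif_single ext_dif_term_def)
    also have "\<dots> = (\<Sum>k\<in>I. ?s (I \<union> J - {k}) ((-1) ^ below (I \<union> J) k * x k * ((-1) ^ shuffle_inv I J * a * b))) +
        (\<Sum>k\<in>J. ?s (I \<union> J - {k}) ((-1) ^ below (I \<union> J) k * x k * ((-1) ^ shuffle_inv I J * a * b)))"
      by (rule sum.union_disjoint[OF fin True])
    also have "(\<Sum>k\<in>I. ?s (I \<union> J - {k}) ((-1) ^ below (I \<union> J) k * x k * ((-1) ^ shuffle_inv I J * a * b))) =
        ext_mul (koszul_dif x (?s I a)) (?s J b)"
      unfolding L
    proof (rule sum.cong[OF refl])
      fix k assume k: "k \<in> I"
      then have "(I - {k}) \<inter> J = {}" "(I - {k}) \<union> J = I \<union> J - {k}" using True by auto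
      moreover have "even (below (I \<union> J) k + shuffle_inv I J) = even (shuffle_inv (I - {k}) J + below I k)"
        using fin True k by (simp add: shuffle_inv_remove_left[OF fin k] below_Un) blast
      ultimately show "?s (I \<union> J - {k}) ((-1) ^ below (I \<union> J) k * x k * ((-1) ^ shuffle_inv I J * a * b)) =
          ext_mul_term (I - {k}) J ((-1) ^ below I k * x k * a) b"
        by (simp add: ext_mul_term_def sign_left)
    qed
    also have "(\<Sum>k\<in>J. ?s (I \<union> J - {k}) ((-1) ^ below (I \<union> J) k * x k * ((-1) ^ shuffle_inv I J * a * b))) =
        alt_sign (int (card I)) (ext_mul (?s I a) (koszul_dif x (?s J b)))"
      unfolding R alt_sign_sum
    proof (rule sum.cong[OF refl])
      fix k assume k: "k \<in> J"
      then have e: "I \<inter> (J - {k}) = {}" "I \<union> (J - {k}) = I \<union> J - {k}" "k \<notin> I" using True by auto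
      have "even (below (I \<union> J) k + shuffle_inv I J) = even (card I + shuffle_inv I (J - {k}) + below J k)"
        using fin True by (simp add: shuffle_inv_remove_right[OF fin k] below_Un card_below_above[OF fin(1) e(3)]) blast
      then show "?s (I \<union> J - {k}) ((-1) ^ below (I \<union> J) k * x k * ((-1) ^ shuffle_inv I J * a * b)) =
          alt_sign (int (card I)) (ext_mul_term I (J - {k}) a ((-1) ^ below J k * x k * b))"
        unfolding ext_mul_term_def using e by (simp add: sgn sign_right)
    qed
    finally show ?thesis .
  next
    case False
    have l: "ext_mul (?s I a) (?s J b) = 0" using False by (simp add: ext_mul_single ext_mul_term_def)
    show ?thesis
    proof (cases "\<exists>k. I \<inter> J = {k}")
      case True
      then obtain k where k: "I \<inter> J = {k}" by blast
      then have kIJ: "k \<in> I" "k \<in> J" by auto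
      have z1: "(I - {i}) \<inter> J \<noteq> {}" if "i \<in> I" "i \<noteq> k" for i using that kIJ by auto
      have z2: "I \<inter> (J - {i}) \<noteq> {}" if "i \<in> J" "i \<noteq> k" for i using that kIJ by auto
      have "ext_mul (koszul_dif x (?s I a)) (?s J b) = (\<Sum>i\<in>{k}. ext_mul_term (I - {i}) J ((-1) ^ below I i * x i * a) b)"
        unfolding L by (rule sum.mono_neutral_right) (use fin kIJ z1 in \<open>auto simp: ext_mul_term_def\<close>)
      moreover have "ext_mul (?s I a) (koszul_dif x (?s J b)) = (\<Sum>i\<in>{k}. ext_mul_term I (J - {i}) a ((-1) ^ below J i * x i * b))"
        unfolding R by (rule sum.mono_neutral_right) (use fin kIJ z2 in \<open>auto simp: ext_mul_term_def\<close>)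
      moreover have "(I - {k}) \<inter> J = {}" "I \<inter> (J - {k}) = {}" "(I - {k}) \<union> J = I \<union> J" "I \<union> (J - {k}) = I \<union> J"
        using k by auto
      moreover have "even (shuffle_inv (I - {k}) J + below I k) \<noteq>
          even (card I + shuffle_inv I (J - {k}) + below J k)"
        using shuffle_inv_remove_right[of "I - {k}" J k] shuffle_inv_remove_left[of I "J - {k}" k] fin kIJ
          card_below_above'[OF fin(1) kIJ(1)]
        by (simp add: below_remove above_remove) blast
      ultimately show ?thesis unfolding l
        by (simp add: ext_mul_term_def sgn sign_cancel flip: single_add)
    next
      case no: False
      have z1: "(I - {i}) \<inter> J \<noteq> {}" for i using no False by blast
      have z2: "I \<inter> (J - {i}) \<noteq> {}" for i using no False by blast
      show ?thesis unfolding l L R by (simp add: ext_mul_term_def z1 z2 alt_sign_sum)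
    qed
  qed
qed

text \<open>Split off \<open>t\<^sub>m\<close> for the least index \<open>m\<close> and apply the Leibniz rule.\<close>

lemma koszul_dif_dif_single: "finite I \<Longrightarrow> koszul_dif x (koszul_dif x (single I a)) = 0"
proof (induction "card I" arbitrary: I a rule: less_induct)
  case (less I)
  show ?case
  proof (cases "I = {}")
    case True
    then show ?thesis by (simp add: koszul_dif_single ext_dif_term_def)
  next
    case False
    define m where "m = Min I"
    have m: "m \<in> I" "\<And>j. j \<in> I \<Longrightarrow> \<not> j < m" using False less.prems by (auto simp: m_def)
    let ?t = "single {m} (1 :: 'a)" and ?v = "single (I - {m}) a"
    have fin: "finite (I - {m})" using less.prems by simp
    have "below (I - {m}) m = 0" unfolding below_def using m(2) less.prems by (auto simp: card_eq_0_iff)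
    then have I: "single I a = ext_mul ?t ?v"
      using m(1) by (simp add: ext_mul_single ext_mul_term_def shuffle_inv_single_left insert_absorb)
    have dt: "koszul_dif x ?t = single {} (x m)"
    proof -
      have "below {m} m = 0" by (auto simp: below_def card_eq_0_iff)
      then show ?thesis by (simp add: koszul_dif_single ext_dif_term_def)
    qed
    have IH: "koszul_dif x (koszul_dif x ?v) = 0"
      by (rule less.hyps[OF card_Diff1_less[OF less.prems m(1)] fin])
    have leib: "koszul_dif x (ext_mul (single J c) w) =
        ext_mul (koszul_dif x (single J c)) w + alt_sign (int (card J)) (ext_mul (single J c) (koszul_dif x w))"
      if "finite J" "\<And>K. K \<in> keys w \<Longrightarrow> finite K" for J c w
    proof (rule poly_mapping_single_induct[of _ w])
      fix K b assume "K \<in> keys w"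
      then show "koszul_dif x (ext_mul (single J c) (single K b)) =
          ext_mul (koszul_dif x (single J c)) (single K b) +
          alt_sign (int (card J)) (ext_mul (single J c) (koszul_dif x (single K b)))"
        by (intro koszul_dif_mul_single that)
    qed (simp_all add: ext_mul_add_right koszul_dif_add alt_sign_add)
    have fk: "finite K" if "K \<in> keys (koszul_dif x ?v)" for K
    proof -
      have "K \<in> (\<Union>i\<in>I - {m}. keys (single (I - {m} - {i}) ((-1) ^ below (I - {m}) i * x i * a)))"
        by (rule subsetD[OF keys_sum that[unfolded koszul_dif_single ext_dif_term_def]])
      then show ?thesis using fin by (auto split: if_splits)
    qed
    have fv: "finite K" if "K \<in> keys ?v" for K using that fin by (auto split: if_splits)
    have 1: "koszul_dif x (ext_mul ?t ?v) = ext_mul (single {} (x m)) ?v - ext_mul ?t (koszul_dif x ?v)"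
      using leib[of "{m}" ?v 1] fv by (simp add: dt alt_sign_def)
    have 2: "koszul_dif x (ext_mul (single {} (x m)) ?v) = ext_mul (single {} (x m)) (koszul_dif x ?v)"
      using leib[of "{}" ?v "x m"] fv by (simp add: alt_sign_def koszul_dif_single[of x "{}"] ext_dif_term_def)
    have 3: "koszul_dif x (ext_mul ?t (koszul_dif x ?v)) = ext_mul (single {} (x m)) (koszul_dif x ?v)"
      using leib[of "{m}" "koszul_dif x ?v" 1] fk by (simp add: dt IH alt_sign_def)
    show ?thesis unfolding I 1
      using koszul_dif_add[of x "ext_mul (single {} (x m)) ?v" "- ext_mul ?t (koszul_dif x ?v)"]
      by (simp add: koszul_dif_uminus 2 3)
  qed
qed

context graded_generators
begin

abbreviation dga_K :: "('k, nat set \<Rightarrow>\<^sub>0 'r) dga" where "dga_K \<equiv> koszul_complex scl gr n x"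

definition scal_K :: "'k \<Rightarrow> (nat set \<Rightarrow>\<^sub>0 'r)" where "scal_K c = single {} (scl c 1)"

definition K_carr :: "(nat set \<Rightarrow>\<^sub>0 'r) set" where
  "K_carr = {f. \<forall>I. \<not> I \<subseteq> {..<n} \<longrightarrow> lookup f I = 0}"

lemma K_comp_iff: "f \<in> acomp dga_K (i, j) \<longleftrightarrow> (\<forall>I. lookup f I \<noteq> 0 \<longrightarrow>
    I \<subseteq> {..<n} \<and> int (card I) = i \<and> lookup f I \<in> gr (j - i))"
  by (simp add: koszul_complex_def in_keys_iff Ball_def)

lemma K_comp_lookup:
  assumes "f \<in> acomp dga_K (i, j)" shows "lookup f I \<in> gr (j - i)"
proof (cases "lookup f I = 0")
  case False
  then show ?thesis using assms[unfolded K_comp_iff, THEN spec, of I] by simp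
qed (simp add: gr_zero)

lemma K_comp_support:
  assumes "f \<in> acomp dga_K (i, j)" "lookup f I \<noteq> 0"
  shows "I \<subseteq> {..<n}" "int (card I) = i"
  using assms(1)[unfolded K_comp_iff, THEN spec, of I] assms(2) by simp_all

lemma K_simps: "amul dga_K = ext_mul" "aone dga_K = single {} 1" "adif dga_K = koszul_dif x"
    "aaug dga_K = (\<lambda>f. aug (lookup f {}))"
  by (simp_all add: koszul_complex_def)

lemma K_comp_single: "I \<subseteq> {..<n} \<Longrightarrow> a \<in> gr j \<Longrightarrow>
    single I a \<in> acomp dga_K (int (card I), j + int (card I))"
  by (auto simp: K_comp_iff lookup_single when_def)

lemma K_comp_subgroup: "additive_subgroup (acomp dga_K p)"
proof -
  obtain i j where p: "p = (i, j)" by (cases p)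
  have "f - g \<in> acomp dga_K (i, j)" if "f \<in> acomp dga_K (i, j)" "g \<in> acomp dga_K (i, j)" for f g
    unfolding K_comp_iff
  proof (intro allI impI)
    fix I assume "lookup (f - g) I \<noteq> 0"
    then have "lookup f I \<noteq> 0 \<or> lookup g I \<noteq> 0" by (auto simp: lookup_minus)
    then have I: "I \<subseteq> {..<n} \<and> int (card I) = i"
      using K_comp_support[OF that(1), of I] K_comp_support[OF that(2), of I] by blast
    note K_comp_lookup[OF that(1), of I] K_comp_lookup[OF that(2), of I]
    then show "I \<subseteq> {..<n} \<and> int (card I) = i \<and> lookup (f - g) I \<in> gr (j - i)"
      using I by (simp add: lookup_minus gr_diff)
  qed
  moreover have "0 \<in> acomp dga_K (i, j)" by (simp add: K_comp_iff)
  ultimately show ?thesis unfolding p additive_subgroup_def by blast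
qed

lemma K_comp_independent: "independent_family (acomp dga_K)"
  unfolding independent_family_def
proof (intro allI impI ballI)
  fix S y p assume fin: "finite S" and y: "\<forall>p\<in>S. y p \<in> acomp dga_K p" and s: "(\<Sum>p\<in>S. y p) = 0" and p: "p \<in> S"
  show "y p = 0"
  proof (rule poly_mapping_eqI)
    fix I
    have yI: "lookup (y q) I = 0" if "q \<in> S" "fst q \<noteq> int (card I)" for q
    proof -
      have "y q \<in> acomp dga_K (fst q, snd q)" using y that(1) by simp
      then show ?thesis using that(2) K_comp_support(2) by metis
    qed
    have yg: "lookup (y q) I \<in> gr (snd q - fst q)" if "q \<in> S" for q
    proof -
      have "y q \<in> acomp dga_K (fst q, snd q)" using y that by simp
      then show ?thesis by (rule K_comp_lookup)
    qed
    show "lookup (y p) I = lookup 0 I"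
    proof (cases "fst p = int (card I)")
      case True
      let ?T = "{q \<in> S. fst q = int (card I)}"
      let ?z = "\<lambda>j. lookup (y (int (card I), j + int (card I))) I"
      let ?J = "(\<lambda>q. snd q - fst q) ` ?T"
      have eq: "(int (card I), snd q - fst q + int (card I)) = q" if "q \<in> ?T" for q
        using that by (simp add: prod_eq_iff)
      have inj: "inj_on (\<lambda>q. snd q - fst q) ?T" by (auto simp: inj_on_def prod_eq_iff)
      have "(\<Sum>j\<in>?J. ?z j) = (\<Sum>q\<in>?T. lookup (y q) I)"
        unfolding sum.reindex[OF inj] by (rule sum.cong[OF refl]) (simp only: o_def eq)
      also have "\<dots> = (\<Sum>q\<in>S. lookup (y q) I)"
        by (rule sum.mono_neutral_left) (use fin yI in auto)
      also have "\<dots> = 0" using s by (simp flip: lookup_sum)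
      finally have sum0: "(\<Sum>j\<in>?J. ?z j) = 0" .
      have zg: "?z j \<in> gr j" if jJ: "j \<in> ?J" for j
      proof -
        obtain q where q: "q \<in> ?T" "j = snd q - fst q" using jJ by blast
        then show "?z j \<in> gr j" using yg[of q] by (simp only: q(2) eq[OF q(1)]) simp
      qed
      have fJ: "finite ?J" using fin by simp
      have pT: "p \<in> ?T" using p True by simp
      have "?z (snd p - fst p) = 0"
        by (rule G.independentD[OF fJ zg sum0 imageI[OF pT]])
      then show ?thesis by (simp only: eq[OF pT] lookup_zero)
    qed (use yI p in simp)
  qed
qed

lemma K_carr_subgroup: "additive_subgroup K_carr"
  by (simp add: additive_subgroup_def K_carr_def lookup_minus)

lemma K_carr_single: "I \<subseteq> {..<n} \<Longrightarrow> single I a \<in> K_carr"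
  by (auto simp: K_carr_def lookup_single when_def)

lemma K_carr_induct [consumes 1, case_names zero add single]:
  assumes "f \<in> K_carr" "P 0" "\<And>f g. f \<in> K_carr \<Longrightarrow> g \<in> K_carr \<Longrightarrow> P f \<Longrightarrow> P g \<Longrightarrow> P (f + g)"
    "\<And>I a. I \<subseteq> {..<n} \<Longrightarrow> P (single I a)"
  shows "P f"
proof -
  have "f \<in> K_carr \<and> P f"
  proof (induction rule: poly_mapping_single_induct)
    case (single I a)
    then have "I \<subseteq> {..<n}" using assms(1) by (auto simp: K_carr_def in_keys_iff)
    then show ?case by (simp add: assms(4) K_carr_single)
  qed (use assms(2,3) additive_subgroup_closed[OF K_carr_subgroup] in auto)
  then show ?thesis by simp
qed

lemma K_carrier: "acarrier dga_K = K_carr"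
proof -
  interpret C: graded_family "acomp dga_K"
    by unfold_locales (rule K_comp_subgroup K_comp_independent)+
  have "f \<in> acarrier dga_K" if "f \<in> K_carr" for f
    using that
  proof (induction rule: K_carr_induct)
    case (single I a)
    have "a \<in> G.carr" by (simp add: G_carr)
    then show ?case
    proof (induction rule: G.carr_induct)
      case (homogeneous j a)
      show ?case by (rule C.comp_carr[OF K_comp_single[OF single homogeneous]])
    qed (simp_all add: C.carr_closed single_add)
  qed (simp_all add: C.carr_closed)
  moreover have "f \<in> K_carr" if "f \<in> acarrier dga_K" for f
    using that
  proof (induction rule: C.carr_induct)
    case (homogeneous p f)
    then show ?case by (cases p) (auto simp: K_comp_iff K_carr_def)
  qed (simp_all add: additive_subgroup_closed[OF K_carr_subgroup])
  ultimately show ?thesis by blast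
qed

lemma K_comp_carr: "f \<in> acomp dga_K p \<Longrightarrow> f \<in> K_carr"
  by (cases p) (auto simp: K_comp_iff K_carr_def)

lemma K_comp_induct [consumes 1, case_names zero add single]:
  assumes f: "f \<in> acomp dga_K (i, j)" and "P 0"
    and add: "\<And>f g. P f \<Longrightarrow> P g \<Longrightarrow> P (f + g)"
    and single: "\<And>I a. I \<subseteq> {..<n} \<Longrightarrow> int (card I) = i \<Longrightarrow> a \<in> gr (j - i) \<Longrightarrow> P (single I a)"
  shows "P f"
proof -
  have "P (sum (\<lambda>I. single I (lookup f I)) W)" if "finite W" "W \<subseteq> keys f" for W
    using that
  proof (induction W)
    case (insert I W)
    have "P (single I (lookup f I))"
      using insert f by (intro single) (auto simp: K_comp_iff in_keys_iff)
    then show ?case using insert by (simp add: add)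
  qed (simp add: assms)
  from this[of "keys f"] show ?thesis by (simp add: sum_single_lookup)
qed

lemma K_mul_comp:
  assumes f: "f \<in> acomp dga_K (i, j)" and g: "g \<in> acomp dga_K (i', j')"
  shows "ext_mul f g \<in> acomp dga_K (i + i', j + j')"
  using f
proof (induction rule: K_comp_induct)
  case (single I a)
  note I = single
  show ?case using g
  proof (induction rule: K_comp_induct)
    case (single J b)
    have fin: "finite I" "finite J" using I(1) single(1) finite_subset by blast+
    show ?case
    proof (cases "I \<inter> J = {}")
      case True
      have "(-1) ^ m * (a * b) \<in> gr (j - i + (j' - i'))" for m :: nat
      proof -
        have "a * b \<in> gr (j - i + (j' - i'))" using gr_mult I(3) single(3) by blast
        then show ?thesis using gr_diff[OF gr_zero] by (cases "even m") auto
      qed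
      then show ?thesis
        using True I single fin by (auto simp: ext_mul_single ext_mul_term_def K_comp_iff lookup_single when_def
            card_Un_disjoint algebra_simps)
    qed (simp add: ext_mul_single ext_mul_term_def additive_subgroup_zero[OF K_comp_subgroup])
  qed (simp_all add: additive_subgroup_closed[OF K_comp_subgroup] ext_mul_add_right)
qed (simp_all add: additive_subgroup_closed[OF K_comp_subgroup] ext_mul_add_left)

lemma K_dif_comp:
  assumes f: "f \<in> acomp dga_K (i, j)" shows "koszul_dif x f \<in> acomp dga_K (i - 1, j)"
  using f
proof (induction rule: K_comp_induct)
  case (single I a)
  have fin: "finite I" using single(1) finite_subset by blast
  have "single (I - {k}) ((-1) ^ below I k * x k * a) \<in> acomp dga_K (i - 1, j)" if k: "k \<in> I" for k
  proof -
    have "x k * a \<in> gr (1 + (j - i))" using gr_mult[OF x_deg single(3)] k single(1) by auto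
    then have "x k * a \<in> gr (j - (i - 1))" by (simp add: algebra_simps)
    then have "(-1) ^ below I k * x k * a \<in> gr (j - (i - 1))"
      using gr_diff[OF gr_zero, of "x k * a" "j - (i - 1)"] by (cases "even (below I k)") auto
    moreover have "int (card (I - {k})) = i - 1"
      using single(2) k fin card_Suc_Diff1[OF fin k] by linarith
    moreover have "I - {k} \<subseteq> {..<n}" using single(1) by auto
    ultimately show ?thesis by (simp add: K_comp_iff lookup_single when_def)
  qed
  then show ?case unfolding koszul_dif_single ext_dif_term_def
    by (rule additive_subgroup_sum[OF K_comp_subgroup])
qed (simp_all add: additive_subgroup_closed[OF K_comp_subgroup] koszul_dif_add)

lemma finite_index: "I \<subseteq> {..<n} \<Longrightarrow> finite I"
  by (rule finite_subset) auto

lemma K_mul_assoc: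
  assumes "f \<in> K_carr" "g \<in> K_carr" "h \<in> K_carr"
  shows "ext_mul (ext_mul f g) h = ext_mul f (ext_mul g h)"
  using assms(1)
proof (induction rule: K_carr_induct)
  case (single I a)
  note I = single
  show ?case using assms(2)
  proof (induction rule: K_carr_induct)
    case (single J b)
    note J = single
    show ?case using assms(3)
      by (induction rule: K_carr_induct) (simp_all add: ext_mul_add_right ext_mul_assoc_single finite_index I J)
  qed (simp_all add: ext_mul_add_right ext_mul_add_left)
qed (simp_all add: ext_mul_add_left)

lemma K_leibniz:
  assumes f: "f \<in> acomp dga_K (i, j)" and g: "g \<in> K_carr"
  shows "koszul_dif x (ext_mul f g) = ext_mul (koszul_dif x f) g + alt_sign i (ext_mul f (koszul_dif x g))"
  using f
proof (induction rule: K_comp_induct)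
  case (single I a)
  note I = single
  show ?case using g
  proof (induction rule: K_carr_induct)
    case (single J b)
    show ?case using koszul_dif_mul_single[of I J x a b] finite_index I(1) single I(2) by simp
  qed (simp_all add: ext_mul_add_right koszul_dif_add alt_sign_add)
qed (simp_all add: ext_mul_add_left koszul_dif_add alt_sign_add)

lemma K_dif_dif: "f \<in> K_carr \<Longrightarrow> koszul_dif x (koszul_dif x f) = 0"
  by (induction rule: K_carr_induct) (simp_all add: koszul_dif_add koszul_dif_dif_single finite_index)

lemma ext_mul_scal: "ext_mul (single {} c) f = Poly_Mapping.map ((*) c) f"
proof (induction f rule: poly_mapping_single_induct)
  case (add f g)
  have "Poly_Mapping.map ((*) c) (f + g) = Poly_Mapping.map ((*) c) f + Poly_Mapping.map ((*) c) g"
    by (rule poly_mapping_eqI) (simp add: map.rep_eq lookup_add when_def flip: distrib_left)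
  then show ?case using add by (simp add: ext_mul_add_right)
next
  case (single I a)
  have "shuffle_inv {} I = 0" by (simp add: shuffle_inv_def)
  then show ?case by (simp add: ext_mul_single ext_mul_term_def)
qed (rule poly_mapping_eqI, simp add: map.rep_eq)

lemma lookup_ext_mul_scal: "lookup (ext_mul (single {} c) f) I = c * lookup f I"
  by (simp add: ext_mul_scal map.rep_eq when_def)

lemma ext_mul_scal_right: "ext_mul f (single {} c) = ext_mul (single {} c) f"
proof (induction f rule: poly_mapping_single_induct)
  case (single I a)
  have "shuffle_inv {} I = 0" "shuffle_inv I {} = 0" by (simp_all add: shuffle_inv_def)
  then show ?case by (simp add: ext_mul_single ext_mul_term_def mult_ac)
qed (simp_all add: ext_mul_add_left ext_mul_add_right)

lemma lookup_ext_mul_empty: "lookup (ext_mul f g) {} = lookup f {} * lookup g {}"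
proof (induction f rule: poly_mapping_single_induct)
  case (single I a)
  show ?case
  proof (induction g rule: poly_mapping_single_induct)
    case (single J b)
    have "shuffle_inv {} {} = 0" by (simp add: shuffle_inv_def)
    then show ?case by (auto simp: ext_mul_single ext_mul_term_def lookup_single when_def)
  qed (simp_all add: ext_mul_add_right lookup_add algebra_simps)
qed (simp_all add: ext_mul_add_left lookup_add algebra_simps)

lemma lookup_koszul_dif_ideal: "f \<in> K_carr \<Longrightarrow> lookup (koszul_dif x f) J \<in> ideal_m"
proof (induction rule: K_carr_induct)
  case (single I a)
  have x: "(-1) ^ below I k * x k * a \<in> ideal_m" if "k \<in> I" for k
    using gr_ideal_m[of 1 "x k"] x_deg single that ideal_m_mult ideal_m_mult' by auto
  have "lookup (single (I - {k}) ((-1) ^ below I k * x k * a)) J \<in> ideal_m" if "k \<in> I" for k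
    using x[OF that] ideal_m_closed(1) by (simp add: lookup_single when_def)
  then have "(\<Sum>k\<in>I. lookup (single (I - {k}) ((-1) ^ below I k * x k * a)) J) \<in> ideal_m"
    unfolding span_ideal[symmetric] by (rule module.span_sum[OF module_times])
  then show ?case by (simp only: koszul_dif_single ext_dif_term_def lookup_sum)
qed (simp_all add: ideal_m_closed koszul_dif_add lookup_add)

lemma connected_dga_K: "connected_dga dga_K scal_K"
proof (unfold_locales; (unfold K_carrier K_simps)?)
  fix f p assume f: "f \<in> acomp dga_K p" and p: "p \<noteq> (0, 0)"
  obtain i j where ij: "p = (i, j)" by (cases p)
  show "aug (lookup f {}) = 0"
  proof (cases "lookup f {} = 0")
    case False
    then have "i = 0" "lookup f {} \<in> gr j" using f ij by (auto simp: K_comp_iff)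
    then show ?thesis using aug_homogeneous p ij by auto
  qed (simp add: aug_zero_iff ideal_m_closed)
next
  fix i j :: int assume ij: "i < 0 \<or> j < 0"
  have "f = 0" if f: "f \<in> acomp dga_K (i, j)" for f
  proof (rule poly_mapping_eqI, rule ccontr)
    fix I assume "lookup f I \<noteq> lookup 0 I"
    then have "lookup f I \<noteq> 0" by simp
    moreover from this have "int (card I) = i" "lookup f I \<in> gr (j - i)"
      using f by (auto simp: K_comp_iff)
    ultimately show False using ij gr_neg[of "j - i"] by force
  qed
  then show "acomp dga_K (i, j) = {0}" using additive_subgroup_zero[OF K_comp_subgroup] by blast
next
  fix c
  show "scal_K c \<in> acomp dga_K (0, 0)"
    using K_comp_single[of "{}" "scl c 1" 0] scl_one_gr by (simp add: scal_K_def)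
next
  fix c d
  show "ext_mul (scal_K c) (scal_K d) = scal_K (c * d)"
    by (simp add: scal_K_def ext_mul_single ext_mul_term_def shuffle_inv_def flip: scl_mult)
next
  fix f :: "nat set \<Rightarrow>\<^sub>0 'r"
  show "ext_mul (single {} 1) f = f"
    by (rule poly_mapping_eqI) (simp add: lookup_ext_mul_scal)
  then show "ext_mul f (single {} 1) = f" by (simp only: ext_mul_scal_right)
next
  fix f assume "f \<in> K_carr"
  then show "aug (lookup (koszul_dif x f) {}) = 0"
    by (simp add: aug_zero_iff lookup_koszul_dif_ideal)
qed (simp_all add: K_comp_subgroup K_comp_independent ext_mul_add_left ext_mul_add_right K_mul_assoc
    K_mul_comp koszul_dif_add K_dif_comp K_dif_dif K_leibniz lookup_add aug_plus lookup_ext_mul_empty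
    aug_times scal_K_def scale_left_distrib single_add aug_scl ext_mul_scal_right)

end

section \<open>The bar resolution over the Koszul complex\<close>

declare split_paired_All [simp del] split_paired_Ex [simp del]

context graded_generators
begin

text \<open>The scalar basis \<open>b t\<^sub>I\<close> of the Koszul complex is indexed by pairs \<open>(b, I)\<close>.\<close>

definition kmons :: "('r \<times> nat set) set" where
  "kmons = basis \<times> Pow {..<n}"

definition kmon :: "'r \<times> nat set \<Rightarrow> (nat set \<Rightarrow>\<^sub>0 'r)" where
  "kmon l = single (snd l) (fst l)"

definition mdeg :: "'r \<times> nat set \<Rightarrow> int \<times> int" where
  "mdeg l = (int (card (snd l)), bdeg (fst l) + int (card (snd l)))"

definition kco :: "(nat set \<Rightarrow>\<^sub>0 'r) \<Rightarrow> 'r \<times> nat set \<Rightarrow> 'k" where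
  "kco a l = rco (lookup a (snd l)) (fst l)"

lemma kco_add: "kco (a + b) l = kco a l + kco b l"
  by (simp add: kco_def lookup_add rco_add)

lemma kco_zero [simp]: "kco 0 l = 0"
  by (simp add: kco_def)

lemma kco_uminus: "kco (- a) l = - kco a l"
  using kco_add[of a "- a" l] by (simp add: eq_neg_iff_add_eq_0 add.commute)

lemma kco_diff: "kco (a - b) l = kco a l - kco b l"
  using kco_add[of a "- b" l] by (simp add: kco_uminus)

lemma kco_sum: "kco (sum f S) l = (\<Sum>x\<in>S. kco (f x) l)"
  by (induction S rule: infinite_finite_induct) (simp_all add: kco_add)

lemma kco_scal: "kco (ext_mul (scal_K c) a) l = c * kco a l"
  by (simp add: kco_def scal_K_def lookup_ext_mul_scal rco_scl flip: scl_mult)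

lemma kco_mono: "l \<in> kmons \<Longrightarrow> kco (kmon l) l' = (if l' = l then 1 else 0)"
  by (cases l; cases l') (auto simp: kmons_def kmon_def kco_def lookup_single when_def rco_basis)

lemma kco_support: "a \<in> K_carr \<Longrightarrow> kco a l \<noteq> 0 \<Longrightarrow> l \<in> kmons"
  using rco_support[of "lookup a (snd l)" "fst l"]
  by (cases l) (auto simp: kco_def kmons_def K_carr_def)

lemma kco_deg: "a \<in> acomp dga_K p \<Longrightarrow> kco a l \<noteq> 0 \<Longrightarrow> mdeg l = p"
proof -
  assume a: "a \<in> acomp dga_K p" and k: "kco a l \<noteq> 0"
  obtain i j where p: "p = (i, j)" by (cases p)
  have nz: "lookup a (snd l) \<noteq> 0" using k by (auto simp: kco_def)
  have "bdeg (fst l) = j - i"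
    using rco_homogeneous[OF K_comp_lookup] a k p by (auto simp: kco_def)
  moreover have "int (card (snd l)) = i" using K_comp_support(2)[of a i j] a p nz by simp
  ultimately show ?thesis by (simp add: mdeg_def p)
qed

lemma kco_finite: "finite {l. kco a l \<noteq> 0}"
proof (rule finite_subset)
  show "{l. kco a l \<noteq> 0} \<subseteq> (\<Union>I\<in>keys a. {b. rco (lookup a I) b \<noteq> 0} \<times> {I})"
  proof
    fix l assume l: "l \<in> {l. kco a l \<noteq> 0}"
    then have "lookup a (snd l) \<noteq> 0" by (auto simp: kco_def)
    then show "l \<in> (\<Union>I\<in>keys a. {b. rco (lookup a I) b \<noteq> 0} \<times> {I})"
      using l by (cases l) (auto simp: kco_def in_keys_iff)
  qed
qed (auto simp: rco_finite)

lemma mono_carr: "l \<in> kmons \<Longrightarrow> kmon l \<in> K_carr"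
  by (auto simp: kmons_def kmon_def intro: K_carr_single)

lemma mono_comp: "l \<in> kmons \<Longrightarrow> kmon l \<in> acomp dga_K (mdeg l)"
  unfolding kmon_def mdeg_def
  by (rule K_comp_single) (auto simp: kmons_def basis_gr)

lemma K_eq_zero: "(\<And>l. kco a l = 0) \<Longrightarrow> a = 0"
proof (rule poly_mapping_eqI)
  fix I assume z: "\<And>l. kco a l = 0"
  have "lookup a I = 0"
    by (rule rco_eq_zero) (use z[of "(_, I)"] in \<open>simp add: kco_def\<close>)
  then show "lookup a I = lookup 0 I" by simp
qed

lemma K_expand:
  assumes "finite S" "\<And>l. kco a l \<noteq> 0 \<Longrightarrow> l \<in> S" "S \<subseteq> kmons"
  shows "a = (\<Sum>l\<in>S. ext_mul (scal_K (kco a l)) (kmon l))"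
proof -
  let ?s = "\<Sum>l\<in>S. ext_mul (scal_K (kco a l)) (kmon l)"
  have "a - ?s = 0"
  proof (rule K_eq_zero)
    fix m
    have "kco ?s m = (\<Sum>l\<in>S. if l = m then kco a l else 0)"
      unfolding kco_sum kco_scal by (rule sum.cong) (use assms(3) in \<open>auto simp: kco_mono subset_iff\<close>)
    also have "\<dots> = kco a m" using assms(1) assms(2)[of m] by auto
    finally show "kco (a - ?s) m = 0" by (simp add: kco_diff)
  qed
  then show ?thesis by simp
qed

lemma aug_K_kco: "aaug dga_K a = kco a (1, {})"
  by (simp add: K_simps kco_def aug_rco)

lemma one_mono: "(1, {}) \<in> kmons" "kmon (1, {}) = single {} 1"
  by (simp_all add: kmons_def one_basis kmon_def)

lemma countable_monos: "countable kmons"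
  unfolding kmons_def by (intro countable_SIGMA countable_basis countable_finite) simp

lemma bar_data_K: obtains N lt ldeg co where "bar_data dga_K scal_K N lt ldeg co"
proof (rule bar_data_countable[OF connected_dga_K, of "kmons - {(1, {})}" kmon mdeg kco];
    (unfold K_carrier)?)
  show "countable (kmons - {(1, {})})" using countable_monos by simp
  fix a assume a: "a \<in> K_carr"
  let ?X = "{l \<in> kmons - {(1, {})}. kco a l \<noteq> 0}"
  show fin: "finite ?X" using kco_finite[of a] by (rule rev_finite_subset) auto
  have "a = (\<Sum>l\<in>insert (1, {}) ?X. ext_mul (scal_K (kco a l)) (kmon l))"
    by (rule K_expand) (use fin kco_support[OF a] one_mono in auto)
  also have "\<dots> = ext_mul (scal_K (kco a (1, {}))) (kmon (1, {})) + (\<Sum>l\<in>?X. ext_mul (scal_K (kco a l)) (kmon l))"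
    by (rule sum.insert) (use fin in auto)
  also have "ext_mul (scal_K (kco a (1, {}))) (kmon (1, {})) = scal_K (aaug dga_K a)"
    unfolding one_mono aug_K_kco scal_K_def by (simp add: ext_mul_single ext_mul_term_def shuffle_inv_def)
  finally show "a = scal_K (aaug dga_K a) + (\<Sum>l\<in>?X. amul dga_K (scal_K (kco a l)) (kmon l))"
    by (simp only: K_simps)
next
  fix l assume "l \<in> kmons - {(1, {})}"
  then show "aaug dga_K (kmon l) = 0" using kco_mono[of l "(1, {})"] by (auto simp: aug_K_kco)
next
  fix c l assume "l \<in> kmons - {(1, {})}"
  then show "kco (scal_K c) l = 0"
    using kco_scal[of c "kmon (1, {})" l] kco_mono[OF one_mono(1), of l]
    by (simp add: one_mono(2) scal_K_def ext_mul_single ext_mul_term_def shuffle_inv_def)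
qed (auto simp: mono_comp kco_add kco_scal kco_mono K_simps kco_deg intro: that)

end

lemma (in bar_data) aug_part_bar: "aug_part A bar = {f \<in> bcarr. \<forall>w. aaug A (lookup f w) = 0}"
proof (intro equalityI subsetI)
  interpret B: dg_module_over A scal bar by (rule bar_dg_module)
  fix f
  {
    assume "f \<in> aug_part A bar"
    then have "f \<in> bcarr \<and> (\<forall>w. aaug A (lookup f w) = 0)"
    proof (induction rule: B.aug_part_induct)
      case zero
      show ?case by (simp add: bcarr_closed)
    next
      case (diff f g)
      then show ?case by (simp add: bcarr_closed lookup_minus aug_diff bcarr_lookup)
    next
      case (act a f)
      then have "f \<in> bcarr" by (simp add: bar_simps)
      then show ?case using act by (simp add: bar_simps bact_carr lookup_bact aug_mul bcarr_lookup)
    qed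
    then show "f \<in> {f \<in> bcarr. \<forall>w. aaug A (lookup f w) = 0}" by simp
  next
    assume f: "f \<in> {f \<in> bcarr. \<forall>w. aaug A (lookup f w) = 0}"
    have "(\<Sum>w\<in>keys f. single w (lookup f w)) \<in> aug_part A bar"
    proof (rule additive_subgroup_sum[OF B.aug_part_subgroup])
      fix w assume "w \<in> keys f"
      then have w: "w \<in> words" "lookup f w \<in> acarrier A" "aaug A (lookup f w) = 0"
        using f by (auto simp: bcarr_def in_keys_iff)
      have "mact bar (lookup f w) (single w (aone A)) \<in> aug_part A bar"
        by (rule B.act_aug_part) (use w in \<open>simp_all add: bar_simps bcarr_single one_carrier\<close>)
      then show "single w (lookup f w) \<in> aug_part A bar"
        using w by (simp add: bar_simps bact_single mul_one)
    qed
    then show "f \<in> aug_part A bar" by (simp add: sum_single_lookup)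
  }
qed

text \<open>The coefficients of words are combinations of the monomials \<open>b t\<^sub>I\<close>, so a set of monomials selects a
  subgroup of the bar resolution.\<close>

locale koszul_bar = graded_generators scl gr n x +
  B: bar_data "koszul_complex scl gr n x" "graded_generators.scal_K scl" N lt ldeg co
  for scl :: "'k::field \<Rightarrow> 'r::comm_ring_1 \<Rightarrow> 'r" and gr n x N lt ldeg co
begin

lemma aug_part_iff: "f \<in> aug_part dga_K B.bar \<longleftrightarrow> f \<in> B.bcarr \<and> (\<forall>w. aaug dga_K (lookup f w) = 0)"
  by (simp add: B.aug_part_bar)

lemma bcarr_lookup_K: "f \<in> B.bcarr \<Longrightarrow> lookup f w \<in> K_carr"
  using B.bcarr_lookup by (simp add: K_carrier)

lemma lookup_bact_K: "a \<in> K_carr \<Longrightarrow> lookup (B.bact a f) w = ext_mul a (lookup f w)"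
  using B.lookup_bact[of a f w] by (simp add: K_carrier K_simps)

lemma bact_carr_K: "a \<in> K_carr \<Longrightarrow> f \<in> B.bcarr \<Longrightarrow> B.bact a f \<in> B.bcarr"
  using B.bact_carr[of a f] by (simp add: K_carrier)

definition span_part :: "('r \<times> nat set) set \<Rightarrow> (nat set \<Rightarrow>\<^sub>0 'r) set" where
  "span_part \<Gamma> = {a \<in> K_carr. \<forall>l. l \<notin> \<Gamma> \<longrightarrow> kco a l = 0}"

text \<open>If \<open>\<Gamma>\<close> spans an ideal, this is the product of the ideal with the module.\<close>

definition sub_part :: "('r \<times> nat set) set \<Rightarrow> (nat \<Rightarrow>\<^sub>0 (nat set \<Rightarrow>\<^sub>0 'r)) set" where
  "sub_part \<Gamma> = {f \<in> B.bcarr. \<forall>w. lookup f w \<in> span_part \<Gamma>}"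

lemma span_part_subgroup: "additive_subgroup (span_part \<Gamma>)"
  unfolding additive_subgroup_def span_part_def
  by (simp add: additive_subgroup_closed[OF K_carr_subgroup] kco_diff)

lemma sub_part_subgroup: "additive_subgroup (sub_part \<Gamma>)"
  unfolding additive_subgroup_def sub_part_def
  by (simp add: B.bcarr_closed lookup_minus additive_subgroup_closed[OF span_part_subgroup])

lemma span_part_mono: "\<Gamma> \<subseteq> \<Gamma>' \<Longrightarrow> a \<in> span_part \<Gamma> \<Longrightarrow> a \<in> span_part \<Gamma>'"
  unfolding span_part_def by auto

lemma sub_part_mono: "\<Gamma> \<subseteq> \<Gamma>' \<Longrightarrow> f \<in> sub_part \<Gamma> \<Longrightarrow> f \<in> sub_part \<Gamma>'"
  unfolding sub_part_def by (simp add: span_part_mono)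

lemma sub_part_carr: "f \<in> sub_part \<Gamma> \<Longrightarrow> f \<in> B.bcarr"
  by (simp add: sub_part_def)

lemma span_part_scal: "a \<in> span_part \<Gamma> \<Longrightarrow> ext_mul (scal_K c) a \<in> span_part \<Gamma>"
  using B.mul_carrier[OF B.scal_carrier, of a c] by (simp add: span_part_def kco_scal K_carrier K_simps)

lemma mono_span_part: "l \<in> \<Gamma> \<Longrightarrow> l \<in> kmons \<Longrightarrow> kmon l \<in> span_part \<Gamma>"
  by (auto simp: span_part_def mono_carr kco_mono)

lemma span_part_expand:
  assumes "a \<in> span_part \<Gamma>"
  shows "a = (\<Sum>l | kco a l \<noteq> 0. ext_mul (scal_K (kco a l)) (kmon l))"
  by (rule K_expand) (use assms kco_support in \<open>auto simp: kco_finite span_part_def\<close>)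

lemma ext_mul_carr: "a \<in> K_carr \<Longrightarrow> b \<in> K_carr \<Longrightarrow> ext_mul a b \<in> K_carr"
  using B.mul_carrier[of a b] by (simp add: K_carrier K_simps)

lemma scal_K_carr: "scal_K c \<in> K_carr"
  using B.scal_carrier[of c] by (simp add: K_carrier)

lemma split_aug:
  assumes "a \<in> K_carr"
  obtains a' where "a' \<in> K_carr" "aaug dga_K a' = 0" "a = scal_K (aaug dga_K a) + a'"
proof (rule that[of "a - scal_K (aaug dga_K a)"])
  show "a - scal_K (aaug dga_K a) \<in> K_carr"
    using additive_subgroup_diff[OF K_carr_subgroup assms scal_K_carr] .
  show "aaug dga_K (a - scal_K (aaug dga_K a)) = 0"
    using B.aug_diff[of a "scal_K (aaug dga_K a)"] assms scal_K_carr by (simp add: K_carrier B.aug_scal)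
qed simp

text \<open>The sets span ideals \<open>I\<close> and \<open>I'\<close> of \<open>K\<close> such that \<open>I'\<close> is closed under \<open>\<partial>\<close> and the augmentation
  ideal acts as zero on \<open>I/I'\<close>. So \<open>I/I'\<close> is a sum of copies of \<open>k\<close> indexed by \<open>\<Gamma> - \<Gamma>'\<close>.\<close>

definition ideal_pair :: "('r \<times> nat set) set \<Rightarrow> ('r \<times> nat set) set \<Rightarrow> bool" where
  "ideal_pair \<Gamma> \<Gamma>' \<longleftrightarrow> \<Gamma>' \<subseteq> \<Gamma> \<and> \<Gamma> \<subseteq> kmons \<and>
     (\<forall>l\<in>\<Gamma>. \<forall>l'\<in>kmons - {(1, {})}. ext_mul (kmon l) (kmon l') \<in> span_part \<Gamma>') \<and>
     (\<forall>l\<in>\<Gamma>'. koszul_dif x (kmon l) \<in> span_part \<Gamma>')"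

lemma ideal_pair_aug:
  assumes p: "ideal_pair \<Gamma> \<Gamma>'" and l: "l \<in> \<Gamma>" and a: "a \<in> K_carr" "aaug dga_K a = 0"
  shows "ext_mul (kmon l) a \<in> span_part \<Gamma>'"
proof -
  have lm: "kmon l \<in> K_carr" using p l by (auto simp: ideal_pair_def intro: mono_carr)
  have supp: "l' \<in> kmons - {(1, {})}" if "kco a l' \<noteq> 0" for l'
    using kco_support[OF a(1) that] that a(2) by (auto simp: aug_K_kco)
  have "a = (\<Sum>l' | kco a l' \<noteq> 0. ext_mul (scal_K (kco a l')) (kmon l'))"
    by (rule K_expand) (use supp in \<open>auto simp: kco_finite\<close>)
  then have "ext_mul (kmon l) a = ext_mul (kmon l) (\<Sum>l' | kco a l' \<noteq> 0. ext_mul (scal_K (kco a l')) (kmon l'))"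
    by (rule arg_cong)
  also have "\<dots> = (\<Sum>l' | kco a l' \<noteq> 0. ext_mul (kmon l) (ext_mul (scal_K (kco a l')) (kmon l')))"
    by (rule ext_mul_sum_right)
  also have "\<dots> \<in> span_part \<Gamma>'"
  proof (rule additive_subgroup_sum[OF span_part_subgroup])
    fix l' assume "l' \<in> {l'. kco a l' \<noteq> 0}"
    then have l': "l' \<in> kmons - {(1, {})}" by (intro supp) simp
    then have lc: "kmon l' \<in> K_carr" by (intro mono_carr) simp
    have "ext_mul (kmon l) (ext_mul (scal_K (kco a l')) (kmon l')) =
        ext_mul (scal_K (kco a l')) (ext_mul (kmon l) (kmon l'))"
      using K_mul_assoc[OF lm scal_K_carr lc] K_mul_assoc[OF scal_K_carr lm lc]
      by (simp add: scal_K_def ext_mul_scal_right[of "kmon l"])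
    moreover have "ext_mul (kmon l) (kmon l') \<in> span_part \<Gamma>'" using p l l' by (simp add: ideal_pair_def)
    ultimately show "ext_mul (kmon l) (ext_mul (scal_K (kco a l')) (kmon l')) \<in> span_part \<Gamma>'"
      by (simp add: span_part_scal)
  qed
  finally show ?thesis .
qed

lemma ideal_pair_mono_mul:
  assumes p: "ideal_pair \<Gamma> \<Gamma>'" and l: "l \<in> \<Gamma>" and a: "a \<in> K_carr" and T: "\<Gamma>' \<subseteq> \<Gamma>''" "l \<in> \<Gamma>''"
  shows "ext_mul (kmon l) a \<in> span_part \<Gamma>''"
proof -
  have lm: "l \<in> kmons" using p l by (auto simp: ideal_pair_def)
  obtain a' where a': "a' \<in> K_carr" "aaug dga_K a' = 0" "a = scal_K (aaug dga_K a) + a'"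
    using split_aug[OF a] .
  have "ext_mul (kmon l) (scal_K (aaug dga_K a)) \<in> span_part \<Gamma>''"
    using span_part_scal[OF mono_span_part[OF T(2) lm]] by (simp add: scal_K_def ext_mul_scal_right[of "kmon l"])
  moreover have "ext_mul (kmon l) a' \<in> span_part \<Gamma>''"
    by (rule span_part_mono[OF T(1) ideal_pair_aug[OF p l a'(1,2)]])
  ultimately have "ext_mul (kmon l) (scal_K (aaug dga_K a) + a') \<in> span_part \<Gamma>''"
    unfolding ext_mul_add_right by (rule additive_subgroup_add[OF span_part_subgroup])
  then show ?thesis by (simp only: a'(3)[symmetric])
qed

lemma ideal_pair_mul:
  assumes p: "ideal_pair \<Gamma> \<Gamma>'" and c: "c \<in> span_part \<Gamma>'" and a: "a \<in> K_carr"
  shows "ext_mul c a \<in> span_part \<Gamma>'"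
proof -
  have G: "\<Gamma>' \<subseteq> \<Gamma>" "\<Gamma> \<subseteq> kmons" using p by (simp_all add: ideal_pair_def)
  have "ext_mul c a = ext_mul (\<Sum>l | kco c l \<noteq> 0. ext_mul (scal_K (kco c l)) (kmon l)) a"
    using span_part_expand[OF c] by (rule arg_cong)
  also have "\<dots> = (\<Sum>l | kco c l \<noteq> 0. ext_mul (ext_mul (scal_K (kco c l)) (kmon l)) a)"
    by (rule ext_mul_sum_left)
  also have "\<dots> \<in> span_part \<Gamma>'"
  proof (rule additive_subgroup_sum[OF span_part_subgroup])
    fix l assume "l \<in> {l. kco c l \<noteq> 0}"
    then have l: "l \<in> \<Gamma>'" using c by (auto simp: span_part_def)
    then have "ext_mul (kmon l) a \<in> span_part \<Gamma>'"
      by (intro ideal_pair_mono_mul[OF p _ a]) (use G in auto)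
    then show "ext_mul (ext_mul (scal_K (kco c l)) (kmon l)) a \<in> span_part \<Gamma>'"
      using K_mul_assoc[OF scal_K_carr mono_carr a, of l "kco c l"] l G
      by (auto simp: span_part_scal)
  qed
  finally show ?thesis .
qed

lemma twist_mono: "l \<in> kmons \<Longrightarrow> twist (acomp dga_K) (kmon l) = alt_sign (int (card (snd l))) (kmon l)"
  using B.A.twist_homogeneous[OF mono_comp] by (simp add: mdeg_def)

lemma span_part_alt_sign: "a \<in> span_part \<Gamma> \<Longrightarrow> alt_sign i a \<in> span_part \<Gamma>"
  by (rule additive_subgroup_alt_sign[OF span_part_subgroup])

lemma span_part_linear:
  assumes c: "c \<in> span_part \<Gamma>" and G: "\<Gamma> \<subseteq> kmons"
    and add: "\<And>a b. a \<in> K_carr \<Longrightarrow> b \<in> K_carr \<Longrightarrow> h (a + b) = h a + h b"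
    and scal: "\<And>c a. a \<in> K_carr \<Longrightarrow> h (ext_mul (scal_K c) a) = ext_mul (scal_K c) (h a)"
    and kmon: "\<And>l. l \<in> \<Gamma> \<Longrightarrow> h (kmon l) \<in> span_part \<Gamma>'"
  shows "h c \<in> span_part \<Gamma>'"
proof -
  have h0: "h 0 = 0" using add[of 0 0] additive_subgroup_zero[OF K_carr_subgroup] by simp
  have "(\<Sum>l\<in>S. ext_mul (scal_K (kco c l)) (kmon l)) \<in> K_carr \<and>
      h (\<Sum>l\<in>S. ext_mul (scal_K (kco c l)) (kmon l)) \<in> span_part \<Gamma>'"
    if "finite S" "S \<subseteq> {l. kco c l \<noteq> 0}" for S
    using that
  proof (induction S)
    case empty
    then show ?case
      by (simp add: h0 additive_subgroup_zero[OF span_part_subgroup] additive_subgroup_zero[OF K_carr_subgroup])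
  next
    case (insert l S)
    then have l: "l \<in> \<Gamma>" using c by (auto simp: span_part_def)
    then have lc: "kmon l \<in> K_carr" by (intro mono_carr subsetD[OF G])
    have 1: "ext_mul (scal_K (kco c l)) (kmon l) \<in> K_carr" by (rule ext_mul_carr[OF scal_K_carr lc])
    have 2: "h (ext_mul (scal_K (kco c l)) (kmon l)) \<in> span_part \<Gamma>'"
      unfolding scal[OF lc] by (rule span_part_scal[OF assms(5)[OF l]])
    show ?case using insert 1 2
      by (simp add: add additive_subgroup_add[OF span_part_subgroup] additive_subgroup_add[OF K_carr_subgroup])
  qed
  from this[OF kco_finite subset_refl] show ?thesis by (simp only: span_part_expand[OF c, symmetric])
qed

lemma ideal_pair_dif:
  assumes p: "ideal_pair \<Gamma> \<Gamma>'" and f: "f \<in> sub_part \<Gamma>'"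
  shows "B.bdif f \<in> sub_part \<Gamma>'"
proof -
  have G: "\<Gamma>' \<subseteq> \<Gamma>" "\<Gamma>' \<subseteq> kmons" using p by (auto simp: ideal_pair_def)
  have fc: "f \<in> B.bcarr" using f by (rule sub_part_carr)
  have "lookup (B.bdif f) v \<in> span_part \<Gamma>'" for v
    unfolding B.bdif_def lookup_sum
  proof (rule additive_subgroup_sum[OF span_part_subgroup])
    fix w
    let ?a = "lookup f w"
    have a: "?a \<in> span_part \<Gamma>'" "?a \<in> K_carr" using f by (auto simp: sub_part_def span_part_def)
    have "koszul_dif x ?a \<in> span_part \<Gamma>'"
    proof (rule span_part_linear[OF a(1) G(2)])
      fix c b assume "b \<in> K_carr"
      then show "koszul_dif x (ext_mul (scal_K c) b) = ext_mul (scal_K c) (koszul_dif x b)"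
        using K_leibniz[of "scal_K c" 0 0 b] B.scal_comp[of c] B.adif_scal[of c]
        by (simp add: K_simps alt_sign_def)
    qed (use p in \<open>auto simp: koszul_dif_add ideal_pair_def\<close>)
    then have 1: "lookup (single w (adif dga_K ?a)) v \<in> span_part \<Gamma>'"
      using additive_subgroup_zero[OF span_part_subgroup]
      by (cases "w = v") (simp_all add: lookup_single when_def K_simps)
    have tc: "twist (acomp dga_K) ?a \<in> K_carr" using B.A.twist_carr[of ?a] a(2) by (simp add: K_carrier)
    have "twist (acomp dga_K) ?a \<in> span_part \<Gamma>'"
    proof (rule span_part_linear[OF a(1) G(2)])
      fix a b assume "a \<in> K_carr" "b \<in> K_carr"
      then show "twist (acomp dga_K) (a + b) = twist (acomp dga_K) a + twist (acomp dga_K) b"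
        using B.A.twist_add[of a b] by (simp add: K_carrier)
    next
      fix c b assume "b \<in> K_carr"
      then show "twist (acomp dga_K) (ext_mul (scal_K c) b) = ext_mul (scal_K c) (twist (acomp dga_K) b)"
        using B.twist_mul[of "scal_K c" b] scal_K_carr by (simp add: K_simps K_carrier B.twist_scal)
    next
      fix l assume l: "l \<in> \<Gamma>'"
      then have "l \<in> kmons" using G by auto
      then show "twist (acomp dga_K) (kmon l) \<in> span_part \<Gamma>'"
        using span_part_alt_sign[OF mono_span_part[OF l]] by (simp add: twist_mono)
    qed
    then have "ext_mul (twist (acomp dga_K) ?a) (lookup (B.bdw w) v) \<in> span_part \<Gamma>'"
      by (rule ideal_pair_mul[OF p _ bcarr_lookup_K[OF B.bdw_carr]])
    then have 2: "lookup (B.bact (twist (acomp dga_K) ?a) (B.bdw w)) v \<in> span_part \<Gamma>'"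
      by (simp add: lookup_bact_K[OF tc])
    show "lookup (single w (adif dga_K ?a) + B.bact (twist (acomp dga_K) ?a) (B.bdw w)) v
        \<in> span_part \<Gamma>'"
      unfolding lookup_add by (rule additive_subgroup_add[OF span_part_subgroup 1 2])
  qed
  then show ?thesis using B.bdif_carr[OF fc] by (simp add: sub_part_def)
qed

text \<open>The coordinate at \<open>l\<close> of the coefficient of each word, as a combination of words over the scalars.\<close>

definition coeff_vec :: "'r \<times> nat set \<Rightarrow> (nat \<Rightarrow>\<^sub>0 (nat set \<Rightarrow>\<^sub>0 'r)) \<Rightarrow> (nat \<Rightarrow>\<^sub>0 (nat set \<Rightarrow>\<^sub>0 'r))" where
  "coeff_vec l f = Poly_Mapping.map (\<lambda>a. scal_K (kco a l)) f"

lemma lookup_coeff_vec: "lookup (coeff_vec l f) w = scal_K (kco (lookup f w) l)"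
  by (simp add: coeff_vec_def map.rep_eq when_def)

lemma coeff_vec_carr: "f \<in> B.bcarr \<Longrightarrow> coeff_vec l f \<in> B.bcarr"
  by (simp add: B.bcarr_def lookup_coeff_vec B.scal_carrier)

lemma coeff_vec_comp:
  assumes f: "f \<in> B.bcomp p" shows "coeff_vec l f \<in> B.bcomp (p - mdeg l)"
proof -
  have "scal_K (kco (lookup f w) l) \<in> acomp dga_K (p - mdeg l - B.wdeg w)" for w
  proof (cases "kco (lookup f w) l = 0")
    case True
    then show ?thesis by (simp add: B.A.comp_zero)
  next
    case False
    have "lookup f w \<in> acomp dga_K (p - B.wdeg w)" using f by (simp add: B.bcomp_def)
    then have "mdeg l = p - B.wdeg w" using False by (rule kco_deg)
    then have "p - mdeg l - B.wdeg w = (0, 0)" by (simp add: zero_prod_def[symmetric])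
    then show ?thesis using B.scal_comp by metis
  qed
  then show ?thesis using f by (simp add: B.bcomp_def lookup_coeff_vec)
qed

lemma aaug_coeff_vec: "aaug dga_K (lookup (coeff_vec l f) w) = kco (lookup f w) l"
  unfolding lookup_coeff_vec by (rule B.aug_scal)

lemma bact_alt_sign:
  "a \<in> K_carr \<Longrightarrow> f \<in> B.bcarr \<Longrightarrow> B.bact (alt_sign i a) f = alt_sign i (B.bact a f)"
  using B.bact_uminus_left[of a f] by (simp add: alt_sign_def K_carrier)

lemma bdif_alt_sign: "f \<in> B.bcarr \<Longrightarrow> B.bdif (alt_sign i f) = alt_sign i (B.bdif f)"
  by (simp add: alt_sign_def B.bdif_uminus)

lemma lookup_alt_sign: "lookup (alt_sign i f) w = alt_sign i (lookup f w)"
  by (simp add: alt_sign_def)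

lemma kco_alt_sign: "kco (alt_sign i a) l = alt_sign i (kco a l)"
  by (simp add: alt_sign_def kco_uminus)

lemma bdif_bact_mono:
  assumes l: "l \<in> kmons" and v: "v \<in> B.bcarr"
  shows "B.bdif (B.bact (kmon l) v) = B.bact (koszul_dif x (kmon l)) v +
    alt_sign (int (card (snd l))) (B.bact (kmon l) (B.bdif v))"
  using B.bdif_bact[of "kmon l" v] mono_carr[OF l] v
  by (simp add: K_carrier K_simps twist_mono[OF l] bact_alt_sign B.bdif_carr)

lemma kco_mono_mul:
  assumes p: "ideal_pair \<Gamma> \<Gamma>'" and l: "l \<in> \<Gamma>" and l0: "l0 \<notin> \<Gamma>'" and q: "q \<in> K_carr"
  shows "kco (ext_mul (kmon l) q) l0 = (if l0 = l then aaug dga_K q else 0)"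
proof -
  have lm: "l \<in> kmons" using p l by (auto simp: ideal_pair_def)
  obtain q' where q': "q' \<in> K_carr" "aaug dga_K q' = 0" "q = scal_K (aaug dga_K q) + q'"
    using split_aug[OF q] .
  have "kco (ext_mul (kmon l) q') l0 = 0"
    using ideal_pair_aug[OF p l q'(1,2)] l0 by (simp add: span_part_def)
  moreover have "kco (ext_mul (kmon l) (scal_K (aaug dga_K q))) l0 = aaug dga_K q * kco (kmon l) l0"
    using kco_scal[of "aaug dga_K q" "kmon l" l0] by (simp add: scal_K_def ext_mul_scal_right[of "kmon l"])
  ultimately have "kco (ext_mul (kmon l) (scal_K (aaug dga_K q) + q')) l0 = aaug dga_K q * kco (kmon l) l0"
    by (simp add: ext_mul_add_right kco_add)
  then show ?thesis unfolding q'(3)[symmetric] by (simp add: kco_mono[OF lm])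
qed

definition support :: "('r \<times> nat set) set \<Rightarrow> (nat \<Rightarrow>\<^sub>0 (nat set \<Rightarrow>\<^sub>0 'r)) \<Rightarrow> ('r \<times> nat set) set" where
  "support D f = {l \<in> D. \<exists>w\<in>keys f. kco (lookup f w) l \<noteq> 0}"

lemma support_finite: "finite (support D f)"
proof (rule finite_subset)
  show "support D f \<subseteq> (\<Union>w\<in>keys f. {l. kco (lookup f w) l \<noteq> 0})"
    by (auto simp: support_def)
qed (simp add: kco_finite)

lemma support_zero: "l \<in> D \<Longrightarrow> l \<notin> support D f \<Longrightarrow> kco (lookup f w) l = 0"
  by (cases "w \<in> keys f") (auto simp: support_def in_keys_iff)

text \<open>Only the monomials outside \<open>\<Gamma>'\<close> of the coefficients matter; collecting the terms of each
  monomial gives its coefficient vector.\<close>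

lemma leading_part:
  assumes p: "ideal_pair \<Gamma> \<Gamma>'" and f: "f \<in> sub_part \<Gamma>"
  shows "f - (\<Sum>l\<in>support (\<Gamma> - \<Gamma>') f. B.bact (kmon l) (coeff_vec l f)) \<in> sub_part \<Gamma>'"
proof -
  let ?S = "support (\<Gamma> - \<Gamma>') f" and ?s = "\<Sum>l\<in>support (\<Gamma> - \<Gamma>') f. B.bact (kmon l) (coeff_vec l f)"
  have fc: "f \<in> B.bcarr" by (rule sub_part_carr[OF f])
  have S: "l \<in> kmons" "l \<in> \<Gamma>" if "l \<in> ?S" for l
    using that p by (auto simp: support_def ideal_pair_def)
  have sc: "?s \<in> B.bcarr"
    by (rule additive_subgroup_sum[OF B.bcarr_subgroup bact_carr_K[OF mono_carr[OF S(1)] coeff_vec_carr[OF fc]]])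
  have "kco (lookup (f - ?s) w) l0 = 0" if l0: "l0 \<notin> \<Gamma>'" for w l0
  proof -
    have "kco (lookup ?s w) l0 = (\<Sum>l\<in>?S. if l = l0 then kco (lookup f w) l else 0)"
      unfolding lookup_sum kco_sum
    proof (rule sum.cong[OF refl])
      fix l assume l: "l \<in> ?S"
      have "kco (ext_mul (kmon l) (lookup (coeff_vec l f) w)) l0 =
          (if l0 = l then aaug dga_K (lookup (coeff_vec l f) w) else 0)"
        by (rule kco_mono_mul[OF p S(2)[OF l] l0 bcarr_lookup_K[OF coeff_vec_carr[OF fc]]])
      then show "kco (lookup (B.bact (kmon l) (coeff_vec l f)) w) l0 =
          (if l = l0 then kco (lookup f w) l else 0)"
        using lookup_bact_K[OF mono_carr[OF S(1)[OF l]]] by (auto simp: aaug_coeff_vec)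
    qed
    also have "\<dots> = (if l0 \<in> ?S then kco (lookup f w) l0 else 0)"
      using support_finite by simp
    also have "\<dots> = kco (lookup f w) l0"
    proof (cases "l0 \<in> \<Gamma>")
      case True
      then show ?thesis using support_zero[of l0 "\<Gamma> - \<Gamma>'" f w] l0 by auto
    next
      case False
      then have "kco (lookup f w) l0 = 0" using f by (simp add: sub_part_def span_part_def)
      then show ?thesis by simp
    qed
    finally show ?thesis by (simp add: lookup_minus kco_diff)
  qed
  then show ?thesis
    using B.bcarr_closed(2)[OF fc sc] bcarr_lookup_K[OF B.bcarr_closed(2)[OF fc sc]]
    by (simp add: sub_part_def span_part_def)
qed

lemma bdif_sum: "(\<And>l. l \<in> S \<Longrightarrow> g l \<in> B.bcarr) \<Longrightarrow> B.bdif (sum g S) = (\<Sum>l\<in>S. B.bdif (g l))"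
proof (induction S rule: infinite_finite_induct)
  case (insert l S)
  then show ?case by (simp add: B.bdif_add additive_subgroup_sum[OF B.bcarr_subgroup])
qed auto

text \<open>A coordinate of the differential: the first sum comes from the differential of the
  monomials, the other term from the differential of the words.\<close>

lemma kco_bdif:
  assumes p: "ideal_pair \<Gamma> \<Gamma>'" and f: "f \<in> sub_part \<Gamma>" and l0: "l0 \<in> \<Gamma> - \<Gamma>'"
  shows "kco (lookup (B.bdif f) w) l0 =
    (\<Sum>l\<in>support (\<Gamma> - \<Gamma>') f. kco (koszul_dif x (kmon l)) l0 * kco (lookup f w) l) +
    alt_sign (int (card (snd l0))) (aaug dga_K (lookup (B.bdif (coeff_vec l0 f)) w))"
proof -
  let ?S = "support (\<Gamma> - \<Gamma>') f" and ?g = "\<lambda>l. B.bact (kmon l) (coeff_vec l f)"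
  let ?q = "\<lambda>l. lookup (B.bdif (coeff_vec l f)) w"
  have fc: "f \<in> B.bcarr" by (rule sub_part_carr[OF f])
  have S: "l \<in> kmons" "l \<in> \<Gamma>" if "l \<in> ?S" for l
    using that p by (auto simp: support_def ideal_pair_def)
  have gc: "?g l \<in> B.bcarr" if "l \<in> ?S" for l
    by (rule bact_carr_K[OF mono_carr[OF S(1)[OF that]] coeff_vec_carr[OF fc]])
  have sc: "sum ?g ?S \<in> B.bcarr" by (rule additive_subgroup_sum[OF B.bcarr_subgroup gc])
  have "B.bdif (f - sum ?g ?S) \<in> sub_part \<Gamma>'" by (rule ideal_pair_dif[OF p leading_part[OF p f]])
  then have "kco (lookup (B.bdif (f - sum ?g ?S)) w) l0 = 0"
    using l0 by (simp add: sub_part_def span_part_def)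
  then have "kco (lookup (B.bdif f) w) l0 = kco (lookup (B.bdif (sum ?g ?S)) w) l0"
    using B.bdif_diff[OF fc sc] by (simp add: lookup_minus kco_diff)
  also have "\<dots> = (\<Sum>l\<in>?S. kco (lookup (B.bdif (?g l)) w) l0)"
    using bdif_sum[of ?S ?g] gc by (simp add: lookup_sum kco_sum)
  also have "\<dots> = (\<Sum>l\<in>?S. kco (koszul_dif x (kmon l)) l0 * kco (lookup f w) l +
      (if l = l0 then alt_sign (int (card (snd l0))) (aaug dga_K (?q l0)) else 0))"
  proof (rule sum.cong[OF refl])
    fix l assume l: "l \<in> ?S"
    note lm = mono_carr[OF S(1)[OF l]] and vc = coeff_vec_carr[OF fc, of l]
    have dc: "koszul_dif x (kmon l) \<in> K_carr"
      using B.adif_carrier[of "kmon l"] lm by (simp add: K_carrier K_simps)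
    have "kco (ext_mul (koszul_dif x (kmon l)) (scal_K (kco (lookup f w) l))) l0 =
        kco (koszul_dif x (kmon l)) l0 * kco (lookup f w) l"
      using kco_scal[of "kco (lookup f w) l" "koszul_dif x (kmon l)" l0]
      by (simp add: scal_K_def ext_mul_scal_right[of "koszul_dif x (kmon l)"])
    moreover have "kco (ext_mul (kmon l) (?q l)) l0 = (if l0 = l then aaug dga_K (?q l) else 0)"
      by (rule kco_mono_mul[OF p S(2)[OF l] _ bcarr_lookup_K[OF B.bdif_carr[OF vc]]]) (use l0 in simp)
    ultimately show "kco (lookup (B.bdif (?g l)) w) l0 =
        kco (koszul_dif x (kmon l)) l0 * kco (lookup f w) l +
        (if l = l0 then alt_sign (int (card (snd l0))) (aaug dga_K (?q l0)) else 0)"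
      by (simp add: bdif_bact_mono[OF S(1)[OF l] vc] lookup_add kco_add lookup_alt_sign kco_alt_sign
          lookup_bact_K[OF dc] lookup_bact_K[OF lm]) (auto simp: lookup_coeff_vec)
  qed
  also have "\<dots> = (\<Sum>l\<in>?S. kco (koszul_dif x (kmon l)) l0 * kco (lookup f w) l) +
      (if l0 \<in> ?S then alt_sign (int (card (snd l0))) (aaug dga_K (?q l0)) else 0)"
    using support_finite by (simp add: sum.distrib)
  also have "(if l0 \<in> ?S then alt_sign (int (card (snd l0))) (aaug dga_K (?q l0)) else 0) =
      alt_sign (int (card (snd l0))) (aaug dga_K (?q l0))"
  proof (cases "l0 \<in> ?S")
    case False
    have "coeff_vec l0 f = 0"
      by (rule poly_mapping_eqI) (simp add: lookup_coeff_vec support_zero[OF l0 False])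
    then show ?thesis using False by simp
  qed simp
  finally show ?thesis .
qed

definition dif_into :: "('r \<times> nat set) set \<Rightarrow> ('r \<times> nat set) set \<Rightarrow> bool" where
  "dif_into \<Gamma> \<Gamma>' \<longleftrightarrow> (\<forall>l\<in>\<Gamma>. koszul_dif x (kmon l) \<in> span_part \<Gamma>')"

text \<open>If \<open>\<partial> u\<close> is the coefficient vector \<open>v\<close> of the monomial \<open>l\<close> up to the augmentation part, then \<open>\<partial>(\<plusminus> l u)\<close> is
  \<open>l v\<close> modulo the part of \<open>\<Gamma>'\<close>: the products of \<open>l\<close> with the augmentation ideal and \<open>\<partial> l\<close> lie there.\<close>

lemma remove_leading:
  assumes p: "ideal_pair \<Gamma> \<Gamma>'" and d: "dif_into \<Gamma> \<Gamma>'"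
    and f: "f \<in> sub_part \<Gamma>" "f \<in> B.bcomp (i, j)"
    and u: "\<And>l. l \<in> \<Gamma> - \<Gamma>' \<Longrightarrow> \<exists>u\<in>B.bcomp ((i, j) - mdeg l + (1, 0)). coeff_vec l f - B.bdif u \<in> aug_part dga_K B.bar"
  shows "\<exists>g\<in>sub_part \<Gamma> \<inter> B.bcomp (i + 1, j). f - B.bdif g \<in> sub_part \<Gamma>'"
proof -
  let ?S = "support (\<Gamma> - \<Gamma>') f" and ?s = "\<lambda>l. int (card (snd l))"
  have G: "\<Gamma>' \<subseteq> \<Gamma>" "\<Gamma> \<subseteq> kmons" using p by (simp_all add: ideal_pair_def)
  have fc: "f \<in> B.bcarr" by (rule sub_part_carr[OF f(1)])
  have S: "l \<in> \<Gamma> - \<Gamma>'" "l \<in> \<Gamma>" "l \<in> kmons" if "l \<in> ?S" for l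
    using that G by (auto simp: support_def)
  define u where "u l = (SOME u. u \<in> B.bcomp ((i, j) - mdeg l + (1, 0)) \<and> coeff_vec l f - B.bdif u \<in> aug_part dga_K B.bar)" for l
  have uu: "u l \<in> B.bcomp ((i, j) - mdeg l + (1, 0)) \<and> coeff_vec l f - B.bdif (u l) \<in> aug_part dga_K B.bar"
    if "l \<in> ?S" for l
    unfolding u_def by (rule someI_ex) (use assms(5)[OF S(1)[OF that]] in \<open>simp add: Bex_def\<close>)
  have uc: "u l \<in> B.bcarr" if "l \<in> ?S" for l by (rule B.bcomp_carr[OF conjunct1[OF uu[OF that]]])
  define h where "h l = alt_sign (?s l) (B.bact (kmon l) (u l))" for l
  have bk: "B.bact (kmon l) (u l) \<in> B.bcarr" if "l \<in> ?S" for l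
    by (rule bact_carr_K[OF mono_carr[OF S(3)[OF that]] uc[OF that]])
  have hc: "h l \<in> B.bcarr" if "l \<in> ?S" for l
    unfolding h_def by (rule additive_subgroup_alt_sign[OF B.bcarr_subgroup bk[OF that]])
  have h_sub: "h l \<in> sub_part \<Gamma>" if l: "l \<in> ?S" for l
  proof -
    have "lookup (B.bact (kmon l) (u l)) w \<in> span_part \<Gamma>" for w
      unfolding lookup_bact_K[OF mono_carr[OF S(3)[OF l]]]
      by (rule ideal_pair_mono_mul[OF p S(2)[OF l] bcarr_lookup_K[OF uc[OF l]] G(1) S(2)[OF l]])
    then have "B.bact (kmon l) (u l) \<in> sub_part \<Gamma>" using bk[OF l] by (simp add: sub_part_def)
    then show ?thesis unfolding h_def by (rule additive_subgroup_alt_sign[OF sub_part_subgroup])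
  qed
  have h_comp: "h l \<in> B.bcomp (i + 1, j)" if l: "l \<in> ?S" for l
  proof -
    have "B.bact (kmon l) (u l) \<in> B.bcomp (mdeg l + ((i, j) - mdeg l + (1, 0)))"
      by (rule B.bact_comp[OF mono_comp[OF S(3)[OF l]] conjunct1[OF uu[OF l]]])
    moreover have "mdeg l + ((i, j) - mdeg l + (1, 0)) = (i + 1, j)" by (simp add: prod_eq_iff)
    ultimately have "B.bact (kmon l) (u l) \<in> B.bcomp (i + 1, j)" by simp
    then show ?thesis unfolding h_def by (rule additive_subgroup_alt_sign[OF B.bcomp_subgroup])
  qed
  have step: "B.bact (kmon l) (coeff_vec l f) - B.bdif (h l) \<in> sub_part \<Gamma>'" if l: "l \<in> ?S" for l
  proof -
    note lm = mono_carr[OF S(3)[OF l]]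
    have dk: "koszul_dif x (kmon l) \<in> span_part \<Gamma>'" using d S(2)[OF l] by (simp add: dif_into_def)
    then have dc: "koszul_dif x (kmon l) \<in> K_carr" by (simp add: span_part_def)
    have duc: "B.bdif (u l) \<in> B.bcarr" by (rule B.bdif_carr[OF uc[OF l]])
    have "lookup (B.bact (koszul_dif x (kmon l)) (u l)) w \<in> span_part \<Gamma>'" for w
      unfolding lookup_bact_K[OF dc] by (rule ideal_pair_mul[OF p dk bcarr_lookup_K[OF uc[OF l]]])
    then have 1: "B.bact (koszul_dif x (kmon l)) (u l) \<in> sub_part \<Gamma>'"
      using bact_carr_K[OF dc uc[OF l]] by (simp add: sub_part_def)
    let ?e = "coeff_vec l f - B.bdif (u l)"
    have e: "?e \<in> B.bcarr" "aaug dga_K (lookup ?e w) = 0" for w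
      using conjunct2[OF uu[OF l]] by (simp_all add: aug_part_iff)
    have "lookup (B.bact (kmon l) ?e) w \<in> span_part \<Gamma>'" for w
      unfolding lookup_bact_K[OF lm] by (rule ideal_pair_aug[OF p S(2)[OF l] bcarr_lookup_K[OF e(1)] e(2)])
    then have 2: "B.bact (kmon l) ?e \<in> sub_part \<Gamma>'"
      using bact_carr_K[OF lm e(1)] by (simp add: sub_part_def)
    have "B.bact (kmon l) (coeff_vec l f) = B.bact (kmon l) ?e + B.bact (kmon l) (B.bdif (u l))"
      using B.bact_add[of "kmon l" ?e "B.bdif (u l)"] lm e(1) duc by (simp add: K_carrier)
    moreover have "B.bdif (h l) = alt_sign (?s l) (B.bact (koszul_dif x (kmon l)) (u l)) + B.bact (kmon l) (B.bdif (u l))"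
      unfolding h_def bdif_alt_sign[OF bk[OF l]] bdif_bact_mono[OF S(3)[OF l] uc[OF l]]
      by (simp add: alt_sign_add)
    ultimately have "B.bact (kmon l) (coeff_vec l f) - B.bdif (h l) =
        B.bact (kmon l) ?e - alt_sign (?s l) (B.bact (koszul_dif x (kmon l)) (u l))"
      by simp
    also have "\<dots> \<in> sub_part \<Gamma>'"
      by (rule additive_subgroup_diff[OF sub_part_subgroup 2 additive_subgroup_alt_sign[OF sub_part_subgroup 1]])
    finally show ?thesis .
  qed
  have "f - B.bdif (sum h ?S) = (f - (\<Sum>l\<in>?S. B.bact (kmon l) (coeff_vec l f))) +
      (\<Sum>l\<in>?S. B.bact (kmon l) (coeff_vec l f) - B.bdif (h l))"
    using bdif_sum[of ?S h] hc by (simp add: sum_subtractf)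
  also have "\<dots> \<in> sub_part \<Gamma>'"
    by (rule additive_subgroup_add[OF sub_part_subgroup leading_part[OF p f(1)]
        additive_subgroup_sum[OF sub_part_subgroup step]])
  finally have "f - B.bdif (sum h ?S) \<in> sub_part \<Gamma>'" .
  moreover have "sum h ?S \<in> sub_part \<Gamma>" by (rule additive_subgroup_sum[OF sub_part_subgroup h_sub])
  moreover have "sum h ?S \<in> B.bcomp (i + 1, j)" by (rule additive_subgroup_sum[OF B.bcomp_subgroup h_comp])
  ultimately show ?thesis by blast
qed

abbreviation tor_zero_K :: "int \<Rightarrow> int \<Rightarrow> bool" where "tor_zero_K i j \<equiv> tor_zero dga_K B.bar i j"

lemma tor_zero_K_iff: "tor_zero_K i j \<longleftrightarrow> (\<forall>f\<in>B.bcomp (i, j). B.bdif f \<in> aug_part dga_K B.bar \<longrightarrow>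
     (\<exists>g\<in>B.bcomp (i + 1, j). f - B.bdif g \<in> aug_part dga_K B.bar))"
  by (simp add: tor_zero_def B.bar_simps)

text \<open>The homology of the quotient of the parts of \<open>\<Gamma>\<close> and \<open>\<Gamma>'\<close> is a sum of shifted copies of
  \<open>Tor\<close>, one for each monomial in \<open>\<Gamma> - \<Gamma>'\<close>.\<close>

lemma quotient_exact:
  assumes p: "ideal_pair \<Gamma> \<Gamma>'" and d: "dif_into \<Gamma> \<Gamma>'"
    and f: "f \<in> sub_part \<Gamma>" "f \<in> B.bcomp (i, j)" "B.bdif f \<in> sub_part \<Gamma>'"
    and t: "\<And>l. l \<in> \<Gamma> - \<Gamma>' \<Longrightarrow> tor_zero_K (i - fst (mdeg l)) (j - snd (mdeg l))"
  shows "\<exists>g\<in>sub_part \<Gamma> \<inter> B.bcomp (i + 1, j). f - B.bdif g \<in> sub_part \<Gamma>'"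
proof (rule remove_leading[OF p d f(1,2)])
  fix l assume l: "l \<in> \<Gamma> - \<Gamma>'"
  have fc: "f \<in> B.bcarr" by (rule sub_part_carr[OF f(1)])
  have "aaug dga_K (lookup (B.bdif (coeff_vec l f)) w) = 0" for w
  proof -
    have "kco (koszul_dif x (kmon l')) l = 0" if "l' \<in> support (\<Gamma> - \<Gamma>') f" for l'
      using that d l by (simp add: support_def dif_into_def span_part_def)
    then have "(\<Sum>l'\<in>support (\<Gamma> - \<Gamma>') f. kco (koszul_dif x (kmon l')) l * kco (lookup f w) l') = 0"
      by (intro sum.neutral) simp
    moreover have "kco (lookup (B.bdif f) w) l = 0"
      using f(3) l by (simp add: sub_part_def span_part_def)
    ultimately have "alt_sign (int (card (snd l))) (aaug dga_K (lookup (B.bdif (coeff_vec l f)) w)) = 0"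
      using kco_bdif[OF p f(1) l, of w] by simp
    then show ?thesis by (metis alt_sign_twice alt_sign_zero)
  qed
  then have "B.bdif (coeff_vec l f) \<in> aug_part dga_K B.bar"
    by (simp add: aug_part_iff B.bdif_carr coeff_vec_carr[OF fc])
  moreover have "coeff_vec l f \<in> B.bcomp (i - fst (mdeg l), j - snd (mdeg l))"
    using coeff_vec_comp[OF f(2), of l] by (metis diff_Pair prod.collapse)
  ultimately obtain u where u: "u \<in> B.bcomp (i - fst (mdeg l) + 1, j - snd (mdeg l))"
      "coeff_vec l f - B.bdif u \<in> aug_part dga_K B.bar"
    using t[OF l] unfolding tor_zero_K_iff by metis
  moreover have "(i - fst (mdeg l) + 1, j - snd (mdeg l)) = (i, j) - mdeg l + (1, 0)"
    by (simp add: prod_eq_iff)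
  ultimately show "\<exists>u\<in>B.bcomp ((i, j) - mdeg l + (1, 0)). coeff_vec l f - B.bdif u \<in> aug_part dga_K B.bar"
    by metis
qed

end

section \<open>Two filtrations of the Koszul complex\<close>

lemma solve_sign:
  fixes a c :: "'k::comm_ring_1"
  assumes "(-1) ^ p * c + alt_sign (int q) a = 0"
  shows "c = alt_sign (int (1 + p + q)) a"
  using assms by (cases "even p"; cases "even q"; auto simp: alt_sign_def add_eq_0_iff)

context koszul_bar
begin

lemma koszul_dif_mono_carr: "l \<in> kmons \<Longrightarrow> koszul_dif x (kmon l) \<in> K_carr"
  using B.adif_carrier[of "kmon l"] mono_carr[of l] by (simp add: K_carrier K_simps)

lemma koszul_dif_mono_comp: "l \<in> kmons \<Longrightarrow> koszul_dif x (kmon l) \<in> acomp dga_K (fst (mdeg l) - 1, snd (mdeg l))"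
  using B.adif_comp'[OF mono_comp[of l]] by (simp add: K_simps)

text \<open>The ideals \<open>\<mm>K + K\<^sub>\<ge>\<^sub>p\<close> (with \<open>K\<^sub>\<ge>\<^sub>p\<close> in homological degree at least \<open>p\<close>), whose successive quotients
  are the exterior powers over the residue field; the last one is \<open>\<mm>K\<close>.\<close>

definition ext_filt :: "nat \<Rightarrow> ('r \<times> nat set) set" where
  "ext_filt p = {l \<in> kmons. fst l \<noteq> 1 \<or> p \<le> card (snd l)}"

lemma ext_filt_dif: "l \<in> kmons \<Longrightarrow> koszul_dif x (kmon l) \<in> span_part (ext_filt p)"
proof -
  assume l: "l \<in> kmons"
  have "kco (koszul_dif x (kmon l)) l0 = 0" if "l0 \<notin> ext_filt p" for l0
  proof (cases "l0 \<in> kmons")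
    case True
    then have "fst l0 = 1" using that by (auto simp: ext_filt_def)
    moreover have "aug (lookup (koszul_dif x (kmon l)) (snd l0)) = 0"
      using lookup_koszul_dif_ideal[OF mono_carr[OF l]] by (simp add: aug_zero_iff)
    ultimately show ?thesis by (simp add: kco_def aug_rco)
  next
    case False
    then show ?thesis using kco_support[OF koszul_dif_mono_carr[OF l]] by blast
  qed
  then show ?thesis using koszul_dif_mono_carr[OF l] by (simp add: span_part_def)
qed

lemma ext_filt_ideal_pair: "ideal_pair (ext_filt p) (ext_filt (Suc p))"
  unfolding ideal_pair_def
proof (intro conjI ballI)
  show "ext_filt (Suc p) \<subseteq> ext_filt p" "ext_filt p \<subseteq> kmons" by (auto simp: ext_filt_def)
  show "koszul_dif x (kmon l) \<in> span_part (ext_filt (Suc p))" if "l \<in> ext_filt (Suc p)" for l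
    by (rule ext_filt_dif) (use that in \<open>simp add: ext_filt_def\<close>)
  fix l l' assume l: "l \<in> ext_filt p" and l': "l' \<in> kmons - {(1, {})}"
  have lm: "l \<in> kmons" "l' \<in> kmons" using l l' by (auto simp: ext_filt_def)
  have car: "ext_mul (kmon l) (kmon l') \<in> K_carr" by (rule ext_mul_carr[OF mono_carr[OF lm(1)] mono_carr[OF lm(2)]])
  have "kco (ext_mul (kmon l) (kmon l')) l0 = 0" if l0: "l0 \<notin> ext_filt (Suc p)" for l0
  proof (rule ccontr)
    assume nz: "kco (ext_mul (kmon l) (kmon l')) l0 \<noteq> 0"
    then have "l0 \<in> kmons" by (rule kco_support[OF car])
    then have l01: "fst l0 = 1" "card (snd l0) < Suc p" using l0 by (auto simp: ext_filt_def)
    obtain b I b' J where bI: "l = (b, I)" "l' = (b', J)" by (cases l, cases l')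
    have fin: "finite I" "finite J" using lm bI finite_index by (auto simp: kmons_def)
    have "lookup (ext_mul (kmon l) (kmon l')) (snd l0) \<noteq> 0" using nz by (auto simp: kco_def)
    then have IJ: "I \<inter> J = {}" "snd l0 = I \<union> J"
      by (auto simp: bI kmon_def ext_mul_single ext_mul_term_def lookup_single when_def split: if_splits)
    have "aug (lookup (ext_mul (kmon l) (kmon l')) (snd l0)) \<noteq> 0"
      using nz l01(1) by (simp add: kco_def aug_rco)
    then have "aug b \<noteq> 0" "aug b' \<noteq> 0"
      using IJ by (auto simp: bI kmon_def ext_mul_single ext_mul_term_def aug_times)
    then have "b = 1" "b' = 1" using lm bI aug_basis by (auto simp: kmons_def split: if_splits)
    then have "p \<le> card I" "J \<noteq> {}" using l l' bI by (auto simp: ext_filt_def)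
    then have "Suc p \<le> card (I \<union> J)" using card_Un_disjoint[OF fin IJ(1)] fin card_gt_0_iff[of J] by simp
    then show False using l01(2) IJ(2) by simp
  qed
  then show "ext_mul (kmon l) (kmon l') \<in> span_part (ext_filt (Suc p))" using car by (simp add: span_part_def)
qed

lemma ext_filt_deg: "l \<in> ext_filt p - ext_filt (Suc p) \<Longrightarrow> mdeg l = (int p, int p)"
  using one_basis(2) by (auto simp: ext_filt_def mdeg_def not_less_eq_eq)

lemma sub_part_ext_filt_0: "sub_part (ext_filt 0) = B.bcarr"
proof -
  have "span_part (ext_filt 0) = K_carr" using kco_support by (auto simp: span_part_def ext_filt_def)
  then show ?thesis using bcarr_lookup_K by (auto simp: sub_part_def)
qed

lemma sub_part_ext_filt_1: "sub_part (ext_filt 1) = aug_part dga_K B.bar"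
proof -
  have "a \<in> span_part (ext_filt 1) \<longleftrightarrow> aaug dga_K a = 0" if a: "a \<in> K_carr" for a
  proof -
    have "kco a l = 0" if "l \<notin> ext_filt 1" "aaug dga_K a = 0" for l
    proof (rule ccontr)
      assume nz: "kco a l \<noteq> 0"
      then have lm: "l \<in> kmons" by (rule kco_support[OF a])
      then have "finite (snd l)" using finite_index by (auto simp: kmons_def)
      then have "l = (1, {})" using that(1) lm by (cases l) (auto simp: ext_filt_def not_le)
      then show False using nz that(2) by (simp add: aug_K_kco)
    qed
    moreover have "(1, {}) \<notin> ext_filt 1" by (simp add: ext_filt_def)
    ultimately show ?thesis using a by (auto simp: span_part_def aug_K_kco)
  qed
  then show ?thesis using bcarr_lookup_K by (auto simp: sub_part_def aug_part_iff)
qed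

text \<open>The step from \<open>p\<close> to \<open>p + 1\<close> removes monomials of the single bidegree \<open>(p, p)\<close> only.\<close>

lemma ext_filt_chain:
  assumes "p \<le> q" "f \<in> sub_part (ext_filt p)" "f \<in> B.bcomp (i, j)" "B.bdif f \<in> sub_part (ext_filt q)"
    and "\<And>r. p \<le> r \<Longrightarrow> tor_zero_K (i - int r) (j - int r)"
  shows "\<exists>g\<in>sub_part (ext_filt p) \<inter> B.bcomp (i + 1, j). f - B.bdif g \<in> sub_part (ext_filt q)"
  using assms
proof (induction p arbitrary: f rule: inc_induct)
  case base
  have "0 \<in> sub_part (ext_filt q) \<inter> B.bcomp (i + 1, j)"
    by (rule IntI[OF additive_subgroup_zero[OF sub_part_subgroup] additive_subgroup_zero[OF B.bcomp_subgroup]])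
  then show ?case using base(1) by (intro bexI[of _ 0]) simp_all
next
  case (step p)
  have "ext_filt q \<subseteq> ext_filt (Suc p)" using step(2) by (auto simp: ext_filt_def)
  then have "B.bdif f \<in> sub_part (ext_filt (Suc p))" by (rule sub_part_mono[OF _ step(6)])
  moreover have "dif_into (ext_filt p) (ext_filt (Suc p))"
    unfolding dif_into_def using ext_filt_dif by (auto simp: ext_filt_def)
  moreover have "tor_zero_K (i - fst (mdeg l)) (j - snd (mdeg l))" if "l \<in> ext_filt p - ext_filt (Suc p)" for l
    using step(7)[of p] ext_filt_deg[OF that] by simp
  ultimately obtain g where g: "g \<in> sub_part (ext_filt p)" "g \<in> B.bcomp (i + 1, j)" "f - B.bdif g \<in> sub_part (ext_filt (Suc p))"
    using quotient_exact[OF ext_filt_ideal_pair _ step(4,5)] by blast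
  note gc = sub_part_carr[OF g(1)] and fc = sub_part_carr[OF step(4)]
  have dg: "B.bdif g \<in> B.bcomp (i, j)" using B.bdif_comp[OF g(2)] by simp
  have c1: "f - B.bdif g \<in> B.bcomp (i, j)" by (rule additive_subgroup_diff[OF B.bcomp_subgroup step(5) dg])
  have "B.bdif (f - B.bdif g) = B.bdif f"
    using fc gc by (simp add: B.bdif_diff B.bdif_carr B.bdif_bdif)
  then have "B.bdif (f - B.bdif g) \<in> sub_part (ext_filt q)" using step(6) by simp
  from step(3)[OF g(3) c1 this] obtain h where h: "h \<in> sub_part (ext_filt (Suc p))" "h \<in> B.bcomp (i + 1, j)"
      "f - B.bdif g - B.bdif h \<in> sub_part (ext_filt q)"
    using step(7) by (auto dest: Suc_leD)
  have "ext_filt (Suc p) \<subseteq> ext_filt p" by (auto simp: ext_filt_def)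
  then have hp: "h \<in> sub_part (ext_filt p)" by (rule sub_part_mono[OF _ h(1)])
  note e = h(3)[unfolded diff_diff_eq, folded B.bdif_add[OF gc sub_part_carr[OF h(1)]]]
  show ?case
    by (intro bexI[of _ "g + h"] IntI e additive_subgroup_add[OF sub_part_subgroup g(1) hp]
        additive_subgroup_add[OF B.bcomp_subgroup g(2) h(2)])
qed

text \<open>For fixed \<open>b\<close> the ideals spanned by these sets interpolate between the parts of internal degree at
  least \<open>b\<close> (for \<open>a = b + 1\<close>, since the homological degree of a monomial is at most its internal degree)
  and greater than \<open>b\<close> (for \<open>a = 0\<close>).\<close>

definition deg_filt :: "nat \<Rightarrow> nat \<Rightarrow> ('r \<times> nat set) set" where
  "deg_filt b a = {l \<in> kmons. int b < snd (mdeg l) \<or> (snd (mdeg l) = int b \<and> card (snd l) < a)}"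

lemma mono_internal_pos: "l \<in> kmons - {(1, {})} \<Longrightarrow> 0 < snd (mdeg l)"
proof -
  assume l: "l \<in> kmons - {(1, {})}"
  then have b: "fst l \<in> basis" "finite (snd l)" using finite_index by (auto simp: kmons_def)
  show "0 < snd (mdeg l)"
  proof (cases "snd l = {}")
    case True
    then have "fst l \<noteq> 1" using l by (cases l) auto
    then show ?thesis using basis_nonneg[OF b(1)] basis_zero_deg[OF b(1)] True by (force simp: mdeg_def)
  next
    case False
    then show ?thesis using basis_nonneg[OF b(1)] b(2) card_gt_0_iff[of "snd l"] by (simp add: mdeg_def)
  qed
qed

lemma card_le_internal: "l \<in> kmons \<Longrightarrow> int (card (snd l)) \<le> snd (mdeg l)"
  using basis_nonneg[of "fst l"] by (auto simp: kmons_def mdeg_def)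

lemma span_part_degree:
  assumes "a \<in> acomp dga_K q" "\<And>l. l \<in> kmons \<Longrightarrow> mdeg l = q \<Longrightarrow> l \<in> \<Gamma>"
  shows "a \<in> span_part \<Gamma>"
proof -
  have "kco a l = 0" if "l \<notin> \<Gamma>" for l
    using that assms(2) kco_deg[OF assms(1)] kco_support[OF K_comp_carr[OF assms(1)]] by blast
  then show ?thesis using K_comp_carr[OF assms(1)] by (simp add: span_part_def)
qed

lemma deg_filt_ideal_pair:
  assumes "a \<le> a'" shows "ideal_pair (deg_filt b a') (deg_filt b a)"
  unfolding ideal_pair_def
proof (intro conjI ballI)
  show "deg_filt b a \<subseteq> deg_filt b a'" "deg_filt b a' \<subseteq> kmons" using assms by (auto simp: deg_filt_def)
  fix l assume l: "l \<in> deg_filt b a"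
  then have lm: "l \<in> kmons" by (simp add: deg_filt_def)
  show "koszul_dif x (kmon l) \<in> span_part (deg_filt b a)"
    by (rule span_part_degree[OF koszul_dif_mono_comp[OF lm]]) (use l in \<open>auto simp: deg_filt_def mdeg_def\<close>)
next
  fix l l' assume l: "l \<in> deg_filt b a'" and l': "l' \<in> kmons - {(1, {})}"
  then have lm: "l \<in> kmons" "l' \<in> kmons" "int b \<le> snd (mdeg l)" by (auto simp: deg_filt_def)
  have "ext_mul (kmon l) (kmon l') \<in> acomp dga_K (mdeg l + mdeg l')"
    using B.mul_comp'[OF mono_comp[OF lm(1)] mono_comp[OF lm(2)]] by (simp add: K_simps)
  then show "ext_mul (kmon l) (kmon l') \<in> span_part (deg_filt b a)"
    by (rule span_part_degree) (use lm mono_internal_pos[OF l'] in \<open>auto simp: deg_filt_def\<close>)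
qed

lemma deg_filt_dif_into: "dif_into (deg_filt b (Suc a)) (deg_filt b a)"
  unfolding dif_into_def
proof
  fix l assume l: "l \<in> deg_filt b (Suc a)"
  then have lm: "l \<in> kmons" by (simp add: deg_filt_def)
  show "koszul_dif x (kmon l) \<in> span_part (deg_filt b a)"
    by (rule span_part_degree[OF koszul_dif_mono_comp[OF lm]]) (use l in \<open>auto simp: deg_filt_def mdeg_def\<close>)
qed

lemma deg_filt_zero: "deg_filt b 0 = deg_filt (Suc b) (Suc (Suc b))"
  using card_le_internal by (force simp: deg_filt_def)

lemma deg_filt_ext_filt: "deg_filt 0 0 = ext_filt 1"
proof -
  have "l \<in> ext_filt 1 \<longleftrightarrow> l \<noteq> (1, {})" if "l \<in> kmons" for l
  proof -
    have "finite (snd l)" using that finite_index by (auto simp: kmons_def)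
    then show ?thesis using that by (cases l) (auto simp: ext_filt_def Suc_le_eq card_gt_0_iff)
  qed
  moreover have "mdeg (1, {}) = (0, 0)" by (simp add: mdeg_def one_basis)
  ultimately show ?thesis using mono_internal_pos by (force simp: deg_filt_def ext_filt_def)
qed

text \<open>Words have nonnegative internal degree, so the internal degree of an element bounds those of its
  coefficients.\<close>

lemma deg_filt_vanish:
  assumes f: "f \<in> sub_part (deg_filt q 0)" "f \<in> B.bcomp (i, j)" and j: "j \<le> int q"
  shows "f = 0"
proof (rule poly_mapping_eqI)
  fix w
  have "lookup f w = 0"
  proof (cases "w \<in> B.words")
    case True
    have a: "lookup f w \<in> acomp dga_K ((i, j) - B.wdeg w)" using f(2) by (simp add: B.bcomp_def)
    show ?thesis
    proof (rule K_eq_zero, rule ccontr)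
      fix l assume nz: "kco (lookup f w) l \<noteq> 0"
      then have "mdeg l = (i, j) - B.wdeg w" by (rule kco_deg[OF a])
      then have "snd (mdeg l) \<le> j" using B.wdeg_nonneg[OF True] by simp
      moreover have "l \<in> deg_filt q 0" using nz f(1) by (auto simp: sub_part_def span_part_def)
      ultimately show False using j by (simp add: deg_filt_def)
    qed
  qed (use f(2) in \<open>simp add: B.bcomp_def\<close>)
  then show "lookup f w = lookup 0 w" by simp
qed

text \<open>This is where the minimality of the generators enters: as the \<open>x\<^sub>k\<close> are linearly
  independent, the coordinate of a boundary at \<open>x\<^sub>k t\<^sub>I\<^sub>-\<^sub>{\<^sub>k\<^sub>}\<close> detects \<open>t\<^sub>I\<close>.\<close>

lemma kco_dif_top:
  assumes I: "I \<subseteq> {..<n}" "k \<in> I" and l: "l \<in> kmons" "snd (mdeg l) = int (card I)"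
  shows "kco (koszul_dif x (kmon l)) (x k, I - {k}) = (if l = (1, I) then (-1) ^ below I k else 0)"
proof -
  have k: "k < n" using I by auto
  have fin: "finite I" by (rule finite_index[OF I(1)])
  show ?thesis
  proof (cases "fst (mdeg l) = int (card I)")
    case False
    then have "l \<noteq> (1, I)" by (auto simp: mdeg_def)
    moreover have "kco (koszul_dif x (kmon l)) (x k, I - {k}) = 0"
    proof (rule ccontr)
      assume "kco (koszul_dif x (kmon l)) (x k, I - {k}) \<noteq> 0"
      then have "mdeg (x k, I - {k}) = (fst (mdeg l) - 1, snd (mdeg l))"
        by (rule kco_deg[OF koszul_dif_mono_comp[OF l(1)]])
      then show False using False card_Suc_Diff1[OF fin I(2)] by (simp add: mdeg_def)
    qed
    ultimately show ?thesis by simp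
  next
    case True
    obtain b J where bJ: "l = (b, J)" by (cases l)
    then have "b \<in> basis" "bdeg b = 0" using True l by (auto simp: mdeg_def kmons_def)
    then have b: "b = 1" by (rule basis_zero_deg)
    have J: "J \<subseteq> {..<n}" "finite J" using l(1) bJ finite_index by (auto simp: kmons_def)
    have sgn: "rco ((-1) ^ m * r) c = (-1) ^ m * rco r c" for m r c
    proof -
      have "rco (- r) c = - rco r c" using rco_add[of r "- r" c] by (simp add: eq_neg_iff_add_eq_0 add.commute)
      then show ?thesis by (cases "even m") simp_all
    qed
    have rsum: "rco (\<Sum>i\<in>S. g i) c = (\<Sum>i\<in>S. rco (g i) c)" for g :: "nat \<Rightarrow> 'r" and S c
      by (induction S rule: infinite_finite_induct) (simp_all add: rco_add)
    have "kco (koszul_dif x (kmon l)) (x k, I - {k}) =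
        (\<Sum>i\<in>J. rco (lookup (single (J - {i}) ((-1) ^ below J i * x i)) (I - {k})) (x k))"
      by (simp add: bJ b kmon_def kco_def koszul_dif_single ext_dif_term_def lookup_sum rsum)
    also have "\<dots> = (\<Sum>i\<in>J. if i = k then (if J = I then (-1) ^ below I k else 0) else 0)"
    proof (rule sum.cong[OF refl])
      fix i assume i: "i \<in> J"
      have "x k = x i \<longleftrightarrow> k = i" using inj_on_eq_iff[OF inj_x, of k i] k subsetD[OF J(1) i] by simp
      moreover have "J - {k} = I - {k} \<longleftrightarrow> J = I" if "k \<in> J"
      proof
        assume "J - {k} = I - {k}"
        then have "insert k (J - {k}) = insert k (I - {k})" by (rule arg_cong)
        then show "J = I" unfolding insert_Diff[OF that] insert_Diff[OF I(2)] .
      qed simp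
      moreover have "i < n" using subsetD[OF J(1) i] by simp
      then have xi: "rco (x i) (x k) = (if x k = x i then 1 else 0)" by (rule rco_basis[OF x_basis(1)])
      ultimately show "rco (lookup (single (J - {i}) ((-1) ^ below J i * x i)) (I - {k})) (x k) =
          (if i = k then (if J = I then (-1) ^ below I k else 0) else 0)"
        using i by (cases "i = k"; cases "J = I") (simp_all add: lookup_single when_def sgn xi)
    qed
    also have "\<dots> = (if l = (1, I) then (-1) ^ below I k else 0)"
      using J(2) I(2) by (auto simp: bJ b)
    finally show ?thesis .
  qed
qed

text \<open>The top monomials, those removed between \<open>a = b + 1\<close> and \<open>a = b\<close>, are the \<open>t\<^sub>I\<close> with \<open>b\<close> indices. Their
  coefficient vectors have a diagonal bidegree, about which the hypothesis says nothing; instead the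
  coordinate of \<open>\<partial> c = 0\<close> at \<open>x\<^sub>k t\<^sub>I\<^sub>-\<^sub>{\<^sub>k\<^sub>}\<close> shows that the vector of \<open>t\<^sub>I\<close> is, up to sign, the boundary of that of
  \<open>x\<^sub>k t\<^sub>I\<^sub>-\<^sub>{\<^sub>k\<^sub>}\<close>. All lower monomials of internal degree \<open>b\<close> are off the diagonal.\<close>

lemma deg_filt_step:
  assumes b: "1 \<le> b" and c: "c \<in> sub_part (deg_filt b (Suc b))" "c \<in> B.bcomp (j, j)" "B.bdif c = 0"
    and t: "\<And>i' j'. j' < j \<Longrightarrow> i' \<noteq> j' \<Longrightarrow> tor_zero_K i' j'"
  shows "\<exists>g\<in>sub_part (deg_filt b (Suc b)) \<inter> B.bcomp (j + 1, j). c - B.bdif g \<in> sub_part (deg_filt b 0)"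
proof -
  have cc: "c \<in> B.bcarr" by (rule sub_part_carr[OF c(1)])
  have "\<exists>g\<in>sub_part (deg_filt b (Suc b)) \<inter> B.bcomp (j + 1, j). c - B.bdif g \<in> sub_part (deg_filt b b)"
  proof (rule remove_leading[OF deg_filt_ideal_pair deg_filt_dif_into c(1,2)])
    fix l assume l: "l \<in> deg_filt b (Suc b) - deg_filt b b"
    then have lm: "l \<in> kmons" "snd (mdeg l) = int b" "card (snd l) = b" by (auto simp: deg_filt_def)
    obtain \<beta> I where lI: "l = (\<beta>, I)" by (cases l)
    have I: "I \<subseteq> {..<n}" "card I = b" "\<beta> \<in> basis" using lm lI by (auto simp: kmons_def)
    have "bdeg \<beta> = 0" using lm lI by (simp add: mdeg_def)
    then have \<beta>: "\<beta> = 1" by (rule basis_zero_deg[OF I(3)])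
    have fin: "finite I" by (rule finite_index[OF I(1)])
    have "I \<noteq> {}" using I(2) b by auto
    then obtain k where k: "k \<in> I" by blast
    then have kn: "k < n" using I(1) by auto
    define l2 where "l2 = (x k, I - {k})"
    have c2: "card (I - {k}) = b - 1" using I(2) k fin by simp
    have d2: "mdeg l2 = (int b - 1, int b)"
      using x_basis(2)[OF kn] c2 b by (simp add: l2_def mdeg_def of_nat_diff)
    have "l2 \<in> kmons" using x_basis(1)[OF kn] I(1) by (auto simp: l2_def kmons_def)
    then have l2: "l2 \<in> deg_filt b (Suc b) - deg_filt b 0"
      using d2 c2 by (auto simp: deg_filt_def l2_def)
    let ?S = "support (deg_filt b (Suc b) - deg_filt b 0) c"
    let ?q = "\<lambda>w. lookup (B.bdif (coeff_vec l2 c)) w"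
    have key: "(-1) ^ below I k * kco (lookup c w) l + alt_sign (int (b - 1)) (aaug dga_K (?q w)) = 0" for w
    proof -
      have "(\<Sum>l'\<in>?S. kco (koszul_dif x (kmon l')) l2 * kco (lookup c w) l') =
          (\<Sum>l'\<in>?S. if l' = l then (-1) ^ below I k * kco (lookup c w) l else 0)"
      proof (rule sum.cong[OF refl])
        fix l' assume "l' \<in> ?S"
        then have "l' \<in> kmons" "snd (mdeg l') = int (card I)" using I(2) by (auto simp: support_def deg_filt_def)
        from kco_dif_top[OF I(1) k this]
        show "kco (koszul_dif x (kmon l')) l2 * kco (lookup c w) l' =
            (if l' = l then (-1) ^ below I k * kco (lookup c w) l else 0)"
          by (simp add: l2_def lI \<beta>)
      qed
      also have "\<dots> = (if l \<in> ?S then (-1) ^ below I k * kco (lookup c w) l else 0)"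
        using support_finite by simp
      also have "\<dots> = (-1) ^ below I k * kco (lookup c w) l"
      proof (cases "l \<in> ?S")
        case False
        have "l \<in> deg_filt b (Suc b) - deg_filt b 0" using l lm by (auto simp: deg_filt_def)
        then show ?thesis using support_zero[OF _ False] by simp
      qed simp
      finally show ?thesis
        using kco_bdif[OF deg_filt_ideal_pair c(1) l2, of w] c(3) c2 by (simp add: l2_def)
    qed
    (* the sign obtained by solving the equation key for the coordinate of c *)
    define m where "m = 1 + below I k + (b - 1)"
    have "kco (lookup c w) l = alt_sign (int m) (aaug dga_K (?q w))" for w
      unfolding m_def by (rule solve_sign[OF key])
    moreover have "aaug dga_K (alt_sign (int m) (?q w)) = alt_sign (int m) (aaug dga_K (?q w))" for w
      using B.aug_uminus[OF B.bcarr_lookup[OF B.bdif_carr[OF coeff_vec_carr[OF cc]]]] by (simp add: alt_sign_def)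
    ultimately have eq: "aaug dga_K (alt_sign (int m) (?q w)) = kco (lookup c w) l" for w by simp
    let ?u = "alt_sign (int m) (coeff_vec l2 c)"
    have uc: "?u \<in> B.bcarr" by (rule additive_subgroup_alt_sign[OF B.bcarr_subgroup coeff_vec_carr[OF cc]])
    have du: "B.bdif ?u = alt_sign (int m) (B.bdif (coeff_vec l2 c))" by (rule bdif_alt_sign[OF coeff_vec_carr[OF cc]])
    have e1: "(j, j) - mdeg l2 = (j, j) - mdeg l + (1, 0)"
      using d2 lm(2,3) by (simp add: prod_eq_iff mdeg_def)
    have "?u \<in> B.bcomp ((j, j) - mdeg l2)"
      by (rule additive_subgroup_alt_sign[OF B.bcomp_subgroup coeff_vec_comp[OF c(2)]])
    then have "?u \<in> B.bcomp ((j, j) - mdeg l + (1, 0))" by (simp only: e1)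
    moreover have "coeff_vec l c - B.bdif ?u \<in> aug_part dga_K B.bar"
      unfolding aug_part_iff
    proof (intro conjI allI)
      show "coeff_vec l c - B.bdif ?u \<in> B.bcarr" by (rule B.bcarr_closed(2)[OF coeff_vec_carr[OF cc] B.bdif_carr[OF uc]])
      fix w
      have "aaug dga_K (lookup (coeff_vec l c) w - lookup (B.bdif ?u) w) =
          aaug dga_K (lookup (coeff_vec l c) w) - aaug dga_K (lookup (B.bdif ?u) w)"
        by (rule B.aug_diff[OF B.bcarr_lookup[OF coeff_vec_carr[OF cc]] B.bcarr_lookup[OF B.bdif_carr[OF uc]]])
      also have "\<dots> = 0" using eq[of w] by (simp add: aaug_coeff_vec du lookup_alt_sign)
      finally show "aaug dga_K (lookup (coeff_vec l c - B.bdif ?u) w) = 0" by (simp add: lookup_minus)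
    qed
    ultimately show "\<exists>u\<in>B.bcomp ((j, j) - mdeg l + (1, 0)). coeff_vec l c - B.bdif u \<in> aug_part dga_K B.bar" by blast
  qed simp
  then obtain g1 where g1: "g1 \<in> sub_part (deg_filt b (Suc b))" "g1 \<in> B.bcomp (j + 1, j)"
      "c - B.bdif g1 \<in> sub_part (deg_filt b b)" by blast
  have down: "\<exists>g\<in>sub_part (deg_filt b a) \<inter> B.bcomp (j + 1, j). f - B.bdif g \<in> sub_part (deg_filt b 0)"
    if "a \<le> b" "f \<in> sub_part (deg_filt b a)" "f \<in> B.bcomp (j, j)" "B.bdif f = 0" for a f
    using that
  proof (induction a arbitrary: f)
    case 0
    have "0 \<in> sub_part (deg_filt b 0) \<inter> B.bcomp (j + 1, j)"
      by (rule IntI[OF additive_subgroup_zero[OF sub_part_subgroup] additive_subgroup_zero[OF B.bcomp_subgroup]])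
    then show ?case using 0(2) by (intro bexI[of _ 0]) simp_all
  next
    case (Suc a)
    have "\<exists>g\<in>sub_part (deg_filt b (Suc a)) \<inter> B.bcomp (j + 1, j). f - B.bdif g \<in> sub_part (deg_filt b a)"
    proof (rule quotient_exact[OF deg_filt_ideal_pair deg_filt_dif_into Suc.prems(2,3)])
      show "B.bdif f \<in> sub_part (deg_filt b a)" using Suc.prems(4) additive_subgroup_zero[OF sub_part_subgroup] by simp
      fix l assume "l \<in> deg_filt b (Suc a) - deg_filt b a"
      then have "snd (mdeg l) = int b" "card (snd l) = a" by (auto simp: deg_filt_def)
      then show "tor_zero_K (j - fst (mdeg l)) (j - snd (mdeg l))"
        using Suc.prems(1) b by (intro t) (auto simp: mdeg_def)
    qed simp
    then obtain g where g: "g \<in> sub_part (deg_filt b (Suc a))" "g \<in> B.bcomp (j + 1, j)"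
        "f - B.bdif g \<in> sub_part (deg_filt b a)" by blast
    note gc = sub_part_carr[OF g(1)] and fc = sub_part_carr[OF Suc.prems(2)]
    have dg: "B.bdif g \<in> B.bcomp (j, j)" using B.bdif_comp[OF g(2)] by simp
    have c1: "f - B.bdif g \<in> B.bcomp (j, j)" by (rule additive_subgroup_diff[OF B.bcomp_subgroup Suc.prems(3) dg])
    have "B.bdif (f - B.bdif g) = 0"
      using fc gc Suc.prems(4) by (simp add: B.bdif_diff B.bdif_carr B.bdif_bdif)
    from Suc.IH[OF _ g(3) c1 this] obtain h where h: "h \<in> sub_part (deg_filt b a)" "h \<in> B.bcomp (j + 1, j)"
        "f - B.bdif g - B.bdif h \<in> sub_part (deg_filt b 0)"
      using Suc.prems(1) by auto
    have "deg_filt b a \<subseteq> deg_filt b (Suc a)" by (auto simp: deg_filt_def)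
    then have hp: "h \<in> sub_part (deg_filt b (Suc a))" by (rule sub_part_mono[OF _ h(1)])
    note e = h(3)[unfolded diff_diff_eq, folded B.bdif_add[OF gc sub_part_carr[OF h(1)]]]
    show ?case
      by (intro bexI[of _ "g + h"] IntI e additive_subgroup_add[OF sub_part_subgroup g(1) hp]
          additive_subgroup_add[OF B.bcomp_subgroup g(2) h(2)])
  qed
  note g1c = sub_part_carr[OF g1(1)]
  have dg1: "B.bdif g1 \<in> B.bcomp (j, j)" using B.bdif_comp[OF g1(2)] by simp
  have c1: "c - B.bdif g1 \<in> B.bcomp (j, j)" by (rule additive_subgroup_diff[OF B.bcomp_subgroup c(2) dg1])
  have "B.bdif (c - B.bdif g1) = 0" using cc g1c c(3) by (simp add: B.bdif_diff B.bdif_carr B.bdif_bdif)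
  from down[OF le_refl g1(3) c1 this] obtain h where h: "h \<in> sub_part (deg_filt b b)" "h \<in> B.bcomp (j + 1, j)"
      "c - B.bdif g1 - B.bdif h \<in> sub_part (deg_filt b 0)" by blast
  have "deg_filt b b \<subseteq> deg_filt b (Suc b)" by (auto simp: deg_filt_def)
  then have hp: "h \<in> sub_part (deg_filt b (Suc b))" by (rule sub_part_mono[OF _ h(1)])
  note e = h(3)[unfolded diff_diff_eq, folded B.bdif_add[OF g1c sub_part_carr[OF h(1)]]]
  show ?thesis
    by (intro bexI[of _ "g1 + h"] IntI e additive_subgroup_add[OF sub_part_subgroup g1(1) hp]
        additive_subgroup_add[OF B.bcomp_subgroup g1(2) h(2)])
qed

text \<open>Boundaries push the internal degree of the coefficients up until nothing is left.\<close>

lemma diagonal_boundary: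
  assumes c: "c \<in> sub_part (ext_filt 1)" "c \<in> B.bcomp (j, j)" "B.bdif c = 0"
    and t: "\<And>i' j'. j' < j \<Longrightarrow> i' \<noteq> j' \<Longrightarrow> tor_zero_K i' j'"
  shows "\<exists>h\<in>sub_part (ext_filt 1) \<inter> B.bcomp (j + 1, j). B.bdif h = c"
proof -
  have cc: "c \<in> B.bcarr" by (rule sub_part_carr[OF c(1)])
  have "\<exists>h\<in>sub_part (ext_filt 1) \<inter> B.bcomp (j + 1, j). c - B.bdif h \<in> sub_part (deg_filt q 0)" for q
  proof (induction q)
    case 0
    have "0 \<in> sub_part (ext_filt 1) \<inter> B.bcomp (j + 1, j)"
      by (rule IntI[OF additive_subgroup_zero[OF sub_part_subgroup] additive_subgroup_zero[OF B.bcomp_subgroup]])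
    moreover have "c - B.bdif 0 \<in> sub_part (deg_filt 0 0)" using c(1) by (simp only: deg_filt_ext_filt B.bdif_zero diff_zero)
    ultimately show ?case by (rule bexI[rotated])
  next
    case (Suc q)
    then obtain h where h: "h \<in> sub_part (ext_filt 1)" "h \<in> B.bcomp (j + 1, j)" "c - B.bdif h \<in> sub_part (deg_filt q 0)"
      by (elim bexE IntE)
    note hc = sub_part_carr[OF h(1)]
    have dh: "B.bdif h \<in> B.bcomp (j, j)" using B.bdif_comp[OF h(2)] by simp
    have c1: "c - B.bdif h \<in> B.bcomp (j, j)" by (rule additive_subgroup_diff[OF B.bcomp_subgroup c(2) dh])
    have c2: "B.bdif (c - B.bdif h) = 0" using cc hc c(3) by (simp add: B.bdif_diff B.bdif_carr B.bdif_bdif)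
    have c3: "c - B.bdif h \<in> sub_part (deg_filt (Suc q) (Suc (Suc q)))" using h(3) by (simp add: deg_filt_zero)
    have b1: "1 \<le> Suc q" by simp
    have "\<exists>g\<in>sub_part (deg_filt (Suc q) (Suc (Suc q))) \<inter> B.bcomp (j + 1, j).
        c - B.bdif h - B.bdif g \<in> sub_part (deg_filt (Suc q) 0)"
      by (rule deg_filt_step[OF b1 c3 c1 c2]) (rule t)
    then obtain g where g: "g \<in> sub_part (deg_filt (Suc q) (Suc (Suc q)))" "g \<in> B.bcomp (j + 1, j)"
        "c - B.bdif h - B.bdif g \<in> sub_part (deg_filt (Suc q) 0)" by (elim bexE IntE)
    have "deg_filt (Suc q) (Suc (Suc q)) \<subseteq> deg_filt 0 0" by (auto simp: deg_filt_def)
    then have "g \<in> sub_part (ext_filt 1)" unfolding deg_filt_ext_filt[symmetric] by (rule sub_part_mono[OF _ g(1)])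
    then have gl: "g \<in> sub_part (ext_filt 1)" .
    note e = g(3)[unfolded diff_diff_eq, folded B.bdif_add[OF hc sub_part_carr[OF g(1)]]]
    show ?case
      by (intro bexI[of _ "h + g"] IntI e additive_subgroup_add[OF sub_part_subgroup h(1) gl]
          additive_subgroup_add[OF B.bcomp_subgroup h(2) g(2)])
  qed
  (* the coefficients of an element of internal degree j have internal degree at most j *)
  from this[of "nat j"] obtain h where h: "h \<in> sub_part (ext_filt 1)" "h \<in> B.bcomp (j + 1, j)"
      "c - B.bdif h \<in> sub_part (deg_filt (nat j) 0)" by (elim bexE IntE)
  have dh: "B.bdif h \<in> B.bcomp (j, j)" using B.bdif_comp[OF h(2)] by simp
  have "c - B.bdif h = 0"
    by (rule deg_filt_vanish[OF h(3) additive_subgroup_diff[OF B.bcomp_subgroup c(2) dh]]) simp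
  then have e: "B.bdif h = c" by simp
  show ?thesis by (intro bexI[of _ h] IntI h(1,2) e)
qed

section \<open>Comparison of the two Koszul conditions\<close>

text \<open>The vanishing of \<open>Tor\<close> over the algebra, computed with the quotient by \<open>\<mm>\<close> of the bar
  resolution over the Koszul complex.\<close>

definition tor_zero_R :: "int \<Rightarrow> int \<Rightarrow> bool" where
  "tor_zero_R i j \<longleftrightarrow> (\<forall>f\<in>B.bcomp (i, j). B.bdif f \<in> sub_part (ext_filt (Suc n)) \<longrightarrow>
     (\<exists>g\<in>B.bcomp (i + 1, j). f - B.bdif g \<in> sub_part (ext_filt (Suc n))))"

text \<open>The whole chain of exterior powers, from \<open>p = 0\<close> to \<open>p = n + 1\<close>.\<close>

lemma tor_zero_R_if_K:
  assumes t: "\<And>i j. i \<noteq> j \<Longrightarrow> tor_zero_K i j" and ij: "i \<noteq> j"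
  shows "tor_zero_R i j"
  unfolding tor_zero_R_def
proof (intro ballI impI)
  fix f assume f: "f \<in> B.bcomp (i, j)" "B.bdif f \<in> sub_part (ext_filt (Suc n))"
  have f0: "f \<in> sub_part (ext_filt 0)" using B.bcomp_carr[OF f(1)] by (simp add: sub_part_ext_filt_0)
  have "\<exists>g\<in>sub_part (ext_filt 0) \<inter> B.bcomp (i + 1, j). f - B.bdif g \<in> sub_part (ext_filt (Suc n))"
    by (rule ext_filt_chain[OF le0 f0 f], rule t) (use ij in simp)
  then show "\<exists>g\<in>B.bcomp (i + 1, j). f - B.bdif g \<in> sub_part (ext_filt (Suc n))" by (elim bexE IntE) (rule bexI)
qed

lemma tor_zero_K_neg: "j < 0 \<Longrightarrow> tor_zero_K i j"
  unfolding tor_zero_K_iff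
proof (intro ballI impI)
  fix f assume j: "j < 0" and f: "f \<in> B.bcomp (i, j)"
  have "B.bcomp (i, j) = {0}" by (rule B.bcomp_neg) (use j in simp)
  then have f0: "f = 0" using f by simp
  have z: "0 \<in> B.bcomp (i + 1, j)" by (rule additive_subgroup_zero[OF B.bcomp_subgroup])
  have "f - B.bdif 0 \<in> aug_part dga_K B.bar"
    unfolding f0 B.bdif_zero diff_zero sub_part_ext_filt_1[symmetric]
    by (rule additive_subgroup_zero[OF sub_part_subgroup])
  then show "\<exists>g\<in>B.bcomp (i + 1, j). f - B.bdif g \<in> aug_part dga_K B.bar" using z by (rule bexI)
qed

text \<open>Induction on the internal degree \<open>j\<close>. A cycle modulo the augmentation part is corrected by an element
  of that part so that it becomes an actual cycle if \<open>i = j + 1\<close>, and a cycle modulo \<open>\<mm>\<close> otherwise.\<close>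

lemma tor_zero_K_if_R:
  assumes t: "\<And>i j. i \<noteq> j \<Longrightarrow> tor_zero_R i j" and ij: "i \<noteq> j"
  shows "tor_zero_K i j"
proof -
  have "\<forall>i. i \<noteq> int m \<longrightarrow> tor_zero_K i (int m)" for m
  proof (induction m rule: less_induct)
    case (less m)
    define j where "j = int m"
    have IH: "tor_zero_K i' j'" if "j' < j" "i' \<noteq> j'" for i' j'
    proof (cases "j' < 0")
      case True
      then show ?thesis by (rule tor_zero_K_neg)
    next
      case False
      then have "nat j' < m" "j' = int (nat j')" using that(1) by (auto simp: j_def)
      then show ?thesis using less[of "nat j'", rule_format, of i'] that(2) by simp
    qed
    have "tor_zero_K i j" if ij: "i \<noteq> j" for i
      unfolding tor_zero_K_iff sub_part_ext_filt_1[symmetric]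
    proof (intro ballI impI)
      fix v assume v: "v \<in> B.bcomp (i, j)" "B.bdif v \<in> sub_part (ext_filt 1)"
      note vc = B.bcomp_carr[OF v(1)]
      have dv: "B.bdif v \<in> B.bcomp (i - 1, j)" using B.bdif_comp[OF v(1)] by simp
      have ddv: "B.bdif (B.bdif v) = 0" by (rule B.bdif_bdif[OF vc])
      show "\<exists>g\<in>B.bcomp (i + 1, j). v - B.bdif g \<in> sub_part (ext_filt 1)"
      proof (cases "i - 1 = j")
        case True
        have dv': "B.bdif v \<in> B.bcomp (j, j)" using dv True by simp
        obtain h where h: "h \<in> sub_part (ext_filt 1)" "h \<in> B.bcomp (j + 1, j)" "B.bdif h = B.bdif v"
        proof -
          have "\<exists>h\<in>sub_part (ext_filt 1) \<inter> B.bcomp (j + 1, j). B.bdif h = B.bdif v"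
            by (rule diagonal_boundary[OF v(2) dv' ddv]) (rule IH)
          then show thesis by (elim bexE IntE) (rule that)
        qed
        have hc: "h \<in> B.bcarr" by (rule sub_part_carr[OF h(1)])
        have ij1: "j + 1 = i" using True by simp
        let ?z = "v - h"
        have z: "?z \<in> B.bcomp (i, j)" using additive_subgroup_diff[OF B.bcomp_subgroup v(1)] h(2) by (simp add: ij1)
        have zc: "?z \<in> B.bcarr" by (rule B.bcomp_carr[OF z])
        have "lookup ?z 0 \<in> acomp dga_K ((i, j) - B.wdeg 0)" using z by (simp add: B.bcomp_def)
        moreover have "(i, j) - B.wdeg 0 = (i, j)" by (simp add: B.wdeg_zero)
        (* the bidegree (j + 1, j) is not (0, 0), so the contracting homotopy is exact on the cycle ?z *)
        ultimately have "B.baug ?z = 0" unfolding B.baug_def using B.aug_comp[of _ "(i, j)"] ij1 by auto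
        then have "B.bunit ?z = 0" by (simp add: B.bunit_def)
        moreover have "B.bdif ?z = 0" using B.bdif_diff[OF vc hc] h(3) by simp
        ultimately have "B.bdif (B.bcontr ?z) = ?z" using B.bcontr_homotopy[OF zc] by simp
        moreover have "B.bcontr ?z \<in> B.bcomp (i + 1, j)" using B.bcontr_comp[OF z] by simp
        ultimately show ?thesis using h(1) by (intro bexI[of _ "B.bcontr ?z"]) simp_all
      next
        case False
        have "B.bdif (B.bdif v) \<in> sub_part (ext_filt (Suc n))"
          unfolding ddv by (rule additive_subgroup_zero[OF sub_part_subgroup])
        moreover have "tor_zero_K (i - 1 - int r) (j - int r)" if "1 \<le> r" for r
          by (rule IH) (use that False in auto)
        ultimately have "\<exists>u\<in>sub_part (ext_filt 1) \<inter> B.bcomp (i - 1 + 1, j). B.bdif v - B.bdif u \<in> sub_part (ext_filt (Suc n))"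
          by (intro ext_filt_chain[OF _ v(2) dv]) simp_all
        then obtain u where u: "u \<in> sub_part (ext_filt 1)" "u \<in> B.bcomp (i - 1 + 1, j)"
            "B.bdif v - B.bdif u \<in> sub_part (ext_filt (Suc n))" by (elim bexE IntE)
        have uc: "u \<in> B.bcarr" by (rule sub_part_carr[OF u(1)])
        have vu: "v - u \<in> B.bcomp (i, j)" using additive_subgroup_diff[OF B.bcomp_subgroup v(1)] u(2) by simp
        have "B.bdif (v - u) \<in> sub_part (ext_filt (Suc n))" using u(3) B.bdif_diff[OF vc uc] by simp
        from t[OF ij, unfolded tor_zero_R_def, rule_format, OF vu this]
        obtain w where w: "w \<in> B.bcomp (i + 1, j)" "v - u - B.bdif w \<in> sub_part (ext_filt (Suc n))" by (elim bexE)
        have "ext_filt (Suc n) \<subseteq> ext_filt 1" by (auto simp: ext_filt_def)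
        then have "v - u - B.bdif w \<in> sub_part (ext_filt 1)" by (rule sub_part_mono[OF _ w(2)])
        from additive_subgroup_add[OF sub_part_subgroup this u(1)]
        have "v - B.bdif w \<in> sub_part (ext_filt 1)" by simp
        then show ?thesis using w(1) by (rule bexI)
      qed
    qed
    then show ?case by (simp add: j_def)
  qed
  note all = this
  show ?thesis
  proof (cases "j < 0")
    case True
    then show ?thesis by (rule tor_zero_K_neg)
  next
    case False
    then show ?thesis using all[of "nat j"] ij by simp
  qed
qed

end

section \<open>Restriction of the bar resolution to the algebra\<close>

context koszul_bar
begin

abbreviation unit_K :: "'r \<Rightarrow> (nat set \<Rightarrow>\<^sub>0 'r)" where "unit_K r \<equiv> single {} r"

lemma unit_K_carr: "unit_K r \<in> K_carr"
  by (rule K_carr_single) simp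

lemma unit_K_mul: "ext_mul (unit_K r) (unit_K s) = unit_K (r * s)"
  by (simp add: ext_mul_single ext_mul_term_def shuffle_inv_def)

lemma unit_K_comp: "r \<in> acomp dga_R p \<Longrightarrow> unit_K r \<in> acomp dga_K p"
  using K_comp_single[of "{}" r "snd p"] additive_subgroup_zero[OF K_comp_subgroup, of p]
  by (cases p) (auto simp: dga_R_comp split: if_splits)

text \<open>The bar resolution over the Koszul complex as a complex of modules over the algebra.\<close>

definition res_bar :: "('r, nat \<Rightarrow>\<^sub>0 (nat set \<Rightarrow>\<^sub>0 'r)) dgm" where
  "res_bar = \<lparr>mcomp = B.bcomp, mact = (\<lambda>r. B.bact (unit_K r)), mdif = B.bdif\<rparr>"

lemma res_bar_simps: "mcomp res_bar = B.bcomp" "mact res_bar r = B.bact (unit_K r)" "mdif res_bar = B.bdif"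
  "internal_sum UNIV B.bcomp = B.bcarr"
  by (simp_all add: res_bar_def B.bcarr_eq)

lemma lookup_res_act: "lookup (lookup (B.bact (unit_K r) f) w) I =
    r * lookup (lookup f w) I"
  by (simp add: lookup_bact_K[OF unit_K_carr] lookup_ext_mul_scal)

lemma res_bar_module: "dg_module_over dga_R scal_R res_bar"
proof -
  interpret M: dg_module_over dga_K scal_K B.bar by (rule B.bar_dg_module)
  note U = unit_K_carr[folded K_carrier]
  show ?thesis
    unfolding dg_module_over_def
  proof (intro conjI connected_dga_R)
    show "dg_module dga_R res_bar"
    proof (unfold_locales; unfold res_bar_simps dga_R_simps)
      show "additive_subgroup (B.bcomp p)" for p by (rule B.bcomp_subgroup)
      show "independent_family B.bcomp" by (rule B.bcomp_independent)
      show "B.bact (unit_K a) (f + g) = B.bact (unit_K a) f + B.bact (unit_K a) g"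
        if "f \<in> B.bcarr" "g \<in> B.bcarr" for a f g by (rule B.bact_add[OF U that])
      show "B.bact (unit_K (a + b)) f = B.bact (unit_K a) f + B.bact (unit_K b) f" if "f \<in> B.bcarr" for a b f
        unfolding single_add by (rule B.bact_add_left[OF U U that])
      show "B.bact (unit_K (a * b)) f = B.bact (unit_K a) (B.bact (unit_K b) f)" if "f \<in> B.bcarr" for a b f
        using B.bact_bact[OF U[of a] U[of b] that] by (simp only: K_simps unit_K_mul)
      show "B.bact (unit_K 1) f = f" if "f \<in> B.bcarr" for f
        using B.bact_one[OF that] by (simp only: K_simps)
      show "B.bact (unit_K a) f \<in> B.bcomp (i + i', j + j')"
        if "a \<in> acomp dga_R (i, j)" "f \<in> B.bcomp (i', j')" for a f i j i' j'
        using B.bact_comp[OF unit_K_comp[OF that(1)] that(2)] by simp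
      show "B.bdif (f + g) = B.bdif f + B.bdif g" if "f \<in> B.bcarr" "g \<in> B.bcarr" for f g
        by (rule B.bdif_add[OF that])
      show "B.bdif f \<in> B.bcomp (i - 1, j)" if "f \<in> B.bcomp (i, j)" for f i j
        using B.bdif_comp[OF that] by simp
      show "B.bdif (B.bdif f) = 0" if "f \<in> B.bcarr" for f by (rule B.bdif_bdif[OF that])
      show "B.bdif (B.bact (unit_K a) f) = B.bact (unit_K 0) f + alt_sign i (B.bact (unit_K a) (B.bdif f))"
        if "a \<in> acomp dga_R (i, j)" "f \<in> B.bcarr" for a f i j
        using M.leibniz[OF unit_K_comp[OF that(1)]] that(2)
        by (simp add: B.bar_simps K_simps koszul_dif_single ext_dif_term_def)
    qed
  qed
qed

lemma res_bar_basis: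
  "basis_of_quotient dga_R res_bar (mcarrier res_bar) {0}
     ((\<lambda>(w, I). single w (single I 1)) ` (B.words \<times> Pow {..<n}))"
proof -
  interpret M: dg_module_over dga_R scal_R res_bar by (rule res_bar_module)
  let ?b = "\<lambda>(w :: nat, I :: nat set). single w (single I (1 :: 'r))"
  let ?\<kappa> = "\<lambda>(f :: nat \<Rightarrow>\<^sub>0 (nat set \<Rightarrow>\<^sub>0 'r)) (w :: nat, I :: nat set). lookup (lookup f w) I"
  let ?X = "B.words \<times> Pow {..<n}"
  have lb: "?\<kappa> (?b y) z = (if z = y then 1 else 0)" for y z
    by (cases y; cases z) (auto simp: lookup_single when_def)
  have ls: "?\<kappa> (\<Sum>y\<in>S. B.bact (unit_K (a y)) (?b y)) z = (if z \<in> S then a z else 0)"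
    if "finite S" for S a z
  proof -
    have "?\<kappa> (\<Sum>y\<in>S. B.bact (unit_K (a y)) (?b y)) z = (\<Sum>y\<in>S. a y * ?\<kappa> (?b y) z)"
      by (cases z) (simp only: lookup_sum lookup_res_act prod.case)
    also have "\<dots> = (\<Sum>y\<in>S. if z = y then a y else 0)" unfolding lb by (rule sum.cong) auto
    finally show ?thesis using that by simp
  qed
  have supp: "y \<in> ?X" if "f \<in> B.bcarr" "?\<kappa> f y \<noteq> 0" for f y
  proof (cases y)
    case (Pair w I)
    have "w \<in> B.words"
    proof (rule ccontr)
      assume "w \<notin> B.words"
      then have "lookup f w = 0" using that(1) by (simp add: B.bcarr_def)
      then show False using that(2) Pair by simp
    qed
    moreover have "I \<subseteq> {..<n}"
    proof (rule ccontr)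
      assume "\<not> I \<subseteq> {..<n}"
      then have "lookup (lookup f w) I = 0"
        using bcarr_lookup_K[OF that(1), of w] by (simp add: K_carr_def)
      then show False using that(2) Pair by simp
    qed
    ultimately show ?thesis using Pair by simp
  qed
  have bin: "?b y \<in> B.bcarr \<and> (\<exists>p. ?b y \<in> B.bcomp p)" if y: "y \<in> ?X" for y
  proof -
    obtain w I where wI: "y = (w, I)" "w \<in> B.words" "I \<subseteq> {..<n}" using y by auto
    have "(1 :: 'r) \<in> gr 0" using dga_R_comp[of 0 0] connected_dga.scal_comp[OF connected_dga_R, of 1] by simp
    from K_comp_single[OF wI(3) this] have "?b y \<in> B.bcomp ((int (card I), 0 + int (card I)) + B.wdeg w)"
      using B.bcomp_single[OF wI(2)] wI(1) by simp
    then show ?thesis using B.bcomp_carr by blast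
  qed
  show ?thesis
  proof (rule M.basis_of_quotientI[where \<kappa> = ?\<kappa>]; (unfold res_bar_simps)?)
    show "inj_on ?b ?X"
    proof (rule inj_onI)
      fix y z assume e: "?b y = ?b z"
      have "?\<kappa> (?b y) z = 1" unfolding e lb by simp
      then show "y = z" unfolding lb by (simp split: if_splits)
    qed
    show "?b y \<in> B.bcarr \<and> (\<exists>p. ?b y \<in> B.bcomp p)" if "y \<in> ?X" for y by (rule bin[OF that])
    show "?\<kappa> f y \<in> acarrier dga_R" for f y unfolding dga_R_carrier by simp
    show fin: "finite {y \<in> ?X. ?\<kappa> f y \<noteq> 0}" for f
    proof (rule finite_subset)
      show "{y \<in> ?X. ?\<kappa> f y \<noteq> 0} \<subseteq> keys f \<times> Pow {..<n}" by (auto simp: in_keys_iff)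
    qed simp
    show "f - (\<Sum>y | y \<in> ?X \<and> ?\<kappa> f y \<noteq> 0. B.bact (unit_K (?\<kappa> f y)) (?b y)) \<in> {0}" if f: "f \<in> B.bcarr" for f
    proof -
      let ?s = "\<Sum>y | y \<in> ?X \<and> ?\<kappa> f y \<noteq> 0. B.bact (unit_K (?\<kappa> f y)) (?b y)"
      have z: "?\<kappa> f z = ?\<kappa> ?s z" for z
        unfolding ls[OF fin] using supp[OF f, of z] by auto
      have "f = ?s"
      proof (rule poly_mapping_eqI, rule poly_mapping_eqI)
        fix w I
        show "lookup (lookup f w) I = lookup (lookup ?s w) I"
          using z[of "(w, I)"] by (simp only: prod.case)
      qed
      then show ?thesis by (simp only: diff_self singleton_iff)
    qed
    fix f a S z assume S: "finite S" and a: "\<And>y. y \<notin> S \<Longrightarrow> a y = 0"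
      and d: "f - (\<Sum>y\<in>S. B.bact (unit_K (a y)) (?b y)) \<in> {0}"
    have "f = (\<Sum>y\<in>S. B.bact (unit_K (a y)) (?b y))" using d by simp
    then have "?\<kappa> f z = ?\<kappa> (\<Sum>y\<in>S. B.bact (unit_K (a y)) (?b y)) z" by (rule arg_cong)
    then show "?\<kappa> f z = a z" unfolding ls[OF S] using a[of z] by (cases "z \<in> S") simp_all
  qed
qed

lemma res_bar_quasi_iso: "quasi_iso dga_R res_bar (residue_module dga_R) B.baug"
proof -
  note q = B.bar_quasi_iso[unfolded quasi_iso_def dg_hom_def B.bar_simps, simplified residue_module_def, simplified]
  have cy: "cycles res_bar = cycles B.bar" "boundaries res_bar = boundaries B.bar"
    by (rule ext, simp add: cycles_def boundaries_def res_bar_simps B.bar_simps)+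
  have rc: "cycles (residue_module dga_R) = cycles (residue_module dga_K)"
    "boundaries (residue_module dga_R) = boundaries (residue_module dga_K)"
    "mcomp (residue_module dga_R) = mcomp (residue_module dga_K)"
    "mdif (residue_module dga_R) = mdif (residue_module dga_K)"
    by (simp_all add: fun_eq_iff cycles_def boundaries_def residue_module_def)
  have act: "B.baug (B.bact (unit_K r) f) = aug r * B.baug f" if "f \<in> B.bcarr" for r f
  proof -
    have "B.baug (mact B.bar (unit_K r) f) = mact (residue_module dga_K) (unit_K r) (B.baug f)"
      using B.bar_quasi_iso that unit_K_carr[of r]
      unfolding quasi_iso_def dg_hom_def B.bar_simps K_carrier by (elim conjE) (drule bspec, assumption, drule bspec, assumption)
    then show ?thesis by (simp add: B.bar_simps residue_module_def K_simps)
  qed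
  have "dg_hom dga_R res_bar (residue_module dga_R) B.baug"
    using B.bar_quasi_iso act
    unfolding quasi_iso_def dg_hom_def B.bar_simps res_bar_simps rc
    by (simp add: residue_module_def dga_R_simps)
  then show ?thesis using B.bar_quasi_iso unfolding quasi_iso_def cy rc by blast
qed

lemma res_bar_resolution: "semifree_resolution dga_R res_bar B.baug"
proof (rule free_resolution_semifree[OF connected_dga_R])
  interpret M: dg_module_over dga_R scal_R res_bar by (rule res_bar_module)
  interpret C: complex_over dga_R scal_R res_bar
    by unfold_locales (simp add: dga_R_comp)
  show "free_resolution scl gr res_bar B.baug"
    unfolding free_resolution_def
  proof (intro conjI allI impI)
    show "mcomp res_bar (i, j) = {0}" if "i < 0" for i j
      unfolding res_bar_simps by (rule B.bcomp_neg) (use that in simp)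
    show "\<exists>E. basis_of_quotient dga_R res_bar (internal_sum ({i} \<times> UNIV) (mcomp res_bar)) {0} E" for i
      using C.degree_part_basis[OF res_bar_basis, of i] unfolding graded_part_def .
  qed (rule M.dg_module_axioms res_bar_quasi_iso)+
qed

lemma sub_part_ext_filt_top:
  "f \<in> sub_part (ext_filt (Suc n)) \<longleftrightarrow>
     f \<in> B.bcarr \<and> (\<forall>w I. aug (lookup (lookup f w) I) = 0)"
proof -
  have "a \<in> span_part (ext_filt (Suc n)) \<longleftrightarrow> (\<forall>I. aug (lookup a I) = 0)" if a: "a \<in> K_carr" for a
  proof
    assume s: "a \<in> span_part (ext_filt (Suc n))"
    show "\<forall>I. aug (lookup a I) = 0"
    proof (intro allI, rule ccontr)
      fix I assume nz: "aug (lookup a I) \<noteq> 0"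
      then have k: "kco a (1, I) \<noteq> 0" by (simp add: kco_def aug_rco)
      then have "(1, I) \<in> kmons" by (rule kco_support[OF a])
      then have "I \<subseteq> {..<n}" by (simp add: kmons_def)
      then have "card I \<le> n" using card_mono[of "{..<n}" I] by simp
      moreover have "(1, I) \<in> ext_filt (Suc n)" using s k by (auto simp: span_part_def)
      ultimately show False by (simp add: ext_filt_def)
    qed
  next
    assume z: "\<forall>I. aug (lookup a I) = 0"
    have "kco a l = 0" if "l \<notin> ext_filt (Suc n)" for l
    proof (rule ccontr)
      assume nz: "kco a l \<noteq> 0"
      then have "l \<in> kmons" by (rule kco_support[OF a])
      then have "fst l = 1" using that by (simp add: ext_filt_def)
      then show False using nz z by (simp add: kco_def aug_rco)
    qed
    then show "a \<in> span_part (ext_filt (Suc n))" using a by (simp add: span_part_def)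
  qed
  then show ?thesis using bcarr_lookup_K by (auto simp: sub_part_def)
qed

lemma aug_part_res_bar: "aug_part dga_R res_bar = sub_part (ext_filt (Suc n))"
proof (intro equalityI subsetI)
  interpret M: dg_module_over dga_R scal_R res_bar by (rule res_bar_module)
  show "f \<in> sub_part (ext_filt (Suc n))" if "f \<in> aug_part dga_R res_bar" for f
    using that
  proof (induction rule: M.aug_part_induct)
    case zero
    show ?case by (rule additive_subgroup_zero[OF sub_part_subgroup])
  next
    case (diff f g)
    show ?case by (rule additive_subgroup_diff[OF sub_part_subgroup diff(3,4)])
  next
    case (act a f)
    then have "f \<in> B.bcarr" "aug a = 0" by (simp_all add: res_bar_simps dga_R_simps)
    then show ?case
      by (simp add: res_bar_simps sub_part_ext_filt_top bact_carr_K unit_K_carr lookup_res_act aug_times)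
  qed
  fix f assume "f \<in> sub_part (ext_filt (Suc n))"
  then have f: "f \<in> B.bcarr" "\<And>w I. aug (lookup (lookup f w) I) = 0"
    by (simp_all add: sub_part_ext_filt_top)
  have "single w (lookup f w) \<in> aug_part dga_R res_bar"
    if w: "w \<in> keys f" for w
  proof -
    let ?a = "lookup f w"
    have ww: "w \<in> B.words" using w f(1) by (auto simp: B.bcarr_def in_keys_iff)
    have "single w (single I (lookup ?a I)) \<in> aug_part dga_R res_bar"
      if I: "I \<in> keys ?a" for I
    proof -
      have "I \<subseteq> {..<n}" using I bcarr_lookup_K[OF f(1), of w] by (auto simp: K_carr_def in_keys_iff)
      then have "single w (single I 1) \<in> B.bcarr"
        by (intro B.bcarr_single[OF ww]) (simp only: K_carrier K_carr_single)
      then have "mact res_bar (lookup ?a I) (single w (single I 1)) \<in> aug_part dga_R res_bar"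
        by (intro M.act_aug_part) (simp_all add: dga_R_carrier dga_R_simps f(2) res_bar_simps)
      moreover have "mact res_bar (lookup ?a I) (single w (single I 1)) =
          single w (single I (lookup ?a I))"
        unfolding res_bar_simps
        by (intro poly_mapping_eqI) (simp add: lookup_res_act lookup_single when_def)
      ultimately show ?thesis by simp
    qed
    then have "(\<Sum>I\<in>keys ?a. single w (single I (lookup ?a I)))
        \<in> aug_part dga_R res_bar"
      by (rule additive_subgroup_sum[OF M.aug_part_subgroup])
    moreover have "(\<Sum>I\<in>S. single w (g I)) = single w (\<Sum>I\<in>S. g I)"
      for S and g :: "nat set \<Rightarrow> (nat set \<Rightarrow>\<^sub>0 'r)"
      by (induction S rule: infinite_finite_induct) (simp_all add: single_add)
    ultimately show ?thesis by (simp only: sum_single_lookup)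
  qed
  then have "(\<Sum>w\<in>keys f. single w (lookup f w)) \<in> aug_part dga_R res_bar"
    by (rule additive_subgroup_sum[OF M.aug_part_subgroup])
  then show "f \<in> aug_part dga_R res_bar" by (simp only: sum_single_lookup)
qed

lemma tor_zero_res_bar: "tor_zero dga_R res_bar i j \<longleftrightarrow> tor_zero_R i j"
  unfolding tor_zero_def tor_zero_R_def aug_part_res_bar res_bar_simps ..

end

lemma (in graded_generators) algebra_Tor_zero_iff:
  fixes F :: "('r, 'f::ab_group_add) dgm"
  assumes F: "semifree_resolution dga_R F \<pi>"
  shows "is_singleton (algebra_Tor scl gr i j) \<longleftrightarrow> tor_zero dga_R F i j"
proof -
  obtain N lt ldeg co where "bar_data dga_R scal_R N lt ldeg co" by (rule bar_data_R)
  then have "\<exists>P :: ('r, nat \<Rightarrow>\<^sub>0 'r) dgm. \<exists>\<pi>. free_resolution scl gr P \<pi>"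
    by (intro exI) (rule bar_free_resolution[THEN someI_ex])
  then have "\<exists>\<pi>. free_resolution scl gr (chosen_free_resolution scl gr) \<pi>"
    unfolding chosen_free_resolution_def by (rule someI_ex)
  then obtain \<rho> where "free_resolution scl gr (chosen_free_resolution scl gr) \<rho>" ..
  then have P: "semifree_resolution dga_R (chosen_free_resolution scl gr) \<rho>"
    by (rule free_resolution_semifree[OF connected_dga_R])
  interpret P: residue_resolution dga_R scal_R "chosen_free_resolution scl gr" \<rho>
    by (rule semifree_resolutionD[OF connected_dga_R P])
  show ?thesis unfolding algebra_Tor_def P.tensor_homology_zero_iff
    using tor_zero_independent[OF connected_dga_R F P] tor_zero_independent[OF connected_dga_R P F] by blast
qed

lemma dga_Tor_zero_iff:
  fixes F :: "('a, nat \<Rightarrow>\<^sub>0 'a::ab_group_add) dgm"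
  assumes A: "connected_dga A scal" and F: "semifree_resolution A F \<pi>"
  shows "is_singleton (dga_Tor A i j) \<longleftrightarrow> tor_zero A F i j"
proof -
  have "\<exists>P :: ('a, nat \<Rightarrow>\<^sub>0 'a) dgm. \<exists>\<pi>. semifree_resolution A P \<pi>" using F by (intro exI)
  then have "\<exists>\<pi>. semifree_resolution A (chosen_semifree_resolution A) \<pi>"
    unfolding chosen_semifree_resolution_def by (rule someI_ex)
  then obtain \<rho> where P: "semifree_resolution A (chosen_semifree_resolution A) \<rho>" ..
  interpret P: residue_resolution A scal "chosen_semifree_resolution A" \<rho>
    by (rule semifree_resolutionD[OF A P])
  show ?thesis unfolding dga_Tor_def P.tensor_homology_zero_iff
    using tor_zero_independent[OF A F P] tor_zero_independent[OF A P F] by blast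
qed

theorem theoremA:
  fixes scl :: "'k::field \<Rightarrow> 'r::comm_ring_1 \<Rightarrow> 'r"
    and gr :: "int \<Rightarrow> 'r set"
    and n :: nat
    and x :: "nat \<Rightarrow> 'r"
  assumes "standard_graded_algebra scl gr"
    and "minimal_generators gr n x"
  shows "koszul_algebra scl gr \<longleftrightarrow> koszul_dga (koszul_complex scl gr n x)"
proof -
  interpret connected_graded_algebra scl gr
    using assms(1) by (simp add: standard_graded_algebra_def)
  interpret graded_generators scl gr n x
    by unfold_locales (rule assms(2))
  obtain N lt ldeg co where bd: "bar_data dga_K scal_K N lt ldeg co" by (rule bar_data_K)
  interpret B: bar_data dga_K scal_K N lt ldeg co by (rule bd)
  interpret koszul_bar scl gr n x N lt ldeg co ..
  have "koszul_algebra scl gr \<longleftrightarrow> (\<forall>i j. i \<noteq> j \<longrightarrow> tor_zero_R i j)"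
    unfolding koszul_algebra_def algebra_Tor_zero_iff[OF res_bar_resolution] tor_zero_res_bar by blast
  also have "\<dots> \<longleftrightarrow> (\<forall>i j. i \<noteq> j \<longrightarrow> tor_zero_K i j)"
    using tor_zero_R_if_K tor_zero_K_if_R by blast
  also have "\<dots> \<longleftrightarrow> koszul_dga (koszul_complex scl gr n x)"
    unfolding koszul_dga_def dga_Tor_zero_iff[OF connected_dga_K B.bar_resolution] by blast
  finally show ?thesis .
qed

end
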